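(* Let $\alpha>0$, $\nu>0$, $0<\beta<1$. Let $A:\mathbb{R}^3\to\mathbb{R}$ satisfy $\beta\le A(x)\le1$ for all $x\in\mathbb{R}^3$ and $A\in\mathcal{C}^{1,1}(\mathbb{R}^3)$, and let $\varphi\in H^1(\mathbb{T}^3)$ be real-valued. Let $\vec u_{0,1},\vec u_{0,2}\in L^2_{\mathrm{s}}(\mathbb{T}^3)$ and let $\vec f_1,\vec f_2\in L^2_{loc}([0,+\infty[,\dot H^{-1}(\mathbb{T}^3))$ be divergence-free and zero-mean. For $i=1,2$ let $(\vec u_i,\vec u_{i,\alpha},P_i,P_{i,\alpha})$ be a weak Leray solution, with initial datum $\vec u_{0,i}$ and force $\vec f_i$, of $$\begin{cases}\partial_t\vec{u}-\nu\Delta\vec{u}+(\vec{u}_\alpha\cdot\vec{\nabla})\vec{u}+\vec{\nabla}P=\vec{f},\quad \mathrm{div}(\vec{u})=0,\\ -\alpha^2\,\mathrm{div}\big(A(\varphi\ast\vec{u})(\vec{\nabla}\otimes\vec{u}_\alpha)^T\big)+\vec{u}_\alpha+\vec{\nabla}P_\alpha=\vec{u},\quad \mathrm{div}(\vec{u}_\alpha)=0,\\ \vec{u}(0,\cdot)=\vec{u}_0.\end{cases}$$ For any time $T>0$ define $$\|\vec u_1-\vec u_2\|_{E_T}=\sup_{0\le t\le T}\|\vec u_1(t,\cdot)-\vec u_2(t,\cdot)\|_{L^2}+\sqrt\nu\left(\int_0^T\|\vec u_1(t,\cdot)-\vec u_2(t,\cdot)\|_{\dot H^1}^2dt\right)^{1/2}.$$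 Then $$\|\vec u_1-\vec u_2\|_{E_T}^2\le e^{\mathfrak{C}_0T^{1/2}}\left(\|\vec u_{0,1}-\vec u_{0,2}\|_{L^2}^2+\frac4\nu\int_0^T\|\vec f_1(t,\cdot)-\vec f_2(t,\cdot)\|_{\dot H^{-1}}^2dt\right),$$ $$\|\vec u_{1,\alpha}-\vec u_{2,\alpha}\|_{L^\infty([0,T],H^1)}^2\le\mathfrak{D}_0\,\|\vec u_1-\vec u_2\|_{L^\infty([0,T],L^2)}^2,$$ with constants $\mathfrak{C}_0>0$ and $\mathfrak{D}_0>0$ depending on the parameters $\alpha,\beta,\nu$, the functions $A$, $\varphi$, the data $\vec u_{0,1},\vec u_{0,2},\vec f_1,\vec f_2$, and the time $T$.
   Context: $\mathbb{T}^3=[0,L]^3$, $L>0$, with periodic boundary conditions. $L^2_{\mathrm{s}}(\mathbb{T}^3)$ is the closure in $L^2(\mathbb{T}^3)$ of the set of divergence-free, zero-mean vector trigonometric polynomials. With ${\bf Z}^3=\frac{2\pi}{L}\mathbb{Z}^3$ and for $s\in\mathbb{R}$, $\dot H^s(\mathbb{T}^3)$ (resp. $H^s(\mathbb{T}^3)$) is the space of real zero-mean $g=\sum_{k\in{\bf Z}^3\setminus\{0\}}e^{ik\cdot x}\widehat g_k$ with $\|g\|_{\dot H^s}^2=L^3\sum|k|^{2s}|\widehat g_k|^2<\infty$ (resp. $\|g\|_{H^s}^2=L^3\sum(1+|k|^2)^s|\widehat g_k|^2<\infty$). $(\vec\nabla\otimes\vec v)^T$ is the matrix with entries $\partial_jv_i$,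 and the divergence of a matrix field is $(\mathrm{div}\,M)_i=\sum_j\partial_jM_{ij}$. $\varphi\ast\vec u$ is the (componentwise) periodic convolution in $x$. $\mathcal{C}^{m}(\mathbb{R}^3)$ is the space of $m$-times continuously differentiable functions with bounded derivatives, and $\mathcal{C}^{m,1}(\mathbb{R}^3)$ is the subspace of those whose derivatives of order $m$ are Lipschitz continuous. Definition (weak Leray solution, $\alpha>0$ fixed). $(\vec u,\vec u_\alpha,P,P_\alpha)$ is a weak Leray solution if: (A) $\vec u\in L^\infty_{loc}([0,+\infty[,L^2_{\mathrm{s}}(\mathbb{T}^3))\cap L^2_{loc}([0,+\infty[,\dot H^1(\mathbb{T}^3))$, $\vec u_\alpha\in L^\infty_{loc}([0,+\infty[,H^1(\mathbb{T}^3))$, $P\in L^2_{loc}([0,+\infty[,L^2(\mathbb{T}^3))$, $P_\alpha\in L^\infty_{loc}([0,+\infty[,L^2(\mathbb{T}^3))$; (B) the system is satisfied in the weak (distributional) sense, with initial datum $\vec u_0$; (C) for all $t\ge0$, $$\|\vec u(t,\cdot)\|_{L^2}^2+2\nu\int_0^t\|\vec u(s,\cdot)\|_{\dot H^1}^2ds\le\|\vec u_0\|_{L^2}^2+2\int_0^t\langle\vec f(s,\cdot),\vec u(s,\cdot)\rangle_{\dot H^{-1}\times\dot H^1}ds.$$ Pointwise-in-time statements refer to the weakly continuous in time representative of $\vec u$. *)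

theory Defs
  imports "HOL-Analysis.Analysis" "HOL-Probability.Essential_Supremum"
begin

section \<open>Differentiability classes\<close>

text \<open>The derivative of \<open>g\<close> at \<open>x\<close> in direction \<open>e\<close>; only used where \<open>g\<close> is differentiable.\<close>

definition pd :: "'a::euclidean_space \<Rightarrow> ('a \<Rightarrow> real) \<Rightarrow> 'a \<Rightarrow> real" where
  "pd e g x = frechet_derivative g (at x) e"

primrec C_diff :: "nat \<Rightarrow> ('a::euclidean_space \<Rightarrow> real) \<Rightarrow> bool" where
  "C_diff 0 g \<longleftrightarrow> continuous_on UNIV g"
| "C_diff (Suc m) g \<longleftrightarrow> (\<forall>x. g differentiable (at x)) \<and> (\<forall>e\<in>Basis. C_diff m (pd e g))"

definition smooth :: "('a::euclidean_space \<Rightarrow> real) \<Rightarrow> bool" where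
  "smooth g \<longleftrightarrow> (\<forall>m. C_diff m g)"

text \<open>The space \<open>\<C>\<^sup>m\<^sup>,\<^sup>1\<close>: all derivatives of order at most \<open>m\<close> exist, are continuous and
  bounded, and those of order \<open>m\<close> are Lipschitz continuous.\<close>

primrec C_bdd_lip :: "nat \<Rightarrow> ('a::euclidean_space \<Rightarrow> real) \<Rightarrow> bool" where
  "C_bdd_lip 0 g \<longleftrightarrow> bounded (range g) \<and> (\<exists>K. K-lipschitz_on UNIV g)"
| "C_bdd_lip (Suc m) g \<longleftrightarrow> bounded (range g) \<and> (\<forall>x. g differentiable (at x))
     \<and> (\<forall>e\<in>Basis. C_bdd_lip m (pd e g))"

section \<open>Function spaces on the torus\<close>

text \<open>Functions on \<open>\<T>\<^sup>3 = [0,L]\<^sup>3\<close> are \<open>L\<close>-periodic functions on \<open>\<real>\<^sup>3\<close>, integrated over one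
  period cell.  Classes modulo a.e.\ equality are handled through Borel representatives.\<close>

definition periodic :: "real \<Rightarrow> (real^3 \<Rightarrow> 'b) \<Rightarrow> bool" where
  "periodic L g \<longleftrightarrow> (\<forall>x i. g (x + L *\<^sub>R axis i 1) = g x)"

definition tint :: "real \<Rightarrow> (real^3 \<Rightarrow> 'b::{banach,second_countable_topology}) \<Rightarrow> 'b" where
  "tint L g = (LINT x:cbox 0 (\<chi> i. L)|lborel. g x)"

definition L2 :: "real \<Rightarrow> (real^3 \<Rightarrow> 'b::euclidean_space) \<Rightarrow> bool" where
  "L2 L g \<longleftrightarrow> periodic L g \<and> g \<in> borel_measurable borel
     \<and> set_integrable lborel (cbox 0 (\<chi> i. L)) (\<lambda>x. (norm (g x))\<^sup>2)"

definition L2_norm :: "real \<Rightarrow> (real^3 \<Rightarrow> 'b::euclidean_space) \<Rightarrow> real" where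
  "L2_norm L g = sqrt (tint L (\<lambda>x. (norm (g x))\<^sup>2))"

text \<open>The frequencies \<open>k \<in> (2\<pi>/L)\<int>\<^sup>3\<close> are indexed by \<open>n \<in> \<int>\<^sup>3\<close>.\<close>

definition freq :: "real \<Rightarrow> int^3 \<Rightarrow> real^3" where
  "freq L n = (2 * pi / L) *\<^sub>R (\<chi> i. real_of_int (n $ i))"

definition trig_poly :: "real \<Rightarrow> (real^3 \<Rightarrow> real^3) \<Rightarrow> bool" where
  "trig_poly L p \<longleftrightarrow> (\<exists>K a b. finite K \<and>
     p = (\<lambda>x. \<Sum>n\<in>K. cos (freq L n \<bullet> x) *\<^sub>R a n + sin (freq L n \<bullet> x) *\<^sub>R b n))"

definition L2s :: "real \<Rightarrow> (real^3 \<Rightarrow> real^3) \<Rightarrow> bool" where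
  "L2s L v \<longleftrightarrow> L2 L v \<and> (\<forall>\<epsilon>>0. \<exists>p. trig_poly L p
     \<and> (\<forall>x. (\<Sum>i\<in>UNIV. pd (axis i 1) (\<lambda>y. p y $ i) x) = 0) \<and> tint L p = 0
     \<and> L2_norm L (\<lambda>x. v x - p x) < \<epsilon>)"

definition fcoeff :: "real \<Rightarrow> (real^3 \<Rightarrow> real) \<Rightarrow> int^3 \<Rightarrow> complex" where
  "fcoeff L g n = tint L (\<lambda>x. cis (- (freq L n \<bullet> x)) * complex_of_real (g x)) / complex_of_real (L^3)"

definition vfcoeff :: "real \<Rightarrow> (real^3 \<Rightarrow> real^3) \<Rightarrow> int^3 \<Rightarrow> complex^3" where
  "vfcoeff L v n = (\<chi> i. fcoeff L (\<lambda>x. v x $ i) n)"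

text \<open>The spaces \<open>\<dot>H\<^sup>s\<close> and \<open>H\<^sup>s\<close> are spaces of formal Fourier series, given by the family of their
  coefficients; the condition involving \<^const>\<open>cnj\<close> says that the series is real.  Functions are
  turned into such families by \<^const>\<open>fcoeff\<close> and \<^const>\<open>vfcoeff\<close>.\<close>

definition real_mean0 :: "(int^3 \<Rightarrow> complex) \<Rightarrow> bool" where
  "real_mean0 c \<longleftrightarrow> c 0 = 0 \<and> (\<forall>n. c (- n) = cnj (c n))"

definition Hdot :: "real \<Rightarrow> real \<Rightarrow> (int^3 \<Rightarrow> complex) \<Rightarrow> bool" where
  "Hdot L s c \<longleftrightarrow> real_mean0 c
     \<and> (\<lambda>n. norm (freq L n) powr (2 * s) * (norm (c n))\<^sup>2) summable_on (- {0})"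

definition Hsob :: "real \<Rightarrow> real \<Rightarrow> (int^3 \<Rightarrow> complex) \<Rightarrow> bool" where
  "Hsob L s c \<longleftrightarrow> real_mean0 c
     \<and> (\<lambda>n. (1 + (norm (freq L n))\<^sup>2) powr s * (norm (c n))\<^sup>2) summable_on (- {0})"

definition Hdot_norm :: "real \<Rightarrow> real \<Rightarrow> (int^3 \<Rightarrow> 'c::real_normed_vector) \<Rightarrow> real" where
  "Hdot_norm L s c =
     sqrt (L^3 * (\<Sum>\<^sub>\<infinity>n\<in>- {0}. norm (freq L n) powr (2 * s) * (norm (c n))\<^sup>2))"

definition Hsob_norm :: "real \<Rightarrow> real \<Rightarrow> (int^3 \<Rightarrow> 'c::real_normed_vector) \<Rightarrow> real" where
  "Hsob_norm L s c =
     sqrt (L^3 * (\<Sum>\<^sub>\<infinity>n\<in>- {0}. (1 + (norm (freq L n))\<^sup>2) powr s * (norm (c n))\<^sup>2))"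

definition vHdot :: "real \<Rightarrow> real \<Rightarrow> (int^3 \<Rightarrow> complex^3) \<Rightarrow> bool" where
  "vHdot L s c \<longleftrightarrow> (\<forall>i. Hdot L s (\<lambda>n. c n $ i))"

text \<open>Duality between \<open>\<dot>H\<^sup>-\<^sup>s\<close> and \<open>\<dot>H\<^sup>s\<close>, normalised so as to extend \<open>\<integral> g h dx\<close>.\<close>

definition pairing :: "real \<Rightarrow> (int^3 \<Rightarrow> complex) \<Rightarrow> (int^3 \<Rightarrow> complex) \<Rightarrow> real" where
  "pairing L c d = L^3 * (\<Sum>\<^sub>\<infinity>n\<in>- {0}. Re (c n * cnj (d n)))"

definition vpairing :: "real \<Rightarrow> (int^3 \<Rightarrow> complex^3) \<Rightarrow> (int^3 \<Rightarrow> complex^3) \<Rightarrow> real" where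
  "vpairing L c d = (\<Sum>i\<in>UNIV. pairing L (\<lambda>n. c n $ i) (\<lambda>n. d n $ i))"

definition div_free_coeffs :: "real \<Rightarrow> (int^3 \<Rightarrow> complex^3) \<Rightarrow> bool" where
  "div_free_coeffs L c \<longleftrightarrow> (\<forall>n. (\<Sum>j\<in>UNIV. \<i> * complex_of_real (freq L n $ j) * c n $ j) = 0)"

definition H1 :: "real \<Rightarrow> (real^3 \<Rightarrow> real) \<Rightarrow> bool" where
  "H1 L g \<longleftrightarrow> L2 L g \<and> Hsob L 1 (fcoeff L g)"

definition vH1 :: "real \<Rightarrow> (real^3 \<Rightarrow> real^3) \<Rightarrow> bool" where
  "vH1 L v \<longleftrightarrow> (\<forall>i. H1 L (\<lambda>x. v x $ i))"

definition conv :: "real \<Rightarrow> (real^3 \<Rightarrow> real) \<Rightarrow> (real^3 \<Rightarrow> real^3) \<Rightarrow> real^3 \<Rightarrow> real^3" where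
  "conv L \<phi> v x = tint L (\<lambda>y. \<phi> (x - y) *\<^sub>R v y)"

definition weak_partial :: "real \<Rightarrow> 3 \<Rightarrow> (real^3 \<Rightarrow> real) \<Rightarrow> (real^3 \<Rightarrow> real) \<Rightarrow> bool" where
  "weak_partial L j g h \<longleftrightarrow> L2 L g \<and> L2 L h \<and>
     (\<forall>\<eta>. smooth \<eta> \<and> periodic L \<eta> \<longrightarrow>
        tint L (\<lambda>x. g x * pd (axis j 1) \<eta> x) = - tint L (\<lambda>x. h x * \<eta> x))"

section \<open>Time-dependent objects\<close>

definition Linf_loc :: "('b \<Rightarrow> bool) \<Rightarrow> ('b \<Rightarrow> real) \<Rightarrow> (real \<Rightarrow> 'b) \<Rightarrow> bool" where
  "Linf_loc X N v \<longleftrightarrow> (AE t in lborel. 0 \<le> t \<longrightarrow> X (v t))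
     \<and> (\<forall>T>0. \<exists>M. AE t in lborel. t \<in> {0..T} \<longrightarrow> N (v t) \<le> M)"

definition L2_loc :: "('b \<Rightarrow> bool) \<Rightarrow> ('b \<Rightarrow> real) \<Rightarrow> (real \<Rightarrow> 'b) \<Rightarrow> bool" where
  "L2_loc X N v \<longleftrightarrow> (AE t in lborel. 0 \<le> t \<longrightarrow> X (v t))
     \<and> (\<forall>T>0. set_integrable lborel {0..T} (\<lambda>t. (N (v t))\<^sup>2))"

definition tx_measurable :: "(real \<Rightarrow> real^3 \<Rightarrow> 'b::euclidean_space) \<Rightarrow> bool" where
  "tx_measurable v \<longleftrightarrow> set_borel_measurable borel ({0..} \<times> UNIV) (\<lambda>(t, x). v t x)"

text \<open>The space \<open>L\<^sup>2\<^sub>l\<^sub>o\<^sub>c([0,\<infinity>[, \<dot>H\<^sup>-\<^sup>1)\<close>; since \<open>\<dot>H\<^sup>-\<^sup>1\<close> is a separable Hilbert space, strong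
  measurability in time amounts to measurability of each Fourier coefficient.\<close>

definition force :: "real \<Rightarrow> (real \<Rightarrow> int^3 \<Rightarrow> complex^3) \<Rightarrow> bool" where
  "force L f \<longleftrightarrow> (\<forall>n. set_borel_measurable lborel {0..} (\<lambda>t. f t n))
     \<and> L2_loc (\<lambda>c. vHdot L (-1) c \<and> div_free_coeffs L c) (Hdot_norm L (-1)) f"

definition weakly_continuous :: "real \<Rightarrow> (real \<Rightarrow> real^3 \<Rightarrow> real^3) \<Rightarrow> bool" where
  "weakly_continuous L u \<longleftrightarrow> (\<forall>t\<ge>0. L2s L (u t))
     \<and> (\<forall>g. L2 L g \<longrightarrow> continuous_on {0..} (\<lambda>t. tint L (\<lambda>x. u t x \<bullet> g x)))"

text \<open>Test functions on \<open>]0,\<infinity>[ \<times> \<T>\<^sup>3\<close>, with compact support.\<close>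

definition test_fun :: "real \<Rightarrow> (real \<times> (real^3) \<Rightarrow> real) \<Rightarrow> bool" where
  "test_fun L \<psi> \<longleftrightarrow> smooth \<psi> \<and> (\<forall>t. periodic L (\<lambda>x. \<psi> (t, x)))
     \<and> (\<exists>a b. 0 < a \<and> (\<forall>t x. t \<notin> {a..b} \<longrightarrow> \<psi> (t, x) = 0))"

definition pdt :: "(real \<times> (real^3) \<Rightarrow> real) \<Rightarrow> real \<times> (real^3) \<Rightarrow> real" where
  "pdt = pd (1, 0)"

definition pdx :: "3 \<Rightarrow> (real \<times> (real^3) \<Rightarrow> real) \<Rightarrow> real \<times> (real^3) \<Rightarrow> real" where
  "pdx j = pd (0, axis j 1)"

definition st_int :: "real \<Rightarrow> (real \<Rightarrow> real^3 \<Rightarrow> real) \<Rightarrow> real" where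
  "st_int L g = (LINT t:{0..}|lborel. tint L (g t))"

text \<open>\<open>Dv t x $ i $ j\<close> is \<open>\<partial>\<^sub>j v\<^sub>i\<close>, i.e.\ \<open>Dv\<close> is the transpose of \<open>\<nabla> \<otimes> v\<close>.\<close>

definition weak_jacobian ::
    "real \<Rightarrow> (real \<Rightarrow> real^3 \<Rightarrow> real^3) \<Rightarrow> (real \<Rightarrow> real^3 \<Rightarrow> real^3^3) \<Rightarrow> bool" where
  "weak_jacobian L v Dv \<longleftrightarrow> tx_measurable Dv \<and>
     (AE t in lborel. 0 \<le> t \<longrightarrow>
        (\<forall>i j. weak_partial L j (\<lambda>x. v t x $ i) (\<lambda>x. Dv t x $ i $ j)))"

section \<open>The system and its weak Leray solutions\<close>

definition weak_div_free :: "real \<Rightarrow> (real \<Rightarrow> real^3 \<Rightarrow> real^3) \<Rightarrow> bool" where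
  "weak_div_free L v \<longleftrightarrow> (\<forall>\<psi>. test_fun L \<psi> \<longrightarrow>
     st_int L (\<lambda>t x. \<Sum>j\<in>UNIV. v t x $ j * pdx j \<psi> (t, x)) = 0)"

text \<open>\<open>\<partial>\<^sub>t u - \<nu> \<Delta> u + (u\<^sub>\<alpha> \<cdot> \<nabla>) u + \<nabla> P = f\<close> in the sense of distributions.\<close>

definition weak_momentum ::
    "real \<Rightarrow> real \<Rightarrow> (real \<Rightarrow> int^3 \<Rightarrow> complex^3) \<Rightarrow> (real \<Rightarrow> real^3 \<Rightarrow> real^3) \<Rightarrow>
     (real \<Rightarrow> real^3 \<Rightarrow> real^3^3) \<Rightarrow> (real \<Rightarrow> real^3 \<Rightarrow> real^3) \<Rightarrow> (real \<Rightarrow> real^3 \<Rightarrow> real) \<Rightarrow> bool" where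
  "weak_momentum L \<nu> f u Du u\<alpha> P \<longleftrightarrow> (\<forall>\<psi> i. test_fun L \<psi> \<longrightarrow>
     st_int L (\<lambda>t x. - (u t x $ i * pdt \<psi> (t, x))
                     - \<nu> * u t x $ i * (\<Sum>j\<in>UNIV. pdx j (pdx j \<psi>) (t, x))
                     + (\<Sum>j\<in>UNIV. u\<alpha> t x $ j * Du t x $ i $ j) * \<psi> (t, x)
                     - P t x * pdx i \<psi> (t, x))
     = (LINT t:{0..}|lborel. pairing L (\<lambda>n. f t n $ i) (fcoeff L (\<lambda>x. \<psi> (t, x)))))"

text \<open>\<open>-\<alpha>\<^sup>2 div (A(\<phi> * u) (\<nabla> \<otimes> u\<^sub>\<alpha>)\<^sup>T) + u\<^sub>\<alpha> + \<nabla> P\<^sub>\<alpha> = u\<close> in the sense of distributions.\<close>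

definition weak_filter ::
    "real \<Rightarrow> real \<Rightarrow> (real^3 \<Rightarrow> real) \<Rightarrow> (real^3 \<Rightarrow> real) \<Rightarrow> (real \<Rightarrow> real^3 \<Rightarrow> real^3) \<Rightarrow>
     (real \<Rightarrow> real^3 \<Rightarrow> real^3) \<Rightarrow> (real \<Rightarrow> real^3 \<Rightarrow> real^3^3) \<Rightarrow> (real \<Rightarrow> real^3 \<Rightarrow> real) \<Rightarrow> bool" where
  "weak_filter L \<alpha> A \<phi> u u\<alpha> Du\<alpha> P\<alpha> \<longleftrightarrow> (\<forall>\<psi> i. test_fun L \<psi> \<longrightarrow>
     st_int L (\<lambda>t x. \<alpha>\<^sup>2 * (\<Sum>j\<in>UNIV. A (conv L \<phi> (u t) x) * Du\<alpha> t x $ i $ j * pdx j \<psi> (t, x))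
                     + u\<alpha> t x $ i * \<psi> (t, x)
                     - P\<alpha> t x * pdx i \<psi> (t, x))
     = st_int L (\<lambda>t x. u t x $ i * \<psi> (t, x)))"

text \<open>The velocity \<open>u\<close> is given by its weakly continuous representative, so that \<open>u t\<close> is
  meaningful for every \<open>t \<ge> 0\<close>; the fields \<open>u\<^sub>\<alpha>\<close>, \<open>P\<close>, \<open>P\<^sub>\<alpha>\<close> are arbitrary representatives.\<close>

definition weak_Leray_solution ::
    "real \<Rightarrow> real \<Rightarrow> real \<Rightarrow> (real^3 \<Rightarrow> real) \<Rightarrow> (real^3 \<Rightarrow> real) \<Rightarrow> (real^3 \<Rightarrow> real^3) \<Rightarrow>
     (real \<Rightarrow> int^3 \<Rightarrow> complex^3) \<Rightarrow> (real \<Rightarrow> real^3 \<Rightarrow> real^3) \<Rightarrow> (real \<Rightarrow> real^3 \<Rightarrow> real^3) \<Rightarrow>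
     (real \<Rightarrow> real^3 \<Rightarrow> real) \<Rightarrow> (real \<Rightarrow> real^3 \<Rightarrow> real) \<Rightarrow> bool" where
  "weak_Leray_solution L \<alpha> \<nu> A \<phi> u0 f u u\<alpha> P P\<alpha> \<longleftrightarrow>
     tx_measurable u \<and> tx_measurable u\<alpha> \<and> tx_measurable P \<and> tx_measurable P\<alpha> \<and>
     Linf_loc (L2s L) (L2_norm L) u \<and>
     L2_loc (\<lambda>v. vHdot L 1 (vfcoeff L v)) (\<lambda>v. Hdot_norm L 1 (vfcoeff L v)) u \<and>
     Linf_loc (vH1 L) (\<lambda>v. Hsob_norm L 1 (vfcoeff L v)) u\<alpha> \<and>
     L2_loc (L2 L) (L2_norm L) P \<and>
     Linf_loc (L2 L) (L2_norm L) P\<alpha> \<and>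
     (\<exists>Du Du\<alpha>. weak_jacobian L u Du \<and> weak_jacobian L u\<alpha> Du\<alpha> \<and>
        weak_momentum L \<nu> f u Du u\<alpha> P \<and> weak_filter L \<alpha> A \<phi> u u\<alpha> Du\<alpha> P\<alpha>) \<and>
     weak_div_free L u \<and> weak_div_free L u\<alpha> \<and>
     weakly_continuous L u \<and> (AE x in lborel. u 0 x = u0 x) \<and>
     (\<forall>t\<ge>0. (L2_norm L (u t))\<^sup>2
          + 2 * \<nu> * (LINT s:{0..t}|lborel. (Hdot_norm L 1 (vfcoeff L (u s)))\<^sup>2)
        \<le> (L2_norm L u0)\<^sup>2 + 2 * (LINT s:{0..t}|lborel. vpairing L (f s) (vfcoeff L (u s))))"

section \<open>The norms in the stability estimate\<close>

definition E_norm :: "real \<Rightarrow> real \<Rightarrow> real \<Rightarrow> (real \<Rightarrow> real^3 \<Rightarrow> real^3) \<Rightarrow> real" where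
  "E_norm L \<nu> T v = (SUP t\<in>{0..T}. L2_norm L (v t))
     + sqrt \<nu> * sqrt (LINT t:{0..T}|lborel. (Hdot_norm L 1 (vfcoeff L (v t)))\<^sup>2)"

definition Linf_norm :: "real \<Rightarrow> ('b \<Rightarrow> real) \<Rightarrow> (real \<Rightarrow> 'b) \<Rightarrow> ereal" where
  "Linf_norm T N v = esssup (restrict_space lborel {0..T}) (\<lambda>t. ereal (N (v t)))"

end

theory Submission
  imports Defs
begin

text \<open>
  Let \<open>w = u1 - u2\<close> and \<open>z = u\<alpha>1 - u\<alpha>2\<close>.  All spatial analysis is done with Fourier
  coefficients; the proof rests on two estimates and on a limiting argument.

  \<^emph>\<open>The filter depends on the velocity in a Lipschitz way.\<close>  Testing the filter equation with the
  filtered velocity bounds the square norm of its gradient by \<open>M / (2 \<alpha>\<^sup>2 \<beta>)\<close>, where \<open>M\<close> bounds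
  the energy of both velocities.  For the difference of two filter equations write
  \<open>A1 \<nabla>u\<alpha>1 - A2 \<nabla>u\<alpha>2 = A1 \<nabla>z + (A1 - A2) \<nabla>u\<alpha>2\<close> and test with \<open>z\<close>.  As \<open>A\<close> is
  Lipschitz and the convolution with \<open>\<phi>\<close> is bounded from \<open>L\<^sup>2\<close> to the bounded functions,
  \<open>A1 - A2\<close> is bounded uniformly by a multiple of the norm of \<open>w\<close>.  Hence the square of the
  \<open>H\<^sup>1\<close> norm of \<open>z\<close> is at most \<open>D\<close> times the square of the \<open>L\<^sup>2\<close> norm of \<open>w\<close>
  (\<open>filtered_stability\<close>).  This is the second claim of the theorem.

  \<^emph>\<open>The advection terms.\<close>  The difference of the advection terms is
  \<open>(u\<alpha>1 \<cdot> \<nabla>) w + (z \<cdot> \<nabla>) u2\<close>.  In three dimensions the integral of \<open>(a \<cdot> \<nabla>) g \<cdot> p\<close> is at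
  most a constant times the product of the \<open>H\<^sup>1\<close> seminorms of \<open>a\<close>, \<open>g\<close> and \<open>p\<close>; in Fourier
  coefficients this follows from the convergence of the sum of \<open>|k|\<^sup>-\<^sup>4\<close> over the nonzero
  frequencies (\<open>trilinear_sum_bound\<close>).  So the second term, tested with \<open>w\<close>, is controlled by the
  \<open>L\<^sup>2\<close> norm of \<open>w\<close>, by the gradient of \<open>u2\<close> and by the gradient of \<open>w\<close>; the last factor is
  absorbed by the viscosity.  The first term, tested with \<open>w\<close>, vanishes since \<open>u\<alpha>1\<close> is
  divergence free.

  \<^emph>\<open>Testing with the difference.\<close>  A Leray solution satisfies an energy inequality only, so testing
  the equation of \<open>w\<close> with \<open>w\<close> has to be justified.  The momentum equation, tested with a smooth
  function of time times one spatial mode, says that each Fourier coefficient of \<open>u\<close> is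
  absolutely continuous and satisfies an ordinary differential equation (\<open>weak_momentum_Fourier\<close>).
  Thus the energy of the finitely many modes of \<open>w\<close> in a box \<open>K\<close> of frequencies satisfies an
  identity.  In it the first advection term no longer cancels: the pairs of frequencies in
  \<open>K \<times> K\<close> cancel, the others contribute at most a constant times
  \<open>sqrt (e - e\<^sub>K) * sqrt e\<^sub>K\<close>, where \<open>e\<close> and \<open>e\<^sub>K\<close> are the squares of the \<open>H\<^sup>1\<close>
  seminorms of \<open>w\<close> and of its part in \<open>K\<close>.  This is bounded by the integrable function \<open>e\<close> and
  tends to \<open>0\<close> as \<open>K\<close> grows, so it disappears by dominated convergence (\<open>leray_stability\<close>).

  What remains is an integral inequality for the energy of \<open>w\<close> whose weight is a multiple of the
  square of the \<open>H\<^sup>1\<close> seminorm of \<open>u2\<close>.  By the energy inequality this weight is integrable, with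
  a bound in terms of the data (\<open>energy_a_priori\<close>), and Gronwall's inequality (\<open>Gronwall_integral\<close>)
  applies.  The resulting factor depends on the parameters, on the data and on \<open>T\<close>, but not on the
  solutions.  It exceeds \<open>1\<close>, so it is of the form \<open>exp (C0 * sqrt T)\<close> with \<open>C0 > 0\<close>.
\<close>

section \<open>Square integrable functions on the period cell\<close>

text \<open>
  Square integrability on a measure space.  Periodicity is not part of it, so that it applies on one
  period cell and is stable under products with bounded functions.
\<close>

definition sqi :: "'a measure \<Rightarrow> ('a \<Rightarrow> 'b::euclidean_space) \<Rightarrow> bool" where
  "sqi M g \<longleftrightarrow> g \<in> borel_measurable M \<and> integrable M (\<lambda>x. (norm (g x))\<^sup>2)"

lemma sqi_measurable [measurable_dest]: "sqi M g \<Longrightarrow> g \<in> borel_measurable M"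
  by (simp add: sqi_def)

lemma sqi_integrable: "sqi M g \<Longrightarrow> integrable M (\<lambda>x. (norm (g x))\<^sup>2)"
  by (simp add: sqi_def)

lemma sqi_dominated:
  assumes "sqi M g" "f \<in> borel_measurable M" "\<And>x. x \<in> space M \<Longrightarrow> norm (f x) \<le> c * norm (g x)"
  shows "sqi M f"
  unfolding sqi_def
proof
  show "integrable M (\<lambda>x. (norm (f x))\<^sup>2)"
  proof (rule Bochner_Integration.integrable_bound)
    show "integrable M (\<lambda>x. c\<^sup>2 * (norm (g x))\<^sup>2)" using assms(1) by (simp add: sqi_def)
    show "(\<lambda>x. (norm (f x))\<^sup>2) \<in> borel_measurable M" using assms(2) by measurable
    show "AE x in M. norm ((norm (f x))\<^sup>2) \<le> norm (c\<^sup>2 * (norm (g x))\<^sup>2)"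
    proof (rule AE_I2)
      fix x assume "x \<in> space M"
      then have "(norm (f x))\<^sup>2 \<le> (c * norm (g x))\<^sup>2" using assms(3) by (intro power_mono) auto
      then show "norm ((norm (f x))\<^sup>2) \<le> norm (c\<^sup>2 * (norm (g x))\<^sup>2)" by (simp add: power_mult_distrib)
    qed
  qed
qed (fact assms(2))

lemma norm_add_sq_le: "(norm (x + y :: 'a::real_normed_vector))\<^sup>2 \<le> 2 * (norm x)\<^sup>2 + 2 * (norm y)\<^sup>2"
proof -
  have "(norm (x + y))\<^sup>2 \<le> (norm x + norm y)\<^sup>2" by (intro power_mono norm_triangle_ineq) auto
  also have "\<dots> \<le> 2 * (norm x)\<^sup>2 + 2 * (norm y)\<^sup>2"
    using zero_le_power2[of "norm x - norm y"] by (simp add: power2_eq_square algebra_simps)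
  finally show ?thesis .
qed

lemma sqi_add:
  assumes "sqi M f" "sqi M g" shows "sqi M (\<lambda>x. f x + g x)"
  unfolding sqi_def
proof
  have [measurable]: "f \<in> borel_measurable M" "g \<in> borel_measurable M" using assms by (auto simp: sqi_def)
  show "(\<lambda>x. f x + g x) \<in> borel_measurable M" by measurable
  show "integrable M (\<lambda>x. (norm (f x + g x))\<^sup>2)"
  proof (rule Bochner_Integration.integrable_bound)
    show "integrable M (\<lambda>x. 2 * (norm (f x))\<^sup>2 + 2 * (norm (g x))\<^sup>2)" using assms by (simp add: sqi_def)
    show "AE x in M. norm ((norm (f x + g x))\<^sup>2) \<le> norm (2 * (norm (f x))\<^sup>2 + 2 * (norm (g x))\<^sup>2)"
      using norm_add_sq_le by auto
  qed measurable
qed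

lemma sqi_uminus: "sqi M f \<Longrightarrow> sqi M (\<lambda>x. - f x)"
  by (rule sqi_dominated[of M f _ 1]) auto

lemma sqi_diff: "sqi M f \<Longrightarrow> sqi M g \<Longrightarrow> sqi M (\<lambda>x. f x - g x)"
  using sqi_add[of M f "\<lambda>x. - g x"] sqi_uminus[of M g] by simp

lemma sqi_mult_bounded:
  assumes "sqi M f" "h \<in> borel_measurable M" "\<And>x. x \<in> space M \<Longrightarrow> \<bar>h x\<bar> \<le> B"
  shows "sqi M (\<lambda>x. h x *\<^sub>R f x)"
proof (rule sqi_dominated[OF assms(1), of _ B])
  show "(\<lambda>x. h x *\<^sub>R f x) \<in> borel_measurable M" using assms by (auto simp: sqi_def)
qed (use assms(3) in \<open>auto intro!: mult_right_mono\<close>)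

lemma sqi_cmult_bounded:
  fixes f :: "'a \<Rightarrow> complex"
  assumes "sqi M f" "h \<in> borel_measurable M" "\<And>x. x \<in> space M \<Longrightarrow> norm (h x) \<le> B"
  shows "sqi M (\<lambda>x. h x * f x)"
proof (rule sqi_dominated[OF assms(1), of _ B])
  show "(\<lambda>x. h x * f x) \<in> borel_measurable M" using assms by (auto simp: sqi_def)
qed (use assms(3) in \<open>auto simp: norm_mult intro!: mult_right_mono\<close>)

lemma sqi_sum: "finite K \<Longrightarrow> (\<And>k. k \<in> K \<Longrightarrow> sqi M (f k)) \<Longrightarrow> sqi M (\<lambda>x. \<Sum>k\<in>K. f k x)"
  by (induction K rule: finite_induct) (auto intro!: sqi_add, auto simp: sqi_def)

lemma sqi_const: "finite_measure M \<Longrightarrow> sqi M (\<lambda>x. c)"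
  by (auto simp: sqi_def finite_measure.integrable_const)

lemma sqi_norm_prod_integrable:
  assumes "sqi M f" "sqi M g"
  shows "integrable M (\<lambda>x. norm (f x) * norm (g x))"
proof (rule Bochner_Integration.integrable_bound)
  have [measurable]: "f \<in> borel_measurable M" "g \<in> borel_measurable M" using assms by (auto simp: sqi_def)
  show "(\<lambda>x. norm (f x) * norm (g x)) \<in> borel_measurable M" by measurable
  show "integrable M (\<lambda>x. (norm (f x))\<^sup>2 + (norm (g x))\<^sup>2)" using assms by (simp add: sqi_def)
  have "\<bar>a * b\<bar> \<le> a\<^sup>2 + b\<^sup>2" for a b :: real
    using sum_squares_bound[of "\<bar>a\<bar>" "\<bar>b\<bar>"] mult_nonneg_nonneg[OF abs_ge_zero[of a] abs_ge_zero[of b]]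
    unfolding abs_mult power2_abs mult.assoc by linarith
  then have "norm (norm (f x) * norm (g x)) \<le> norm ((norm (f x))\<^sup>2 + (norm (g x))\<^sup>2)" for x
    by (metis abs_ge_self order_trans real_norm_def)
  then show "AE x in M. norm (norm (f x) * norm (g x)) \<le> norm ((norm (f x))\<^sup>2 + (norm (g x))\<^sup>2)"
    by (intro AE_I2)
qed

text \<open>
  The integral of \<open>(|f| - s |g|)\<^sup>2\<close> is a nonnegative quadratic polynomial in \<open>s\<close>; take its
  minimum, or a large \<open>s\<close> if \<open>g\<close> vanishes.
\<close>

lemma sqi_Cauchy_Schwarz:
  assumes "sqi M f" "sqi M g"
  shows "(\<integral>x. norm (f x) * norm (g x) \<partial>M)
    \<le> sqrt (\<integral>x. (norm (f x))\<^sup>2 \<partial>M) * sqrt (\<integral>x. (norm (g x))\<^sup>2 \<partial>M)" (is "?C \<le> sqrt ?A * sqrt ?B")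
proof -
  have i: "integrable M (\<lambda>x. (norm (f x))\<^sup>2)" "integrable M (\<lambda>x. (norm (g x))\<^sup>2)"
    "integrable M (\<lambda>x. norm (f x) * norm (g x))"
    using assms sqi_norm_prod_integrable by (auto simp: sqi_def)
  have q: "0 \<le> ?A - 2 * s * ?C + s\<^sup>2 * ?B" for s
  proof -
    have "0 \<le> (\<integral>x. (norm (f x) - s * norm (g x))\<^sup>2 \<partial>M)" by (intro integral_nonneg_AE) auto
    also have "\<dots> = (\<integral>x. (norm (f x))\<^sup>2 - 2 * s * (norm (f x) * norm (g x)) + s\<^sup>2 * (norm (g x))\<^sup>2 \<partial>M)"
      by (intro Bochner_Integration.integral_cong) (auto simp: power2_eq_square algebra_simps)
    also have "\<dots> = ?A - 2 * s * ?C + s\<^sup>2 * ?B"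
      using i by simp
    finally show ?thesis .
  qed
  have nn: "0 \<le> ?A" "0 \<le> ?B" "0 \<le> ?C" by (auto intro!: integral_nonneg_AE)
  have "?C\<^sup>2 \<le> ?A * ?B"
  proof (cases "?B = 0")
    case True
    have "?C = 0"
    proof (rule ccontr)
      assume c: "?C \<noteq> 0"
      show False using q[of "(?A + 1) / (2 * ?C)"] True c nn by (simp add: field_simps)
    qed
    then show ?thesis using nn by simp
  next
    case False
    then have "?B > 0" using nn(2) by linarith
    then show ?thesis using q[of "?C / ?B"] by (simp add: field_simps power2_eq_square)
  qed
  then have "sqrt (?C\<^sup>2) \<le> sqrt (?A * ?B)" by (rule real_sqrt_le_mono)
  then show ?thesis using nn by (simp add: real_sqrt_mult)
qed

lemma sqi_mult_integrable:
  fixes f g :: "'a \<Rightarrow> 'b::{euclidean_space,real_normed_algebra}"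
  assumes "sqi M f" "sqi M g"
  shows "integrable M (\<lambda>x. f x * g x)"
proof (rule Bochner_Integration.integrable_bound[OF sqi_norm_prod_integrable[OF assms]])
  have [measurable]: "f \<in> borel_measurable M" "g \<in> borel_measurable M" using assms by (auto simp: sqi_def)
  show "(\<lambda>x. f x * g x) \<in> borel_measurable M" by measurable
qed (auto simp: norm_mult_ineq)

lemma sqi_mult_norm_le:
  fixes f g :: "'a \<Rightarrow> 'b::{euclidean_space,real_normed_algebra}"
  assumes "sqi M f" "sqi M g"
  shows "norm (\<integral>x. f x * g x \<partial>M)
    \<le> sqrt (\<integral>x. (norm (f x))\<^sup>2 \<partial>M) * sqrt (\<integral>x. (norm (g x))\<^sup>2 \<partial>M)"
proof -
  have "norm (\<integral>x. f x * g x \<partial>M) \<le> (\<integral>x. norm (f x * g x) \<partial>M)" by simp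
  also have "\<dots> \<le> (\<integral>x. norm (f x) * norm (g x) \<partial>M)"
    by (intro integral_mono integrable_norm sqi_mult_integrable sqi_norm_prod_integrable assms norm_mult_ineq)
  finally show ?thesis using sqi_Cauchy_Schwarz[OF assms] by simp
qed

text \<open>
  With the cell as a measure space of finite measure, \<^const>\<open>tint\<close> is a plain integral.
\<close>

definition cell :: "real \<Rightarrow> (real^3) measure" where
  "cell L = restrict_space lborel (cbox 0 (\<chi> i. L))"

lemma space_cell: "space (cell L) = cbox 0 (\<chi> i. L)"
  by (simp add: cell_def space_restrict_space)

lemma tint_cell: "tint L g = integral\<^sup>L (cell L) g"
  unfolding tint_def cell_def set_lebesgue_integral_def
  by (subst integral_restrict_space) auto

lemma borel_measurable_cell: "f \<in> borel_measurable borel \<Longrightarrow> f \<in> borel_measurable (cell L)"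
  unfolding cell_def by (intro measurable_restrict_space1) simp

lemma emeasure_cell: "L > 0 \<Longrightarrow> emeasure (cell L) (space (cell L)) = ennreal (L^3)"
proof -
  assume L: "L > 0"
  have "emeasure (cell L) (space (cell L)) = emeasure lborel (cbox 0 ((\<chi> i. L) :: real^3))"
    by (simp add: space_cell) (simp add: cell_def emeasure_restrict_space)
  also have "\<dots> = ennreal (\<Prod>b\<in>Basis. (((\<chi> i. L) :: real^3) - 0) \<bullet> b)"
    by (rule emeasure_lborel_cbox) (use L in \<open>auto simp: Basis_vec_def inner_axis\<close>)
  also have "(\<Prod>b\<in>Basis. (((\<chi> i. L) :: real^3) - 0) \<bullet> b) = (\<Prod>b\<in>(Basis::(real^3) set). L)"
    by (intro prod.cong) (auto simp: Basis_vec_def inner_axis)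
  finally show ?thesis by simp
qed

lemma finite_measure_cell: "finite_measure (cell L)"
proof
  have "emeasure lborel (cbox 0 ((\<chi> i. L) :: real^3)) < \<infinity>" by (rule emeasure_lborel_cbox_finite)
  then show "emeasure (cell L) (space (cell L)) \<noteq> \<infinity>"
    by (simp add: space_cell) (simp add: cell_def emeasure_restrict_space less_top)
qed

lemma measure_cell: "L > 0 \<Longrightarrow> measure (cell L) (space (cell L)) = L^3"
  using emeasure_cell[of L] by (simp add: measure_def)

lemma L2_sqi: "L2 L g \<Longrightarrow> sqi (cell L) g"
  unfolding L2_def sqi_def cell_def set_integrable_def
  by (auto simp: integrable_restrict_space intro!: measurable_restrict_space1)

lemma sqi_cell_integrable: "sqi (cell L) (f :: _ \<Rightarrow> 'b::euclidean_space) \<Longrightarrow> integrable (cell L) f"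
proof -
  assume f: "sqi (cell L) f"
  interpret finite_measure "cell L" by (rule finite_measure_cell)
  have "integrable (cell L) (\<lambda>x. norm (f x) * norm (1::real))"
    by (rule sqi_norm_prod_integrable[OF f sqi_const[OF finite_measure_cell]])
  then show ?thesis using f by (simp add: sqi_def integrable_norm_iff)
qed

lemma integral_lborel_prod:
  fixes f :: "'a::euclidean_space \<Rightarrow> real \<Rightarrow> complex"
  assumes "\<And>b. b \<in> Basis \<Longrightarrow> integrable lborel (f b)"
  shows "(\<integral>x. (\<Prod>b\<in>Basis. f b (x \<bullet> b)) \<partial>(lborel :: 'a measure)) = (\<Prod>b\<in>Basis. integral\<^sup>L lborel (f b))"
proof -
  interpret product_sigma_finite "\<lambda>b::'a. lborel :: real measure"
    by (simp add: product_sigma_finite_def lborel.sigma_finite_measure_axioms)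
  have [measurable]: "\<And>b. b \<in> Basis \<Longrightarrow> f b \<in> borel_measurable borel"
    using assms by (auto dest!: borel_measurable_integrable)
  have "(\<integral>x. (\<Prod>b\<in>Basis. f b (x \<bullet> b)) \<partial>(lborel :: 'a measure))
     = (\<integral>y. (\<Prod>b\<in>Basis. f b ((\<Sum>c\<in>Basis. y c *\<^sub>R c) \<bullet> b)) \<partial>(\<Pi>\<^sub>M b\<in>Basis. lborel))"
    by (subst lborel_eq) (simp add: integral_distr)
  also have "\<dots> = (\<integral>y. (\<Prod>b\<in>Basis. f b (y b)) \<partial>(\<Pi>\<^sub>M b\<in>Basis. lborel))"
    by (intro Bochner_Integration.integral_cong prod.cong refl arg_cong[where f="f _"])
      (simp add: inner_sum_left inner_Basis if_distrib sum.delta cong: if_cong)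
  also have "\<dots> = (\<Prod>b\<in>Basis. integral\<^sup>L lborel (f b))"
    by (rule product_integral_prod) (use assms in auto)
  finally show ?thesis .
qed

lemma integral_cis_Icc:
  assumes "L > 0"
  shows "integrable lborel (\<lambda>s. indicator {0..L} s *\<^sub>R cis (c * s))"
    and "c = 2 * pi / L * of_int m \<Longrightarrow>
      (\<integral>s. indicator {0..L} s *\<^sub>R cis (c * s) \<partial>lborel) = (if m = 0 then complex_of_real L else 0)"
proof -
  have cont: "continuous_on {0..L} (\<lambda>s. cis (c * s))" by (intro continuous_intros)
  show "integrable lborel (\<lambda>s. indicator {0..L} s *\<^sub>R cis (c * s))"
    using borel_integrable_atLeastAtMost'[OF cont] by (simp add: set_integrable_def)
  assume c: "c = 2 * pi / L * of_int m"
  show "(\<integral>s. indicator {0..L} s *\<^sub>R cis (c * s) \<partial>lborel) = (if m = 0 then complex_of_real L else 0)"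
  proof (cases "m = 0")
    case True
    then show ?thesis using assms c by (simp add: scaleR_conv_of_real)
  next
    case False
    then have c0: "c \<noteq> 0" using c assms by simp
    define F where "F s = cis (c * s) / (\<i> * of_real c)" for s :: real
    have "(F has_vector_derivative cis (c * s)) (at s within {0..L})" for s
    proof -
      have "((\<lambda>s. cis (c * s)) has_vector_derivative c *\<^sub>R (\<i> * cis (c * s))) (at s within {0..L})"
      proof -
        have "((\<lambda>s. exp (\<i> * of_real c * of_real s)) has_vector_derivative (\<i> * of_real c * exp (\<i> * of_real c * of_real s))) (at s within {0..L})"
          by (rule has_vector_derivative_real_field) (auto intro!: derivative_eq_intros)
        then show ?thesis by (simp add: cis_conv_exp scaleR_conv_of_real mult.assoc mult.left_commute)
      qed
      then have "(F has_vector_derivative (c *\<^sub>R (\<i> * cis (c * s))) / (\<i> * of_real c)) (at s within {0..L})"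
        unfolding F_def by (rule has_vector_derivative_divide)
      then show ?thesis using c0 by (simp add: scaleR_conv_of_real)
    qed
    then have "(\<integral>s. indicator {0..L} s *\<^sub>R cis (c * s) \<partial>lborel) = F L - F 0"
      using integral_FTC_atLeastAtMost[of 0 L F "\<lambda>s. cis (c * s)"] assms cont by simp
    also have "\<dots> = 0" using cis_multiple_2pi[of "of_int m"] assms by (simp add: F_def c mult.commute mult.left_commute)
    finally show ?thesis using False by simp
  qed
qed

text \<open>
  Orthogonality of the characters: the integral factorises over the coordinates, and a nonconstant
  factor runs over full periods.
\<close>

lemma integral_cell_cis:
  assumes "L > 0"
  shows "(\<integral>x. cis (freq L n \<bullet> x) \<partial>cell L) = (if n = 0 then complex_of_real (L^3) else 0)"
proof -
  define g where "g b s = indicator {0..L} s *\<^sub>R cis ((freq L n \<bullet> b) * s)" for b :: "real^3" and s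
  have "(\<integral>x. cis (freq L n \<bullet> x) \<partial>cell L) = (\<integral>x. indicator (cbox 0 (\<chi> i. L)) x *\<^sub>R cis (freq L n \<bullet> x) \<partial>lborel)"
    unfolding cell_def by (subst integral_restrict_space) auto
  also have "\<dots> = (\<integral>x. (\<Prod>b\<in>Basis. g b (x \<bullet> b)) \<partial>lborel)"
  proof (rule Bochner_Integration.integral_cong[OF refl])
    fix x :: "real^3"
    have mem: "x \<in> cbox 0 (\<chi> i. L) \<longleftrightarrow> (\<forall>b\<in>Basis. x \<bullet> b \<in> {0..L})"
      by (auto simp: mem_box Basis_vec_def inner_axis)
    have "indicat_real (cbox 0 (\<chi> i. L)) x = (\<Prod>b\<in>Basis. indicator {0..L} (x \<bullet> b))"
    proof (cases "x \<in> cbox 0 (\<chi> i. L)")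
      case True
      then have "(\<Prod>b\<in>Basis. indicat_real {0..L} (x \<bullet> b)) = (\<Prod>b\<in>(Basis::(real^3) set). 1)"
        unfolding mem by (intro prod.cong) auto
      then show ?thesis using True by simp
    next
      case False
      then obtain b where b: "b \<in> Basis" "x \<bullet> b \<notin> {0..L}" unfolding mem by blast
      then have "(\<Prod>b\<in>Basis. indicat_real {0..L} (x \<bullet> b)) = 0" by (intro prod_zero bexI[of _ b]) (simp_all add: indicator_def)
      then show ?thesis using False by simp
    qed
    moreover have "cis (freq L n \<bullet> x) = (\<Prod>b\<in>Basis. cis ((freq L n \<bullet> b) * (x \<bullet> b)))"
      by (subst euclidean_inner) (simp add: cis_conv_exp sum_distrib_left exp_sum)
    ultimately show "indicator (cbox 0 (\<chi> i. L)) x *\<^sub>R cis (freq L n \<bullet> x) = (\<Prod>b\<in>Basis. g b (x \<bullet> b))"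
      by (simp add: g_def scaleR_conv_of_real prod.distrib)
  qed
  also have "\<dots> = (\<Prod>b\<in>Basis. integral\<^sup>L lborel (g b))"
    by (rule integral_lborel_prod) (use integral_cis_Icc(1)[OF assms] in \<open>auto simp: g_def\<close>)
  also have "\<dots> = (\<Prod>b\<in>(Basis::(real^3) set). (\<integral>s. indicator {0..L} s *\<^sub>R cis ((freq L n \<bullet> b) * s) \<partial>lborel))"
    unfolding g_def[abs_def] ..
  also have "\<dots> = (\<Prod>i\<in>(UNIV::3 set). (\<integral>s. indicator {0..L} s *\<^sub>R cis ((freq L n \<bullet> axis i 1) * s) \<partial>lborel))"
    by (simp add: Basis_vec_def UNION_singleton_eq_range) (subst prod.reindex, auto simp: inj_on_def axis_eq_axis)
  also have "\<dots> = (\<Prod>i\<in>(UNIV::3 set). if n $ i = 0 then complex_of_real L else 0)"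
    by (intro prod.cong refl integral_cis_Icc(2)[OF assms]) (simp add: freq_def inner_axis)
  also have "\<dots> = (if n = 0 then complex_of_real (L^3) else 0)"
    by (auto simp: vec_eq_iff)
  finally show ?thesis .
qed

section \<open>Density of trigonometric polynomials and Parseval's identity\<close>

abbreviation tsum :: "real \<Rightarrow> (int^3) set \<Rightarrow> (int^3 \<Rightarrow> complex) \<Rightarrow> real^3 \<Rightarrow> complex" where
  "tsum L K c \<equiv> (\<lambda>x. \<Sum>n\<in>K. c n * cis (freq L n \<bullet> x))"

abbreviation sqdist :: "real \<Rightarrow> (real^3 \<Rightarrow> complex) \<Rightarrow> (real^3 \<Rightarrow> complex) \<Rightarrow> real" where
  "sqdist L f g \<equiv> \<integral>x. (norm (f x - g x))\<^sup>2 \<partial>cell L"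

text \<open>
  Scalar complex trigonometric polynomials; in contrast to \<^const>\<open>trig_poly\<close> they form an algebra.
\<close>

definition tpoly :: "real \<Rightarrow> (real^3 \<Rightarrow> complex) \<Rightarrow> bool" where
  "tpoly L q \<longleftrightarrow> (\<exists>K c. finite K \<and> q = tsum L K c)"

lemma freq_add: "freq L (m + n) = freq L m + freq L n"
  by (simp add: freq_def vec_eq_iff algebra_simps)
lemma freq_uminus: "freq L (- n) = - freq L n"
  by (simp add: freq_def vec_eq_iff)
lemma freq_0 [simp]: "freq L 0 = 0"
  by (simp add: freq_def vec_eq_iff)
lemma freq_diff: "freq L (m - n) = freq L m - freq L n"
  by (simp add: freq_def vec_eq_iff algebra_simps)

lemma tpolyI: "finite K \<Longrightarrow> tpoly L (tsum L K c)"
  unfolding tpoly_def by blast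

lemma tpoly_mono: "tpoly L (\<lambda>x. c * cis (freq L n \<bullet> x))"
  using tpolyI[of "{n}" L "\<lambda>_. c"] by simp

lemma tpoly_const: "tpoly L (\<lambda>x. c)"
  using tpoly_mono[of L c 0] by simp

lemma tpoly_add: assumes "tpoly L p" "tpoly L q" shows "tpoly L (\<lambda>x. p x + q x)"
proof -
  obtain K c where p: "finite K" "p = tsum L K c"
    using assms(1) unfolding tpoly_def by blast
  obtain M d where q: "finite M" "q = tsum L M d"
    using assms(2) unfolding tpoly_def by blast
  have "(\<lambda>x. p x + q x) = (\<lambda>x. \<Sum>n\<in>K \<union> M. ((if n \<in> K then c n else 0) + (if n \<in> M then d n else 0)) * cis (freq L n \<bullet> x))"
  proof
    fix x
    have "p x = (\<Sum>n\<in>K \<union> M. (if n \<in> K then c n else 0) * cis (freq L n \<bullet> x))"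
      unfolding p(2) by (rule sum.mono_neutral_cong_left) (use p q in auto)
    moreover have "q x = (\<Sum>n\<in>K \<union> M. (if n \<in> M then d n else 0) * cis (freq L n \<bullet> x))"
      unfolding q(2) by (rule sum.mono_neutral_cong_left) (use p q in auto)
    ultimately show "p x + q x = (\<Sum>n\<in>K \<union> M. ((if n \<in> K then c n else 0) + (if n \<in> M then d n else 0)) * cis (freq L n \<bullet> x))"
      by (simp add: distrib_right sum.distrib)
  qed
  then show ?thesis using tpolyI[of "K \<union> M" L] p q by simp
qed

lemma tpoly_sum: "finite A \<Longrightarrow> (\<And>a. a \<in> A \<Longrightarrow> tpoly L (p a)) \<Longrightarrow> tpoly L (\<lambda>x. \<Sum>a\<in>A. p a x)"
  by (induction A rule: finite_induct) (auto intro: tpoly_add tpoly_const)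

lemma tpoly_mult: assumes "tpoly L p" "tpoly L q" shows "tpoly L (\<lambda>x. p x * q x)"
proof -
  obtain K c where p: "finite K" "p = tsum L K c"
    using assms(1) unfolding tpoly_def by blast
  obtain M d where q: "finite M" "q = tsum L M d"
    using assms(2) unfolding tpoly_def by blast
  have "(\<lambda>x. p x * q x) = (\<lambda>x. \<Sum>n\<in>K. \<Sum>m\<in>M. (c n * d m) * cis (freq L (n + m) \<bullet> x))"
    unfolding p(2) q(2) sum_product
    by (intro ext sum.cong refl) (simp add: freq_add inner_add_left flip: cis_mult)
  then show ?thesis using p q by (auto intro!: tpoly_sum tpoly_mono)
qed

lemma tpoly_cos_sin:
  shows "tpoly L (\<lambda>x. complex_of_real (cos (freq L n \<bullet> x)))" "tpoly L (\<lambda>x. complex_of_real (sin (freq L n \<bullet> x)))"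
proof -
  have "(\<lambda>x. complex_of_real (cos (freq L n \<bullet> x))) = (\<lambda>x. (1/2) * cis (freq L n \<bullet> x) + (1/2) * cis (freq L (- n) \<bullet> x))"
    by (auto simp: fun_eq_iff complex_eq_iff freq_uminus)
  then show "tpoly L (\<lambda>x. complex_of_real (cos (freq L n \<bullet> x)))"
    by (simp only:) (intro tpoly_add tpoly_mono)
  have "(\<lambda>x. complex_of_real (sin (freq L n \<bullet> x))) = (\<lambda>x. (-\<i>/2) * cis (freq L n \<bullet> x) + (\<i>/2) * cis (freq L (- n) \<bullet> x))"
    by (auto simp: fun_eq_iff complex_eq_iff freq_uminus)
  then show "tpoly L (\<lambda>x. complex_of_real (sin (freq L n \<bullet> x)))"
    by (simp only:) (intro tpoly_add tpoly_mono)
qed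

lemma cis_measurable_cell [measurable]: "(\<lambda>x. cis (v \<bullet> x)) \<in> borel_measurable (cell L)"
  by (intro borel_measurable_cell borel_measurable_continuous_onI continuous_intros)

lemma tpoly_sqi: "tpoly L q \<Longrightarrow> sqi (cell L) q"
  unfolding tpoly_def
proof clarify
  fix K :: "(int^3) set" and c :: "int^3 \<Rightarrow> complex" assume "finite K"
  then show "sqi (cell L) (tsum L K c)"
  proof (rule sqi_sum)
    fix n
    show "sqi (cell L) (\<lambda>x. c n * cis (freq L n \<bullet> x))"
      using sqi_cmult_bounded[OF sqi_const[OF finite_measure_cell, of L "c n"], of "\<lambda>x. cis (freq L n \<bullet> x)" 1]
      by (simp add: mult.commute)
  qed
qed

text \<open>
  The embedding of the torus into \<open>\<complex>\<^sup>3\<close>.  Polynomials in these coordinates are trigonometric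
  polynomials, so the Stone-Weierstrass theorem on the compact image of the cell approximates
  continuous periodic functions uniformly.
\<close>

definition torus :: "real \<Rightarrow> real^3 \<Rightarrow> complex^3" where
  "torus L x = (\<chi> i. cis (2 * pi / L * x $ i))"

lemma continuous_torus: "continuous_on S (torus L)"
  unfolding torus_def by (intro continuous_intros)

lemma tpoly_polynomial:
  assumes "real_polynomial_function p"
  shows "tpoly L (\<lambda>x. complex_of_real (p (torus L x)))"
  using assms
proof (induction p rule: real_polynomial_function.induct)
  case (linear f)
  have ax: "2 * pi / L * x $ i = freq L (axis i 1) \<bullet> x" for x i
  proof -
    have "freq L (axis i 1) = axis i (2 * pi / L)" by (auto simp: freq_def vec_eq_iff axis_def)
    then show ?thesis by (simp add: inner_axis')
  qed
  have b: "tpoly L (\<lambda>x. complex_of_real (torus L x \<bullet> b))" if b: "b \<in> Basis" for b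
  proof -
    obtain i c where "b = axis i c" "c \<in> {1, \<i>}" using b by (auto simp: Basis_vec_def Basis_complex_def)
    then have "(\<forall>x. torus L x \<bullet> b = cos (freq L (axis i 1) \<bullet> x)) \<or> (\<forall>x. torus L x \<bullet> b = sin (freq L (axis i 1) \<bullet> x))"
      by (auto simp: torus_def inner_axis inner_complex_def simp flip: ax)
    then show ?thesis using tpoly_cos_sin[of L "axis i 1"] by auto
  qed
  have "complex_of_real (f (torus L x)) = (\<Sum>b\<in>Basis. complex_of_real (f b) * complex_of_real (torus L x \<bullet> b))" for x
  proof -
    interpret bounded_linear f by fact
    have "f (torus L x) = f (\<Sum>b\<in>Basis. (torus L x \<bullet> b) *\<^sub>R b)" by (simp add: euclidean_representation)
    also have "\<dots> = (\<Sum>b\<in>Basis. f b * (torus L x \<bullet> b))" by (simp add: sum scaleR mult.commute)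
    finally show ?thesis by simp
  qed
  then show ?case by (auto intro!: tpoly_sum tpoly_mult tpoly_const b)
next
  case (const c) then show ?case by (simp add: tpoly_const)
next
  case (add f g) then show ?case by (auto intro: tpoly_add)
next
  case (mult f g) then show ?case by (auto intro: tpoly_mult)
qed

text \<open>
  One point has to be interior since opposite faces of the cell are identified.
\<close>

lemma inj_torus:
  assumes L: "L > 0" and x: "x \<in> box 0 (\<chi> i. L)" and y: "y \<in> cbox 0 (\<chi> i. L)" and e: "torus L x = torus L y"
  shows "x = y"
proof -
  have "x $ i = y $ i" for i
  proof -
    have "cis (2 * pi / L * x $ i) = cis (2 * pi / L * y $ i)" using e by (simp add: torus_def vec_eq_iff)
    then have "cis (2 * pi / L * x $ i - 2 * pi / L * y $ i) = 1" by (simp flip: cis_divide)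
    then obtain k :: int where "2 * pi / L * x $ i - 2 * pi / L * y $ i = of_int k * (2 * pi)"
      by (auto simp: complex_eq_iff cos_one_2pi_int)
    then have "(2 * pi / L * x $ i - 2 * pi / L * y $ i) * (L / (2 * pi)) = of_int k * L" by simp
    moreover have "x $ i - y $ i = (2 * pi / L * x $ i - 2 * pi / L * y $ i) * (L / (2 * pi))" using L by (simp add: field_simps)
    ultimately have k: "x $ i - y $ i = of_int k * L" by simp
    have b: "0 < x $ i" "x $ i < L" "0 \<le> y $ i" "y $ i \<le> L"
      using x y by (auto simp: mem_box_cart)
    then have "\<bar>of_int k * L\<bar> < 1 * L" unfolding k[symmetric] by linarith
    then have "\<bar>of_int k\<bar> < (1::real)" using L by (simp add: abs_mult)
    then have "k = 0" by linarith
    then show ?thesis using k by simp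
  qed
  then show ?thesis by (simp add: vec_eq_iff)
qed

text \<open>
  Membership in the \<open>L\<^sup>2\<close> closure of the trigonometric polynomials.
\<close>

definition tapprox :: "real \<Rightarrow> (real^3 \<Rightarrow> complex) \<Rightarrow> bool" where
  "tapprox L g \<longleftrightarrow> sqi (cell L) g \<and> (\<forall>e>0. \<exists>q. tpoly L q \<and> sqdist L g q < e)"

lemma sqi_integral_add_le:
  assumes "sqi M f" "sqi M g"
  shows "(\<integral>x. (norm (f x + g x))\<^sup>2 \<partial>M) \<le> 2 * (\<integral>x. (norm (f x))\<^sup>2 \<partial>M) + 2 * (\<integral>x. (norm (g x))\<^sup>2 \<partial>M)"
proof -
  have "(\<integral>x. (norm (f x + g x))\<^sup>2 \<partial>M) \<le> (\<integral>x. 2 * (norm (f x))\<^sup>2 + 2 * (norm (g x))\<^sup>2 \<partial>M)"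
    by (intro integral_mono sqi_integrable sqi_add assms Bochner_Integration.integrable_add integrable_mult_right norm_add_sq_le)
  also have "\<dots> = 2 * (\<integral>x. (norm (f x))\<^sup>2 \<partial>M) + 2 * (\<integral>x. (norm (g x))\<^sup>2 \<partial>M)"
    using assms by (simp add: sqi_def)
  finally show ?thesis .
qed

lemma tapprox_limit:
  assumes "sqi (cell L) g" "\<And>e. e > 0 \<Longrightarrow> \<exists>h. tapprox L h \<and> sqdist L g h < e"
  shows "tapprox L g"
  unfolding tapprox_def
proof (intro conjI allI impI)
  fix e :: real assume e: "e > 0"
  obtain h where h: "tapprox L h" "sqdist L g h < e/4" using assms(2)[of "e/4"] e by auto
  obtain q where q: "tpoly L q" "sqdist L h q < e/4" using h(1) e unfolding tapprox_def by (meson divide_pos_pos zero_less_numeral)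
  have "(\<integral>x. (norm ((g x - h x) + (h x - q x)))\<^sup>2 \<partial>cell L) \<le> 2 * sqdist L g h + 2 * sqdist L h q"
    by (rule sqi_integral_add_le; rule sqi_diff) (use h q assms in \<open>auto simp: tapprox_def intro!: tpoly_sqi\<close>)
  then show "\<exists>q. tpoly L q \<and> sqdist L g q < e"
    using h q by (intro exI[of _ q]) auto
qed (fact assms(1))

lemma tapprox_tpoly: "tpoly L q \<Longrightarrow> tapprox L q"
  unfolding tapprox_def by (auto intro!: tpoly_sqi exI[of _ q])

lemma tapprox_add:
  assumes "tapprox L f" "tapprox L g" shows "tapprox L (\<lambda>x. f x + g x)"
proof -
  have s: "sqi (cell L) f" "sqi (cell L) g" using assms by (auto simp: tapprox_def)
  show ?thesis unfolding tapprox_def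
  proof (intro conjI allI impI)
    fix e :: real assume e: "e > 0"
    obtain p where p: "tpoly L p" "sqdist L f p < e/4" using assms(1) e unfolding tapprox_def by (meson divide_pos_pos zero_less_numeral)
    obtain q where q: "tpoly L q" "sqdist L g q < e/4" using assms(2) e unfolding tapprox_def by (meson divide_pos_pos zero_less_numeral)
    have "(\<integral>x. (norm ((f x - p x) + (g x - q x)))\<^sup>2 \<partial>cell L) \<le> 2 * sqdist L f p + 2 * sqdist L g q"
      by (rule sqi_integral_add_le; rule sqi_diff) (use p q s in \<open>auto intro!: tpoly_sqi\<close>)
    then show "\<exists>q. tpoly L q \<and> (\<integral>x. (norm (f x + g x - q x))\<^sup>2 \<partial>cell L) < e"
      using p q by (intro exI[of _ "\<lambda>x. p x + q x"]) (auto intro: tpoly_add simp: algebra_simps)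
  qed (use s in \<open>auto intro: sqi_add\<close>)
qed

lemma tapprox_cmult:
  assumes "tapprox L f" shows "tapprox L (\<lambda>x. c * f x)"
  unfolding tapprox_def
proof (intro conjI allI impI)
  have s: "sqi (cell L) f" using assms by (auto simp: tapprox_def)
  show "sqi (cell L) (\<lambda>x. c * f x)" by (rule sqi_cmult_bounded[OF s, of _ "norm c"]) auto
  fix e :: real assume e: "e > 0"
  have pos: "(norm c)\<^sup>2 + 1 > 0" by (simp add: add_nonneg_pos)
  then have "e / ((norm c)\<^sup>2 + 1) > 0" using e by simp
  then obtain q where q: "tpoly L q" "sqdist L f q < e / ((norm c)\<^sup>2 + 1)"
    using assms unfolding tapprox_def by meson
  have "(\<integral>x. (norm (c * f x - c * q x))\<^sup>2 \<partial>cell L) = (norm c)\<^sup>2 * sqdist L f q"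
    by (simp add: norm_mult power_mult_distrib flip: right_diff_distrib)
  also have "\<dots> \<le> ((norm c)\<^sup>2 + 1) * sqdist L f q"
    by (intro mult_right_mono integral_nonneg_AE) auto
  also have "\<dots> < e" using q(2) pos by (simp only: pos_less_divide_eq mult.commute)
  finally show "\<exists>q. tpoly L q \<and> (\<integral>x. (norm (c * f x - q x))\<^sup>2 \<partial>cell L) < e"
    using q by (intro exI[of _ "\<lambda>x. c * q x"]) (auto intro: tpoly_mult tpoly_const)
qed

lemma tapprox_sum: "finite S \<Longrightarrow> (\<And>y. y \<in> S \<Longrightarrow> tapprox L (f y)) \<Longrightarrow> tapprox L (\<lambda>x. \<Sum>y\<in>S. f y x)"
proof (induction S rule: finite_induct)
  case empty then show ?case using tapprox_tpoly[OF tpoly_const[of L 0]] by simp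
next
  case (insert y S)
  then have "tapprox L (\<lambda>x. f y x + (\<Sum>y\<in>S. f y x))" by (intro tapprox_add) auto
  then show ?case using insert(1,2) by simp
qed

text \<open>
  The closure admits dominated pointwise limits.  This carries the approximation from continuous
  periodic functions to indicators of open sets, then of Borel sets, then to all of \<open>L\<^sup>2\<close>.
\<close>

lemma tapprox_dominated:
  assumes "\<And>i. tapprox L (s i)" "f \<in> borel_measurable (cell L)" "sqi (cell L) (w :: _ \<Rightarrow> real)"
    "\<And>x. x \<in> space (cell L) \<Longrightarrow> (\<lambda>i. s i x) \<longlonglongrightarrow> f x"
    "\<And>i x. x \<in> space (cell L) \<Longrightarrow> norm (s i x) \<le> norm (w x)"
  shows "tapprox L f"
proof (rule tapprox_limit)
  have [measurable]: "\<And>i. s i \<in> borel_measurable (cell L)" "f \<in> borel_measurable (cell L)" "w \<in> borel_measurable (cell L)"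
    using assms by (auto simp: tapprox_def sqi_def)
  have fw: "norm (f x) \<le> norm (w x)" if "x \<in> space (cell L)" for x
    by (rule LIMSEQ_le_const2[OF tendsto_norm[OF assms(4)[OF that]]]) (use assms(5)[OF that] in auto)
  show sf: "sqi (cell L) f" by (rule sqi_dominated[OF assms(3), of _ 1]) (use fw in auto)
  have "(\<lambda>i. sqdist L f (s i)) \<longlonglongrightarrow> (\<integral>x. 0 \<partial>cell L)"
  proof (rule integral_dominated_convergence[where w="\<lambda>x. 4 * (norm (w x))\<^sup>2"])
    show "integrable (cell L) (\<lambda>x. 4 * (norm (w x))\<^sup>2)" using assms(3) by (simp add: sqi_def)
    show "AE x in cell L. (\<lambda>i. (norm (f x - s i x))\<^sup>2) \<longlonglongrightarrow> 0"
    proof (rule AE_I2)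
      fix x assume x: "x \<in> space (cell L)"
      have "(\<lambda>i. (norm (f x - s i x))\<^sup>2) \<longlonglongrightarrow> (norm (f x - f x))\<^sup>2" by (intro tendsto_intros assms(4) x)
      then show "(\<lambda>i. (norm (f x - s i x))\<^sup>2) \<longlonglongrightarrow> 0" by simp
    qed
    show "AE x in cell L. norm ((norm (f x - s i x))\<^sup>2) \<le> 4 * (norm (w x))\<^sup>2" for i
    proof (rule AE_I2)
      fix x assume x: "x \<in> space (cell L)"
      have "norm (f x - s i x) \<le> 2 * norm (w x)" using fw[OF x] assms(5)[OF x, of i] norm_triangle_ineq4[of "f x" "s i x"] by simp
      then have "(norm (f x - s i x))\<^sup>2 \<le> (2 * norm (w x))\<^sup>2" by (intro power_mono) auto
      then show "norm ((norm (f x - s i x))\<^sup>2) \<le> 4 * (norm (w x))\<^sup>2" by (simp add: power_mult_distrib)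
    qed
  qed measurable
  then have lim: "(\<lambda>i. sqdist L f (s i)) \<longlonglongrightarrow> 0" by simp
  fix e :: real assume "e > 0"
  then have "\<forall>\<^sub>F i in sequentially. sqdist L f (s i) < e" using order_tendstoD(2)[OF lim] by blast
  then obtain i where "sqdist L f (s i) < e" by (auto simp: eventually_sequentially)
  then show "\<exists>h. tapprox L h \<and> sqdist L f h < e" using assms(1) by blast
qed

lemma tapprox_cong_AE:
  assumes "tapprox L f" "g \<in> borel_measurable (cell L)" "AE x in cell L. f x = g x"
  shows "tapprox L g"
proof (rule tapprox_limit)
  have [measurable]: "f \<in> borel_measurable (cell L)" "g \<in> borel_measurable (cell L)"
    using assms by (auto simp: tapprox_def sqi_def)
  have "integrable (cell L) (\<lambda>x. (norm (g x))\<^sup>2) = integrable (cell L) (\<lambda>x. (norm (f x))\<^sup>2)"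
    by (rule integrable_cong_AE) (use assms(3) in auto)
  then show "sqi (cell L) g" using assms by (auto simp: tapprox_def sqi_def)
  fix e :: real assume e: "e > 0"
  have "sqdist L g f = (\<integral>x. 0 \<partial>cell L)"
    by (rule integral_cong_AE) (use assms(3) in auto)
  then show "\<exists>h. tapprox L h \<and> sqdist L g h < e" using e assms(1) by auto
qed

text \<open>
  Let \<open>C\<close> be the image on the torus of the complement of \<open>B\<close> in the cell.  The indicator of \<open>B\<close> is
  the limit of the continuous functions \<open>min 1 (i * dist(-, C))\<close>, and each of these lies within
  \<open>1 / (i + 1)\<close> of a trigonometric polynomial.
\<close>

lemma tapprox_open:
  assumes L: "L > 0" and B: "open B" "B \<subseteq> box 0 (\<chi> i. L)"
  shows "tapprox L (\<lambda>x. indicator B x)"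
proof -
  define Q where "Q = cbox (0::real^3) (\<chi> i. L)"
  define C where "C = torus L ` (Q - B)"
  have BQ: "B \<subseteq> Q" using B box_subset_cbox unfolding Q_def by blast
  have "compact (Q - B)" unfolding Q_def using B(1) by (intro compact_diff compact_cbox)
  then have cC: "compact C" unfolding C_def by (intro compact_continuous_image continuous_torus)
  have cT: "compact (torus L ` Q)" unfolding Q_def by (intro compact_continuous_image continuous_torus compact_cbox)
  have C_iff: "torus L x \<in> C \<longleftrightarrow> x \<notin> B" if "x \<in> Q" for x
  proof
    assume "torus L x \<in> C"
    then obtain y where y: "y \<in> Q - B" "torus L x = torus L y" unfolding C_def by blast
    show "x \<notin> B"
    proof
      assume "x \<in> B"
      then have "x = y" using inj_torus[OF L, of x y] y B unfolding Q_def by auto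
      then show False using y \<open>x \<in> B\<close> by simp
    qed
  next
    assume "x \<notin> B" then show "torus L x \<in> C" using that unfolding C_def by blast
  qed
  define F where "F i z = (if C = {} then 1 else min 1 (real i * setdist {z} C))" for i :: nat and z
  have cF: "continuous_on UNIV (F i)" for i
    unfolding F_def by (cases "C = {}") (auto intro!: continuous_intros continuous_on_setdist)
  have "\<exists>p. real_polynomial_function p \<and> (\<forall>z\<in>torus L ` Q. \<bar>F i z - p z\<bar> < 1 / real (Suc i))" for i
  proof -
    have "continuous_on (torus L ` Q) (F i)" "0 < 1 / real (Suc i)" using continuous_on_subset[OF cF] by auto
    from Stone_Weierstrass_real_polynomial_function[OF cT this] show ?thesis by metis
  qed
  then obtain p where p: "\<And>i. real_polynomial_function (p i)" "\<And>i z. z \<in> torus L ` Q \<Longrightarrow> \<bar>F i z - p i z\<bar> < 1 / real (Suc i)"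
    by metis
  have Flim: "(\<lambda>i. F i (torus L x)) \<longlonglongrightarrow> indicator B x" if x: "x \<in> Q" for x
  proof (cases "x \<in> B")
    case False
    then have "torus L x \<in> C" using C_iff[OF x] by simp
    then have "F i (torus L x) = 0" for i unfolding F_def using setdist_sing_in_set[of "torus L x" C] by auto
    then show ?thesis using False by simp
  next
    case True
    then have nC: "torus L x \<notin> C" using C_iff[OF x] by simp
    show ?thesis
    proof (cases "C = {}")
      case True
      then show ?thesis using \<open>x \<in> B\<close> by (simp add: F_def)
    next
      case False
      then have d: "setdist {torus L x} C > 0"
        using nC setdist_eq_0_closed[OF compact_imp_closed[OF cC], of "torus L x"] setdist_pos_le[of "{torus L x}" C] by linarith
      obtain N :: nat where N: "real N * setdist {torus L x} C > 1" using reals_Archimedean3[OF d] by blast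
      have "F i (torus L x) = 1" if "i \<ge> N" for i
      proof -
        have "real i * setdist {torus L x} C \<ge> real N * setdist {torus L x} C" using that d by (intro mult_right_mono) auto
        then show ?thesis using N False unfolding F_def by auto
      qed
      then have "\<forall>\<^sub>F i in sequentially. F i (torus L x) = 1" by (auto simp: eventually_sequentially)
      then show ?thesis using \<open>x \<in> B\<close> by (simp add: tendsto_eventually)
    qed
  qed
  have Fb: "0 \<le> F i z \<and> F i z \<le> 1" for i z unfolding F_def by (auto simp: setdist_pos_le)
  show ?thesis
  proof (rule tapprox_dominated[where s="\<lambda>i x. complex_of_real (p i (torus L x))" and w="\<lambda>x. 2"])
    show "tapprox L (\<lambda>x. complex_of_real (p i (torus L x)))" for i
      by (intro tapprox_tpoly tpoly_polynomial p(1))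
    show "(\<lambda>x. indicator B x :: complex) \<in> borel_measurable (cell L)"
      using B(1) by (intro borel_measurable_cell) auto
    show "sqi (cell L) (\<lambda>x. 2 :: real)" by (intro sqi_const finite_measure_cell)
  next
    fix x assume "x \<in> space (cell L)"
    then have x: "x \<in> Q" by (simp add: space_cell Q_def)
    have "(\<lambda>i. p i (torus L x) - F i (torus L x)) \<longlonglongrightarrow> 0"
    proof (rule Lim_null_comparison)
      show "\<forall>\<^sub>F i in sequentially. norm (p i (torus L x) - F i (torus L x)) \<le> 1 / real (Suc i)"
        using p(2)[of "torus L x"] x by (auto simp: abs_minus_commute less_imp_le)
      show "(\<lambda>i. 1 / real (Suc i)) \<longlonglongrightarrow> 0" by (rule LIMSEQ_Suc[OF lim_1_over_n])
    qed
    from tendsto_add[OF this Flim[OF x]] have "(\<lambda>i. p i (torus L x)) \<longlonglongrightarrow> indicator B x" by simp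
    then have "(\<lambda>i. complex_of_real (p i (torus L x))) \<longlonglongrightarrow> complex_of_real (indicator B x)" by (rule tendsto_of_real)
    then show "(\<lambda>i. complex_of_real (p i (torus L x))) \<longlonglongrightarrow> indicator B x" by (cases "x \<in> B") auto
  next
    fix i x assume "x \<in> space (cell L)"
    then have x: "x \<in> Q" by (simp add: space_cell Q_def)
    have "1 / real (Suc i) \<le> 1" by simp
    moreover have "\<bar>F i (torus L x) - p i (torus L x)\<bar> < 1 / real (Suc i)" using p(2) x by blast
    ultimately have "\<bar>p i (torus L x)\<bar> \<le> 2" using Fb[of i "torus L x"] by linarith
    then show "norm (complex_of_real (p i (torus L x))) \<le> norm (2::real)" by simp
  qed
qed

text \<open>
  The boundary of the cell, where \<^const>\<open>torus\<close> is not injective, is a null set.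
\<close>

lemma AE_cell_interior: "AE x in cell L. x \<in> box 0 (\<chi> i. L)"
proof -
  let ?c = "cbox (0::real^3) (\<chi> i. L)" and ?b = "box (0::real^3) (\<chi> i. L)"
  have "negligible (?c - ?b)" by (rule negligible_frontier_interval)
  then have "?c - ?b \<in> null_sets lebesgue" by (simp add: negligible_iff_null_sets)
  then have "?c - ?b \<in> null_sets lborel" by (subst (asm) null_sets_completion_iff) auto
  then have "AE x in lborel. x \<notin> ?c - ?b" by (rule AE_not_in)
  then show ?thesis unfolding cell_def by (subst AE_restrict_space_iff) auto
qed

text \<open>
  The sets \<open>A\<close> for which this holds form a Dynkin system that contains the open sets.
\<close>

lemma tapprox_borel:
  assumes L: "L > 0" and A: "A \<in> sets borel"
  shows "tapprox L (\<lambda>x. indicator (A \<inter> box 0 (\<chi> i. L)) x)"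
proof -
  let ?b = "box (0::real^3) (\<chi> i. L)"
  have "A \<in> sigma_sets UNIV {S. open S}" using A by (simp add: borel_def)
  then show ?thesis
  proof (rule sigma_sets_induct_disjoint[rotated 2])
    show "Int_stable {S::(real^3) set. open S}" by (auto simp: Int_stable_def)
    fix S :: "(real^3) set" assume "S \<in> {S. open S}"
    then show "tapprox L (\<lambda>x. indicator (S \<inter> ?b) x)" by (intro tapprox_open L) (auto simp: open_Int open_box)
  next
    show "tapprox L (\<lambda>x. indicator ({} \<inter> ?b) x)" using tapprox_tpoly[OF tpoly_const[of L 0]] by simp
  next
    fix S :: "(real^3) set" assume S: "tapprox L (\<lambda>x. indicator (S \<inter> ?b) x)"
    have "tapprox L (\<lambda>x. indicator ?b x + (-1) * indicator (S \<inter> ?b) x)"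
      by (intro tapprox_add tapprox_cmult S tapprox_open L) auto
    moreover have "(\<lambda>x. indicator ?b x + (-1) * indicator (S \<inter> ?b) x) = (\<lambda>x. indicator ((UNIV - S) \<inter> ?b) x :: complex)"
      by (auto simp: fun_eq_iff indicator_def)
    ultimately show "tapprox L (\<lambda>x. indicator ((UNIV - S) \<inter> ?b) x)" by simp
  next
    fix S :: "nat \<Rightarrow> (real^3) set"
    assume d: "disjoint_family S" and r: "range S \<subseteq> sigma_sets UNIV {S. open S}" and a: "\<And>i. tapprox L (\<lambda>x. indicator (S i \<inter> ?b) x)"
    have m: "S i \<in> sets borel" for i using r by (auto simp: borel_def)
    have fin: "tapprox L (\<lambda>x. indicator ((\<Union>i<n. S i) \<inter> ?b) x)" for n
    proof (induction n)
      case 0 then show ?case using tapprox_tpoly[OF tpoly_const[of L 0]] by simp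
    next
      case (Suc n)
      have dj: "S n \<inter> S i = {}" if "i < n" for i using d that unfolding disjoint_family_on_def by auto
      have "(\<lambda>x. indicator ((\<Union>i<Suc n. S i) \<inter> ?b) x :: complex) = (\<lambda>x. indicator ((\<Union>i<n. S i) \<inter> ?b) x + indicator (S n \<inter> ?b) x)"
        using dj by (auto simp: fun_eq_iff indicator_def less_Suc_eq)
      then show ?case using tapprox_add[OF Suc a[of n]] by simp
    qed
    show "tapprox L (\<lambda>x. indicator ((\<Union>i. S i) \<inter> ?b) x)"
    proof (rule tapprox_dominated[OF fin, where w="\<lambda>x. 1"])
      have "(\<Union>i. S i) \<inter> ?b \<in> sets borel" using m by auto
      then show "(\<lambda>x. indicator ((\<Union>i. S i) \<inter> ?b) x :: complex) \<in> borel_measurable (cell L)"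
        by (intro borel_measurable_cell) auto
      show "sqi (cell L) (\<lambda>x. 1 :: real)" by (intro sqi_const finite_measure_cell)
      fix x
      show "(\<lambda>n. indicator ((\<Union>i<n. S i) \<inter> ?b) x) \<longlonglongrightarrow> (indicator ((\<Union>i. S i) \<inter> ?b) x :: complex)"
      proof (cases "x \<in> (\<Union>i. S i) \<inter> ?b")
        case True
        then obtain k where k: "x \<in> S k" by blast
        have "(indicator ((\<Union>i<n. S i) \<inter> ?b) x :: complex) = 1" if "n > k" for n using k that True by (auto simp: indicator_def)
        then have "\<forall>\<^sub>F n in sequentially. (indicator ((\<Union>i<n. S i) \<inter> ?b) x :: complex) = 1"
          unfolding eventually_sequentially by (meson Suc_le_lessD)
        then show ?thesis using True by (simp add: tendsto_eventually)
      next
        case False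
        then have "(indicator ((\<Union>i<n. S i) \<inter> ?b) x :: complex) = 0" for n by (auto simp: indicator_def)
        then show ?thesis using False by simp
      qed
    qed (auto simp: indicator_def)
  qed auto
qed

lemma sqi_tapprox:
  assumes L: "L > 0" and g: "sqi (cell L) (g :: _ \<Rightarrow> complex)"
  shows "tapprox L g"
proof -
  have ind: "tapprox L (\<lambda>x. indicator A x * c)" if A: "A \<in> sets (cell L)" for A c
  proof -
    have A': "A \<in> sets borel" using A unfolding cell_def by (auto simp: sets_restrict_space)
    have "tapprox L (\<lambda>x. c * indicator (A \<inter> box 0 (\<chi> i. L)) x)" by (intro tapprox_cmult tapprox_borel L A')
    moreover have "AE x in cell L. c * indicator (A \<inter> box 0 (\<chi> i. L)) x = indicator A x * c"
      using AE_cell_interior[of L] by eventually_elim (simp add: indicator_def)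
    moreover have "(\<lambda>x. indicator A x * c) \<in> borel_measurable (cell L)" using A by measurable
    ultimately show ?thesis using tapprox_cong_AE by blast
  qed
  have gm: "g \<in> borel_measurable (cell L)" using g by (simp add: sqi_def)
  obtain F where F: "\<And>i. simple_function (cell L) (F i)"
    "\<And>x. x \<in> space (cell L) \<Longrightarrow> (\<lambda>i. F i x) \<longlonglongrightarrow> g x"
    "\<And>i x. x \<in> space (cell L) \<Longrightarrow> dist (F i x) 0 \<le> 2 * dist (g x) 0"
    using borel_measurable_implies_sequence_metric[OF gm, of 0] by blast
  show ?thesis
  proof (rule tapprox_dominated[where s=F and w="\<lambda>x. 2 * norm (g x)"])
    show "sqi (cell L) (\<lambda>x. 2 * norm (g x))" by (rule sqi_dominated[OF g, of _ 2]) (use gm in auto)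
    fix i
    have fin: "finite (F i ` space (cell L))" using F(1) by (simp add: simple_function_def)
    have "tapprox L (\<lambda>x. \<Sum>y\<in>F i ` space (cell L). indicator (F i -` {y} \<inter> space (cell L)) x * y)"
      by (intro tapprox_sum fin ind simple_functionD(2)[OF F(1)])
    then show "tapprox L (F i)"
    proof (rule tapprox_cong_AE)
      show "AE x in cell L. (\<Sum>y\<in>F i ` space (cell L). indicator (F i -` {y} \<inter> space (cell L)) x * y) = F i x"
        by (rule AE_I2) (use fin in \<open>simp add: indicator_def sum.delta if_distrib cong: if_cong\<close>)
    qed (use F in \<open>auto intro: borel_measurable_simple_function\<close>)
  qed (use F gm in auto)
qed

text \<open>
  Fourier coefficients of complex functions.  \<^const>\<open>fcoeff\<close> is the case of real functions
  (\<open>fcoeff_cfc\<close> below), but products with characters leave the real functions.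
\<close>

definition cfc :: "real \<Rightarrow> (real^3 \<Rightarrow> complex) \<Rightarrow> int^3 \<Rightarrow> complex" where
  "cfc L g n = (\<integral>x. cis (- (freq L n \<bullet> x)) * g x \<partial>cell L) / complex_of_real (L^3)"

lemma sqi_cis_mult: "sqi (cell L) g \<Longrightarrow> sqi (cell L) (\<lambda>x. cis (v \<bullet> x) * g x)"
  by (rule sqi_cmult_bounded[of _ _ _ 1]) auto

lemma sqi_cis_mult': "sqi (cell L) g \<Longrightarrow> sqi (cell L) (\<lambda>x. cis (- (v \<bullet> x)) * g x)"
  using sqi_cis_mult[of L g "- v"] by simp

lemma sqi_of_real: "sqi M g \<Longrightarrow> sqi M (\<lambda>x. complex_of_real (g x))"
  by (auto simp: sqi_def)

lemma sqi_cnj: "sqi M g \<Longrightarrow> sqi M (\<lambda>x. cnj (g x))"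
proof -
  have "cnj \<in> borel_measurable borel" by (intro borel_measurable_continuous_onI continuous_intros)
  then show "sqi M g \<Longrightarrow> sqi M (\<lambda>x. cnj (g x))"
    unfolding sqi_def using measurable_compose[of g M borel cnj borel] by auto
qed

lemma cnj_lebesgue_integral: "cnj (\<integral>x. f x \<partial>M) = (\<integral>x. cnj (f x) \<partial>M)"
  by simp

lemma cfc_tpoly:
  assumes L: "L > 0" and K: "finite K"
  shows "cfc L (tsum L K c) m = (if m \<in> K then c m else 0)"
proof -
  have i: "integrable (cell L) (\<lambda>x. cis (v \<bullet> x))" for v
    by (rule sqi_cell_integrable) (use sqi_cis_mult[OF sqi_const[OF finite_measure_cell, where c="1::complex"]] in simp)
  have "(\<integral>x. cis (- (freq L m \<bullet> x)) * (tsum L K c x) \<partial>cell L)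
      = (\<integral>x. (\<Sum>n\<in>K. c n * cis (freq L (n - m) \<bullet> x)) \<partial>cell L)"
    by (intro Bochner_Integration.integral_cong refl)
      (simp add: sum_distrib_left freq_diff inner_diff_left cis_mult mult.left_commute)
  also have "\<dots> = (\<Sum>n\<in>K. c n * (if n - m = 0 then complex_of_real (L^3) else 0))"
    by (subst Bochner_Integration.integral_sum) (auto intro!: i simp: integral_cell_cis[OF L])
  also have "\<dots> = (if m \<in> K then c m * complex_of_real (L^3) else 0)"
    using K by (simp add: if_distrib sum.delta eq_commute[of _ m] cong: if_cong)
  finally show ?thesis using L by (simp add: cfc_def)
qed

lemma cfc_add: "sqi (cell L) f \<Longrightarrow> sqi (cell L) g \<Longrightarrow> cfc L (\<lambda>x. f x + g x) n = cfc L f n + cfc L g n"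
  unfolding cfc_def by (simp add: distrib_left sqi_cell_integrable[OF sqi_cis_mult'] add_divide_distrib)

lemma integral_mult_cnj_tpoly:
  assumes L: "L > 0" and g: "sqi (cell L) g" and K: "finite K"
  shows "(\<integral>x. g x * cnj (tsum L K c x) \<partial>cell L) = complex_of_real (L^3) * (\<Sum>n\<in>K. cfc L g n * cnj (c n))"
proof -
  have "(\<integral>x. g x * cnj (tsum L K c x) \<partial>cell L)
    = (\<integral>x. (\<Sum>n\<in>K. cnj (c n) * (cis (- (freq L n \<bullet> x)) * g x)) \<partial>cell L)"
    by (intro Bochner_Integration.integral_cong refl) (simp add: sum_distrib_left cis_cnj mult_ac)
  also have "\<dots> = (\<Sum>n\<in>K. cnj (c n) * (\<integral>x. cis (- (freq L n \<bullet> x)) * g x \<partial>cell L))"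
    by (subst Bochner_Integration.integral_sum) (auto intro!: sqi_cell_integrable[OF sqi_cis_mult'] g)
  also have "\<dots> = complex_of_real (L^3) * (\<Sum>n\<in>K. cfc L g n * cnj (c n))"
    using L by (simp add: cfc_def sum_distrib_left mult_ac)
  finally show ?thesis .
qed

text \<open>
  Pythagoras' theorem: among the trigonometric polynomials with frequencies in \<open>K\<close>, the partial Fourier
  sum is the closest one to \<open>g\<close>.
\<close>

lemma integral_norm_diff_tpoly:
  assumes L: "L > 0" and g: "sqi (cell L) g" and K: "finite K"
  shows "sqdist L g (tsum L K c)
    = (\<integral>x. (norm (g x))\<^sup>2 \<partial>cell L) - L^3 * (\<Sum>n\<in>K. (norm (cfc L g n))\<^sup>2) + L^3 * (\<Sum>n\<in>K. (norm (cfc L g n - c n))\<^sup>2)"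
proof -
  define q where "q x = tsum L K c x" for x
  have q: "sqi (cell L) q" unfolding q_def by (rule tpoly_sqi[OF tpolyI[OF K]])
  have i: "integrable (cell L) (\<lambda>x. g x * cnj (q x))" "integrable (cell L) (\<lambda>x. q x * cnj (q x))"
    by (intro sqi_mult_integrable sqi_cnj g q)+
  have e: "(norm (a - b))\<^sup>2 = (norm a)\<^sup>2 - 2 * Re (a * cnj b) + Re (b * cnj b)" for a b :: complex
    unfolding cmod_power2 by (simp add: power2_eq_square algebra_simps)
  define a where "a x = Re (g x * cnj (q x))" for x
  define b where "b x = Re (q x * cnj (q x))" for x
  have ab: "integrable (cell L) a" "integrable (cell L) b" unfolding a_def b_def by (rule integrable_Re[OF i(1)], rule integrable_Re[OF i(2)])
  have "sqdist L g q = (\<integral>x. (norm (g x))\<^sup>2 - 2 * a x + b x \<partial>cell L)"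
    unfolding a_def b_def e ..
  also have "\<dots> = (\<integral>x. (norm (g x))\<^sup>2 \<partial>cell L) - 2 * (\<integral>x. a x \<partial>cell L) + (\<integral>x. b x \<partial>cell L)"
    using ab sqi_integrable[OF g] by simp
  also have "(\<integral>x. a x \<partial>cell L) = Re (\<integral>x. g x * cnj (q x) \<partial>cell L)"
    unfolding a_def by (rule integral_Re[OF i(1)])
  also have "(\<integral>x. b x \<partial>cell L) = Re (\<integral>x. q x * cnj (q x) \<partial>cell L)"
    unfolding b_def by (rule integral_Re[OF i(2)])
  also have "(\<integral>x. g x * cnj (q x) \<partial>cell L) = complex_of_real (L^3) * (\<Sum>n\<in>K. cfc L g n * cnj (c n))"
    unfolding q_def by (rule integral_mult_cnj_tpoly[OF L g K])
  also have "(\<integral>x. q x * cnj (q x) \<partial>cell L) = complex_of_real (L^3) * (\<Sum>n\<in>K. c n * cnj (c n))"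
  proof -
    have "(\<integral>x. q x * cnj (q x) \<partial>cell L) = complex_of_real (L^3) * (\<Sum>n\<in>K. cfc L q n * cnj (c n))"
      using integral_mult_cnj_tpoly[OF L q K, of c] by (simp add: q_def)
    then show ?thesis unfolding q_def by (simp add: cfc_tpoly[OF L K])
  qed
  finally show ?thesis
    by (simp add: q_def e sum.distrib sum_subtractf sum_distrib_left algebra_simps)
qed

text \<open>
  By density some polynomial is close to \<open>g\<close>; the partial Fourier sum over its frequencies is at least
  as close, and more frequencies only improve it.
\<close>

lemma fourier_partial_close:
  assumes L: "L > 0" and g: "sqi (cell L) g" and e: "e > 0"
  obtains K where "finite K" "\<And>M. finite M \<Longrightarrow> K \<subseteq> M \<Longrightarrow>
     sqdist L g (tsum L M (cfc L g)) < e"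
proof -
  obtain K c where K: "finite K" and c: "sqdist L g (tsum L K c) < e"
    using sqi_tapprox[OF L g] e unfolding tapprox_def tpoly_def by blast
  show ?thesis
  proof (rule that[OF K])
    fix M :: "(int^3) set" assume M: "finite M" "K \<subseteq> M"
    have "sqdist L g (tsum L M (cfc L g))
       = (\<integral>x. (norm (g x))\<^sup>2 \<partial>cell L) - L^3 * (\<Sum>n\<in>M. (norm (cfc L g n))\<^sup>2)"
      using integral_norm_diff_tpoly[OF L g M(1), of "cfc L g"] by simp
    also have "\<dots> \<le> (\<integral>x. (norm (g x))\<^sup>2 \<partial>cell L) - L^3 * (\<Sum>n\<in>K. (norm (cfc L g n))\<^sup>2)"
      using L M by (intro diff_left_mono mult_left_mono sum_mono2) auto
    also have "\<dots> \<le> sqdist L g (tsum L K c)"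
      using integral_norm_diff_tpoly[OF L g K, of c] L by (simp add: sum_nonneg)
    finally show "sqdist L g (tsum L M (cfc L g)) < e" using c by simp
  qed
qed

text \<open>
  The partial sum on the left is the integral of a partial Fourier sum of \<open>g\<close> against \<open>h\<close>, and the
  partial sums converge to \<open>g\<close> in \<open>L\<^sup>2\<close>.
\<close>

lemma parseval_cnj:
  assumes L: "L > 0" and g: "sqi (cell L) g" and h: "sqi (cell L) h"
  shows "((\<lambda>n. cfc L g n * cnj (cfc L h n)) has_sum (\<integral>x. g x * cnj (h x) \<partial>cell L) / complex_of_real (L^3)) UNIV"
  unfolding has_sum_def tendsto_iff eventually_finite_subsets_at_top
proof (intro allI impI)
  fix e :: real assume e: "e > 0"
  define H where "H = sqrt (\<integral>x. (norm (h x))\<^sup>2 \<partial>cell L)"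
  have H: "H \<ge> 0" unfolding H_def by (simp add: integral_nonneg_AE)
  have "(e * L^3 / (H + 1))\<^sup>2 > 0" using e L H by (intro zero_less_power divide_pos_pos mult_pos_pos) auto
  note pos = this
  obtain K where K: "finite K" "\<And>M. finite M \<Longrightarrow> K \<subseteq> M \<Longrightarrow>
     sqdist L g (tsum L M (cfc L g)) < (e * L^3 / (H + 1))\<^sup>2"
    by (rule fourier_partial_close[OF L g pos]) (rule that)
  have "dist (\<Sum>n\<in>M. cfc L g n * cnj (cfc L h n)) ((\<integral>x. g x * cnj (h x) \<partial>cell L) / complex_of_real (L^3)) < e"
    if M: "finite M" "K \<subseteq> M" for M
  proof -
    define S where "S x = tsum L M (cfc L g) x" for x
    have S: "sqi (cell L) S" unfolding S_def by (rule tpoly_sqi[OF tpolyI[OF M(1)]])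
    have "(\<integral>x. h x * cnj (S x) \<partial>cell L) = complex_of_real (L^3) * (\<Sum>n\<in>M. cfc L h n * cnj (cfc L g n))"
      unfolding S_def by (rule integral_mult_cnj_tpoly[OF L h M(1)])
    then have "cnj (\<integral>x. h x * cnj (S x) \<partial>cell L) = cnj (complex_of_real (L^3) * (\<Sum>n\<in>M. cfc L h n * cnj (cfc L g n)))"
      by simp
    then have Sh: "(\<integral>x. S x * cnj (h x) \<partial>cell L) = complex_of_real (L^3) * (\<Sum>n\<in>M. cfc L g n * cnj (cfc L h n))"
      by (simp only: cnj_lebesgue_integral complex_cnj_mult complex_cnj_cnj complex_cnj_complex_of_real cnj_sum mult.commute)
    have "(\<integral>x. (g x - S x) * cnj (h x) \<partial>cell L) = (\<integral>x. g x * cnj (h x) \<partial>cell L) - (\<integral>x. S x * cnj (h x) \<partial>cell L)"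
      by (simp add: left_diff_distrib sqi_mult_integrable sqi_cnj g h S)
    then have "norm ((\<integral>x. g x * cnj (h x) \<partial>cell L) - complex_of_real (L^3) * (\<Sum>n\<in>M. cfc L g n * cnj (cfc L h n)))
      = norm (\<integral>x. (g x - S x) * cnj (h x) \<partial>cell L)" using Sh by simp
    also have "\<dots> \<le> sqrt (sqdist L g S) * sqrt (\<integral>x. (norm (cnj (h x)))\<^sup>2 \<partial>cell L)"
      by (rule sqi_mult_norm_le[OF sqi_diff[OF g S] sqi_cnj[OF h]])
    also have "\<dots> = sqrt (sqdist L g S) * H" by (simp add: H_def)
    also have "\<dots> \<le> (e * L^3 / (H + 1)) * H"
    proof (rule mult_right_mono[OF _ H])
      show "sqrt (sqdist L g S) \<le> e * L^3 / (H + 1)"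
        by (rule real_le_lsqrt) (use K(2)[OF M] e L H in \<open>auto simp: S_def\<close>)
    qed
    also have "\<dots> < e * L^3"
    proof -
      have "e * L^3 > 0" using e L by simp
      then show ?thesis using H by (simp add: field_simps)
    qed
    finally have n: "norm ((\<integral>x. g x * cnj (h x) \<partial>cell L) - complex_of_real (L^3) * (\<Sum>n\<in>M. cfc L g n * cnj (cfc L h n))) < e * L^3" .
    have "(\<Sum>n\<in>M. cfc L g n * cnj (cfc L h n)) - (\<integral>x. g x * cnj (h x) \<partial>cell L) / complex_of_real (L^3)
      = - (((\<integral>x. g x * cnj (h x) \<partial>cell L) - complex_of_real (L^3) * (\<Sum>n\<in>M. cfc L g n * cnj (cfc L h n))) / complex_of_real (L^3))"
      using L by (simp add: field_simps)
    then have "dist (\<Sum>n\<in>M. cfc L g n * cnj (cfc L h n)) ((\<integral>x. g x * cnj (h x) \<partial>cell L) / complex_of_real (L^3))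
      = norm ((\<integral>x. g x * cnj (h x) \<partial>cell L) - complex_of_real (L^3) * (\<Sum>n\<in>M. cfc L g n * cnj (cfc L h n))) / L^3"
      using L by (simp only: dist_norm norm_minus_cancel norm_divide norm_of_real) simp
    also have "\<dots> < e" using n L by (simp add: pos_divide_less_eq)
    finally show ?thesis .
  qed
  then show "\<exists>X. finite X \<and> X \<subseteq> UNIV \<and> (\<forall>Y. finite Y \<and> X \<subseteq> Y \<and> Y \<subseteq> UNIV \<longrightarrow>
      dist (\<Sum>n\<in>Y. cfc L g n * cnj (cfc L h n)) ((\<integral>x. g x * cnj (h x) \<partial>cell L) / complex_of_real (L^3)) < e)"
    using K(1) by blast
qed

lemma fcoeff_cfc: "fcoeff L g = cfc L (\<lambda>x. complex_of_real (g x))"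
  by (simp add: fun_eq_iff fcoeff_def cfc_def tint_cell)

lemma parseval_real:
  fixes g h :: "real^3 \<Rightarrow> real"
  assumes L: "L > 0" and g: "sqi (cell L) g" and h: "sqi (cell L) h"
  shows "((\<lambda>n. fcoeff L g n \<bullet> fcoeff L h n) has_sum (\<integral>x. g x * h x \<partial>cell L) / L^3) UNIV"
proof -
  have "((\<lambda>n. Re (fcoeff L g n * cnj (fcoeff L h n))) has_sum Re ((\<integral>x. complex_of_real (g x) * cnj (complex_of_real (h x)) \<partial>cell L) / complex_of_real (L^3))) UNIV"
    unfolding fcoeff_cfc by (intro has_sum_Re parseval_cnj L sqi_of_real g h)
  moreover have "(\<integral>x. complex_of_real (g x) * cnj (complex_of_real (h x)) \<partial>cell L) = complex_of_real (\<integral>x. g x * h x \<partial>cell L)"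
    by (simp flip: of_real_mult)
  moreover have "Re (a * cnj b) = a \<bullet> b" for a b by (simp add: inner_complex_def)
  ultimately show ?thesis by (simp flip: of_real_divide of_real_power)
qed

text \<open>
  The coefficient of a product is the convolution of the coefficients: this is Parseval's identity for
  \<open>h\<close> and the product of \<open>g\<close> with the \<open>k\<close>-th character.
\<close>

lemma fcoeff_mult_has_sum:
  fixes g h :: "real^3 \<Rightarrow> real"
  assumes L: "L > 0" and g: "sqi (cell L) g" and h: "sqi (cell L) h"
  shows "((\<lambda>m. fcoeff L g (k - m) * fcoeff L h m) has_sum fcoeff L (\<lambda>x. g x * h x) k) UNIV"
proof -
  have gc: "sqi (cell L) (\<lambda>x. cis (freq L k \<bullet> x) * complex_of_real (g x))"
    by (intro sqi_cis_mult sqi_of_real g)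
  have 1: "((\<lambda>m. cfc L (\<lambda>x. complex_of_real (h x)) m * cnj (cfc L (\<lambda>x. cis (freq L k \<bullet> x) * complex_of_real (g x)) m))
     has_sum (\<integral>x. complex_of_real (h x) * cnj (cis (freq L k \<bullet> x) * complex_of_real (g x)) \<partial>cell L) / complex_of_real (L^3)) UNIV"
    by (rule parseval_cnj[OF L sqi_of_real[OF h] gc])
  have 2: "(\<integral>x. complex_of_real (h x) * cnj (cis (freq L k \<bullet> x) * complex_of_real (g x)) \<partial>cell L) / complex_of_real (L^3) = fcoeff L (\<lambda>x. g x * h x) k"
    unfolding fcoeff_cfc cfc_def by (simp add: cis_cnj mult_ac)
  have 3: "cnj (cfc L (\<lambda>x. cis (freq L k \<bullet> x) * complex_of_real (g x)) m) = fcoeff L g (k - m)" for m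
  proof -
    have "cnj (\<integral>x. cis (- (freq L m \<bullet> x)) * (cis (freq L k \<bullet> x) * complex_of_real (g x)) \<partial>cell L)
      = (\<integral>x. cis (- (freq L (k - m) \<bullet> x)) * complex_of_real (g x) \<partial>cell L)"
      by (simp only: cnj_lebesgue_integral) (simp flip: mult.assoc add: cis_mult cis_cnj freq_diff inner_diff_left)
    then show ?thesis by (simp add: cfc_def fcoeff_cfc)
  qed
  from 1 show ?thesis unfolding 2 3 fcoeff_cfc[symmetric] by (simp only: mult.commute)
qed

section \<open>The trilinear estimate on the frequency lattice\<close>

text \<open>
  An increasing sequence of finite sets of frequencies that exhausts the lattice, so that sums over the
  lattice become limits of sequences.
\<close>

definition zbox :: "nat \<Rightarrow> (int^3) set" where
  "zbox N = {n. \<forall>i. \<bar>n $ i\<bar> \<le> int N}"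

lemma zbox_eq: "zbox N = (\<lambda>g. \<chi> i. g i) ` (Pi\<^sub>E UNIV (\<lambda>_. {- int N..int N}))"
proof (intro set_eqI iffI)
  fix n assume "n \<in> zbox N"
  then have "n = (\<chi> i. (\<lambda>i. n $ i) i)" "(\<lambda>i. n $ i) \<in> Pi\<^sub>E UNIV (\<lambda>_. {- int N..int N})"
    by (auto simp: zbox_def abs_le_iff minus_le_iff)
  then show "n \<in> (\<lambda>g. \<chi> i. g i) ` (Pi\<^sub>E UNIV (\<lambda>_. {- int N..int N}))" by blast
qed (auto simp: zbox_def PiE_iff abs_le_iff minus_le_iff)

lemma finite_zbox: "finite (zbox N)"
  unfolding zbox_eq by (intro finite_imageI finite_PiE) auto

lemma zbox_mono: "M \<le> N \<Longrightarrow> zbox M \<subseteq> zbox N"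
  by (auto simp: zbox_def intro: order_trans)

lemma subset_zbox: "finite K \<Longrightarrow> \<exists>N. K \<subseteq> zbox N"
proof (induction K rule: finite_induct)
  case (insert n K)
  then obtain N where N: "K \<subseteq> zbox N" by blast
  define M where "M = Max (range (\<lambda>i. nat \<bar>n $ i\<bar>))"
  have "nat \<bar>n $ i\<bar> \<le> M" for i unfolding M_def by (intro Max_ge) auto
  then have "n \<in> zbox M" by (auto simp: zbox_def nat_le_iff)
  then have "insert n K \<subseteq> zbox (max M N)" using N zbox_mono[of M "max M N"] zbox_mono[of N "max M N"] by auto
  then show ?case by blast
qed auto

lemma filterlim_zbox: "filterlim (\<lambda>N. zbox N - {0}) (finite_subsets_at_top (- {0})) sequentially"
  unfolding filterlim_iff eventually_finite_subsets_at_top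
proof clarify
  fix P :: "(int^3) set \<Rightarrow> bool" and X assume X: "finite X" "X \<subseteq> - {0}" "\<forall>Y. finite Y \<and> X \<subseteq> Y \<and> Y \<subseteq> - {0} \<longrightarrow> P Y"
  obtain N where N: "X \<subseteq> zbox N" using subset_zbox[OF X(1)] by blast
  have "P (zbox M - {0})" if "M \<ge> N" for M
  proof -
    have "finite (zbox M - {0})" "X \<subseteq> zbox M - {0}" "zbox M - {0} \<subseteq> - {0}"
      using N X(2) zbox_mono[OF that] finite_zbox[of M] by auto
    then show ?thesis using X(3)[rule_format, of "zbox M - {0}"] by simp
  qed
  then show "\<forall>\<^sub>F x in sequentially. P (zbox x - {0})" unfolding eventually_sequentially by blast
qed

lemma has_sum_zbox: "(f has_sum s) (- {0}) \<Longrightarrow> (\<lambda>N. \<Sum>n\<in>zbox N - {0}. f n) \<longlonglongrightarrow> s"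
  unfolding has_sum_def using filterlim_compose[OF _ filterlim_zbox] by auto

lemma sum_int_le:
  fixes f :: "int \<Rightarrow> real"
  assumes "\<And>n. f (- n) = f n" "\<And>n. f n \<ge> 0"
  shows "(\<Sum>m\<in>{- int N..int N}. f m) \<le> f 0 + 2 * (\<Sum>k=1..N. f (int k))"
proof (induction N)
  case (Suc N)
  have "{- int (Suc N)..int (Suc N)} = insert (- int (Suc N)) (insert (int (Suc N)) {- int N..int N})" by auto
  then have "(\<Sum>m\<in>{- int (Suc N)..int (Suc N)}. f m) = 2 * f (int (Suc N)) + (\<Sum>m\<in>{- int N..int N}. f m)"
  proof -
    have i: "sum f (insert a (insert b S)) = f a + (f b + sum f S)" if "finite S" "a \<noteq> b" "a \<notin> S" "b \<notin> S" for a b S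
      using that by auto
    show ?thesis unfolding \<open>{- int (Suc N)..int (Suc N)} = _\<close>
      using assms(1)[of "int (Suc N)"] by (subst i) auto
  qed
  then show ?case using Suc by simp
qed simp

text \<open>
  For \<open>n \<noteq> 0\<close> each of the three numbers \<open>1 + n_i\<^sup>2\<close> is at most \<open>1 + |n|\<^sup>2\<close>, so \<open>(1 + |n|\<^sup>2)\<^sup>-\<^sup>2\<close> is at
  most the product of the \<open>(1 + n_i\<^sup>2) powr (-2/3)\<close>; since \<open>|n| \<ge> 1\<close>, this controls \<open>|n|\<^sup>-\<^sup>4\<close>.  The sum
  of the products is a product of one-dimensional sums, which converge since \<open>4/3 > 1\<close>.
\<close>

lemma lattice_sum_bounded:
  assumes L: "L > 0"
  obtains S where "S > 0" "\<And>K. finite K \<Longrightarrow> K \<subseteq> - {0} \<Longrightarrow> (\<Sum>n\<in>K. 1 / (norm (freq L n))^4) \<le> S"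
proof -
  define f :: "int \<Rightarrow> real" where "f m = (1 + (real_of_int m)\<^sup>2) powr (-2/3)" for m
  have f0: "f m \<ge> 0" "f (- m) = f m" for m by (auto simp: f_def)
  have "summable (\<lambda>k. real k powr (-4/3))" by (subst summable_real_powr_iff) auto
  then obtain C where C: "\<And>N. (\<Sum>k<N. real k powr (-4/3)) \<le> C"
    using sum_le_suminf[of "\<lambda>k. real k powr (-4/3)"] by (metis finite_lessThan powr_ge_zero)
  have fle: "f (int k) \<le> real k powr (-4/3)" if "k \<ge> 1" for k :: nat
  proof -
    have "f (int k) \<le> ((real k)\<^sup>2) powr (-2/3)" unfolding f_def using that by (intro powr_mono2') auto
    also have "(real k)\<^sup>2 = real k powr 2" using that by simp
    also have "(real k powr 2) powr (-2/3) = real k powr (2 * (-2/3))" by (rule powr_powr)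
    finally show ?thesis by simp
  qed
  define D where "D = 1 + 2 * C"
  have C0: "C \<ge> 0" using C[of 0] by simp
  have D: "(\<Sum>m\<in>{- int N..int N}. f m) \<le> D" for N
  proof -
    have "(\<Sum>m\<in>{- int N..int N}. f m) \<le> f 0 + 2 * (\<Sum>k=1..N. f (int k))" by (rule sum_int_le) (auto simp: f0)
    also have "(\<Sum>k=1..N. f (int k)) \<le> (\<Sum>k=1..N. real k powr (-4/3))" by (intro sum_mono fle) auto
    also have "\<dots> \<le> (\<Sum>k<Suc N. real k powr (-4/3))" by (intro sum_mono2) auto
    also have "\<dots> \<le> C" by (rule C)
    finally show ?thesis by (simp add: D_def f_def)
  qed
  define c where "c = 4 * (L / (2 * pi))^4"
  have c: "c > 0" using L by (simp add: c_def)
  have lterm: "1 / (norm (freq L n))^4 \<le> c * (\<Prod>i\<in>UNIV. f (n $ i))" if n: "n \<noteq> 0" for n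
  proof -
    define Q where "Q = (\<Sum>i\<in>UNIV. (real_of_int (n $ i))\<^sup>2)"
    obtain j where "n $ j \<noteq> 0" using n by (auto simp: vec_eq_iff)
    then have "1 \<le> (n $ j)\<^sup>2" by (simp add: int_one_le_iff_zero_less)
    then have "1 \<le> (real_of_int (n $ j))\<^sup>2" by (metis of_int_1_le_iff of_int_power)
    also have "\<dots> \<le> Q" unfolding Q_def by (intro member_le_sum) auto
    finally have Q1: "1 \<le> Q" .
    have nf: "(norm (freq L n))\<^sup>2 = (2 * pi / L)\<^sup>2 * Q"
      unfolding freq_def by (simp add: power_mult_distrib norm_vec_def L2_set_def Q_def sum_nonneg power_divide sum_distrib_left sum_divide_distrib)
    then have n4: "(norm (freq L n))^4 = (2 * pi / L)^4 * Q\<^sup>2"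
    proof -
      have "(norm (freq L n))^4 = ((norm (freq L n))\<^sup>2)\<^sup>2" by simp
      then show ?thesis unfolding nf by (simp add: power_mult_distrib)
    qed
    have le: "1 + (real_of_int (n $ i))\<^sup>2 \<le> 1 + Q" for i unfolding Q_def by (auto intro!: member_le_sum)
    have "(1 + Q) powr (-2) = (\<Prod>i\<in>(UNIV::3 set). (1 + Q) powr (-2/3))"
      using Q1 by (simp add: powr_power)
    also have "\<dots> \<le> (\<Prod>i\<in>UNIV. f (n $ i))"
      unfolding f_def by (intro prod_mono conjI powr_mono2' le powr_ge_zero) (auto simp: add_pos_nonneg)
    finally have p: "(1 + Q) powr (-2) \<le> (\<Prod>i\<in>UNIV. f (n $ i))" .
    have "1 / Q\<^sup>2 \<le> 4 * (1 + Q) powr (-2)"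
    proof -
      have "(1 + Q)\<^sup>2 \<le> (2 * Q)\<^sup>2" using Q1 by (intro power_mono) auto
      then have "1 / Q\<^sup>2 \<le> 4 / (1 + Q)\<^sup>2" using Q1 by (simp add: field_simps)
      moreover have "(1 + Q) powr (-2) = 1 / (1 + Q)\<^sup>2" using Q1 by (simp add: powr_minus_divide)
      ultimately show ?thesis by simp
    qed
    then have "1 / Q\<^sup>2 \<le> 4 * (\<Prod>i\<in>UNIV. f (n $ i))" using p by linarith
    then have "(L / (2 * pi))^4 * (1 / Q\<^sup>2) \<le> (L / (2 * pi))^4 * (4 * (\<Prod>i\<in>UNIV. f (n $ i)))"
      using L by (intro mult_left_mono) auto
    then show ?thesis unfolding n4 c_def by (simp add: power_divide field_simps)
  qed
  show ?thesis
  proof (rule that[of "c * D^3 + 1"])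
    show "c * D^3 + 1 > 0" using c C0 by (simp add: D_def add_nonneg_pos)
    fix K :: "(int^3) set" assume K: "finite K" "K \<subseteq> - {0}"
    obtain N where N: "K \<subseteq> zbox N" using subset_zbox[OF K(1)] by blast
    have "(\<Sum>n\<in>K. 1 / (norm (freq L n))^4) \<le> (\<Sum>n\<in>K. c * (\<Prod>i\<in>UNIV. f (n $ i)))"
      using K by (intro sum_mono lterm) auto
    also have "\<dots> \<le> (\<Sum>n\<in>zbox N. c * (\<Prod>i\<in>UNIV. f (n $ i)))"
      by (intro sum_mono2 N finite_zbox mult_nonneg_nonneg prod_nonneg ballI f0 less_imp_le[OF c])
    also have "\<dots> = c * (\<Sum>g\<in>Pi\<^sub>E UNIV (\<lambda>_. {- int N..int N}). (\<Prod>i\<in>(UNIV::3 set). f (g i)))"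
      unfolding zbox_eq sum_distrib_left[symmetric] by (subst sum.reindex) (auto simp: inj_on_def vec_eq_iff)
    also have "(\<Sum>g\<in>Pi\<^sub>E UNIV (\<lambda>_. {- int N..int N}). (\<Prod>i\<in>(UNIV::3 set). f (g i))) = (\<Prod>i\<in>(UNIV::3 set). \<Sum>m\<in>{- int N..int N}. f m)"
      by (rule prod_sum_PiE[symmetric]) auto
    also have "\<dots> = (\<Sum>m\<in>{- int N..int N}. f m)^3" by simp
    also have "\<dots> \<le> D^3" by (intro power_mono D sum_nonneg f0)
    finally show "(\<Sum>n\<in>K. 1 / (norm (freq L n))^4) \<le> c * D^3 + 1" using c by (simp add: mult_left_mono)
  qed
qed

lemma Cauchy_Schwarz_sum_sqrt:
  fixes f g :: "'i \<Rightarrow> real"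
  assumes "(\<Sum>i\<in>I. (f i)\<^sup>2) \<le> A\<^sup>2" "(\<Sum>i\<in>I. (g i)\<^sup>2) \<le> B\<^sup>2" "A \<ge> 0" "B \<ge> 0"
  shows "(\<Sum>i\<in>I. f i * g i) \<le> A * B"
proof -
  have "(\<Sum>i\<in>I. f i * g i)\<^sup>2 \<le> (\<Sum>i\<in>I. (f i)\<^sup>2) * (\<Sum>i\<in>I. (g i)\<^sup>2)" by (rule Cauchy_Schwarz_ineq_sum)
  also have "\<dots> \<le> A\<^sup>2 * B\<^sup>2" using assms by (intro mult_mono) (auto intro: sum_nonneg)
  finally have "(\<Sum>i\<in>I. f i * g i)\<^sup>2 \<le> (A * B)\<^sup>2" by (simp add: power_mult_distrib)
  then show ?thesis using assms by (meson abs_le_square_iff abs_ge_self mult_nonneg_nonneg order_trans abs_of_nonneg power2_le_imp_le)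
qed

text \<open>
  The \<open>\<ell>\<^sup>2\<close> norm of \<open>f\<close> is at most \<open>A\<close>.
\<close>

definition sqsum_le :: "(int^3 \<Rightarrow> real) \<Rightarrow> real \<Rightarrow> bool" where
  "sqsum_le f A \<longleftrightarrow> A \<ge> 0 \<and> (\<forall>K. finite K \<longrightarrow> (\<Sum>n\<in>K. (f n)\<^sup>2) \<le> A\<^sup>2)"

lemma sqsum_le_shift: "sqsum_le f A \<Longrightarrow> finite K \<Longrightarrow> inj_on s K \<Longrightarrow> (\<Sum>n\<in>K. (f (s n))\<^sup>2) \<le> A\<^sup>2"
  unfolding sqsum_le_def by (metis (no_types, lifting) finite_imageI sum.reindex_cong)

text \<open>
  With \<open>a\<close>, \<open>p\<close> and \<open>g\<close> the absolute values of the Fourier coefficients of \<open>a\<close>, of \<open>p\<close> and of a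
  gradient \<open>\<nabla>u\<close>, this is the bound of the integral of \<open>(a \<cdot> \<nabla>) u \<cdot> p\<close> by the \<open>H\<^sup>1\<close> seminorms of
  the three functions, as given by the Hoelder inequality with exponents 6, 2, 3 and Sobolev embeddings.
  Stated for finite sums, it covers the truncations used below.
\<close>

definition trilinear_bound :: "real \<Rightarrow> real \<Rightarrow> bool" where
  "trilinear_bound L C \<longleftrightarrow> C > 0 \<and> (\<forall>a g p A G P K M. finite K \<longrightarrow> finite M \<longrightarrow>
     (\<forall>n. a n \<ge> 0) \<longrightarrow> (\<forall>n. g n \<ge> 0) \<longrightarrow> (\<forall>n. p n \<ge> 0) \<longrightarrow> a 0 = 0 \<longrightarrow> p 0 = 0 \<longrightarrow>
     sqsum_le (\<lambda>n. norm (freq L n) * a n) A \<longrightarrow> sqsum_le g G \<longrightarrow> sqsum_le (\<lambda>n. norm (freq L n) * p n) P \<longrightarrow>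
     (\<Sum>k\<in>K. \<Sum>m\<in>M. a (k - m) * g m * p k) \<le> C * A * G * P)"

text \<open>
  Write \<open>l = k - m\<close>.  One of \<open>|l| / |k|\<close> and \<open>|k| / |l|\<close> is at least \<open>1\<close>, hence
  \<open>a l * p k \<le> (|l| a l) (p k / |k|) + (a l / |l|) (|k| p k)\<close>.  In each summand the factor that is
  divided by its frequency is summable, by the Cauchy-Schwarz inequality and \<open>lattice_sum_bounded\<close>;
  the other factor and \<open>g\<close> are handled by the Cauchy-Schwarz inequality.
\<close>

lemma trilinear_sum_bound:
  assumes L: "L > 0"
  obtains C where "trilinear_bound L C"
proof -
  obtain S where S: "S > 0" "\<And>K. finite K \<Longrightarrow> K \<subseteq> - {0} \<Longrightarrow> (\<Sum>n\<in>K. 1 / (norm (freq L n))^4) \<le> S"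
    using lattice_sum_bounded[OF L] by blast
  have fz: "norm (freq L n) > 0" if "n \<noteq> 0" for n
    using that L by (auto simp: freq_def vec_eq_iff)
  have l1: "(\<Sum>n\<in>K. q n / norm (freq L n)) \<le> Q * sqrt S"
    if K: "finite K" and q: "sqsum_le (\<lambda>n. norm (freq L n) * q n) Q" and q0: "q 0 = 0" for K q Q
  proof -
    have "(\<Sum>n\<in>K. q n / norm (freq L n)) = (\<Sum>n\<in>K - {0}. (norm (freq L n) * q n) * (1 / (norm (freq L n))\<^sup>2))"
      by (rule sum.mono_neutral_cong_right) (use K q0 fz in \<open>auto simp: power2_eq_square\<close>)
    also have "\<dots> \<le> Q * sqrt S"
    proof (rule Cauchy_Schwarz_sum_sqrt)
      show "(\<Sum>i\<in>K - {0}. (norm (freq L i) * q i)\<^sup>2) \<le> Q\<^sup>2" using q K by (auto simp: sqsum_le_def)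
      have "(\<Sum>n\<in>K-{0}. (1 / (norm (freq L n))\<^sup>2)\<^sup>2) = (\<Sum>n\<in>K-{0}. 1 / (norm (freq L n))^4)"
        by (intro sum.cong) (auto simp: power_divide)
      then show "(\<Sum>n\<in>K-{0}. (1 / (norm (freq L n))\<^sup>2)\<^sup>2) \<le> (sqrt S)\<^sup>2" using S(2)[of "K - {0}"] K S(1) by auto
    qed (use q S in \<open>auto simp: sqsum_le_def\<close>)
    finally show ?thesis .
  qed
  show ?thesis
  proof (rule that[of "2 * sqrt S"], unfold trilinear_bound_def, intro conjI allI impI)
    show "2 * sqrt S > 0" using S by simp
  next
    fix a g p :: "int^3 \<Rightarrow> real" and A G P :: real and K M :: "(int^3) set"
    assume K: "finite K" and M: "finite M" and nonneg: "\<forall>n. a n \<ge> 0" "\<forall>n. g n \<ge> 0" "\<forall>n. p n \<ge> 0"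
      and z: "a 0 = 0" "p 0 = 0"
      and A: "sqsum_le (\<lambda>n. norm (freq L n) * a n) A" and G: "sqsum_le g G" and P: "sqsum_le (\<lambda>n. norm (freq L n) * p n) P"
    have nn: "a n \<ge> 0" "g n \<ge> 0" "p n \<ge> 0" for n using nonneg by auto
    have A0: "A \<ge> 0" "G \<ge> 0" "P \<ge> 0" using A G P by (auto simp: sqsum_le_def)
    define N where "N n = norm (freq L n)" for n
    have N0: "N n \<ge> 0" for n by (simp add: N_def)
    \<comment> \<open>one of the two ratios of frequencies is at least \<open>1\<close>\<close>
    have pt: "a l * p k \<le> (N l * a l) * (p k / N k) + (a l / N l) * (N k * p k)" for k l
    proof (cases "k = 0 \<or> l = 0")
      case True then show ?thesis using z by (auto simp: nn N0)
    next
      case False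
      then have pos: "N k > 0" "N l > 0" using fz by (auto simp: N_def)
      have ap: "a l * p k \<ge> 0" by (simp add: nn)
      have e1: "(N l * a l) * (p k / N k) = (N l / N k) * (a l * p k)" "(a l / N l) * (N k * p k) = (N k / N l) * (a l * p k)" by simp_all
      have "1 \<le> N l / N k + N k / N l"
      proof (cases "N k \<le> N l")
        case True then have "1 \<le> N l / N k" using pos by simp
        then show ?thesis using pos by (simp add: add_increasing2)
      next
        case False then have "1 \<le> N k / N l" using pos by simp
        then show ?thesis using pos by (simp add: add_increasing)
      qed
      then have "1 * (a l * p k) \<le> (N l / N k + N k / N l) * (a l * p k)" using ap by (rule mult_right_mono)
      then show ?thesis unfolding e1 by (simp add: distrib_right)
    qed
    have "(\<Sum>k\<in>K. \<Sum>m\<in>M. a (k - m) * g m * p k)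
      \<le> (\<Sum>k\<in>K. \<Sum>m\<in>M. g m * ((N (k - m) * a (k - m)) * (p k / N k) + (a (k - m) / N (k - m)) * (N k * p k)))"
    proof (intro sum_mono)
      fix k m
      have "g m * (a (k - m) * p k) \<le> g m * ((N (k - m) * a (k - m)) * (p k / N k) + (a (k - m) / N (k - m)) * (N k * p k))"
        by (intro mult_left_mono pt nn)
      then show "a (k - m) * g m * p k \<le> g m * ((N (k - m) * a (k - m)) * (p k / N k) + (a (k - m) / N (k - m)) * (N k * p k))"
        by (simp only: mult_ac)
    qed
    also have "\<dots> = (\<Sum>k\<in>K. (p k / N k) * (\<Sum>m\<in>M. g m * (N (k - m) * a (k - m))))
        + (\<Sum>k\<in>K. \<Sum>m\<in>M. (a (k - m) / N (k - m)) * (g m * (N k * p k)))"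
      by (simp add: distrib_left sum.distrib sum_distrib_left mult_ac)
    also have "(\<Sum>k\<in>K. (p k / N k) * (\<Sum>m\<in>M. g m * (N (k - m) * a (k - m)))) \<le> (\<Sum>k\<in>K. (p k / N k) * (G * A))"
    proof (intro sum_mono mult_left_mono)
      fix k
      show "(\<Sum>m\<in>M. g m * (N (k - m) * a (k - m))) \<le> G * A"
      proof (rule Cauchy_Schwarz_sum_sqrt)
        show "(\<Sum>m\<in>M. (g m)\<^sup>2) \<le> G\<^sup>2" using G M by (auto simp: sqsum_le_def)
        show "(\<Sum>m\<in>M. (N (k - m) * a (k - m))\<^sup>2) \<le> A\<^sup>2"
          using sqsum_le_shift[OF A M, of "\<lambda>m. k - m"] by (auto simp: N_def inj_on_def)
      qed (use A0 in auto)
      show "0 \<le> p k / N k" by (simp add: nn N0)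
    qed
    also have "\<dots> = (\<Sum>k\<in>K. p k / N k) * (G * A)" by (simp add: sum_distrib_right)
    also have "\<dots> \<le> (P * sqrt S) * (G * A)"
      by (intro mult_right_mono) (use l1[OF K P z(2)] A0 in \<open>auto simp: N_def\<close>)
    also have "(\<Sum>k\<in>K. \<Sum>m\<in>M. (a (k - m) / N (k - m)) * (g m * (N k * p k))) \<le> (A * sqrt S) * (G * P)"
    proof -
      define D where "D = (\<lambda>(k, m). k - m) ` (K \<times> M)"
      have D: "finite D" unfolding D_def using K M by auto
      have "(\<Sum>k\<in>K. \<Sum>m\<in>M. (a (k - m) / N (k - m)) * (g m * (N k * p k)))
        \<le> (\<Sum>k\<in>K. \<Sum>l\<in>D. (a l / N l) * (g (k - l) * (N k * p k)))"
      proof (rule sum_mono)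
        fix k assume k: "k \<in> K"
        have "(\<Sum>m\<in>M. (a (k - m) / N (k - m)) * (g m * (N k * p k))) = (\<Sum>l\<in>(\<lambda>m. k - m) ` M. (a l / N l) * (g (k - l) * (N k * p k)))"
          by (subst sum.reindex) (auto simp: inj_on_def)
        also have "\<dots> \<le> (\<Sum>l\<in>D. (a l / N l) * (g (k - l) * (N k * p k)))"
          by (rule sum_mono2[OF D]) (use k in \<open>auto simp: D_def nn N0\<close>)
        finally show "(\<Sum>m\<in>M. (a (k - m) / N (k - m)) * (g m * (N k * p k))) \<le> (\<Sum>l\<in>D. (a l / N l) * (g (k - l) * (N k * p k)))" .
      qed
      also have "\<dots> = (\<Sum>l\<in>D. (a l / N l) * (\<Sum>k\<in>K. g (k - l) * (N k * p k)))"
        by (subst sum.swap) (simp add: sum_distrib_left)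
      also have "\<dots> \<le> (\<Sum>l\<in>D. (a l / N l) * (G * P))"
      proof (intro sum_mono mult_left_mono)
        fix l
        show "(\<Sum>k\<in>K. g (k - l) * (N k * p k)) \<le> G * P"
        proof (rule Cauchy_Schwarz_sum_sqrt)
          show "(\<Sum>k\<in>K. (g (k - l))\<^sup>2) \<le> G\<^sup>2" by (rule sqsum_le_shift[OF G K]) (auto simp: inj_on_def)
          show "(\<Sum>k\<in>K. (N k * p k)\<^sup>2) \<le> P\<^sup>2" using P K by (auto simp: sqsum_le_def N_def)
        qed (use A0 in auto)
        show "0 \<le> a l / N l" by (simp add: nn N0)
      qed
      also have "\<dots> = (\<Sum>l\<in>D. a l / N l) * (G * P)" by (simp add: sum_distrib_right)
      also have "\<dots> \<le> (A * sqrt S) * (G * P)"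
        by (intro mult_right_mono) (use l1[OF D A z(1)] A0 in \<open>auto simp: N_def\<close>)
      finally show ?thesis .
    qed
    finally show "(\<Sum>k\<in>K. \<Sum>m\<in>M. a (k - m) * g m * p k) \<le> 2 * sqrt S * A * G * P" by (simp add: mult_ac)
  qed
qed

section \<open>Smooth functions and the lemma of du Bois-Reymond\<close>

lemma pd_eqI: "(g has_derivative D) (at x) \<Longrightarrow> pd e g x = D e"
  unfolding pd_def using frechet_derivative_at[of g D x] by simp

lemma has_derivative_pd: "g differentiable (at x) \<Longrightarrow> (g has_derivative (\<lambda>e. pd e g x)) (at x)"
  unfolding pd_def using frechet_derivative_works by blast

lemma C_diff_cont: "C_diff m g \<Longrightarrow> continuous_on UNIV g"
  by (cases m) (auto intro!: differentiable_imp_continuous_on simp: differentiable_on_def intro: differentiable_at_withinI)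

lemma C_diff_Suc_imp: "C_diff (Suc m) g \<Longrightarrow> C_diff m g"
proof (induction m arbitrary: g)
  case 0 then show ?case using C_diff_cont[of "Suc 0" g] by simp
next
  case (Suc m)
  then show ?case by simp
qed

lemma C_diff_const: "C_diff m (\<lambda>x. c)"
proof (induction m arbitrary: c)
  case (Suc m)
  have "pd e (\<lambda>x. c) = (\<lambda>x. 0)" for e :: 'a by (rule ext) (rule pd_eqI, auto)
  then show ?case using Suc by simp
qed simp

lemma C_diff_add: "C_diff m f \<Longrightarrow> C_diff m g \<Longrightarrow> C_diff m (\<lambda>x. f x + g x)"
proof (induction m arbitrary: f g)
  case (Suc m)
  have "pd e (\<lambda>x. f x + g x) = (\<lambda>x. pd e f x + pd e g x)" for e
    by (rule ext, rule pd_eqI) (use Suc.prems in \<open>auto intro!: has_derivative_add has_derivative_pd\<close>)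
  then show ?case using Suc by (auto intro: differentiable_add)
qed (auto intro: continuous_on_add)

lemma C_diff_mult: "C_diff m f \<Longrightarrow> C_diff m g \<Longrightarrow> C_diff m (\<lambda>x. f x * g x)"
proof (induction m arbitrary: f g)
  case (Suc m)
  have "pd e (\<lambda>x. f x * g x) = (\<lambda>x. f x * pd e g x + pd e f x * g x)" for e
    by (rule ext, rule pd_eqI) (use Suc.prems in \<open>auto intro!: has_derivative_mult has_derivative_pd\<close>)
  then show ?case using Suc C_diff_Suc_imp[OF Suc.prems(1)] C_diff_Suc_imp[OF Suc.prems(2)]
    by (auto intro: differentiable_mult C_diff_add)
qed (auto intro: continuous_on_mult)

lemma C_diff_minus: "C_diff m f \<Longrightarrow> C_diff m (\<lambda>x. - f x)"
  using C_diff_mult[OF C_diff_const[of m "-1"], of f] by simp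

lemma C_diff_inverse: "C_diff m f \<Longrightarrow> (\<And>x. f x \<noteq> 0) \<Longrightarrow> C_diff m (\<lambda>x. inverse (f x))"
proof (induction m)
  case (Suc m)
  have d: "((\<lambda>x. inverse (f x)) has_derivative (\<lambda>e. - (inverse (f x) * pd e f x * inverse (f x)))) (at x)" for x
    by (rule Deriv.has_derivative_inverse) (use Suc.prems in \<open>auto intro: has_derivative_pd\<close>)
  have "pd e (\<lambda>x. inverse (f x)) = (\<lambda>x. - (inverse (f x) * pd e f x * inverse (f x)))" for e
    by (rule ext, rule pd_eqI[OF d])
  moreover have "C_diff m (\<lambda>x. inverse (f x))" using Suc C_diff_Suc_imp by blast
  moreover have "(\<lambda>x. inverse (f x)) differentiable (at x)" for x using d unfolding differentiable_def by blast
  ultimately show ?case using Suc.prems by (auto intro!: C_diff_minus C_diff_mult)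
qed (auto intro: continuous_on_inverse)

lemma smooth_const: "smooth (\<lambda>x. c)" by (simp add: smooth_def C_diff_const)
lemma smooth_add: "smooth f \<Longrightarrow> smooth g \<Longrightarrow> smooth (\<lambda>x. f x + g x)" by (simp add: smooth_def C_diff_add)
lemma smooth_mult: "smooth f \<Longrightarrow> smooth g \<Longrightarrow> smooth (\<lambda>x. f x * g x)" by (simp add: smooth_def C_diff_mult)
lemma smooth_inverse: "smooth f \<Longrightarrow> (\<And>x. f x \<noteq> 0) \<Longrightarrow> smooth (\<lambda>x. inverse (f x))" by (simp add: smooth_def C_diff_inverse)

lemma smooth_differentiable: "smooth g \<Longrightarrow> g differentiable (at x)"
proof -
  assume "smooth g"
  then have "C_diff (Suc 0) g" unfolding smooth_def by blast
  then show ?thesis by simp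
qed

lemma has_real_derivative_pd: "smooth (g :: real \<Rightarrow> real) \<Longrightarrow> (g has_real_derivative pd 1 g x) (at x)"
proof -
  assume "smooth g"
  then have d: "(g has_derivative (\<lambda>e. pd e g x)) (at x)" by (intro has_derivative_pd smooth_differentiable)
  then interpret bounded_linear "\<lambda>e. pd e g x" by (rule has_derivative_bounded_linear)
  have "pd e g x = pd 1 g x * e" for e using scaleR[of e 1] by simp
  then have "(\<lambda>e. pd e g x) = (*) (pd 1 g x)" by (rule ext)
  then show ?thesis using d unfolding has_field_derivative_def by (simp only:)
qed

lemma continuous_pd1: "smooth (g :: real \<Rightarrow> real) \<Longrightarrow> continuous_on UNIV (pd 1 g)"
proof -
  assume "smooth g"
  then have "C_diff (Suc 0) g" unfolding smooth_def by blast
  then show ?thesis by simp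
qed

lemma pd1_eqI: "(g has_real_derivative d) (at x) \<Longrightarrow> pd 1 g x = d"
  using pd_eqI[of g "\<lambda>e. d * e" x 1] by (simp add: has_field_derivative_def)

text \<open>
  Smoothness of functions whose higher derivatives are known explicitly, such as \<^const>\<open>cos\<close>.
\<close>

lemma smooth_derivative_sequence:
  fixes H :: "nat \<Rightarrow> real \<Rightarrow> real"
  assumes "\<And>n x. (H n has_real_derivative H (Suc n) x) (at x)"
  shows "smooth (H n)"
proof -
  have "C_diff m (H n)" for m
  proof (induction m arbitrary: n)
    case 0
    show ?case using assms by (auto intro!: continuous_at_imp_continuous_on DERIV_isCont)
  next
    case (Suc m)
    have "pd 1 (H n) = H (Suc n)" for n by (rule ext) (rule pd1_eqI, rule assms)
    moreover have "H n differentiable (at x)" for n x using assms[of n x] real_differentiable_def by blast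
    ultimately show ?case using Suc by simp
  qed
  then show ?thesis by (simp add: smooth_def)
qed

text \<open>
  Partial derivatives of \<open>h (l z + c)\<close> are multiples of \<open>h' (l z + c)\<close>, so the induction stays
  within functions of this form.
\<close>

lemma C_diff_compose_affine:
  fixes h :: "real \<Rightarrow> real" and l :: "'a::euclidean_space \<Rightarrow> real"
  assumes l: "bounded_linear l"
  shows "C_diff m h \<Longrightarrow> C_diff m (\<lambda>z. h (l z + c))"
proof (induction m arbitrary: h)
  case 0
  have "continuous_on UNIV (\<lambda>z. l z + c)" by (intro continuous_intros linear_continuous_on l)
  then show ?case using 0 by (auto intro: continuous_on_compose2[of UNIV h])
next
  case (Suc m)
  have d: "((\<lambda>z. h (l z + c)) has_derivative (\<lambda>e. pd (l e) h (l z + c))) (at z)" for z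
  proof -
    have "((\<lambda>z. l z + c) has_derivative l) (at z)"
      using bounded_linear_imp_has_derivative[OF l] by (auto intro!: derivative_eq_intros)
    from has_derivative_compose[OF this has_derivative_pd[of h]] show ?thesis using Suc.prems by simp
  qed
  have lin: "pd e h x = e * pd 1 h x" for e x
  proof -
    have "(h has_derivative (\<lambda>e. pd e h x)) (at x)" using Suc.prems by (intro has_derivative_pd) simp
    then interpret bounded_linear "\<lambda>e. pd e h x" by (rule has_derivative_bounded_linear)
    show ?thesis using scaleR[of e 1] by simp
  qed
  have "pd e (\<lambda>z. h (l z + c)) = (\<lambda>z. l e * pd 1 h (l z + c))" for e
    by (rule ext, subst pd_eqI[OF d], rule lin)
  moreover have "(\<lambda>z. h (l z + c)) differentiable (at z)" for z using d unfolding differentiable_def by blast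
  ultimately show ?case using Suc by (auto intro!: C_diff_mult[OF C_diff_const])
qed

lemma smooth_compose_affine: "bounded_linear l \<Longrightarrow> smooth h \<Longrightarrow> smooth (\<lambda>z. h (l z + c))" for h :: "real \<Rightarrow> real"
  unfolding smooth_def using C_diff_compose_affine by blast

lemma smooth_compose_real_affine: "smooth h \<Longrightarrow> smooth (\<lambda>x::real. h (a * x + c))"
  by (rule smooth_compose_affine) (auto intro: bounded_linear_mult_right)

lemma smooth_cos: "smooth (cos :: real \<Rightarrow> real)"
proof -
  have "cos (x + real (Suc n) * (pi / 2)) = - sin (x + real n * (pi / 2))" for x n
  proof -
    have "x + real (Suc n) * (pi / 2) = (x + real n * (pi / 2)) + pi / 2" by (simp add: field_simps)
    then show ?thesis by (simp only: cos_add[of _ "pi / 2"] sin_pi_half cos_pi_half mult_zero_right mult_1_right diff_0)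
  qed
  then have "smooth ((\<lambda>n x. cos (x + real n * (pi / 2))) 0)"
    by (intro smooth_derivative_sequence[of "\<lambda>n x. cos (x + real n * (pi / 2))"])
       (auto intro!: derivative_eq_intros simp del: of_nat_Suc)
  then show ?thesis by simp
qed

text \<open>
  The function \<open>p(1/x) exp(-1/x)\<close>, extended by zero to \<open>x \<le> 0\<close>.  The polynomial factor makes the family
  closed under differentiation.
\<close>

definition flat :: "real poly \<Rightarrow> real \<Rightarrow> real" where
  "flat p x = (if x \<le> 0 then 0 else poly p (1 / x) * exp (- (1 / x)))"

lemma poly_div_exp_tendsto_0: "((\<lambda>y. poly p y / exp y) \<longlongrightarrow> 0) (at_top :: real filter)"
proof -
  have "((\<lambda>y. \<Sum>i\<le>degree p. coeff p i * (y ^ i / exp y)) \<longlongrightarrow> (\<Sum>i\<le>degree p. coeff p i * 0)) (at_top :: real filter)"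
    by (intro tendsto_intros tendsto_power_div_exp_0)
  then show ?thesis by (simp add: poly_altdef sum_divide_distrib)
qed

lemma flat_derivative: "(flat p has_real_derivative flat ([:0, 0, 1:] * (p - pderiv p)) x) (at x)"
proof (cases "x = 0")
  case False
  show ?thesis
  proof (cases "x < 0")
    case True
    have "((\<lambda>x. 0) has_real_derivative 0) (at x)" by simp
    then have "(flat p has_real_derivative 0) (at x)"
      by (rule has_field_derivative_transform_within_open[of _ _ _ "{..<0}"]) (use True in \<open>auto simp: flat_def\<close>)
    then show ?thesis using True by (simp add: flat_def)
  next
    case False
    then have x: "x > 0" using \<open>x \<noteq> 0\<close> by simp
    have "((\<lambda>x. poly p (1 / x) * exp (- (1 / x))) has_real_derivative
        (poly (pderiv p) (1 / x) * (- (1 / x\<^sup>2))) * exp (- (1 / x)) + poly p (1 / x) * (exp (- (1 / x)) * (1 / x\<^sup>2))) (at x)"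
    proof -
      have i: "((\<lambda>x. 1 / x) has_real_derivative - (1 / x\<^sup>2)) (at x)"
        using x by (auto intro!: derivative_eq_intros simp: power2_eq_square field_simps)
      have "((\<lambda>x. poly p (1 / x)) has_real_derivative poly (pderiv p) (1 / x) * (- (1 / x\<^sup>2))) (at x)"
        by (rule DERIV_chain2[OF poly_DERIV i])
      moreover have "((\<lambda>x. exp (- (1 / x))) has_real_derivative exp (- (1 / x)) * (1 / x\<^sup>2)) (at x)"
        using DERIV_chain2[OF DERIV_exp DERIV_minus[OF i]] by simp
      ultimately show ?thesis by (rule DERIV_cong[OF DERIV_mult]) (simp add: mult.commute)
    qed
    then have "(flat p has_real_derivative
        (poly (pderiv p) (1 / x) * (- (1 / x\<^sup>2))) * exp (- (1 / x)) + poly p (1 / x) * (exp (- (1 / x)) * (1 / x\<^sup>2))) (at x)"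
      by (rule has_field_derivative_transform_within_open[of _ _ _ "{0<..}"]) (use x in \<open>auto simp: flat_def\<close>)
    also have "(poly (pderiv p) (1 / x) * (- (1 / x\<^sup>2))) * exp (- (1 / x)) + poly p (1 / x) * (exp (- (1 / x)) * (1 / x\<^sup>2))
       = flat ([:0, 0, 1:] * (p - pderiv p)) x"
      using x by (simp add: flat_def power2_eq_square algebra_simps)
    finally show ?thesis .
  qed
next
  case True
  have "((\<lambda>h. flat p h / h) \<longlongrightarrow> 0) (at_right 0)"
  proof -
    have "((\<lambda>y. poly ([:0, 1:] * p) y / exp y) \<longlongrightarrow> 0) at_top" by (rule poly_div_exp_tendsto_0)
    from filterlim_compose[OF this filterlim_inverse_at_top_right]
    have "((\<lambda>h. poly ([:0, 1:] * p) (inverse h) / exp (inverse h)) \<longlongrightarrow> 0) (at_right (0::real))" .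
    then show ?thesis
    proof (rule Lim_transform_eventually)
      show "\<forall>\<^sub>F h in at_right (0::real). poly ([:0, 1:] * p) (inverse h) / exp (inverse h) = flat p h / h"
        unfolding eventually_at_right_field
        by (intro exI[of _ 1]) (auto simp: flat_def exp_minus field_simps)
    qed
  qed
  moreover have "((\<lambda>h. flat p h / h) \<longlongrightarrow> 0) (at_left 0)"
    by (rule tendsto_eventually) (auto simp: eventually_at_left_field flat_def intro!: exI[of _ "-1"])
  ultimately have "((\<lambda>h. flat p h / h) \<longlongrightarrow> 0) (at 0)" by (simp add: filterlim_at_split)
  then show ?thesis using True by (simp add: DERIV_def flat_def)
qed

lemma smooth_flat: "smooth (flat p)"
proof -
  define H where "H n = flat (((\<lambda>p. [:0, 0, 1:] * (p - pderiv p)) ^^ n) p)" for n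
  have "smooth (H 0)" by (rule smooth_derivative_sequence) (simp add: H_def flat_derivative del: mult_pCons_left)
  then show ?thesis by (simp add: H_def)
qed

text \<open>
  A smooth step from \<open>0\<close> on the negative half-line to \<open>1\<close> beyond \<open>1\<close>.
\<close>

definition sstep :: "real \<Rightarrow> real" where
  "sstep x = flat 1 x * inverse (flat 1 x + flat 1 (- 1 * x + 1))"

lemma flat1_nonneg: "flat 1 x \<ge> 0" and flat1_pos: "x > 0 \<Longrightarrow> flat 1 x > 0" and flat1_0: "x \<le> 0 \<Longrightarrow> flat 1 x = 0"
  by (auto simp: flat_def)

lemma sstep_denominator: "flat 1 x + flat 1 (- 1 * x + 1) > 0"
  using flat1_nonneg[of x] flat1_nonneg[of "- 1 * x + 1"] flat1_pos[of x] flat1_pos[of "- 1 * x + 1"]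
  by (cases "x > 0") auto

lemma smooth_sstep: "smooth sstep"
  unfolding sstep_def using sstep_denominator
  by (intro smooth_mult smooth_inverse smooth_add smooth_flat smooth_compose_real_affine[of "flat 1"]) (simp add: less_imp_neq[symmetric])

lemma sstep_0: "x \<le> 0 \<Longrightarrow> sstep x = 0" by (simp add: sstep_def flat1_0)
lemma sstep_1: "x \<ge> 1 \<Longrightarrow> sstep x = 1" using flat1_pos[of x] by (simp add: sstep_def flat1_0)
lemma sstep_bounds: "0 \<le> sstep x" "sstep x \<le> 1"
  using sstep_denominator[of x] flat1_nonneg[of x] flat1_nonneg[of "- 1 * x + 1"]
  by (auto simp: sstep_def field_simps)

definition sstep' :: "real \<Rightarrow> real" where "sstep' = pd 1 sstep"

lemma sstep_deriv: "(sstep has_real_derivative sstep' x) (at x)"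
  unfolding sstep'_def by (rule has_real_derivative_pd[OF smooth_sstep])

lemma continuous_sstep': "continuous_on S sstep'"
  unfolding sstep'_def using continuous_pd1[OF smooth_sstep] continuous_on_subset by blast

lemma sstep'_0: "x < 0 \<or> x > 1 \<Longrightarrow> sstep' x = 0"
proof -
  assume x: "x < 0 \<or> x > 1"
  then have "(sstep has_real_derivative 0) (at x)"
  proof
    assume "x < 0"
    have "((\<lambda>x. 0) has_real_derivative 0) (at x)" by simp
    then show ?thesis
      by (rule has_field_derivative_transform_within_open[of _ _ _ "{..<0}"]) (use \<open>x < 0\<close> in \<open>auto simp: sstep_0\<close>)
  next
    assume "x > 1"
    have "((\<lambda>x. 1) has_real_derivative 0) (at x)" by simp
    then show ?thesis
      by (rule has_field_derivative_transform_within_open[of _ _ _ "{1<..}"]) (use \<open>x > 1\<close> in \<open>auto simp: sstep_1\<close>)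
  qed
  then show ?thesis using sstep_deriv DERIV_unique by blast
qed

lemma sstep'_integral: "(\<integral>r. indicator {0..1} r * sstep' r \<partial>lborel) = 1"
proof -
  have "(\<integral>r. indicator {0..1} r *\<^sub>R sstep' r \<partial>lborel) = sstep 1 - sstep 0"
    by (rule integral_FTC_atLeastAtMost)
      (auto intro!: continuous_sstep' DERIV_subset[OF sstep_deriv, THEN has_real_derivative_iff_has_vector_derivative[THEN iffD1]])
  then show ?thesis by (simp add: sstep_0 sstep_1)
qed

text \<open>
  Test functions of time, supported in a compact subset of the open half-line.
\<close>

definition ttest :: "(real \<Rightarrow> real) \<Rightarrow> bool" where
  "ttest \<theta> \<longleftrightarrow> smooth \<theta> \<and> (\<exists>a b. 0 < a \<and> (\<forall>t. t \<notin> {a..b} \<longrightarrow> \<theta> t = 0))"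

text \<open>
  Smooth approximations of the indicator of the interval from \<open>s\<close> to \<open>t\<close>.
\<close>

definition plateau :: "real \<Rightarrow> real \<Rightarrow> nat \<Rightarrow> real \<Rightarrow> real" where
  "plateau s t n \<tau> = sstep (real (Suc n) * (\<tau> - s)) - sstep (real (Suc n) * (\<tau> - t))"

lemma plateau_after: "s \<le> t \<Longrightarrow> t + 1 \<le> \<tau> \<Longrightarrow> plateau s t n \<tau> = 0"
proof -
  assume st: "s \<le> t" "t + 1 \<le> \<tau>"
  have g: "1 \<le> real (Suc n) * x" if "x \<ge> 1" for x using mult_mono[of 1 "real (Suc n)" 1 x] that by simp
  show ?thesis using sstep_1[OF g[of "\<tau> - s"]] sstep_1[OF g[of "\<tau> - t"]] st by (simp add: plateau_def)
qed

lemma ttest_plateau: "0 < s \<Longrightarrow> s \<le> t \<Longrightarrow> ttest (plateau s t n)"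
proof -
  assume st: "0 < s" "s \<le> t"
  have "smooth (\<lambda>\<tau>. sstep (real (Suc n) * \<tau> + (- (real (Suc n) * s))) + (-1) * sstep (real (Suc n) * \<tau> + (- (real (Suc n) * t))))"
    by (intro smooth_add smooth_mult smooth_const smooth_compose_real_affine smooth_sstep)
  then have "smooth (plateau s t n)" unfolding plateau_def by (simp add: right_diff_distrib)
  moreover have "plateau s t n \<tau> = 0" if "\<tau> \<notin> {s..t + 1}" for \<tau>
  proof (cases "\<tau> < s")
    case True then show ?thesis using st by (simp add: plateau_def sstep_0 mult_le_0_iff)
  next
    case False
    then have t: "\<tau> > t + 1" using that by auto
    then show ?thesis using st by (intro plateau_after) auto
  qed
  ultimately show ?thesis using st unfolding ttest_def by blast
qed

text \<open>
  The derivative of a steepened step: an approximation of the Dirac measure at \<open>s\<close> from the right.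
\<close>

abbreviation bump :: "nat \<Rightarrow> real \<Rightarrow> real \<Rightarrow> real" where
  "bump n s \<tau> \<equiv> real (Suc n) * sstep' (real (Suc n) * (\<tau> - s))"

lemma plateau_deriv: "pd 1 (plateau s t n) \<tau> = bump n s \<tau> - bump n t \<tau>"
  unfolding plateau_def
  by (rule pd1_eqI) (auto intro!: derivative_eq_intros DERIV_chain2[OF sstep_deriv])

lemma plateau_bound: "\<bar>plateau s t n \<tau>\<bar> \<le> 1"
  unfolding plateau_def using sstep_bounds[of "real (Suc n) * (\<tau> - s)"] sstep_bounds[of "real (Suc n) * (\<tau> - t)"] by linarith

lemma sstep_scaled_tendsto: "(\<lambda>n. sstep (real (Suc n) * x)) \<longlonglongrightarrow> (if x > 0 then 1 else 0)"
proof (cases "x > 0")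
  case True
  then obtain N :: nat where N: "real N * x > 1" using reals_Archimedean3 by blast
  have "sstep (real (Suc n) * x) = 1" if "n \<ge> N" for n
  proof (rule sstep_1)
    have "real (Suc n) * x \<ge> real N * x" using that True by (intro mult_right_mono) auto
    then show "1 \<le> real (Suc n) * x" using N by simp
  qed
  then have "\<forall>\<^sub>F n in sequentially. sstep (real (Suc n) * x) = 1" unfolding eventually_sequentially by blast
  then show ?thesis using True by (simp add: tendsto_eventually)
next
  case False
  then have "sstep (real (Suc n) * x) = 0" for n by (intro sstep_0) (simp add: mult_le_0_iff)
  then show ?thesis using False by simp
qed

lemma sstep'_concentrates:
  assumes V: "continuous_on UNIV (V :: real \<Rightarrow> real)"
  shows "integrable lborel (\<lambda>\<tau>. bump n s \<tau> * V \<tau>)"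
    and "(\<lambda>n. \<integral>\<tau>. bump n s \<tau> * V \<tau> \<partial>lborel) \<longlonglongrightarrow> V s"
proof -
  have eq: "(\<lambda>x. real (Suc n) * sstep' (real (Suc n) * ((s + (1 / real (Suc n)) * x) - s)) * V (s + (1 / real (Suc n)) * x))
    = (\<lambda>r. real (Suc n) * (indicator {0..1} r * (sstep' r * V (s + (1 / real (Suc n)) * r))))" for n
  proof -
    have "0 \<le> x \<and> x \<le> 1" if "sstep' x \<noteq> 0" for x using sstep'_0[of x] that by force
    then show ?thesis by (auto simp: fun_eq_iff indicator_def)
  qed
  have int: "integrable lborel (\<lambda>r. indicator {0..1} r * (sstep' r * V (s + (1 / real (Suc n)) * r)))" for n
  proof -
    have "continuous_on {0..1} (\<lambda>r. sstep' r * V (s + (1 / real (Suc n)) * r))"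
      by (intro continuous_intros continuous_sstep' continuous_on_compose2[OF V]) auto
    from borel_integrable_atLeastAtMost'[OF this] show ?thesis by (simp add: set_integrable_def)
  qed
  have c: "1 / real (Suc n) \<noteq> 0" for n by simp
  show "integrable lborel (\<lambda>\<tau>. bump n s \<tau> * V \<tau>)"
    by (subst lborel_integrable_real_affine_iff[OF c[of n], of _ s, symmetric], subst eq) (use int in simp)
  have val: "(\<integral>\<tau>. bump n s \<tau> * V \<tau> \<partial>lborel)
     = (\<integral>r. indicator {0..1} r * (sstep' r * V (s + (1 / real (Suc n)) * r)) \<partial>lborel)" for n
    by (subst lborel_integral_real_affine[OF c[of n], of _ s], subst eq) simp
  have "(\<lambda>n. \<integral>r. indicator {0..1} r * (sstep' r * V (s + (1 / real (Suc n)) * r)) \<partial>lborel)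
      \<longlonglongrightarrow> (\<integral>r. indicator {0..1} r * (sstep' r * V s) \<partial>lborel)"
  proof -
    have "compact (V ` {s..s + 1})" "compact (sstep' ` {0..1})"
      by (intro compact_continuous_image continuous_on_subset[OF V] continuous_sstep' compact_Icc; simp)+
    then have bd: "bounded (V ` {s..s + 1})" "bounded (sstep' ` {0..1})" by (auto intro: compact_imp_bounded)
    obtain B where B1: "\<And>x. x \<in> {s..s+1} \<Longrightarrow> norm (V x) \<le> B" using bd(1) unfolding bounded_iff by blast
    obtain B' where B2: "\<And>x. x \<in> {0..1} \<Longrightarrow> norm (sstep' x) \<le> B'" using bd(2) unfolding bounded_iff by blast
    note B = B1 B2
    have B0: "B' \<ge> 0" using B(2)[of 0] norm_ge_zero[of "sstep' 0"] by (simp del: norm_ge_zero)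
    have [measurable]: "V \<in> borel_measurable borel" "sstep' \<in> borel_measurable borel"
      by (intro borel_measurable_continuous_onI V continuous_sstep')+
    show ?thesis
    proof (rule integral_dominated_convergence[where w="\<lambda>r. indicator {0..1} r * (B' * B)"])
      show "integrable lborel (\<lambda>r::real. indicator {0..1} r * (B' * B))"
        using borel_integrable_atLeastAtMost'[of 0 1 "\<lambda>r. B' * B"] by (auto simp: set_integrable_def)
      show "AE r in lborel. (\<lambda>n. indicator {0..1} r * (sstep' r * V (s + (1 / real (Suc n)) * r))) \<longlonglongrightarrow> indicator {0..1} r * (sstep' r * V s)"
      proof (rule AE_I2)
        fix r :: real
        have "(\<lambda>n. 1 / real (Suc n)) \<longlonglongrightarrow> 0" by (rule LIMSEQ_Suc[OF lim_1_over_n])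
        then have "(\<lambda>n. s + (1 / real (Suc n)) * r) \<longlonglongrightarrow> s + 0 * r" by (intro tendsto_intros)
        then have "(\<lambda>n. V (s + (1 / real (Suc n)) * r)) \<longlonglongrightarrow> V s"
          using V by (intro isCont_tendsto_compose[of _ V]) (auto simp: continuous_on_eq_continuous_at)
        then show "(\<lambda>n. indicator {0..1} r * (sstep' r * V (s + (1 / real (Suc n)) * r))) \<longlonglongrightarrow> indicator {0..1} r * (sstep' r * V s)"
          by (intro tendsto_intros)
      qed
      show "AE r in lborel. norm (indicator {0..1} r * (sstep' r * V (s + (1 / real (Suc n)) * r))) \<le> indicator {0..1} r * (B' * B)" for n
      proof (rule AE_I2)
        fix r :: real
        have "norm (sstep' r) * norm (V (s + (1 / real (Suc n)) * r)) \<le> B' * B" if "r \<in> {0..1}"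
        proof (rule mult_mono)
          have "(1 / real (Suc n)) * r \<le> 1 * 1" using that by (intro mult_mono) auto
          then show "norm (V (s + (1 / real (Suc n)) * r)) \<le> B" using that by (intro B(1)) auto
        qed (use B(2)[OF that] B0 in auto)
        then show "norm (indicator {0..1} r * (sstep' r * V (s + (1 / real (Suc n)) * r))) \<le> indicator {0..1} r * (B' * B)"
          by (auto simp: indicator_def abs_mult)
      qed
    qed measurable
  qed
  also have "(\<integral>r. indicator {0..1} r * (sstep' r * V s) \<partial>lborel) = V s"
  proof -
    have "(\<integral>r. indicator {0..1} r * (sstep' r * V s) \<partial>lborel) = (\<integral>r. (indicator {0..1} r * sstep' r) * V s \<partial>lborel)"
      by (simp add: mult.assoc)
    also have "\<dots> = V s" by (simp add: sstep'_integral del: mult.assoc)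
    finally show ?thesis .
  qed
  finally show "(\<lambda>n. \<integral>\<tau>. bump n s \<tau> * V \<tau> \<partial>lborel) \<longlonglongrightarrow> V s"
    unfolding val .
qed

lemma set_integrable_Icc_bounded:
  assumes "set_integrable lborel {0..T} F" "0 \<le> s" "t \<le> T"
  shows "set_integrable lborel {s..t} (F :: real \<Rightarrow> real)"
  by (rule set_integrable_subset[OF assms(1)]) (use assms in auto)

text \<open>
  If \<open>V\<close> has the weak derivative \<open>F\<close>, then \<open>V\<close> is a primitive of \<open>F\<close>.  Testing with \<^const>\<open>plateau\<close>, the
  derivative of the test function picks out \<open>V s - V t\<close>, and the plateau itself tends to the indicator
  of the interval.  The endpoint \<open>s = 0\<close> is beyond the reach of the test functions and is obtained from
  the continuity of \<open>V\<close>.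
\<close>

lemma du_Bois_Reymond:
  fixes V F :: "real \<Rightarrow> real"
  assumes V: "continuous_on {0..} V" and F: "\<And>T. T > 0 \<Longrightarrow> set_integrable lborel {0..T} F"
    and eq: "\<And>\<theta>. ttest \<theta> \<Longrightarrow> (LINT \<tau>:{0..}|lborel. pd 1 \<theta> \<tau> * V \<tau> + \<theta> \<tau> * F \<tau>) = 0"
    and st: "0 \<le> s" "s \<le> t"
  shows "V t - V s = (LINT \<tau>:{s..t}|lborel. F \<tau>)"
proof -
  \<comment> \<open>a continuous extension of \<open>V\<close> to the negative times, where the mollifiers are not supported\<close>
  define W where "W x = V (max 0 x)" for x
  have W: "continuous_on UNIV W" unfolding W_def
    by (rule continuous_on_compose2[OF V]) (auto intro!: continuous_intros)
  have pos: "V t - V s = (LINT \<tau>:{s..t}|lborel. F \<tau>)" if st: "0 < s" "s \<le> t" for s t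
  proof -
    define G where "G \<tau> = indicator {0..t+1} \<tau> * F \<tau>" for \<tau>
    have G: "integrable lborel G" using F[of "t + 1"] st by (auto simp: G_def[abs_def] set_integrable_def)
    have [measurable]: "G \<in> borel_measurable borel" using G by auto
    have pm: "plateau s t n \<in> borel_measurable borel" for n
      using ttest_plateau[OF st, of n] unfolding ttest_def smooth_def
      by (intro borel_measurable_continuous_onI) (meson C_diff_cont)
    note [measurable] = pm
    have pG: "integrable lborel (\<lambda>\<tau>. plateau s t n \<tau> * G \<tau>)" for n
      by (rule Bochner_Integration.integrable_bound[OF G])
        (auto simp: abs_mult intro!: mult_left_le_one_le plateau_bound)
    have pF: "indicator {0..} \<tau> * (plateau s t n \<tau> * F \<tau>) = plateau s t n \<tau> * G \<tau>" for n \<tau>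
    proof (cases "\<tau> \<in> {0..t+1}")
      case True then show ?thesis by (simp add: G_def)
    next
      case False
      have "plateau s t n \<tau> = 0 \<or> \<tau> < 0"
      proof (cases "\<tau> < 0")
        case False
        then have "\<tau> > t + 1" using \<open>\<tau> \<notin> {0..t+1}\<close> by auto
        then show ?thesis using st by (intro disjI1 plateau_after) auto
      qed simp
      then show ?thesis using False by (auto simp: G_def)
    qed
    have pV: "indicator {0..} \<tau> * (pd 1 (plateau s t n) \<tau> * V \<tau>)
       = bump n s \<tau> * W \<tau> - bump n t \<tau> * W \<tau>" for n \<tau>
    proof (cases "\<tau> \<ge> 0")
      case True then show ?thesis by (simp add: plateau_deriv W_def left_diff_distrib)
    next
      case False
      then have "real (Suc n) * (\<tau> - s) < 0" "real (Suc n) * (\<tau> - t) < 0" using st by (simp_all add: mult_less_0_iff)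
      then have "sstep' (real (Suc n) * (\<tau> - s)) = 0" "sstep' (real (Suc n) * (\<tau> - t)) = 0" using sstep'_0 by blast+
      then show ?thesis using False by simp
    qed
    have e: "((\<integral>\<tau>. bump n s \<tau> * W \<tau> \<partial>lborel) - (\<integral>\<tau>. bump n t \<tau> * W \<tau> \<partial>lborel))
        + (\<integral>\<tau>. plateau s t n \<tau> * G \<tau> \<partial>lborel) = 0" for n
    proof -
      have "0 = (LINT \<tau>:{0..}|lborel. pd 1 (plateau s t n) \<tau> * V \<tau> + plateau s t n \<tau> * F \<tau>)"
        using eq[OF ttest_plateau[OF st, of n]] by simp
      also have "\<dots> = (\<integral>\<tau>. (bump n s \<tau> * W \<tau> - bump n t \<tau> * W \<tau>) + plateau s t n \<tau> * G \<tau> \<partial>lborel)"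
        unfolding set_lebesgue_integral_def
        by (intro Bochner_Integration.integral_cong refl) (simp only: real_scaleR_def distrib_left pV pF)
      also have "\<dots> = ((\<integral>\<tau>. bump n s \<tau> * W \<tau> \<partial>lborel) - (\<integral>\<tau>. bump n t \<tau> * W \<tau> \<partial>lborel))
        + (\<integral>\<tau>. plateau s t n \<tau> * G \<tau> \<partial>lborel)"
        by (subst Bochner_Integration.integral_add, intro Bochner_Integration.integrable_diff sstep'_concentrates(1)[OF W], rule pG,
            subst Bochner_Integration.integral_diff) (intro sstep'_concentrates(1)[OF W] refl)+
      finally show ?thesis by simp
    qed
    have lim: "(\<lambda>n. \<integral>\<tau>. plateau s t n \<tau> * G \<tau> \<partial>lborel) \<longlonglongrightarrow> (\<integral>\<tau>. indicator {s<..t} \<tau> * G \<tau> \<partial>lborel)"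
    proof (rule integral_dominated_convergence[where w="\<lambda>\<tau>. norm (G \<tau>)"])
      show "AE \<tau> in lborel. (\<lambda>n. plateau s t n \<tau> * G \<tau>) \<longlonglongrightarrow> indicator {s<..t} \<tau> * G \<tau>"
      proof (rule AE_I2)
        fix \<tau>
        have "(\<lambda>n. plateau s t n \<tau>) \<longlonglongrightarrow> (if \<tau> - s > 0 then 1 else 0) - (if \<tau> - t > 0 then 1 else 0)"
          unfolding plateau_def by (intro tendsto_diff sstep_scaled_tendsto)
        also have "(if \<tau> - s > 0 then 1 else 0) - (if \<tau> - t > 0 then 1 else 0) = (indicator {s<..t} \<tau> :: real)"
          using st by (auto simp: indicator_def)
        finally show "(\<lambda>n. plateau s t n \<tau> * G \<tau>) \<longlonglongrightarrow> indicator {s<..t} \<tau> * G \<tau>" by (intro tendsto_intros)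
      qed
      show "AE \<tau> in lborel. norm (plateau s t n \<tau> * G \<tau>) \<le> norm (G \<tau>)" for n
        by (rule AE_I2) (auto simp: abs_mult intro!: mult_left_le_one_le plateau_bound)
    qed (use G in auto)
    have "(\<lambda>n. ((\<integral>\<tau>. bump n s \<tau> * W \<tau> \<partial>lborel) - (\<integral>\<tau>. bump n t \<tau> * W \<tau> \<partial>lborel))
        + (\<integral>\<tau>. plateau s t n \<tau> * G \<tau> \<partial>lborel)) \<longlonglongrightarrow> (W s - W t) + (\<integral>\<tau>. indicator {s<..t} \<tau> * G \<tau> \<partial>lborel)"
      by (intro tendsto_add tendsto_diff lim sstep'_concentrates(2)[OF W])
    then have "(W s - W t) + (\<integral>\<tau>. indicator {s<..t} \<tau> * G \<tau> \<partial>lborel) = 0"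
      unfolding e by (simp add: LIMSEQ_const_iff)
    moreover have "(\<integral>\<tau>. indicator {s<..t} \<tau> * G \<tau> \<partial>lborel) = (LINT \<tau>:{s..t}|lborel. F \<tau>)"
      unfolding set_lebesgue_integral_def
    proof (rule integral_cong_AE)
      show "AE \<tau> in lborel. indicator {s<..t} \<tau> * G \<tau> = indicator {s..t} \<tau> *\<^sub>R F \<tau>"
        using AE_lborel_singleton[of s] by eventually_elim (use st in \<open>auto simp: G_def indicator_def\<close>)
      show "(\<lambda>\<tau>. indicator {s..t} \<tau> *\<^sub>R F \<tau>) \<in> borel_measurable lborel"
        using set_integrable_Icc_bounded[OF F[of t], of s t] st by (auto simp: set_integrable_def)
    qed measurable
    ultimately show ?thesis using st by (simp add: W_def)
  qed
  show ?thesis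
  proof (cases "s > 0")
    case True then show ?thesis using pos st by simp
  next
    case False
    then have s0: "s = 0" using st by simp
    show ?thesis
    proof (cases "t = 0")
      case True
      have "(LINT \<tau>:{0..0}|lborel. F \<tau>) = (\<integral>\<tau>. 0 \<partial>(lborel :: real measure))"
        unfolding set_lebesgue_integral_def
      proof (rule integral_cong_AE)
        show "AE \<tau> in lborel. indicator {0..0} \<tau> *\<^sub>R F \<tau> = 0"
          using AE_lborel_singleton[of 0] by eventually_elim (auto simp: indicator_def)
        show "(\<lambda>\<tau>. indicator {0..0} \<tau> *\<^sub>R F \<tau>) \<in> borel_measurable lborel"
          using set_integrable_Icc_bounded[OF F[of 1], of 0 0] by (auto simp: set_integrable_def)
      qed simp
      then show ?thesis using True s0 by simp
    next
      case False
      then have t: "t > 0" using st by simp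
      define a where "a n = t / real (Suc n)" for n
      have a: "0 < a n" "a n \<le> t" for n using t by (auto simp: a_def field_simps)
      have "(\<lambda>n. t * (1 / real (Suc n))) \<longlonglongrightarrow> t * 0" by (intro tendsto_intros LIMSEQ_Suc[OF lim_1_over_n])
      then have al: "a \<longlonglongrightarrow> 0" by (simp add: a_def[abs_def])
      have Fi: "integrable lborel (\<lambda>\<tau>. indicator {0..t} \<tau> * F \<tau>)" using F[OF t] by (simp add: set_integrable_def)
      have "(\<lambda>n. V t - V (a n)) \<longlonglongrightarrow> V t - V 0"
      proof -
        have "(\<lambda>n. W (a n)) \<longlonglongrightarrow> W 0"
          using W al by (intro isCont_tendsto_compose[of _ W]) (auto simp: continuous_on_eq_continuous_at)
        moreover have "W (a n) = V (a n)" for n using a(1)[of n] by (simp add: W_def)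
        ultimately show ?thesis by (auto simp: W_def intro!: tendsto_intros)
      qed
      moreover have "(\<lambda>n. LINT \<tau>:{a n..t}|lborel. F \<tau>) \<longlonglongrightarrow> (LINT \<tau>:{0..t}|lborel. F \<tau>)"
        unfolding set_lebesgue_integral_def
      proof (rule integral_dominated_convergence[where w="\<lambda>\<tau>. norm (indicator {0..t} \<tau> * F \<tau>)"])
        show "AE \<tau> in lborel. (\<lambda>n. indicator {a n..t} \<tau> *\<^sub>R F \<tau>) \<longlonglongrightarrow> indicator {0..t} \<tau> *\<^sub>R F \<tau>"
          using AE_lborel_singleton[of 0]
        proof eventually_elim
          case (elim \<tau>)
          have "\<forall>\<^sub>F n in sequentially. indicator {a n..t} \<tau> = (indicator {0..t} \<tau> :: real)"
          proof (cases "\<tau> > 0")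
            case True
            have "\<forall>\<^sub>F n in sequentially. a n < \<tau>" using order_tendstoD(2)[OF al True] .
            then show ?thesis by eventually_elim (use True in \<open>auto simp: indicator_def\<close>)
          next
            case False
            then have "indicator {a n..t} \<tau> = (indicator {0..t} \<tau> :: real)" for n using elim a(1)[of n] by (auto simp: indicator_def)
            then show ?thesis by simp
          qed
          then have "\<forall>\<^sub>F n in sequentially. indicator {a n..t} \<tau> *\<^sub>R F \<tau> = indicator {0..t} \<tau> *\<^sub>R F \<tau>"
            by eventually_elim simp
          then show ?case by (rule tendsto_eventually)
        qed
        show "AE \<tau> in lborel. norm (indicator {a n..t} \<tau> *\<^sub>R F \<tau>) \<le> norm (indicator {0..t} \<tau> * F \<tau>)" for n
          by (rule AE_I2) (use a(1)[of n] in \<open>auto simp: indicator_def\<close>)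
        show "(\<lambda>\<tau>. indicator {a n..t} \<tau> *\<^sub>R F \<tau>) \<in> borel_measurable lborel" for n
          using set_integrable_Icc_bounded[OF F[OF t], of "a n" t] a(1)[of n] by (auto simp: set_integrable_def)
      qed (use Fi in auto)
      moreover have "V t - V (a n) = (LINT \<tau>:{a n..t}|lborel. F \<tau>)" for n using pos[OF a] .
      ultimately show ?thesis using LIMSEQ_unique s0 by force
    qed
  qed
qed

section \<open>Integral calculus in time and Gronwall's inequality\<close>

text \<open>
  The integral vanishes over the members of a Dynkin system that contains the half-lines, thus over
  the sets where \<open>f > 0\<close> and where \<open>f < 0\<close>.
\<close>

lemma AE_zero_if_interval_integrals_zero:
  fixes f :: "real \<Rightarrow> real"
  assumes f: "\<And>T. T > 0 \<Longrightarrow> set_integrable lborel {0..T} f"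
    and z: "\<And>s t. 0 \<le> s \<Longrightarrow> s \<le> t \<Longrightarrow> (LINT x:{s..t}|lborel. f x) = 0"
  shows "AE t in lborel. 0 \<le> t \<longrightarrow> f t = 0"
proof -
  have "AE t in lborel. 0 \<le> t \<and> t \<le> real (Suc n) \<longrightarrow> f t = 0" for n
  proof -
    define T where "T = real (Suc n)"
    have T: "T > 0" by (simp add: T_def)
    define g where "g x = indicator {0..T} x * f x" for x
    have g: "integrable lborel g" using f[OF T] by (simp add: set_integrable_def g_def[abs_def])
    have gi: "set_integrable lborel A g" if "A \<in> sets borel" for A
      unfolding set_integrable_def using integrable_mult_indicator[of A lborel g] g that by simp
    have tot: "integral\<^sup>L lborel g = 0" using z[of 0 T] T by (simp add: g_def[abs_def] set_lebesgue_integral_def)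
    have all: "(LINT x:A|lborel. g x) = 0" if A: "A \<in> sets borel" for A
    proof -
      have "A \<in> sigma_sets UNIV (range (\<lambda>a::real. {..a}))" using A by (simp add: borel_eq_atMost)
      then show ?thesis
      proof (rule sigma_sets_induct_disjoint[rotated 2])
        show "Int_stable (range (\<lambda>a::real. {..a}))" by (auto simp: Int_stable_def)
        fix B assume "B \<in> range (\<lambda>a::real. {..a})"
        then obtain a where B: "B = {..a}" by blast
        show "(LINT x:B|lborel. g x) = 0"
        proof (cases "a < 0")
          case True
          then have "(\<lambda>x. indicator {..a} x * g x) = (\<lambda>x. 0)" by (auto simp: g_def indicator_def fun_eq_iff)
          then show ?thesis by (simp add: B set_lebesgue_integral_def)
        next
          case False
          have "(\<lambda>x. indicator {..a} x * g x) = (\<lambda>x. indicator {0..min a T} x * f x)"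
            by (auto simp: g_def indicator_def fun_eq_iff)
          then show ?thesis using z[of 0 "min a T"] False T by (simp add: B set_lebesgue_integral_def)
        qed
      next
        fix B assume B: "B \<in> sigma_sets UNIV (range (\<lambda>a::real. {..a}))" "(LINT x:B|lborel. g x) = 0"
        then have Bm: "B \<in> sets borel" by (simp add: borel_eq_atMost)
        have "(LINT x:UNIV - B|lborel. g x) = (\<integral>x. g x - indicator B x * g x \<partial>lborel)"
          unfolding set_lebesgue_integral_def by (intro Bochner_Integration.integral_cong) (auto simp: indicator_def)
        also have "\<dots> = 0" using g gi[OF Bm] B(2) tot by (simp add: set_integrable_def set_lebesgue_integral_def)
        finally show "(LINT x:UNIV - B|lborel. g x) = 0" .
      next
        fix B :: "nat \<Rightarrow> real set"
        assume d: "disjoint_family B" and r: "range B \<subseteq> sigma_sets UNIV (range (\<lambda>a::real. {..a}))" and B0: "\<And>i. (LINT x:B i|lborel. g x) = 0"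
        have m: "B i \<in> sets borel" for i using r by (auto simp: borel_eq_atMost)
        have "(LINT x:(\<Union>i. B i)|lborel. g x) = (\<Sum>i. LINT x:B i|lborel. g x)"
          by (rule lebesgue_integral_countable_add) (use m d gi in \<open>auto simp: disjoint_family_on_def\<close>)
        then show "(LINT x:(\<Union>i. B i)|lborel. g x) = 0" using B0 by simp
      qed (auto simp: set_lebesgue_integral_def)
    qed
    have gm [measurable]: "g \<in> borel_measurable borel" using g by auto
    have "AE x in lborel. indicator {x. g x > 0} x * g x = 0"
      using all[of "{x. g x > 0}"] gi[of "{x. g x > 0}"]
      by (subst integral_nonneg_eq_0_iff_AE[symmetric]) (auto simp: set_integrable_def set_lebesgue_integral_def indicator_def)
    moreover have "AE x in lborel. indicator {x. g x < 0} x * (- g x) = 0"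
      using all[of "{x. g x < 0}"] gi[of "{x. g x < 0}"]
      by (subst integral_nonneg_eq_0_iff_AE[symmetric]) (auto simp: set_integrable_def set_lebesgue_integral_def indicator_def)
    ultimately show ?thesis
      by eventually_elim (auto simp: g_def T_def indicator_def split: if_splits)
  qed
  then have "AE t in lborel. \<forall>n. 0 \<le> t \<and> t \<le> real (Suc n) \<longrightarrow> f t = 0"
    by (subst AE_all_countable) blast
  then show ?thesis
  proof eventually_elim
    case (elim t)
    obtain n where "t \<le> real n" using real_arch_simple by blast
    then show ?case using elim by (meson le_SucI of_nat_le_iff order_trans lessI less_imp_le_nat)
  qed
qed

text \<open>
  \<open>F\<close> is the weak derivative of the constant \<open>0\<close>.
\<close>

lemma ttest_integral_zero_imp_AE:
  fixes F :: "real \<Rightarrow> real"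
  assumes F: "\<And>T. T > 0 \<Longrightarrow> set_integrable lborel {0..T} F"
    and eq: "\<And>\<theta>. ttest \<theta> \<Longrightarrow> (LINT \<tau>:{0..}|lborel. \<theta> \<tau> * F \<tau>) = 0"
  shows "AE t in lborel. 0 \<le> t \<longrightarrow> F t = 0"
proof (rule AE_zero_if_interval_integrals_zero[OF F])
  fix s t :: real assume st: "0 \<le> s" "s \<le> t"
  have "0 - 0 = (LINT \<tau>:{s..t}|lborel. F \<tau>)"
    by (rule du_Bois_Reymond[of "\<lambda>_. 0" F, OF _ F _ st]) (use eq in auto)
  then show "(LINT \<tau>:{s..t}|lborel. F \<tau>) = 0" by simp
qed

text \<open>
  Integration by parts for absolutely continuous functions: split the square \<open>[0,t] \<times> [0,t]\<close> along its
  diagonal and apply Fubini's theorem.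
\<close>

lemma indefinite_integral_product:
  fixes f g :: "real \<Rightarrow> real"
  assumes f: "set_integrable lborel {0..t} f" and g: "set_integrable lborel {0..t} g"
  shows "set_integrable lborel {0..t} (\<lambda>x. f x * (LINT y:{0..x}|lborel. g y))" (is ?i)
    and "(LINT x:{0..t}|lborel. f x) * (LINT x:{0..t}|lborel. g x)
      = (LINT x:{0..t}|lborel. f x * (LINT y:{0..x}|lborel. g y)) + (LINT x:{0..t}|lborel. g x * (LINT y:{0..x}|lborel. f y))"
proof -
  define f' where "f' x = indicator {0..t} x * f x" for x
  define g' where "g' x = indicator {0..t} x * g x" for x
  have i: "integrable lborel f'" "integrable lborel g'"
    using f g by (simp_all add: set_integrable_def f'_def[abs_def] g'_def[abs_def])
  have [measurable]: "f' \<in> borel_measurable borel" "g' \<in> borel_measurable borel" using i by auto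
  have prod: "integrable (lborel \<Otimes>\<^sub>M lborel) (\<lambda>(x, y). f' x * g' y)"
  proof (rule lborel_pair.Fubini_integrable)
    show "(\<lambda>(x, y). f' x * g' y) \<in> borel_measurable (lborel \<Otimes>\<^sub>M lborel)" by measurable
    show "integrable lborel (\<lambda>x. \<integral>y. norm (case (x, y) of (x, y) \<Rightarrow> f' x * g' y) \<partial>lborel)"
      using i by (simp add: abs_mult)
    show "AE x in lborel. integrable lborel (\<lambda>y. case (x, y) of (x, y) \<Rightarrow> f' x * g' y)"
      using i by simp
  qed
  have lo: "integrable (lborel \<Otimes>\<^sub>M lborel) (\<lambda>(x, y). f' x * (indicator {..x} y * g' y))"
    by (rule Bochner_Integration.integrable_bound[OF prod]) (auto simp: indicator_def split_beta')
  have up: "integrable (lborel \<Otimes>\<^sub>M lborel) (\<lambda>(x, y). (indicator {..<y} x * f' x) * g' y)"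
    by (rule Bochner_Integration.integrable_bound[OF prod]) (auto simp: indicator_def split_beta')
  have gx: "(\<integral>y. indicator {..x} y * g' y \<partial>lborel) = (LINT y:{0..x}|lborel. g y)" if "x \<le> t" for x
    unfolding set_lebesgue_integral_def
    by (intro Bochner_Integration.integral_cong refl) (use that in \<open>auto simp: g'_def indicator_def\<close>)
  have fx: "(\<integral>y. indicator {..<x} y * f' y \<partial>lborel) = (LINT y:{0..x}|lborel. f y)" if "x \<le> t" for x
  proof -
    have "(\<integral>y. indicator {..<x} y * f' y \<partial>lborel) = (\<integral>y. indicator {..x} y * f' y \<partial>lborel)"
      by (rule integral_cong_AE, measurable) (use AE_lborel_singleton[of x] in eventually_elim, auto simp: indicator_def)
    also have "\<dots> = (LINT y:{0..x}|lborel. f y)"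
      unfolding set_lebesgue_integral_def
      by (intro Bochner_Integration.integral_cong refl) (use that in \<open>auto simp: f'_def indicator_def\<close>)
    finally show ?thesis .
  qed
  have e1: "(\<lambda>x. \<integral>y. f' x * (indicator {..x} y * g' y) \<partial>lborel) = (\<lambda>x. indicator {0..t} x *\<^sub>R (f x * (LINT y:{0..x}|lborel. g y)))"
  proof
    fix x show "(\<integral>y. f' x * (indicator {..x} y * g' y) \<partial>lborel) = indicator {0..t} x *\<^sub>R (f x * (LINT y:{0..x}|lborel. g y))"
      using gx[of x] by (cases "x \<in> {0..t}") (simp_all add: f'_def)
  qed
  show ?i unfolding set_integrable_def e1[symmetric] using lborel_pair.integrable_fst'[OF lo] by simp
  have e2: "(\<lambda>y. \<integral>x. (indicator {..<y} x * f' x) * g' y \<partial>lborel) = (\<lambda>x. indicator {0..t} x *\<^sub>R (g x * (LINT y:{0..x}|lborel. f y)))"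
  proof
    fix x show "(\<integral>y. (indicator {..<x} y * f' y) * g' x \<partial>lborel) = indicator {0..t} x *\<^sub>R (g x * (LINT y:{0..x}|lborel. f y))"
      using fx[of x] by (cases "x \<in> {0..t}") (simp_all add: g'_def)
  qed
  have "(LINT x:{0..t}|lborel. f x) * (LINT x:{0..t}|lborel. g x) = (\<integral>x. (\<integral>y. f' x * g' y \<partial>lborel) \<partial>lborel)"
    by (simp add: f'_def[abs_def] g'_def[abs_def] set_lebesgue_integral_def)
  also have "\<dots> = (\<integral>p. (case p of (x, y) \<Rightarrow> f' x * g' y) \<partial>(lborel \<Otimes>\<^sub>M lborel))"
    using lborel_pair.integral_fst'[OF prod] by simp
  also have "\<dots> = (\<integral>p. (case p of (x, y) \<Rightarrow> f' x * (indicator {..x} y * g' y)) + (case p of (x, y) \<Rightarrow> (indicator {..<y} x * f' x) * g' y) \<partial>(lborel \<Otimes>\<^sub>M lborel))"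
    by (intro Bochner_Integration.integral_cong) (auto simp: indicator_def)
  also have "\<dots> = (\<integral>p. (case p of (x, y) \<Rightarrow> f' x * (indicator {..x} y * g' y)) \<partial>(lborel \<Otimes>\<^sub>M lborel)) + (\<integral>p. (case p of (x, y) \<Rightarrow> (indicator {..<y} x * f' x) * g' y) \<partial>(lborel \<Otimes>\<^sub>M lborel))"
    using lo up by (rule Bochner_Integration.integral_add)
  also have "(\<integral>p. (case p of (x, y) \<Rightarrow> f' x * (indicator {..x} y * g' y)) \<partial>(lborel \<Otimes>\<^sub>M lborel)) = (LINT x:{0..t}|lborel. f x * (LINT y:{0..x}|lborel. g y))"
    using lborel_pair.integral_fst'[OF lo] unfolding set_lebesgue_integral_def[of lborel "{0..t}"] e1[symmetric] by simp
  also have "(\<integral>p. (case p of (x, y) \<Rightarrow> (indicator {..<y} x * f' x) * g' y) \<partial>(lborel \<Otimes>\<^sub>M lborel)) = (LINT x:{0..t}|lborel. g x * (LINT y:{0..x}|lborel. f y))"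
    using lborel_pair.integral_snd[OF up] unfolding set_lebesgue_integral_def[of lborel "{0..t}"] e2[symmetric] by simp
  finally show "(LINT x:{0..t}|lborel. f x) * (LINT x:{0..t}|lborel. g x)
      = (LINT x:{0..t}|lborel. f x * (LINT y:{0..x}|lborel. g y)) + (LINT x:{0..t}|lborel. g x * (LINT y:{0..x}|lborel. f y))" .
qed

text \<open>
  The chain rule for the square of an absolutely continuous function; this is what gives the energy
  identity of a mode.
\<close>

lemma indefinite_integral_square:
  fixes F v :: "real \<Rightarrow> real"
  assumes F: "set_integrable lborel {0..t} F" and t: "0 \<le> t"
    and v: "\<And>s. 0 \<le> s \<Longrightarrow> s \<le> t \<Longrightarrow> v s - v 0 = (LINT x:{0..s}|lborel. F x)"
  shows "set_integrable lborel {0..t} (\<lambda>x. F x * v x)"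
    and "(v t)\<^sup>2 = (v 0)\<^sup>2 + 2 * (LINT x:{0..t}|lborel. F x * v x)"
proof -
  define I where "I x = (LINT y:{0..x}|lborel. F y)" for x
  have p: "set_integrable lborel {0..t} (\<lambda>x. F x * I x)"
    "I t * I t = (LINT x:{0..t}|lborel. F x * I x) + (LINT x:{0..t}|lborel. F x * I x)"
    unfolding I_def using indefinite_integral_product[OF F F] by auto
  have vI: "v s = v 0 + I s" if "0 \<le> s" "s \<le> t" for s using v[OF that] by (simp add: I_def)
  have eq: "(\<lambda>x. indicator {0..t} x *\<^sub>R (F x * v x)) = (\<lambda>x. v 0 * (indicator {0..t} x *\<^sub>R F x) + indicator {0..t} x *\<^sub>R (F x * I x))"
  proof
    fix x show "indicator {0..t} x *\<^sub>R (F x * v x) = v 0 * (indicator {0..t} x *\<^sub>R F x) + indicator {0..t} x *\<^sub>R (F x * I x)"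
      using vI[of x] by (cases "x \<in> {0..t}") (simp_all add: algebra_simps)
  qed
  show "set_integrable lborel {0..t} (\<lambda>x. F x * v x)"
    unfolding set_integrable_def eq using F p(1) by (auto simp: set_integrable_def)
  have "(LINT x:{0..t}|lborel. F x * v x) = v 0 * I t + (LINT x:{0..t}|lborel. F x * I x)"
    unfolding set_lebesgue_integral_def eq I_def using F p(1)
    by (subst Bochner_Integration.integral_add) (auto simp: set_integrable_def I_def set_lebesgue_integral_def)
  then show "(v t)\<^sup>2 = (v 0)\<^sup>2 + 2 * (LINT x:{0..t}|lborel. F x * v x)"
    using p(2) vI[OF t order_refl] by (simp add: power2_eq_square algebra_simps)
qed

lemma indefinite_integral_power:
  fixes m :: "real \<Rightarrow> real"
  assumes m: "set_integrable lborel {0..T} m" and t: "t \<in> {0..T}"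
  defines "\<mu> \<equiv> \<lambda>x. LINT y:{0..x}|lborel. m y"
  shows "set_integrable lborel {0..t} (\<lambda>x. m x * \<mu> x ^ n) \<and> (LINT x:{0..t}|lborel. m x * \<mu> x ^ n) = \<mu> t ^ Suc n / real (Suc n)"
  using t
proof (induction n arbitrary: t)
  case 0
  then show ?case using set_integrable_Icc_bounded[OF m, of 0 t] by (simp add: \<mu>_def)
next
  case (Suc n)
  define f where "f x = m x * \<mu> x ^ n" for x
  have f: "set_integrable lborel {0..t} f" using Suc by (simp add: f_def[abs_def])
  have mt: "set_integrable lborel {0..t} m" using set_integrable_Icc_bounded[OF m, of 0 t] Suc.prems by simp
  have F: "(LINT y:{0..x}|lborel. f y) = \<mu> x ^ Suc n / real (Suc n)" if "x \<in> {0..t}" for x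
    using Suc.IH[of x] Suc.prems that by (simp add: f_def)
  have c: "c * (indicator {0..t} x *\<^sub>R g x) = indicator {0..t} x *\<^sub>R (c * g x :: real)" for c x g by simp
  have e1: "indicator {0..t} x *\<^sub>R (m x * (LINT y:{0..x}|lborel. f y)) = (1 / real (Suc n)) * (indicator {0..t} x *\<^sub>R (m x * \<mu> x ^ Suc n))" for x
    using F by (auto simp: indicator_def)
  have e2: "indicator {0..t} x *\<^sub>R (f x * (LINT y:{0..x}|lborel. m y)) = indicator {0..t} x *\<^sub>R (m x * \<mu> x ^ Suc n)" for x
    by (simp add: f_def \<mu>_def)
  have i: "set_integrable lborel {0..t} (\<lambda>x. m x * \<mu> x ^ Suc n)"
    using indefinite_integral_product(1)[OF f mt] unfolding set_integrable_def e2 .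
  have "(LINT x:{0..t}|lborel. f x) * (LINT x:{0..t}|lborel. m x)
      = (LINT x:{0..t}|lborel. m x * \<mu> x ^ Suc n) + (1 / real (Suc n)) * (LINT x:{0..t}|lborel. m x * \<mu> x ^ Suc n)"
    using indefinite_integral_product(2)[OF f mt] unfolding set_lebesgue_integral_def[of lborel "{0..t}"] e1 e2 by (simp only: integral_mult_right_zero add.commute)
  moreover have "(LINT x:{0..t}|lborel. f x) * (LINT x:{0..t}|lborel. m x) = \<mu> t ^ Suc (Suc n) / real (Suc n)"
    using F[of t] Suc.prems by (simp add: \<mu>_def)
  ultimately have "(LINT x:{0..t}|lborel. m x * \<mu> x ^ Suc n) * (1 + 1 / real (Suc n)) = \<mu> t ^ Suc (Suc n) / real (Suc n)"
    by (simp add: algebra_simps)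
  moreover have "1 + 1 / real (Suc n) = real (Suc (Suc n)) / real (Suc n)" by (simp add: field_simps)
  ultimately have "(LINT x:{0..t}|lborel. m x * \<mu> x ^ Suc n) = \<mu> t ^ Suc (Suc n) / real (Suc (Suc n))"
    by (simp add: field_simps)
  then show ?case using i by simp
qed

text \<open>
  The weight is merely integrable and \<open>y\<close> merely bounded above, so the inequality is iterated: after
  \<open>n\<close> steps the bound is the \<open>n\<close>-th partial sum of the exponential series plus a remainder
  \<open>Y * \<mu>\<^sup>n / n!\<close>, which tends to zero.
\<close>

lemma Gronwall_integral:
  fixes m y :: "real \<Rightarrow> real"
  assumes m: "set_integrable lborel {0..T} m" and m0: "\<And>t. m t \<ge> 0"
    and my: "set_integrable lborel {0..T} (\<lambda>t. m t * y t)"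
    and yb: "\<And>t. t \<in> {0..T} \<Longrightarrow> y t \<le> Y"
    and le: "\<And>t. t \<in> {0..T} \<Longrightarrow> y t \<le> a + (LINT s:{0..t}|lborel. m s * y s)"
    and t: "t \<in> {0..T}"
  shows "y t \<le> a * exp (LINT s:{0..t}|lborel. m s)"
proof -
  define \<mu> where "\<mu> = (\<lambda>x. LINT y:{0..x}|lborel. m y)"
  have pw: "set_integrable lborel {0..t} (\<lambda>x. m x * \<mu> x ^ n)" "(LINT x:{0..t}|lborel. m x * \<mu> x ^ n) = \<mu> t ^ Suc n / real (Suc n)"
    if "t \<in> {0..T}" for t n
    unfolding \<mu>_def using indefinite_integral_power[OF m that, of n] by auto
  have it: "y t \<le> a * (\<Sum>j<n. \<mu> t ^ j / fact j) + Y * (\<mu> t ^ n / fact n)" if "t \<in> {0..T}" for t n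
    using that
  proof (induction n arbitrary: t)
    case 0 then show ?case using yb by simp
  next
    case (Suc n)
    have st: "set_integrable lborel {0..t} (\<lambda>s. m s * y s)" using set_integrable_Icc_bounded[OF my, of 0 t] Suc.prems by simp
    define b where "b j = (if j < n then a / fact j else Y / fact n)" for j
    have iS: "integrable lborel (\<lambda>s. \<Sum>j<Suc n. b j * (indicator {0..t} s * (m s * \<mu> s ^ j)))"
      using pw(1)[OF Suc.prems] by (auto simp: set_integrable_def)
    have "(LINT s:{0..t}|lborel. m s * y s) \<le> (\<integral>s. (\<Sum>j<Suc n. b j * (indicator {0..t} s * (m s * \<mu> s ^ j))) \<partial>lborel)"
      unfolding set_lebesgue_integral_def
    proof (rule integral_mono)
      fix s
      show "indicator {0..t} s *\<^sub>R (m s * y s) \<le> (\<Sum>j<Suc n. b j * (indicator {0..t} s * (m s * \<mu> s ^ j)))"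
      proof (cases "s \<in> {0..t}")
        case True
        then have "s \<in> {0..T}" using Suc.prems by auto
        from Suc.IH[OF this] have "m s * y s \<le> m s * (a * (\<Sum>j<n. \<mu> s ^ j / fact j) + Y * (\<mu> s ^ n / fact n))"
          by (intro mult_left_mono m0)
        also have "\<dots> = (\<Sum>j<Suc n. b j * (m s * \<mu> s ^ j))"
        proof -
          have "(\<Sum>j<n. b j * (m s * \<mu> s ^ j)) = (\<Sum>j<n. m s * (a * (\<mu> s ^ j / fact j)))"
            by (intro sum.cong) (auto simp: b_def)
          then show ?thesis by (simp add: b_def distrib_left sum_distrib_left)
        qed
        finally show ?thesis using True by simp
      qed simp
    qed (use st iS in \<open>auto simp: set_integrable_def\<close>)
    also have "\<dots> = (\<Sum>j<Suc n. b j * (\<mu> t ^ Suc j / real (Suc j)))"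
    proof (subst Bochner_Integration.integral_sum)
      fix j
      show "integrable lborel (\<lambda>s. b j * (indicator {0..t} s * (m s * \<mu> s ^ j)))"
        using pw(1)[OF Suc.prems] by (auto simp: set_integrable_def)
    qed (use pw(2)[OF Suc.prems] in \<open>simp add: set_lebesgue_integral_def\<close>)
    also have "\<dots> = (\<Sum>j<n. a * (\<mu> t ^ Suc j / fact (Suc j))) + Y * (\<mu> t ^ Suc n / fact (Suc n))"
    proof -
      have "(\<Sum>j<n. b j * (\<mu> t ^ Suc j / real (Suc j))) = (\<Sum>j<n. a * (\<mu> t ^ Suc j / fact (Suc j)))"
        by (intro sum.cong) (auto simp: b_def field_simps)
      then show ?thesis by (simp add: b_def field_simps)
    qed
    finally have "y t \<le> a + ((\<Sum>j<n. a * (\<mu> t ^ Suc j / fact (Suc j))) + Y * (\<mu> t ^ Suc n / fact (Suc n)))"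
      using le[OF Suc.prems] by simp
    also have "\<dots> = a * (\<Sum>j<Suc n. \<mu> t ^ j / fact j) + Y * (\<mu> t ^ Suc n / fact (Suc n))"
      by (subst sum.lessThan_Suc_shift) (simp add: distrib_left sum_distrib_left)
    finally show ?case .
  qed
  have s: "(\<lambda>j. \<mu> t ^ j / fact j) sums exp (\<mu> t)"
    using exp_converges[of "\<mu> t"] by (simp add: divide_inverse mult.commute)
  have "(\<lambda>n. a * (\<Sum>j<n. \<mu> t ^ j / fact j) + Y * (\<mu> t ^ n / fact n)) \<longlonglongrightarrow> a * exp (\<mu> t) + Y * 0"
    by (intro tendsto_intros s[unfolded sums_def] summable_LIMSEQ_zero[OF sums_summable[OF s]])
  then have "y t \<le> a * exp (\<mu> t) + Y * 0"
    by (rule LIMSEQ_le_const) (use it[OF t] in auto)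
  then show ?thesis by (simp add: \<mu>_def)
qed

text \<open>
  The sum is the supremum of its partial sums over boxes.  Where this supremum is infinite, the family
  is not summable and \<^const>\<open>infsum\<close> is \<open>0\<close>, the value of \<^const>\<open>enn2real\<close> at infinity.
\<close>

lemma borel_measurable_infsum_zbox:
  fixes f :: "int^3 \<Rightarrow> 'a \<Rightarrow> real"
  assumes m: "\<And>n. f n \<in> borel_measurable M" and nn: "\<And>n x. f n x \<ge> 0"
  shows "(\<lambda>x. \<Sum>\<^sub>\<infinity>n\<in>- {0}. f n x) \<in> borel_measurable M"
proof -
  define S where "S N x = (\<Sum>n\<in>zbox N - {0}. f n x)" for N x
  have mono: "incseq (\<lambda>N. S N x)" for x
    unfolding S_def incseq_def using zbox_mono finite_zbox by (auto intro!: sum_mono2 nn)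
  have eq: "(\<Sum>\<^sub>\<infinity>n\<in>- {0}. f n x) = enn2real (SUP N. ennreal (S N x))" for x
  proof (cases "(\<lambda>n. f n x) summable_on (- {0})")
    case True
    then have l: "(\<lambda>N. S N x) \<longlonglongrightarrow> (\<Sum>\<^sub>\<infinity>n\<in>- {0}. f n x)"
      unfolding S_def by (intro has_sum_zbox has_sum_infsum)
    have "(\<lambda>N. ennreal (S N x)) \<longlonglongrightarrow> ennreal (\<Sum>\<^sub>\<infinity>n\<in>- {0}. f n x)" using l by (rule tendsto_ennrealI)
    moreover have "(\<lambda>N. ennreal (S N x)) \<longlonglongrightarrow> (SUP N. ennreal (S N x))"
      by (rule LIMSEQ_SUP) (use mono in \<open>auto simp: incseq_def intro!: ennreal_leI\<close>)
    ultimately have "(SUP N. ennreal (S N x)) = ennreal (\<Sum>\<^sub>\<infinity>n\<in>- {0}. f n x)" using LIMSEQ_unique by blast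
    then show ?thesis by (simp add: infsum_nonneg nn)
  next
    case False
    have T: "(SUP N. ennreal (S N x)) = top"
    proof (rule ccontr)
      assume "(SUP N. ennreal (S N x)) \<noteq> top"
      then obtain B where B: "B \<ge> 0" "(SUP N. ennreal (S N x)) = ennreal B" by (cases "SUP N. ennreal (S N x)") auto
      have SB: "S N x \<le> B" for N
      proof -
        have "ennreal (S N x) \<le> ennreal B" unfolding B(2)[symmetric] by (rule SUP_upper) simp
        then show ?thesis using B(1) by (simp add: ennreal_le_iff)
      qed
      have "(\<lambda>n. f n x) summable_on (- {0})"
      proof (rule nonneg_bdd_above_summable_on)
        show "bdd_above (sum (\<lambda>n. f n x) ` {F. F \<subseteq> - {0} \<and> finite F})"
        proof (rule bdd_aboveI2)
          fix F :: "(int^3) set" assume F: "F \<in> {F. F \<subseteq> - {0} \<and> finite F}"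
          then obtain N where "F \<subseteq> zbox N" using subset_zbox by blast
          then have "sum (\<lambda>n. f n x) F \<le> S N x" unfolding S_def using F finite_zbox by (intro sum_mono2 nn) auto
          then show "sum (\<lambda>n. f n x) F \<le> B" using SB order_trans by blast
        qed
      qed (rule nn)
      then show False using False by simp
    qed
    show ?thesis unfolding T infsum_not_exists[OF False] by simp
  qed
  have [measurable]: "S N \<in> borel_measurable M" for N unfolding S_def using m by measurable
  show ?thesis unfolding eq by measurable
qed

section \<open>Testing with a single spatial mode\<close>

text \<open>
  The half-line of times.
\<close>

definition tpos :: "real measure" where "tpos = restrict_space lborel {0..}"

text \<open>
  Joint measurability in time and in a point of the cell.
\<close>

definition txm :: "real \<Rightarrow> (real \<Rightarrow> real^3 \<Rightarrow> 'b::euclidean_space) \<Rightarrow> bool" where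
  "txm L v \<longleftrightarrow> (\<lambda>p. v (fst p) (snd p)) \<in> borel_measurable (tpos \<Otimes>\<^sub>M cell L)"

lemma AE_tpos: "(AE t in tpos. P t) \<longleftrightarrow> (AE t in lborel. 0 \<le> t \<longrightarrow> P t)"
  unfolding tpos_def by (subst AE_restrict_space_iff) auto

lemma space_tpos: "space tpos = {0..}" by (simp add: tpos_def space_restrict_space)

lemma measurable_tpos_id: "(\<lambda>t. t) \<in> measurable tpos borel"
  unfolding tpos_def by (intro measurable_restrict_space1) simp

lemma borel_measurable_tposI: "f \<in> borel_measurable borel \<Longrightarrow> f \<in> borel_measurable tpos"
  unfolding tpos_def by (intro measurable_restrict_space1) simp

lemma borel_measurable_tpos_indicator:
  fixes h :: "real \<Rightarrow> 'b::euclidean_space"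
  assumes "h \<in> borel_measurable tpos" "A \<in> sets borel" "A \<subseteq> {0..}"
  shows "(\<lambda>t. indicator A t *\<^sub>R h t) \<in> borel_measurable borel"
proof -
  have "(\<lambda>t. indicator {0..} t *\<^sub>R h t) \<in> borel_measurable lborel"
    using assms(1) unfolding tpos_def by (subst (asm) borel_measurable_restrict_space_iff) auto
  then have m: "(\<lambda>t. indicator {0..} t *\<^sub>R h t) \<in> borel_measurable borel" by simp
  have "(\<lambda>t. indicator A t *\<^sub>R (indicator {0..} t *\<^sub>R h t)) \<in> borel_measurable borel"
    by (rule borel_measurable_scaleR[OF borel_measurable_indicator[OF assms(2)] m])
  also have "(\<lambda>t. indicator A t *\<^sub>R (indicator {0..} t *\<^sub>R h t)) = (\<lambda>t. indicator A t *\<^sub>R h t)"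
    using assms(3) by (auto simp: fun_eq_iff indicator_def)
  finally show ?thesis .
qed

lemma tx_measurable_txm: assumes "tx_measurable v" shows "txm L v"
proof -
  have f: "fst \<in> measurable (tpos \<Otimes>\<^sub>M cell L) borel"
    by (rule measurable_compose[OF measurable_fst measurable_tpos_id])
  have "(\<lambda>x. x) \<in> measurable (cell L) borel" by (rule borel_measurable_cell) simp
  then have s: "snd \<in> measurable (tpos \<Otimes>\<^sub>M cell L) borel" by (rule measurable_compose[OF measurable_snd])
  have "(\<lambda>p. (fst p, snd p)) \<in> measurable (tpos \<Otimes>\<^sub>M cell L) (borel \<Otimes>\<^sub>M borel)"
    by (rule measurable_Pair[OF f s])
  then have m: "(\<lambda>p. (fst p, snd p)) \<in> measurable (tpos \<Otimes>\<^sub>M cell L) (borel :: (real \<times> (real^3)) measure)"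
    by (simp add: borel_prod)
  have "(\<lambda>p. indicator ({0..} \<times> UNIV) p *\<^sub>R (case p of (t, x) \<Rightarrow> v t x)) \<in> borel_measurable borel"
    using assms unfolding tx_measurable_def set_borel_measurable_def .
  from measurable_compose[OF m this]
  have "(\<lambda>p. indicator ({0..} \<times> UNIV) p *\<^sub>R v (fst p) (snd p)) \<in> borel_measurable (tpos \<Otimes>\<^sub>M cell L)"
    by (simp add: split_beta')
  then show ?thesis unfolding txm_def
    by (rule measurable_cong[THEN iffD1, rotated]) (auto simp: space_pair_measure space_tpos)
qed

lemma txm_component: "txm L v \<Longrightarrow> txm L (\<lambda>t x. v t x $ i)" for v :: "real \<Rightarrow> real^3 \<Rightarrow> real^'n"
  unfolding txm_def cart_eq_inner_axis by (intro borel_measurable_inner borel_measurable_const)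

lemma txm_component2: "txm L v \<Longrightarrow> txm L (\<lambda>t x. v t x $ i $ j)" for v :: "real \<Rightarrow> real^3 \<Rightarrow> real^3^3"
proof -
  have e: "v t x $ i $ j = v t x \<bullet> axis i (axis j 1)" for t x by (simp add: inner_axis)
  show "txm L v \<Longrightarrow> ?thesis" unfolding txm_def e by (intro borel_measurable_inner borel_measurable_const)
qed

lemma txm_add: "txm L f \<Longrightarrow> txm L g \<Longrightarrow> txm L (\<lambda>t x. f t x + g t x)"
  unfolding txm_def by (intro borel_measurable_add)
lemma txm_diff: "txm L f \<Longrightarrow> txm L g \<Longrightarrow> txm L (\<lambda>t x. f t x - g t x)"
  unfolding txm_def by (intro borel_measurable_diff)
lemma txm_mult: "txm L f \<Longrightarrow> txm L g \<Longrightarrow> txm L (\<lambda>t x. f t x * g t x :: real)"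
  unfolding txm_def by (intro borel_measurable_times)
lemma txm_space: "f \<in> borel_measurable borel \<Longrightarrow> txm L (\<lambda>t x. f x)"
  unfolding txm_def using measurable_compose[OF measurable_snd borel_measurable_cell] .
lemma txm_time: "f \<in> borel_measurable borel \<Longrightarrow> txm L (\<lambda>t x. f t)"
  unfolding txm_def using measurable_compose[OF measurable_fst borel_measurable_tposI] .
lemma txm_const: "txm L (\<lambda>t x. c)" unfolding txm_def by simp
lemma txm_compose: "txm L v \<Longrightarrow> h \<in> borel_measurable borel \<Longrightarrow> txm L (\<lambda>t x. h (v t x))"
  unfolding txm_def using measurable_compose by blast

lemma txm_integral:
  fixes g :: "real \<Rightarrow> real^3 \<Rightarrow> 'b::euclidean_space"
  assumes "txm L g" shows "(\<lambda>t. \<integral>x. g t x \<partial>cell L) \<in> borel_measurable tpos"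
proof -
  interpret sigma_finite_measure "cell L" using finite_measure_cell finite_measure.axioms(1) by blast
  show ?thesis using assms unfolding txm_def
    by (intro borel_measurable_lebesgue_integral) (simp add: split_beta')
qed

lemma txm_section: "txm L g \<Longrightarrow> 0 \<le> t \<Longrightarrow> g t \<in> borel_measurable (cell L)"
  unfolding txm_def using measurable_Pair2[of "\<lambda>p. g (fst p) (snd p)" tpos "cell L" borel t] by (simp add: space_tpos)

lemma set_integrable_tpos_bound:
  fixes h g :: "real \<Rightarrow> real"
  assumes "h \<in> borel_measurable tpos" "set_integrable lborel {0..T} g"
    and "AE t in lborel. t \<in> {0..T} \<longrightarrow> \<bar>h t\<bar> \<le> g t"
  shows "set_integrable lborel {0..T} h"
  unfolding set_integrable_def
proof (rule Bochner_Integration.integrable_bound)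
  show "integrable lborel (\<lambda>t. indicator {0..T} t *\<^sub>R g t)" using assms(2) by (simp add: set_integrable_def)
  show "(\<lambda>t. indicator {0..T} t *\<^sub>R h t) \<in> borel_measurable lborel"
    using borel_measurable_tpos_indicator[OF assms(1), of "{0..T}"] by simp
  show "AE t in lborel. norm (indicator {0..T} t *\<^sub>R h t) \<le> norm (indicator {0..T} t *\<^sub>R g t)"
    using assms(3) by eventually_elim (auto simp: indicator_def)
qed

text \<open>
  \<open>g\<close> is locally integrable in time with values in \<open>L\<^sup>1\<close> of the cell.
\<close>

definition ti1 :: "real \<Rightarrow> (real \<Rightarrow> real^3 \<Rightarrow> real) \<Rightarrow> bool" where
  "ti1 L g \<longleftrightarrow> txm L g \<and> (AE t in tpos. integrable (cell L) (g t))
     \<and> (\<forall>T>0. set_integrable lborel {0..T} (\<lambda>t. \<integral>x. \<bar>g t x\<bar> \<partial>cell L))"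

text \<open>
  \<open>g\<close> is locally square integrable in time with values in \<open>L\<^sup>2\<close> of the cell.
\<close>

definition tsq :: "real \<Rightarrow> (real \<Rightarrow> real^3 \<Rightarrow> real) \<Rightarrow> bool" where
  "tsq L g \<longleftrightarrow> txm L g \<and> (AE t in tpos. sqi (cell L) (g t))
     \<and> (\<forall>T>0. set_integrable lborel {0..T} (\<lambda>t. \<integral>x. (g t x)\<^sup>2 \<partial>cell L))"

lemma AE_tpos_imp: "(AE t in tpos. P t) \<Longrightarrow> AE t in lborel. t \<in> {0..T} \<longrightarrow> P t"
  unfolding AE_tpos by (auto elim!: eventually_mono)

lemma ti1_add: assumes "ti1 L f" "ti1 L g" shows "ti1 L (\<lambda>t x. f t x + g t x)"
  unfolding ti1_def
proof (intro conjI allI impI)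
  show m: "txm L (\<lambda>t x. f t x + g t x)" using assms by (auto simp: ti1_def intro: txm_add)
  have ae: "AE t in tpos. integrable (cell L) (f t)" "AE t in tpos. integrable (cell L) (g t)" using assms by (auto simp: ti1_def)
  then show "AE t in tpos. integrable (cell L) (\<lambda>x. f t x + g t x)" by eventually_elim simp
  fix T :: real assume T: "T > 0"
  show "set_integrable lborel {0..T} (\<lambda>t. \<integral>x. \<bar>f t x + g t x\<bar> \<partial>cell L)"
  proof (rule set_integrable_tpos_bound)
    show "(\<lambda>t. \<integral>x. \<bar>f t x + g t x\<bar> \<partial>cell L) \<in> borel_measurable tpos"
      by (rule txm_integral, rule txm_compose[OF m]) simp
    show "set_integrable lborel {0..T} (\<lambda>t. (\<integral>x. \<bar>f t x\<bar> \<partial>cell L) + (\<integral>x. \<bar>g t x\<bar> \<partial>cell L))"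
      using assms T by (auto simp: ti1_def)
    have "AE t in tpos. \<bar>\<integral>x. \<bar>f t x + g t x\<bar> \<partial>cell L\<bar> \<le> (\<integral>x. \<bar>f t x\<bar> \<partial>cell L) + (\<integral>x. \<bar>g t x\<bar> \<partial>cell L)"
      using ae
    proof eventually_elim
      case (elim t)
      have "(\<integral>x. \<bar>f t x + g t x\<bar> \<partial>cell L) \<le> (\<integral>x. \<bar>f t x\<bar> + \<bar>g t x\<bar> \<partial>cell L)"
        using elim by (intro integral_mono) auto
      then show ?case using elim by (simp add: integral_nonneg_AE)
    qed
    then show "AE t in lborel. t \<in> {0..T} \<longrightarrow> \<bar>\<integral>x. \<bar>f t x + g t x\<bar> \<partial>cell L\<bar> \<le> (\<integral>x. \<bar>f t x\<bar> \<partial>cell L) + (\<integral>x. \<bar>g t x\<bar> \<partial>cell L)"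
      by (rule AE_tpos_imp)
  qed
qed

lemma ti1_cmult: assumes "ti1 L f" shows "ti1 L (\<lambda>t x. c * f t x)"
  using assms unfolding ti1_def by (auto intro: txm_mult[OF txm_const] simp: abs_mult)

lemma ti1_0: "ti1 L (\<lambda>t x. 0)" by (auto simp: ti1_def txm_const set_integrable_def)

lemma ti1_sum: "finite I \<Longrightarrow> (\<And>i. i \<in> I \<Longrightarrow> ti1 L (f i)) \<Longrightarrow> ti1 L (\<lambda>t x. \<Sum>i\<in>I. f i t x)"
  by (induction I rule: finite_induct) (auto intro: ti1_add ti1_0)

lemma tsq_mult_ti1: assumes "tsq L f" "tsq L g" shows "ti1 L (\<lambda>t x. f t x * g t x)"
  unfolding ti1_def
proof (intro conjI allI impI)
  show m: "txm L (\<lambda>t x. f t x * g t x)" using assms by (auto simp: tsq_def intro: txm_mult)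
  have ae: "AE t in tpos. sqi (cell L) (f t)" "AE t in tpos. sqi (cell L) (g t)" using assms by (auto simp: tsq_def)
  then show "AE t in tpos. integrable (cell L) (\<lambda>x. f t x * g t x)" by eventually_elim (rule sqi_mult_integrable)
  fix T :: real assume T: "T > 0"
  show "set_integrable lborel {0..T} (\<lambda>t. \<integral>x. \<bar>f t x * g t x\<bar> \<partial>cell L)"
  proof (rule set_integrable_tpos_bound)
    show "(\<lambda>t. \<integral>x. \<bar>f t x * g t x\<bar> \<partial>cell L) \<in> borel_measurable tpos"
      by (rule txm_integral, rule txm_compose[OF m]) simp
    show "set_integrable lborel {0..T} (\<lambda>t. (\<integral>x. (f t x)\<^sup>2 \<partial>cell L) + (\<integral>x. (g t x)\<^sup>2 \<partial>cell L))"
      using assms T by (auto simp: tsq_def)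
    have "AE t in tpos. \<bar>\<integral>x. \<bar>f t x * g t x\<bar> \<partial>cell L\<bar> \<le> (\<integral>x. (f t x)\<^sup>2 \<partial>cell L) + (\<integral>x. (g t x)\<^sup>2 \<partial>cell L)"
      using ae
    proof eventually_elim
      case (elim t)
      have i: "integrable (cell L) (\<lambda>x. (f t x)\<^sup>2)" "integrable (cell L) (\<lambda>x. (g t x)\<^sup>2)" using elim by (auto simp: sqi_def)
      have "(\<integral>x. \<bar>f t x * g t x\<bar> \<partial>cell L) \<le> (\<integral>x. (f t x)\<^sup>2 + (g t x)\<^sup>2 \<partial>cell L)"
      proof (rule integral_mono)
        show "integrable (cell L) (\<lambda>x. \<bar>f t x * g t x\<bar>)" using sqi_mult_integrable[OF elim] by simp
        fix x
        show "\<bar>f t x * g t x\<bar> \<le> (f t x)\<^sup>2 + (g t x)\<^sup>2"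
          using sum_squares_bound[of "\<bar>f t x\<bar>" "\<bar>g t x\<bar>"] mult_nonneg_nonneg[OF abs_ge_zero[of "f t x"] abs_ge_zero[of "g t x"]]
          unfolding abs_mult power2_abs mult.assoc by linarith
      qed (use i in simp)
      then show ?case using i by (simp add: integral_nonneg_AE)
    qed
    then show "AE t in lborel. t \<in> {0..T} \<longrightarrow> \<bar>\<integral>x. \<bar>f t x * g t x\<bar> \<partial>cell L\<bar> \<le> (\<integral>x. (f t x)\<^sup>2 \<partial>cell L) + (\<integral>x. (g t x)\<^sup>2 \<partial>cell L)"
      by (rule AE_tpos_imp)
  qed
qed

lemma tsq_const: "tsq L (\<lambda>t x. c)"
  unfolding tsq_def
proof (intro conjI allI impI)
  show "AE t in tpos. sqi (cell L) (\<lambda>x. c)" by (simp add: sqi_const finite_measure_cell)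
  show "set_integrable lborel {0..T} (\<lambda>t. \<integral>x. c\<^sup>2 \<partial>cell L)" for T :: real by (rule borel_integrable_atLeastAtMost') simp
qed (rule txm_const)

lemma tsq_ti1: "tsq L f \<Longrightarrow> ti1 L f"
  using tsq_mult_ti1[OF _ tsq_const[of L 1]] by simp

text \<open>
  The integral of \<open>h(x) cos(k \<cdot> x + d)\<close>, expressed by the Fourier coefficient of \<open>h\<close>
  (\<open>integral_cos_mode\<close>).  The phases \<open>0\<close> and \<open>\<pi>/2\<close> give its real and imaginary part.
\<close>

definition mode :: "real \<Rightarrow> int^3 \<Rightarrow> real \<Rightarrow> (real^3 \<Rightarrow> real) \<Rightarrow> real" where
  "mode L k d h = L^3 * Re (cis (- d) * fcoeff L h k)"

lemma integrable_cos_mult: "integrable (cell L) (h :: _ \<Rightarrow> real) \<Longrightarrow> integrable (cell L) (\<lambda>x. h x * cos (v \<bullet> x + d))"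
proof (rule Bochner_Integration.integrable_bound[where f=h])
  assume h: "integrable (cell L) h"
  have [measurable]: "h \<in> borel_measurable (cell L)" using h by auto
  have [measurable]: "(\<lambda>x. cos (v \<bullet> x + d)) \<in> borel_measurable (cell L)"
    by (intro borel_measurable_cell borel_measurable_continuous_onI continuous_intros)
  show "(\<lambda>x. h x * cos (v \<bullet> x + d)) \<in> borel_measurable (cell L)" by measurable
  show "AE x in cell L. norm (h x * cos (v \<bullet> x + d)) \<le> norm (h x)"
    by (rule AE_I2) (auto simp: abs_mult intro!: mult_left_le)
qed

lemma integral_cos_mode:
  assumes L: "L > 0" and h: "integrable (cell L) h"
  shows "(\<integral>x. h x * cos (freq L k \<bullet> x + d) \<partial>cell L) = mode L k d h"
proof -
  have [measurable]: "h \<in> borel_measurable (cell L)" using h by auto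
  have i: "integrable (cell L) (\<lambda>x. cis (- (freq L k \<bullet> x)) * complex_of_real (h x))"
  proof (rule Bochner_Integration.integrable_bound[OF h])
    have "(\<lambda>x. cis (- (freq L k \<bullet> x))) \<in> borel_measurable (cell L)"
      by (intro borel_measurable_cell borel_measurable_continuous_onI continuous_intros)
    then show "(\<lambda>x. cis (- (freq L k \<bullet> x)) * complex_of_real (h x)) \<in> borel_measurable (cell L)" by measurable
  qed (simp add: norm_mult)
  have "complex_of_real (L^3) * fcoeff L h k = (\<integral>x. cis (- (freq L k \<bullet> x)) * complex_of_real (h x) \<partial>cell L)"
    using L by (simp add: fcoeff_cfc cfc_def)
  then have "cis (- d) * (complex_of_real (L^3) * fcoeff L h k) = (\<integral>x. cis (- d) * (cis (- (freq L k \<bullet> x)) * complex_of_real (h x)) \<partial>cell L)"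
    by simp
  then have "Re (cis (- d) * (complex_of_real (L^3) * fcoeff L h k)) = (\<integral>x. Re (cis (- d) * (cis (- (freq L k \<bullet> x)) * complex_of_real (h x))) \<partial>cell L)"
    using integral_Re[OF integrable_mult_right[OF i, of "cis (- d)"]] by simp
  also have "\<dots> = (\<integral>x. h x * cos (freq L k \<bullet> x + d) \<partial>cell L)"
  proof (intro Bochner_Integration.integral_cong refl)
    fix x
    have c: "cis (- d) * cis (- (freq L k \<bullet> x)) = cis (- (freq L k \<bullet> x + d))"
      by (simp add: cis_mult algebra_simps)
    have "Re (cis (- y) * complex_of_real r) = r * cos y" for y r by simp
    then show "Re (cis (- d) * (cis (- (freq L k \<bullet> x)) * complex_of_real (h x))) = h x * cos (freq L k \<bullet> x + d)"
      by (simp only: mult.assoc[symmetric] c)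
  qed
  finally show ?thesis by (simp add: mode_def algebra_simps)
qed

lemma mode_abs_le:
  assumes L: "L > 0" and h: "integrable (cell L) h"
  shows "\<bar>mode L k d h\<bar> \<le> (\<integral>x. \<bar>h x\<bar> \<partial>cell L)"
proof -
  have "\<bar>\<integral>x. h x * cos (freq L k \<bullet> x + d) \<partial>cell L\<bar> \<le> (\<integral>x. \<bar>h x * cos (freq L k \<bullet> x + d)\<bar> \<partial>cell L)"
    by (rule integral_abs_bound)
  also have "\<dots> \<le> (\<integral>x. \<bar>h x\<bar> \<partial>cell L)"
  proof (rule integral_mono)
    show "integrable (cell L) (\<lambda>x. \<bar>h x * cos (freq L k \<bullet> x + d)\<bar>)" by (rule integrable_abs[OF integrable_cos_mult[OF h]])
  qed (use h in \<open>auto simp: abs_mult intro!: mult_left_le\<close>)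
  finally show ?thesis by (simp add: integral_cos_mode[OF L h])
qed

text \<open>
  What is needed of \<^const>\<open>ttest\<close> functions and of their derivatives as factors in time integrals.
\<close>

definition tcut :: "(real \<Rightarrow> real) \<Rightarrow> bool" where
  "tcut \<theta> \<longleftrightarrow> \<theta> \<in> borel_measurable borel \<and> (\<exists>B b. b > 0 \<and> (\<forall>t. \<bar>\<theta> t\<bar> \<le> B \<and> (t > b \<longrightarrow> \<theta> t = 0)))"

lemma ttest_tcut:
  assumes "ttest \<theta>" shows "tcut \<theta>" "tcut (pd 1 \<theta>)"
proof -
  obtain a b where s: "smooth \<theta>" and ab: "0 < a" "\<And>t. t \<notin> {a..b} \<Longrightarrow> \<theta> t = 0" using assms unfolding ttest_def by blast
  have "C_diff 0 \<theta>" using s unfolding smooth_def by blast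
  then have c: "continuous_on UNIV \<theta>" by simp
  have c': "continuous_on UNIV (pd 1 \<theta>)" by (rule continuous_pd1[OF s])
  have z': "pd 1 \<theta> t = 0" if "t \<notin> {a..b}" for t
  proof -
    have "((\<lambda>x. 0) has_real_derivative 0) (at t)" by simp
    then have "(\<theta> has_real_derivative 0) (at t)"
    proof (rule has_field_derivative_transform_within_open[of _ _ _ "- {a..b}"])
      show "open (- {a..b})" by (simp add: open_Compl)
      show "0 = \<theta> x" if "x \<in> - {a..b}" for x using ab(2)[of x] that by simp
    qed (use that in simp)
    then show ?thesis by (rule pd1_eqI)
  qed
  have *: "tcut g" if g: "continuous_on UNIV g" "\<And>t. t \<notin> {a..b} \<Longrightarrow> g t = 0" for g
  proof -
    have "compact (g ` {a..b})" by (intro compact_continuous_image continuous_on_subset[OF g(1)]) auto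
    then have "bounded (g ` {a..b})" by (rule compact_imp_bounded)
    then obtain B where B: "\<And>t. t \<in> {a..b} \<Longrightarrow> norm (g t) \<le> B" unfolding bounded_iff by blast
    have "\<bar>g t\<bar> \<le> \<bar>B\<bar>" for t using B[of t] g(2)[of t] by (cases "t \<in> {a..b}") auto
    moreover have "g t = 0" if "t > max 1 b" for t using g(2)[of t] that by auto
    ultimately show ?thesis unfolding tcut_def using g(1)
      by (intro conjI exI[of _ "\<bar>B\<bar>"] exI[of _ "max 1 b"]) (auto intro: borel_measurable_continuous_onI)
  qed
  show "tcut \<theta>" "tcut (pd 1 \<theta>)" using *[OF c ab(2)] *[OF c' z'] by auto
qed

text \<open>
  \<open>H\<close> can be integrated over space-time, and \<open>h\<close> is its integral over the cell at almost every time.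
\<close>

definition has_st :: "real \<Rightarrow> (real \<Rightarrow> real^3 \<Rightarrow> real) \<Rightarrow> (real \<Rightarrow> real) \<Rightarrow> bool" where
  "has_st L H h \<longleftrightarrow> txm L H \<and> (AE t in tpos. integrable (cell L) (H t) \<and> tint L (H t) = h t) \<and> set_integrable lborel {0..} h"

lemma has_st_add: "has_st L H h \<Longrightarrow> has_st L G g \<Longrightarrow> has_st L (\<lambda>t x. H t x + G t x) (\<lambda>t. h t + g t)"
  unfolding has_st_def tint_cell
proof (elim conjE, intro conjI)
  assume "AE t in tpos. integrable (cell L) (H t) \<and> integral\<^sup>L (cell L) (H t) = h t"
    "AE t in tpos. integrable (cell L) (G t) \<and> integral\<^sup>L (cell L) (G t) = g t"
  then show "AE t in tpos. integrable (cell L) (\<lambda>x. H t x + G t x) \<and> (\<integral>x. H t x + G t x \<partial>cell L) = h t + g t"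
    by eventually_elim auto
qed (auto intro: txm_add)

lemma has_st_int: assumes "has_st L H h" shows "st_int L H = (LINT t:{0..}|lborel. h t)"
  unfolding st_int_def set_lebesgue_integral_def
proof (rule integral_cong_AE)
  have "(\<lambda>t. tint L (H t)) \<in> borel_measurable tpos" unfolding tint_cell using assms by (intro txm_integral) (simp add: has_st_def)
  from borel_measurable_tpos_indicator[OF this, of "{0..}"]
  show "(\<lambda>t. indicator {0..} t *\<^sub>R tint L (H t)) \<in> borel_measurable lborel" by simp
  show "(\<lambda>t. indicator {0..} t *\<^sub>R h t) \<in> borel_measurable lborel"
    using assms by (auto simp: has_st_def set_integrable_def)
  have "AE t in lborel. 0 \<le> t \<longrightarrow> tint L (H t) = h t"
    using assms unfolding has_st_def AE_tpos by (auto elim!: eventually_mono)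
  then show "AE t in lborel. indicator {0..} t *\<^sub>R tint L (H t) = indicator {0..} t *\<^sub>R h t"
    by eventually_elim (auto simp: indicator_def)
qed

lemma tcut_mult_integrable:
  assumes th: "tcut \<theta>" and g: "\<And>T. T > 0 \<Longrightarrow> set_integrable lborel {0..T} g"
  shows "set_integrable lborel {0..} (\<lambda>t. \<theta> t * g t :: real)"
proof -
  obtain B b where b: "b > 0" "\<And>t. \<bar>\<theta> t\<bar> \<le> B" "\<And>t. t > b \<Longrightarrow> \<theta> t = 0" and [measurable]: "\<theta> \<in> borel_measurable borel"
    using th unfolding tcut_def by blast
  have gi: "integrable lborel (\<lambda>t. indicator {0..b} t *\<^sub>R g t)" using g[OF b(1)] by (simp add: set_integrable_def)
  have [measurable]: "(\<lambda>t. indicator {0..b} t *\<^sub>R g t) \<in> borel_measurable borel" using gi by auto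
  have "integrable lborel (\<lambda>t. \<theta> t * (indicator {0..b} t *\<^sub>R g t))"
  proof (rule Bochner_Integration.integrable_bound)
    show "integrable lborel (\<lambda>t. B * (indicator {0..b} t *\<^sub>R g t))" using gi by (rule integrable_mult_right)
    have "\<bar>\<theta> t\<bar> \<le> \<bar>B\<bar>" for t using b(2)[of t] by linarith
    then show "AE t in lborel. norm (\<theta> t * (indicator {0..b} t *\<^sub>R g t)) \<le> norm (B * (indicator {0..b} t *\<^sub>R g t))"
      by (intro AE_I2) (auto simp: abs_mult indicator_def intro!: mult_right_mono)
  qed measurable
  also have "(\<lambda>t. \<theta> t * (indicator {0..b} t *\<^sub>R g t)) = (\<lambda>t. indicator {0..} t *\<^sub>R (\<theta> t * g t))"
    using b(3) by (auto simp: fun_eq_iff indicator_def not_le)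
  finally show ?thesis by (simp add: set_integrable_def)
qed

lemma ti1_mode_integrable:
  assumes L: "L > 0" and g: "ti1 L g" and T: "T > 0"
  shows "(\<lambda>t. \<integral>x. g t x * cos (freq L k \<bullet> x + d) \<partial>cell L) \<in> borel_measurable tpos"
    and "set_integrable lborel {0..T} (\<lambda>t. \<integral>x. g t x * cos (freq L k \<bullet> x + d) \<partial>cell L)"
proof -
  have "txm L (\<lambda>t x. cos (freq L k \<bullet> x + d))"
    by (intro txm_space borel_measurable_continuous_onI continuous_intros)
  then show m: "(\<lambda>t. \<integral>x. g t x * cos (freq L k \<bullet> x + d) \<partial>cell L) \<in> borel_measurable tpos"
    using g by (intro txm_integral txm_mult) (auto simp: ti1_def)
  show "set_integrable lborel {0..T} (\<lambda>t. \<integral>x. g t x * cos (freq L k \<bullet> x + d) \<partial>cell L)"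
  proof (rule set_integrable_tpos_bound[OF m])
    show "set_integrable lborel {0..T} (\<lambda>t. \<integral>x. \<bar>g t x\<bar> \<partial>cell L)" using g T by (auto simp: ti1_def)
    have "AE t in tpos. integrable (cell L) (g t)" using g by (simp add: ti1_def)
    then have "AE t in tpos. \<bar>\<integral>x. g t x * cos (freq L k \<bullet> x + d) \<partial>cell L\<bar> \<le> (\<integral>x. \<bar>g t x\<bar> \<partial>cell L)"
      by eventually_elim (simp add: integral_cos_mode[OF L] mode_abs_le[OF L])
    then show "AE t in lborel. t \<in> {0..T} \<longrightarrow> \<bar>\<integral>x. g t x * cos (freq L k \<bullet> x + d) \<partial>cell L\<bar> \<le> (\<integral>x. \<bar>g t x\<bar> \<partial>cell L)"
      by (rule AE_tpos_imp)
  qed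
qed

text \<open>
  As an integral the mode is a measurable function of all times, while its expression by the Fourier
  coefficient is valid at almost every time.
\<close>

definition tmode :: "real \<Rightarrow> int^3 \<Rightarrow> real \<Rightarrow> (real \<Rightarrow> real^3 \<Rightarrow> real) \<Rightarrow> real \<Rightarrow> real" where
  "tmode L k d g t = (\<integral>x. g t x * cos (freq L k \<bullet> x + d) \<partial>cell L)"

lemma tmode_mode: "L > 0 \<Longrightarrow> ti1 L g \<Longrightarrow> AE t in tpos. tmode L k d g t = mode L k d (g t)"
  unfolding tmode_def ti1_def by (auto elim!: eventually_mono simp: integral_cos_mode)

lemma has_st_test:
  assumes L: "L > 0" and g: "ti1 L g" and th: "tcut \<theta>"
  shows "has_st L (\<lambda>t x. g t x * (\<theta> t * cos (freq L k \<bullet> x + d))) (\<lambda>t. \<theta> t * tmode L k d g t)"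
  unfolding has_st_def
proof (intro conjI)
  have m: "\<theta> \<in> borel_measurable borel" using th by (simp add: tcut_def)
  have "txm L (\<lambda>t x. cos (freq L k \<bullet> x + d))"
    by (intro txm_space borel_measurable_continuous_onI continuous_intros)
  then show "txm L (\<lambda>t x. g t x * (\<theta> t * cos (freq L k \<bullet> x + d)))"
    using g m by (intro txm_mult txm_time) (auto simp: ti1_def)
  show "set_integrable lborel {0..} (\<lambda>t. \<theta> t * tmode L k d g t)"
    unfolding tmode_def by (intro tcut_mult_integrable[OF th] ti1_mode_integrable(2)[OF L g])
  have e: "(\<lambda>x. g t x * (\<theta> t * cos (freq L k \<bullet> x + d))) = (\<lambda>x. \<theta> t * (g t x * cos (freq L k \<bullet> x + d)))" for t
    by (simp add: mult_ac)
  have "AE t in tpos. integrable (cell L) (g t)" using g by (simp add: ti1_def)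
  then show "AE t in tpos. integrable (cell L) (\<lambda>x. g t x * (\<theta> t * cos (freq L k \<bullet> x + d)))
      \<and> tint L (\<lambda>x. g t x * (\<theta> t * cos (freq L k \<bullet> x + d))) = \<theta> t * tmode L k d g t"
    unfolding e by eventually_elim (simp add: integrable_cos_mult tint_cell tmode_def)
qed

text \<open>
  Separated test functions: varying \<open>\<theta>\<close> localises in time, and two phases \<open>d\<close> give a Fourier coefficient.
\<close>

definition tfun :: "real \<Rightarrow> int^3 \<Rightarrow> real \<Rightarrow> (real \<Rightarrow> real) \<Rightarrow> real \<times> (real^3) \<Rightarrow> real" where
  "tfun L k d \<theta> z = \<theta> (fst z) * cos (freq L k \<bullet> snd z + d)"

lemma freq_period: "L > 0 \<Longrightarrow> cos (freq L k \<bullet> (x + L *\<^sub>R axis i 1) + d) = cos (freq L k \<bullet> x + d)"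
proof -
  assume L: "L > 0"
  have "freq L k \<bullet> (x + L *\<^sub>R axis i 1) + d = (freq L k \<bullet> x + d) + 2 * pi * real_of_int (k $ i)"
    using L by (simp add: inner_add_right inner_axis freq_def)
  also have "cos \<dots> = cos (freq L k \<bullet> x + d)"
    using cos_int_2pin[of "k $ i"] sin_int_2pin[of "k $ i"] by (simp add: cos_add mult.assoc mult.left_commute)
  finally show ?thesis .
qed

lemma smooth_cos_mode: "smooth (\<lambda>x::real^3. cos (freq L k \<bullet> x + d))"
  by (rule smooth_compose_affine[OF _ smooth_cos]) (rule bounded_linear_inner_right)

lemma smooth_tfun: assumes "smooth \<theta>" shows "smooth (tfun L k d \<theta>)"
proof -
  have "smooth (\<lambda>z::real \<times> (real^3). \<theta> (fst z + 0))" by (rule smooth_compose_affine[OF bounded_linear_fst assms])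
  moreover have "smooth (\<lambda>z::real \<times> (real^3). cos (freq L k \<bullet> snd z + d))"
    by (rule smooth_compose_affine[OF _ smooth_cos]) (intro bounded_linear_compose[OF bounded_linear_inner_right bounded_linear_snd])
  ultimately show ?thesis unfolding tfun_def by (intro smooth_mult) auto
qed

lemma test_fun_tfun: "L > 0 \<Longrightarrow> ttest \<theta> \<Longrightarrow> test_fun L (tfun L k d \<theta>)"
  unfolding test_fun_def
proof (intro conjI)
  assume "L > 0" "ttest \<theta>"
  then show "smooth (tfun L k d \<theta>)" "\<forall>t. periodic L (\<lambda>x. tfun L k d \<theta> (t, x))"
    by (auto simp: ttest_def smooth_tfun periodic_def tfun_def freq_period)
  show "\<exists>a b. 0 < a \<and> (\<forall>t x. t \<notin> {a..b} \<longrightarrow> tfun L k d \<theta> (t, x) = 0)"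
    using \<open>ttest \<theta>\<close> unfolding ttest_def tfun_def by (metis fst_conv mult_zero_left)
qed

lemma tfun_has_derivative:
  assumes "smooth \<theta>"
  shows "(tfun L k d \<theta> has_derivative (\<lambda>h. pd 1 \<theta> t * fst h * cos (freq L k \<bullet> x + d) - \<theta> t * sin (freq L k \<bullet> x + d) * (freq L k \<bullet> snd h))) (at (t, x))"
proof -
  have "(\<theta> has_derivative (\<lambda>h. pd 1 \<theta> t * h)) (at t)"
    using has_real_derivative_pd[OF assms] by (simp add: has_field_derivative_def)
  then have th: "((\<lambda>z. \<theta> (fst z)) has_derivative (\<lambda>h. pd 1 \<theta> t * fst h)) (at (t, x))"
    using has_derivative_compose[OF has_derivative_fst[OF has_derivative_ident], where g=\<theta>] by fastforce
  have co: "((\<lambda>z. cos (freq L k \<bullet> snd z + d)) has_derivative (\<lambda>h. - sin (freq L k \<bullet> x + d) * (freq L k \<bullet> snd h))) (at (t, x))"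
    by (auto intro!: derivative_eq_intros simp: fun_eq_iff)
  show ?thesis unfolding tfun_def
    by (rule has_derivative_eq_rhs[OF has_derivative_mult[OF th co]]) (auto simp: fun_eq_iff)
qed

lemma pdt_tfun: "smooth \<theta> \<Longrightarrow> pdt (tfun L k d \<theta>) (t, x) = pd 1 \<theta> t * cos (freq L k \<bullet> x + d)"
  unfolding pdt_def by (subst pd_eqI[OF tfun_has_derivative]) auto

lemma cos_shift: "cos (a + (d + pi / 2)) = - sin (a + d)"
  by (simp add: cos_add[of "a + d" "pi/2"] add.assoc[symmetric])

text \<open>
  A derivative in space multiplies by the frequency and shifts the phase by \<open>\<pi>/2\<close>; the result is again
  of the form \<^const>\<open>tfun\<close>.
\<close>

lemma pdx_tfun: "smooth \<theta> \<Longrightarrow> pdx j (tfun L k d \<theta>) = tfun L k (d + pi / 2) (\<lambda>t. freq L k $ j * \<theta> t)"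
proof
  fix z :: "real \<times> (real^3)" assume s: "smooth \<theta>"
  obtain t x where z: "z = (t, x)" by fastforce
  have "pdx j (tfun L k d \<theta>) (t, x) = - \<theta> t * sin (freq L k \<bullet> x + d) * (freq L k \<bullet> axis j 1)"
    unfolding pdx_def by (subst pd_eqI[OF tfun_has_derivative[OF s]]) simp
  then show "pdx j (tfun L k d \<theta>) z = tfun L k (d + pi / 2) (\<lambda>t. freq L k $ j * \<theta> t) z"
    by (simp add: z tfun_def cos_shift inner_axis)
qed

lemma pdx_tfun_eq: "smooth \<theta> \<Longrightarrow> pdx j (tfun L k d \<theta>) (t, x) = freq L k $ j * (\<theta> t * cos (freq L k \<bullet> x + (d + pi / 2)))"
  by (simp add: pdx_tfun tfun_def)

lemma pdx_pdx_tfun: "smooth \<theta> \<Longrightarrow> pdx j (pdx j (tfun L k d \<theta>)) (t, x) = - ((freq L k $ j)\<^sup>2 * (\<theta> t * cos (freq L k \<bullet> x + d)))"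
proof -
  assume s: "smooth \<theta>"
  have s': "smooth (\<lambda>t. freq L k $ j * \<theta> t)" by (intro smooth_mult smooth_const s)
  have "cos (freq L k \<bullet> x + (d + pi / 2 + pi / 2)) = - cos (freq L k \<bullet> x + d)"
    using cos_periodic_pi[of "freq L k \<bullet> x + d"] by (simp add: add.assoc)
  then show ?thesis by (simp add: pdx_tfun[OF s] pdx_tfun_eq[OF s'] power2_eq_square)
qed

lemma fcoeff_cos:
  assumes L: "L > 0"
  shows "fcoeff L (\<lambda>x. a * cos (freq L k \<bullet> x + d)) n = complex_of_real a / 2 * ((if n = k then cis d else 0) + (if n = - k then cis (- d) else 0))"
proof -
  have "complex_of_real (a * cos (freq L k \<bullet> x + d)) = complex_of_real a / 2 * cis d * cis (freq L k \<bullet> x) + complex_of_real a / 2 * cis (- d) * cis (freq L (- k) \<bullet> x)" for x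
    by (simp add: complex_eq_iff freq_uminus cos_add field_simps)
  then have "fcoeff L (\<lambda>x. a * cos (freq L k \<bullet> x + d)) n =
      cfc L (\<lambda>x. (\<Sum>m\<in>{k}. complex_of_real a / 2 * cis d * cis (freq L m \<bullet> x)) + (\<Sum>m\<in>{- k}. complex_of_real a / 2 * cis (- d) * cis (freq L m \<bullet> x))) n"
    unfolding fcoeff_cfc by simp
  also have "\<dots> = cfc L (\<lambda>x. \<Sum>m\<in>{k}. complex_of_real a / 2 * cis d * cis (freq L m \<bullet> x)) n + cfc L (\<lambda>x. \<Sum>m\<in>{- k}. complex_of_real a / 2 * cis (- d) * cis (freq L m \<bullet> x)) n"
    by (rule cfc_add) (rule tpoly_sqi[OF tpolyI], simp)+
  also have "\<dots> = complex_of_real a / 2 * ((if n = k then cis d else 0) + (if n = - k then cis (- d) else 0))"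
    by (subst (1 2) cfc_tpoly[OF L]) (auto simp: distrib_left)
  finally show ?thesis .
qed

text \<open>
  A real wave has exactly the two nonzero coefficients at \<open>k\<close> and \<open>-k\<close>, and these differ as
  \<open>k \<noteq> 0\<close>.
\<close>

lemma pairing_cos_two_modes:
  assumes L: "L > 0" and k: "k \<noteq> 0"
  shows "pairing L c (fcoeff L (\<lambda>x. a * cos (freq L k \<bullet> x + d)))
    = L^3 * (a / 2) * (c k \<bullet> cis d + c (- k) \<bullet> cis (- d))"
proof -
  have kk: "k \<noteq> - k"
  proof
    assume "k = - k"
    then have "k $ i = 0" for i by (metis neg_equal_zero vector_uminus_component)
    then show False using k by (simp add: vec_eq_iff)
  qed
  define g where "g n = Re (c n * cnj (fcoeff L (\<lambda>x. a * cos (freq L k \<bullet> x + d)) n))" for n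
  have "(g has_sum (\<Sum>n\<in>{k, - k}. g n)) {k, - k}" by (rule has_sum_finite) simp
  then have "(g has_sum (\<Sum>n\<in>{k, - k}. g n)) (- {0})"
    by (rule has_sum_cong_neutral[THEN iffD1, rotated 3]) (use k in \<open>auto simp: g_def fcoeff_cos[OF L]\<close>)
  then have "(\<Sum>\<^sub>\<infinity>n\<in>- {0}. g n) = g k + g (- k)" using kk by (simp add: infsumI)
  also have "\<dots> = (a / 2) * (c k \<bullet> cis d + c (- k) \<bullet> cis (- d))"
  proof -
    have "fcoeff L (\<lambda>x. a * cos (freq L k \<bullet> x + d)) k = complex_of_real a / 2 * cis d"
      "fcoeff L (\<lambda>x. a * cos (freq L k \<bullet> x + d)) (- k) = complex_of_real a / 2 * cis (- d)"
      using kk kk[symmetric] by (simp_all only: fcoeff_cos[OF L] if_True if_False simp_thms add_0_right add_0_left)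
    then show ?thesis unfolding g_def by (simp only:) (simp add: inner_complex_def field_simps)
  qed
  finally show ?thesis by (simp add: pairing_def g_def)
qed

lemma pairing_cos:
  assumes L: "L > 0" and c: "real_mean0 c" and k: "k \<noteq> 0"
  shows "pairing L c (fcoeff L (\<lambda>x. a * cos (freq L k \<bullet> x + d))) = a * (L^3 * Re (cis (- d) * c k))"
proof -
  have "c (- k) = cnj (c k)" using c by (simp add: real_mean0_def)
  then show ?thesis unfolding pairing_cos_two_modes[OF L k] by (simp add: inner_complex_def field_simps)
qed

section \<open>Fourier coefficients, Sobolev norms and regularity in time\<close>

text \<open>
  The two phases determine the real and the imaginary part.
\<close>

lemma fcoeff_eqI:
  assumes L: "L > 0" and m: "\<And>d. d \<in> {0, pi / 2} \<Longrightarrow> mode L k d h = L^3 * Re (cis (- d) * z)"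
  shows "fcoeff L h k = z"
  using m[of 0] m[of "pi / 2"] L by (simp add: mode_def complex_eq_iff)

lemma mode_shift: "mode L k (d + pi / 2) h = L^3 * Re (cis (- d) * (- \<i> * fcoeff L h k))"
proof -
  have "cis (- (d + pi / 2)) = cis (- d) * (- \<i>)"
    by (simp add: complex_eq_iff cos_diff sin_diff)
  then show ?thesis by (simp only: mode_def mult.assoc)
qed

lemma fcoeff_add: "integrable (cell L) f \<Longrightarrow> integrable (cell L) g \<Longrightarrow> L > 0 \<Longrightarrow> fcoeff L (\<lambda>x. f x + g x) k = fcoeff L f k + fcoeff L g k"
  for f g :: "real^3 \<Rightarrow> real"
proof (rule fcoeff_eqI)
  fix d assume i: "integrable (cell L) f" "integrable (cell L) g" "L > 0"
  have "mode L k d (\<lambda>x. f x + g x) = mode L k d f + mode L k d g"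
    using i by (simp add: integral_cos_mode[symmetric] distrib_right integrable_cos_mult)
  then show "mode L k d (\<lambda>x. f x + g x) = L ^ 3 * Re (cis (- d) * (fcoeff L f k + fcoeff L g k))"
    by (simp add: mode_def algebra_simps)
qed

lemma fcoeff_cmult: "fcoeff L (\<lambda>x. c * f x) k = complex_of_real c * fcoeff L f k"
  by (simp add: fcoeff_cfc cfc_def mult.left_commute[of _ "complex_of_real c"])

lemma fcoeff_0: "fcoeff L (\<lambda>x. 0) k = 0"
  by (simp add: fcoeff_cfc cfc_def)

lemma fcoeff_diff: "integrable (cell L) f \<Longrightarrow> integrable (cell L) g \<Longrightarrow> L > 0 \<Longrightarrow> fcoeff L (\<lambda>x. f x - g x) k = fcoeff L f k - fcoeff L g k"
  for f g :: "real^3 \<Rightarrow> real"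
  using fcoeff_add[of L f "\<lambda>x. (-1) * g x" k] fcoeff_cmult[of L "-1" g k] by simp

lemma fcoeff_sum:
  assumes "finite I" "\<And>i. i \<in> I \<Longrightarrow> integrable (cell L) (f i)" "L > 0"
  shows "fcoeff L (\<lambda>x. \<Sum>i\<in>I. f i x :: real) k = (\<Sum>i\<in>I. fcoeff L (f i) k)"
  using assms by (induction I rule: finite_induct) (auto simp: fcoeff_0 fcoeff_add)

text \<open>
  Test the definition of the weak derivative with \<open>cos(k \<cdot> x + d)\<close>.
\<close>

lemma fcoeff_weak_partial:
  assumes L: "L > 0" and w: "weak_partial L j g h"
  shows "fcoeff L h k = \<i> * complex_of_real (freq L k $ j) * fcoeff L g k"
proof (rule fcoeff_eqI[OF L])
  fix d
  define \<eta> where "\<eta> x = cos (freq L k \<bullet> x + d)" for x :: "real^3"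
  have gi: "integrable (cell L) g" "integrable (cell L) h"
    using w unfolding weak_partial_def by (auto intro: sqi_cell_integrable L2_sqi)
  have "smooth \<eta>" "periodic L \<eta>" unfolding \<eta>_def periodic_def using smooth_cos_mode freq_period[OF L] by auto
  then have "tint L (\<lambda>x. g x * pd (axis j 1) \<eta> x) = - tint L (\<lambda>x. h x * \<eta> x)"
    using w unfolding weak_partial_def by blast
  moreover have "pd (axis j 1) \<eta> x = freq L k $ j * cos (freq L k \<bullet> x + (d + pi / 2))" for x
  proof -
    have "(\<eta> has_derivative (\<lambda>h. - sin (freq L k \<bullet> x + d) * (freq L k \<bullet> h))) (at x)"
      unfolding \<eta>_def by (auto intro!: derivative_eq_intros simp: fun_eq_iff)
    from pd_eqI[OF this, of "axis j 1"] show ?thesis by (simp add: cos_shift inner_axis)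
  qed
  ultimately have "freq L k $ j * mode L k (d + pi / 2) g = - mode L k d h"
    using gi by (simp add: tint_cell \<eta>_def integral_cos_mode[OF L, symmetric] mult.left_commute[of _ "freq L k $ j"])
  then show "mode L k d h = L ^ 3 * Re (cis (- d) * (\<i> * complex_of_real (freq L k $ j) * fcoeff L g k))"
    unfolding mode_shift by (simp add: algebra_simps)
qed

lemma has_sum_finite_sum:
  fixes f :: "'i \<Rightarrow> 'a \<Rightarrow> 'b::topological_comm_monoid_add"
  assumes "finite I" "\<And>i. i \<in> I \<Longrightarrow> (f i has_sum S i) A"
  shows "((\<lambda>x. \<Sum>i\<in>I. f i x) has_sum (\<Sum>i\<in>I. S i)) A"
  using assms by (induction I rule: finite_induct) (auto intro: has_sum_add)

lemma summable_on_finite_sum: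
  fixes f :: "'i \<Rightarrow> 'a \<Rightarrow> 'b::topological_comm_monoid_add"
  assumes "finite I" "\<And>i. i \<in> I \<Longrightarrow> f i summable_on A"
  shows "(\<lambda>x. \<Sum>i\<in>I. f i x) summable_on A"
  using assms by (induction I rule: finite_induct) (auto intro: summable_on_add)

lemma norm_vec_complex: "(norm (v :: complex^3))\<^sup>2 = (\<Sum>i\<in>UNIV. (norm (v $ i))\<^sup>2)"
  by (simp add: norm_vec_def L2_set_def sum_nonneg)

lemma norm_vec_real: "(norm (v :: real^3))\<^sup>2 = (\<Sum>i\<in>UNIV. (v $ i)\<^sup>2)"
  by (simp add: norm_vec_def L2_set_def sum_nonneg)

lemma norm_freq_pos: "L > 0 \<Longrightarrow> n \<noteq> 0 \<Longrightarrow> norm (freq L n) > 0"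
  by (auto simp: freq_def vec_eq_iff)

lemma has_sum_Hdot:
  assumes L: "L > 0" and c: "\<And>i. (\<lambda>n. norm (freq L n) powr (2 * s) * (norm (c n $ i))\<^sup>2) summable_on (- {0})"
  shows "((\<lambda>n. norm (freq L n) powr (2 * s) * (norm (c n :: complex^3))\<^sup>2) has_sum ((Hdot_norm L s c)\<^sup>2 / L^3)) (- {0})"
proof -
  have "(\<lambda>n. \<Sum>i\<in>UNIV. norm (freq L n) powr (2 * s) * (norm (c n $ i))\<^sup>2) summable_on (- {0})"
    by (intro summable_on_finite_sum c) simp
  then have "(\<lambda>n. norm (freq L n) powr (2 * s) * (norm (c n))\<^sup>2) summable_on (- {0})"
    by (simp add: norm_vec_complex sum_distrib_left)
  moreover have "(Hdot_norm L s c)\<^sup>2 / L^3 = (\<Sum>\<^sub>\<infinity>n\<in>- {0}. norm (freq L n) powr (2 * s) * (norm (c n))\<^sup>2)"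
    using L unfolding Hdot_norm_def by (simp add: infsum_nonneg)
  ultimately show ?thesis by (simp only: has_sum_infsum)
qed

lemma has_sum_Hsob:
  assumes L: "L > 0" and c: "\<And>i. (\<lambda>n. (1 + (norm (freq L n))\<^sup>2) powr s * (norm (c n $ i))\<^sup>2) summable_on (- {0})"
  shows "((\<lambda>n. (1 + (norm (freq L n))\<^sup>2) powr s * (norm (c n :: complex^3))\<^sup>2) has_sum ((Hsob_norm L s c)\<^sup>2 / L^3)) (- {0})"
proof -
  have "(\<lambda>n. \<Sum>i\<in>UNIV. (1 + (norm (freq L n))\<^sup>2) powr s * (norm (c n $ i))\<^sup>2) summable_on (- {0})"
    by (intro summable_on_finite_sum c) simp
  then have "(\<lambda>n. (1 + (norm (freq L n))\<^sup>2) powr s * (norm (c n))\<^sup>2) summable_on (- {0})"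
    by (simp add: norm_vec_complex sum_distrib_left)
  moreover have "(Hsob_norm L s c)\<^sup>2 / L^3 = (\<Sum>\<^sub>\<infinity>n\<in>- {0}. (1 + (norm (freq L n))\<^sup>2) powr s * (norm (c n))\<^sup>2)"
    using L unfolding Hsob_norm_def by (simp add: infsum_nonneg)
  ultimately show ?thesis by (simp only: has_sum_infsum)
qed

lemma vHdot1_has_sum:
  assumes L: "L > 0" and c: "vHdot L 1 c"
  shows "((\<lambda>n. (norm (freq L n))\<^sup>2 * (norm (c n))\<^sup>2) has_sum ((Hdot_norm L 1 c)\<^sup>2 / L^3)) (- {0})"
proof -
  have "((\<lambda>n. norm (freq L n) powr (2 * 1) * (norm (c n))\<^sup>2) has_sum ((Hdot_norm L 1 c)\<^sup>2 / L^3)) (- {0})"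
    by (rule has_sum_Hdot[OF L]) (use c in \<open>auto simp: vHdot_def Hdot_def\<close>)
  then show ?thesis
    by (rule has_sum_cong[THEN iffD1, rotated]) (use norm_freq_pos[OF L] in auto)
qed

lemma vHdotm1_has_sum:
  assumes L: "L > 0" and c: "vHdot L (-1) c"
  shows "((\<lambda>n. (norm (c n))\<^sup>2 / (norm (freq L n))\<^sup>2) has_sum ((Hdot_norm L (-1) c)\<^sup>2 / L^3)) (- {0})"
proof -
  have "((\<lambda>n. norm (freq L n) powr (2 * -1) * (norm (c n))\<^sup>2) has_sum ((Hdot_norm L (-1) c)\<^sup>2 / L^3)) (- {0})"
    by (rule has_sum_Hdot[OF L]) (use c in \<open>auto simp: vHdot_def Hdot_def\<close>)
  then show ?thesis
  proof (rule has_sum_cong[THEN iffD1, rotated])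
    fix n :: "int^3" assume "n \<in> - {0}"
    then have "norm (freq L n) > 0" using norm_freq_pos[OF L] by auto
    then have "norm (freq L n) powr (2 * -1) = 1 / (norm (freq L n))\<^sup>2" by (simp add: powr_minus_divide)
    then show "norm (freq L n) powr (2 * -1) * (norm (c n))\<^sup>2 = (norm (c n))\<^sup>2 / (norm (freq L n))\<^sup>2" by simp
  qed
qed

lemma vH1_sqi: "vH1 L v \<Longrightarrow> sqi (cell L) (\<lambda>x. v x $ i)"
  unfolding vH1_def H1_def by (auto intro: L2_sqi)

lemma vH1_has_sum:
  assumes L: "L > 0" and v: "vH1 L v"
  shows "((\<lambda>n. (1 + (norm (freq L n))\<^sup>2) * (norm (vfcoeff L v n))\<^sup>2) has_sum ((Hsob_norm L 1 (vfcoeff L v))\<^sup>2 / L^3)) (- {0})"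
proof -
  have "((\<lambda>n. (1 + (norm (freq L n))\<^sup>2) powr 1 * (norm (vfcoeff L v n))\<^sup>2) has_sum ((Hsob_norm L 1 (vfcoeff L v))\<^sup>2 / L^3)) (- {0})"
    by (rule has_sum_Hsob[OF L]) (use v in \<open>auto simp: vH1_def H1_def Hsob_def vfcoeff_def\<close>)
  moreover have "(1 + (norm (freq L n))\<^sup>2) powr 1 = 1 + (norm (freq L n))\<^sup>2" for n by (simp add: add_pos_nonneg)
  ultimately show ?thesis by simp
qed

lemma vH1_mean0: "vH1 L v \<Longrightarrow> vfcoeff L v 0 = 0"
  by (simp add: vH1_def H1_def Hsob_def real_mean0_def vfcoeff_def vec_eq_iff)

lemma parseval_component:
  assumes L: "L > 0" and g: "sqi (cell L) (g :: _ \<Rightarrow> real)"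
  shows "((\<lambda>n. (norm (fcoeff L g n))\<^sup>2) has_sum (\<integral>x. (g x)\<^sup>2 \<partial>cell L) / L^3) UNIV"
proof -
  have "z \<bullet> z = (norm z)\<^sup>2" for z :: complex by (simp add: power2_norm_eq_inner)
  moreover have "g x * g x = (g x)\<^sup>2" for x by (simp add: power2_eq_square)
  ultimately show ?thesis using parseval_real[OF L g g] by (simp only:)
qed

text \<open>
  Parseval's identity as a bound: a function of mean zero is bounded in \<open>L\<^sup>2\<close> by a summable majorant of
  its squared coefficients.
\<close>

lemma integral_sq_le_has_sum:
  assumes L: "L > 0" and g: "sqi (cell L) (g :: _ \<Rightarrow> real)" and s: "(q has_sum S / L^3) (- {0})"
    and le: "\<And>n. n \<noteq> 0 \<Longrightarrow> (norm (fcoeff L g n))\<^sup>2 \<le> q n" and z: "fcoeff L g 0 = 0"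
  shows "(\<integral>x. (g x)\<^sup>2 \<partial>cell L) \<le> S"
proof -
  have "((\<lambda>n. (norm (fcoeff L g n))\<^sup>2) has_sum (\<integral>x. (g x)\<^sup>2 \<partial>cell L) / L^3) (- {0})"
    by (rule has_sum_cong_neutral[THEN iffD1, OF _ _ _ parseval_component[OF L g]]) (use z in auto)
  then have "(\<integral>x. (g x)\<^sup>2 \<partial>cell L) / L^3 \<le> S / L^3" by (rule has_sum_mono[OF _ s]) (use le in auto)
  then show ?thesis using L by (simp add: divide_le_cancel)
qed

lemma L2_norm_sq: "(L2_norm L v)\<^sup>2 = (\<integral>x. (norm (v x))\<^sup>2 \<partial>cell L)"
  by (simp add: L2_norm_def tint_cell integral_nonneg_AE)

lemma sqi_vec_component: "sqi M v \<Longrightarrow> sqi M (\<lambda>x. v x $ i)" for v :: "'a \<Rightarrow> real^3"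
proof (rule sqi_dominated[of M v _ 1])
  assume "sqi M v"
  then have "v \<in> borel_measurable M" by (simp add: sqi_def)
  then show "(\<lambda>x. v x $ i) \<in> borel_measurable M" unfolding cart_eq_inner_axis by (intro borel_measurable_inner borel_measurable_const)
qed (auto simp: component_le_norm_cart)

lemma integral_norm_sq_vec: "sqi M v \<Longrightarrow> (\<integral>x. (norm (v x))\<^sup>2 \<partial>M) = (\<Sum>i\<in>UNIV. \<integral>x. (v x $ i)\<^sup>2 \<partial>M)" for v :: "'a \<Rightarrow> real^3"
  unfolding norm_vec_real using sqi_vec_component[of M v] by (subst Bochner_Integration.integral_sum) (auto simp: sqi_def)

lemma parseval_vector:
  assumes L: "L > 0" and v: "sqi (cell L) (v :: _ \<Rightarrow> real^3)"
  shows "((\<lambda>n. (norm (vfcoeff L v n))\<^sup>2) has_sum (L2_norm L v)\<^sup>2 / L^3) UNIV"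
proof -
  have "((\<lambda>n. \<Sum>i\<in>UNIV. (norm (fcoeff L (\<lambda>x. v x $ i) n))\<^sup>2) has_sum (\<Sum>i\<in>UNIV. (\<integral>x. (v x $ i)\<^sup>2 \<partial>cell L) / L^3)) UNIV"
    by (intro has_sum_finite_sum finite parseval_component L sqi_vec_component v)
  then show ?thesis by (simp add: norm_vec_complex vfcoeff_def L2_norm_sq integral_norm_sq_vec[OF v] sum_divide_distrib)
qed

lemma tsqI:
  assumes m: "txm L g" and s: "AE t in tpos. sqi (cell L) (g t)"
    and b: "\<And>T. T > 0 \<Longrightarrow> \<exists>h. set_integrable lborel {0..T} h \<and> (AE t in lborel. t \<in> {0..T} \<longrightarrow> (\<integral>x. (g t x)\<^sup>2 \<partial>cell L) \<le> h t)"
  shows "tsq L g"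
  unfolding tsq_def
proof (intro conjI allI impI m s)
  fix T :: real assume "T > 0"
  then obtain h where h: "set_integrable lborel {0..T} h" "AE t in lborel. t \<in> {0..T} \<longrightarrow> (\<integral>x. (g t x)\<^sup>2 \<partial>cell L) \<le> h t"
    using b by blast
  have "(\<lambda>t. \<integral>x. (g t x)\<^sup>2 \<partial>cell L) \<in> borel_measurable tpos"
    by (rule txm_integral, rule txm_compose[OF m]) simp
  then show "set_integrable lborel {0..T} (\<lambda>t. \<integral>x. (g t x)\<^sup>2 \<partial>cell L)"
    by (rule set_integrable_tpos_bound[OF _ h(1)]) (use h(2) in \<open>simp add: integral_nonneg_AE\<close>)
qed

lemma tsq_mult_bounded:
  assumes g: "tsq L g" and m: "txm L h" and b: "\<And>t x. \<bar>h t x\<bar> \<le> (1::real)"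
  shows "tsq L (\<lambda>t x. h t x * g t x)"
proof (rule tsqI)
  show "txm L (\<lambda>t x. h t x * g t x)" using g m by (intro txm_mult) (auto simp: tsq_def)
  have ae: "AE t in tpos. sqi (cell L) (g t)" using g by (simp add: tsq_def)
  have nn: "AE t in tpos. 0 \<le> t" unfolding AE_tpos by simp
  have both: "AE t in tpos. sqi (cell L) (\<lambda>x. h t x * g t x) \<and> (\<integral>x. (h t x * g t x)\<^sup>2 \<partial>cell L) \<le> (\<integral>x. (g t x)\<^sup>2 \<partial>cell L)"
    using ae nn
  proof eventually_elim
    case (elim t)
    have s: "sqi (cell L) (\<lambda>x. h t x * g t x)"
      using sqi_mult_bounded[OF elim(1) txm_section[OF m elim(2)], of 1] b by simp
    moreover have "(\<integral>x. (h t x * g t x)\<^sup>2 \<partial>cell L) \<le> (\<integral>x. (g t x)\<^sup>2 \<partial>cell L)"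
    proof (rule integral_mono)
      fix x
      have "(h t x)\<^sup>2 \<le> 1" using b[of t x] by (simp add: abs_square_le_1)
      then have "(h t x)\<^sup>2 * (g t x)\<^sup>2 \<le> 1 * (g t x)\<^sup>2" by (intro mult_right_mono) auto
      then show "(h t x * g t x)\<^sup>2 \<le> (g t x)\<^sup>2" by (simp add: power_mult_distrib)
    qed (use s elim(1) in \<open>auto simp: sqi_def\<close>)
    ultimately show ?case by simp
  qed
  then show "AE t in tpos. sqi (cell L) (\<lambda>x. h t x * g t x)" by eventually_elim simp
  fix T :: real assume T: "T > 0"
  show "\<exists>k. set_integrable lborel {0..T} k \<and> (AE t in lborel. t \<in> {0..T} \<longrightarrow> (\<integral>x. (h t x * g t x)\<^sup>2 \<partial>cell L) \<le> k t)"
  proof (intro exI conjI)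
    show "set_integrable lborel {0..T} (\<lambda>t. \<integral>x. (g t x)\<^sup>2 \<partial>cell L)" using g T by (simp add: tsq_def)
    have "AE t in tpos. (\<integral>x. (h t x * g t x)\<^sup>2 \<partial>cell L) \<le> (\<integral>x. (g t x)\<^sup>2 \<partial>cell L)" using both by eventually_elim simp
    then show "AE t in lborel. t \<in> {0..T} \<longrightarrow> (\<integral>x. (h t x * g t x)\<^sup>2 \<partial>cell L) \<le> (\<integral>x. (g t x)\<^sup>2 \<partial>cell L)" by (rule AE_tpos_imp)
  qed
qed

lemma L2_norm_nonneg: "0 \<le> L2_norm L v" by (simp add: L2_norm_def tint_cell integral_nonneg_AE)

lemma Linf_loc_tsq_bound:
  assumes "Linf_loc X N v" "T > 0" "\<And>t. X (v t) \<Longrightarrow> N (v t) \<ge> 0 \<and> F t \<le> (N (v t))\<^sup>2"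
  shows "\<exists>h. set_integrable lborel {0..T} h \<and> (AE t in lborel. t \<in> {0..T} \<longrightarrow> F t \<le> h t)"
proof -
  have 1: "AE t in lborel. 0 \<le> t \<longrightarrow> X (v t)" using assms(1) by (simp add: Linf_loc_def)
  obtain M where 2: "AE t in lborel. t \<in> {0..T} \<longrightarrow> N (v t) \<le> M" using assms(1,2) unfolding Linf_loc_def by blast
  have "AE t in lborel. t \<in> {0..T} \<longrightarrow> F t \<le> M\<^sup>2"
    using 1 2
  proof eventually_elim
    case (elim t)
    show ?case
    proof
      assume t: "t \<in> {0..T}"
      then have "F t \<le> (N (v t))\<^sup>2" "0 \<le> N (v t)" "N (v t) \<le> M" using elim assms(3) by auto
      then show "F t \<le> M\<^sup>2" using power_mono order_trans by blast
    qed
  qed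
  moreover have "set_integrable lborel {0..T} (\<lambda>t. M\<^sup>2)" by (rule borel_integrable_atLeastAtMost') simp
  ultimately show ?thesis by blast
qed

lemma L2s_sqi: "L2s L v \<Longrightarrow> sqi (cell L) v"
  unfolding L2s_def by (auto intro: L2_sqi)

lemma component_integral_le: "sqi (cell L) v \<Longrightarrow> (\<integral>x. (v x $ i)\<^sup>2 \<partial>cell L) \<le> (L2_norm L v)\<^sup>2" for v :: "real^3 \<Rightarrow> real^3"
  unfolding L2_norm_sq using sqi_vec_component[of "cell L" v i]
  by (intro integral_mono) (auto simp: sqi_def norm_vec_real intro!: member_le_sum)

lemma tsq_velocity:
  assumes m: "tx_measurable u" and l: "Linf_loc (L2s L) (L2_norm L) u"
  shows "tsq L (\<lambda>t x. u t x $ i)"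
proof (rule tsqI)
  show "txm L (\<lambda>t x. u t x $ i)" by (rule txm_component[OF tx_measurable_txm[OF m]])
  have "AE t in tpos. L2s L (u t)" using l by (simp add: Linf_loc_def AE_tpos)
  then show "AE t in tpos. sqi (cell L) (\<lambda>x. u t x $ i)" by eventually_elim (intro sqi_vec_component L2s_sqi)
qed (rule Linf_loc_tsq_bound[OF l], auto simp: L2_norm_nonneg intro: component_integral_le L2s_sqi)

lemma Hsob_norm_nonneg: "0 \<le> L \<Longrightarrow> 0 \<le> Hsob_norm L s c" unfolding Hsob_norm_def by (intro real_sqrt_ge_zero mult_nonneg_nonneg infsum_nonneg) auto
lemma vfcoeff_component_le: "(norm (fcoeff L (\<lambda>x. v x $ i) n))\<^sup>2 \<le> (norm (vfcoeff L v n))\<^sup>2"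
  by (auto simp: norm_vec_complex vfcoeff_def intro!: member_le_sum)

lemma freq_component_sq_le: "(freq L n $ j)\<^sup>2 \<le> (norm (freq L n))\<^sup>2"
  by (auto simp: norm_vec_real intro!: member_le_sum)

lemma tsq_filtered:
  assumes L: "L > 0" and m: "tx_measurable v" and l: "Linf_loc (vH1 L) (\<lambda>v. Hsob_norm L 1 (vfcoeff L v)) v"
  shows "tsq L (\<lambda>t x. v t x $ i)"
proof (rule tsqI)
  show "txm L (\<lambda>t x. v t x $ i)" by (rule txm_component[OF tx_measurable_txm[OF m]])
  have "AE t in tpos. vH1 L (v t)" using l by (simp add: Linf_loc_def AE_tpos)
  then show "AE t in tpos. sqi (cell L) (\<lambda>x. v t x $ i)" by eventually_elim (rule vH1_sqi)
next
  fix T :: real assume T: "T > 0"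
  show "\<exists>h. set_integrable lborel {0..T} h \<and> (AE t in lborel. t \<in> {0..T} \<longrightarrow> (\<integral>x. (v t x $ i)\<^sup>2 \<partial>cell L) \<le> h t)"
  proof (rule Linf_loc_tsq_bound[OF l T])
    fix t assume v: "vH1 L (v t)"
    have "(\<integral>x. (v t x $ i)\<^sup>2 \<partial>cell L) \<le> (Hsob_norm L 1 (vfcoeff L (v t)))\<^sup>2"
    proof (rule integral_sq_le_has_sum[OF L vH1_sqi[OF v] vH1_has_sum[OF L v]])
      show "fcoeff L (\<lambda>x. v t x $ i) 0 = 0" using vH1_mean0[OF v] by (simp add: vfcoeff_def vec_eq_iff)
      fix n
      have "(norm (fcoeff L (\<lambda>x. v t x $ i) n))\<^sup>2 \<le> 1 * (norm (vfcoeff L (v t) n))\<^sup>2" using vfcoeff_component_le[of L "v t"] by simp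
      also have "\<dots> \<le> (1 + (norm (freq L n))\<^sup>2) * (norm (vfcoeff L (v t) n))\<^sup>2" by (intro mult_right_mono) auto
      finally show "(norm (fcoeff L (\<lambda>x. v t x $ i) n))\<^sup>2 \<le> (1 + (norm (freq L n))\<^sup>2) * (norm (vfcoeff L (v t) n))\<^sup>2" .
    qed
    then show "0 \<le> Hsob_norm L 1 (vfcoeff L (v t)) \<and> (\<integral>x. (v t x $ i)\<^sup>2 \<partial>cell L) \<le> (Hsob_norm L 1 (vfcoeff L (v t)))\<^sup>2"
      using L by (simp add: Hsob_norm_nonneg)
  qed
qed

lemma gradient_coeff_le:
  assumes L: "L > 0" and w: "weak_partial L j (\<lambda>x. v x $ i) h"
  shows "(norm (fcoeff L h n))\<^sup>2 \<le> (norm (freq L n))\<^sup>2 * (norm (vfcoeff L v n))\<^sup>2"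
  unfolding fcoeff_weak_partial[OF L w] norm_mult power_mult_distrib
  using mult_mono[OF freq_component_sq_le[of L n j] vfcoeff_component_le[of L v i n]] by simp

text \<open>
  \<open>B\<close> bounds the square of the \<open>H\<^sup>1\<close> seminorm with coefficients \<open>c\<close>, through a summable majorant \<open>q\<close>.
  The two regularity classes of \<open>u\<close> and of \<open>u\<alpha>\<close> provide different majorants.
\<close>

abbreviation coeff_grad_le :: "real \<Rightarrow> (int^3 \<Rightarrow> complex^3) \<Rightarrow> real \<Rightarrow> bool" where
  "coeff_grad_le L c B \<equiv> (\<exists>S q. (q has_sum S / L^3) (- {0}) \<and> S \<le> B \<and>
     (\<forall>n. n \<noteq> 0 \<longrightarrow> (norm (freq L n))\<^sup>2 * (norm (c n))\<^sup>2 \<le> q n))"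

lemma tsq_gradient:
  assumes L: "L > 0" and J: "weak_jacobian L v Dv"
    and b: "\<And>T. T > 0 \<Longrightarrow> \<exists>h. set_integrable lborel {0..T} h \<and> (AE t in lborel. t \<in> {0..T} \<longrightarrow> coeff_grad_le L (vfcoeff L (v t)) (h t))"
  shows "tsq L (\<lambda>t x. Dv t x $ i $ j)"
proof (rule tsqI)
  show "txm L (\<lambda>t x. Dv t x $ i $ j)" using J unfolding weak_jacobian_def by (intro txm_component2 tx_measurable_txm) simp
  have ae: "AE t in lborel. 0 \<le> t \<longrightarrow> weak_partial L j (\<lambda>x. v t x $ i) (\<lambda>x. Dv t x $ i $ j)"
    using J unfolding weak_jacobian_def by (auto elim!: eventually_mono)
  then show "AE t in tpos. sqi (cell L) (\<lambda>x. Dv t x $ i $ j)"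
    unfolding AE_tpos by eventually_elim (auto simp: weak_partial_def intro: L2_sqi)
  fix T :: real assume "T > 0"
  then obtain h where h: "set_integrable lborel {0..T} h" "AE t in lborel. t \<in> {0..T} \<longrightarrow> coeff_grad_le L (vfcoeff L (v t)) (h t)"
    using b by blast
  have "AE t in lborel. t \<in> {0..T} \<longrightarrow> (\<integral>x. (Dv t x $ i $ j)\<^sup>2 \<partial>cell L) \<le> h t"
    using h(2) ae
  proof eventually_elim
    case (elim t)
    show ?case
    proof
      assume t: "t \<in> {0..T}"
      then have w: "weak_partial L j (\<lambda>x. v t x $ i) (\<lambda>x. Dv t x $ i $ j)" using elim by auto
      obtain S q where q: "(q has_sum S / L^3) (- {0})" "S \<le> h t" "\<And>n. n \<noteq> 0 \<Longrightarrow> (norm (freq L n))\<^sup>2 * (norm (vfcoeff L (v t) n))\<^sup>2 \<le> q n"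
        using elim(1)[rule_format, OF t] by blast
      have "(\<integral>x. (Dv t x $ i $ j)\<^sup>2 \<partial>cell L) \<le> S"
      proof (rule integral_sq_le_has_sum[OF L _ q(1)])
        show "sqi (cell L) (\<lambda>x. Dv t x $ i $ j)" using w by (auto simp: weak_partial_def intro: L2_sqi)
        show "fcoeff L (\<lambda>x. Dv t x $ i $ j) 0 = 0" using fcoeff_weak_partial[OF L w, of 0] by simp
        show "(norm (fcoeff L (\<lambda>x. Dv t x $ i $ j) n))\<^sup>2 \<le> q n" if "n \<noteq> 0" for n
          using gradient_coeff_le[OF L w, of n] q(3)[OF that] by linarith
      qed
      then show "(\<integral>x. (Dv t x $ i $ j)\<^sup>2 \<partial>cell L) \<le> h t" using q(2) by simp
    qed
  qed
  then show "\<exists>h. set_integrable lborel {0..T} h \<and> (AE t in lborel. t \<in> {0..T} \<longrightarrow> (\<integral>x. (Dv t x $ i $ j)\<^sup>2 \<partial>cell L) \<le> h t)"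
    using h(1) by blast
qed

lemma tsq_gradient_velocity:
  assumes L: "L > 0" and J: "weak_jacobian L u Du"
    and l: "L2_loc (\<lambda>v. vHdot L 1 (vfcoeff L v)) (\<lambda>v. Hdot_norm L 1 (vfcoeff L v)) u"
  shows "tsq L (\<lambda>t x. Du t x $ i $ j)"
proof (rule tsq_gradient[OF L J])
  fix T :: real assume T: "T > 0"
  have "AE t in lborel. 0 \<le> t \<longrightarrow> vHdot L 1 (vfcoeff L (u t))" using l by (simp add: L2_loc_def)
  then have "AE t in lborel. t \<in> {0..T} \<longrightarrow> coeff_grad_le L (vfcoeff L (u t)) ((Hdot_norm L 1 (vfcoeff L (u t)))\<^sup>2)"
  proof eventually_elim
    case (elim t)
    show ?case
    proof
      assume "t \<in> {0..T}"
      then have "vHdot L 1 (vfcoeff L (u t))" using elim by simp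
      from vHdot1_has_sum[OF L this]
      show "\<exists>S q. (q has_sum S / L^3) (- {0}) \<and> S \<le> (Hdot_norm L 1 (vfcoeff L (u t)))\<^sup>2 \<and> (\<forall>n. n \<noteq> 0 \<longrightarrow> (norm (freq L n))\<^sup>2 * (norm (vfcoeff L (u t) n))\<^sup>2 \<le> q n)"
        by (intro exI conjI) (assumption, auto)
    qed
  qed
  then show "\<exists>h. set_integrable lborel {0..T} h \<and> (AE t in lborel. t \<in> {0..T} \<longrightarrow> coeff_grad_le L (vfcoeff L (u t)) (h t))"
    using l T by (intro exI conjI) (auto simp: L2_loc_def)
qed

lemma tsq_gradient_filtered:
  assumes L: "L > 0" and J: "weak_jacobian L v Dv"
    and l: "Linf_loc (vH1 L) (\<lambda>v. Hsob_norm L 1 (vfcoeff L v)) v"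
  shows "tsq L (\<lambda>t x. Dv t x $ i $ j)"
proof (rule tsq_gradient[OF L J])
  fix T :: real assume T: "T > 0"
  obtain h where h: "set_integrable lborel {0..T} h" "AE t in lborel. t \<in> {0..T} \<longrightarrow> (Hsob_norm L 1 (vfcoeff L (v t)))\<^sup>2 \<le> h t"
    using Linf_loc_tsq_bound[OF l T, of "\<lambda>t. (Hsob_norm L 1 (vfcoeff L (v t)))\<^sup>2"] L by (auto simp: Hsob_norm_nonneg)
  have "AE t in lborel. 0 \<le> t \<longrightarrow> vH1 L (v t)" using l by (simp add: Linf_loc_def)
  then have "AE t in lborel. t \<in> {0..T} \<longrightarrow> coeff_grad_le L (vfcoeff L (v t)) (h t)"
    using h(2)
  proof eventually_elim
    case (elim t)
    show ?case
    proof
      assume t: "t \<in> {0..T}"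
      then have v: "vH1 L (v t)" using elim by simp
      show "\<exists>S q. (q has_sum S / L^3) (- {0}) \<and> S \<le> h t \<and> (\<forall>n. n \<noteq> 0 \<longrightarrow> (norm (freq L n))\<^sup>2 * (norm (vfcoeff L (v t) n))\<^sup>2 \<le> q n)"
        using elim t by (intro exI[of _ "(Hsob_norm L 1 (vfcoeff L (v t)))\<^sup>2"]
          exI[of _ "\<lambda>n. (1 + (norm (freq L n))\<^sup>2) * (norm (vfcoeff L (v t) n))\<^sup>2"] conjI vH1_has_sum[OF L v]) (auto intro!: mult_right_mono)
    qed
  qed
  then show "\<exists>h. set_integrable lborel {0..T} h \<and> (AE t in lborel. t \<in> {0..T} \<longrightarrow> coeff_grad_le L (vfcoeff L (v t)) (h t))"
    using h(1) by blast
qed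

lemma tsq_Linf_pressure:
  assumes "tx_measurable P" "Linf_loc (L2 L) (L2_norm L) P" shows "tsq L P"
proof (rule tsqI)
  show "txm L P" by (rule tx_measurable_txm[OF assms(1)])
  have "AE t in tpos. L2 L (P t)" using assms(2) by (simp add: Linf_loc_def AE_tpos)
  then show "AE t in tpos. sqi (cell L) (P t)" by eventually_elim (rule L2_sqi)
qed (rule Linf_loc_tsq_bound[OF assms(2)], auto simp: L2_norm_nonneg L2_norm_sq)

lemma tsq_L2_pressure:
  assumes "tx_measurable P" "L2_loc (L2 L) (L2_norm L) P" shows "tsq L P"
proof (rule tsqI)
  show "txm L P" by (rule tx_measurable_txm[OF assms(1)])
  have "AE t in tpos. L2 L (P t)" using assms(2) by (simp add: L2_loc_def AE_tpos)
  then show "AE t in tpos. sqi (cell L) (P t)" by eventually_elim (rule L2_sqi)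
  fix T :: real assume "T > 0"
  then have "set_integrable lborel {0..T} (\<lambda>t. (L2_norm L (P t))\<^sup>2)" using assms(2) by (simp add: L2_loc_def)
  then show "\<exists>h. set_integrable lborel {0..T} h \<and> (AE t in lborel. t \<in> {0..T} \<longrightarrow> (\<integral>x. (P t x)\<^sup>2 \<partial>cell L) \<le> h t)"
    by (intro exI[of _ "\<lambda>t. (L2_norm L (P t))\<^sup>2"]) (simp add: L2_norm_sq)
qed

section \<open>The equations in Fourier coefficients\<close>

text \<open>
  Up to the factor \<open>\<i>\<close> the \<open>k\<close>-th coefficient of the divergence of the field with coefficients \<open>c\<close>.
\<close>

abbreviation freq_dot :: "real \<Rightarrow> int^3 \<Rightarrow> complex^3 \<Rightarrow> complex" where
  "freq_dot L k c \<equiv> (\<Sum>j\<in>UNIV. complex_of_real (freq L k $ j) * c $ j)"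

text \<open>
  Test with \<open>\<theta>(t) cos(k \<cdot> x + d)\<close> and vary \<open>\<theta>\<close>: the \<open>k\<close>-th mode of \<open>freq L k \<bullet> v\<close> vanishes
  at almost every time, for the two phases that determine a coefficient.
\<close>

lemma weak_div_free_Fourier:
  assumes L: "L > 0" and v: "\<And>i. tsq L (\<lambda>t x. v t x $ i)" and w: "weak_div_free L v"
  shows "AE t in tpos. \<forall>k. freq_dot L k (vfcoeff L (v t) k) = 0"
proof -
  define g where "g k t x = (\<Sum>j\<in>UNIV. freq L k $ j * v t x $ j)" for k t x
  have gi: "ti1 L (g k)" for k unfolding g_def by (intro ti1_sum ti1_cmult tsq_ti1 v) simp
  have one: "AE t in tpos. tmode L k (d + pi / 2) (g k) t = 0" for k d
    unfolding AE_tpos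
  proof (rule ttest_integral_zero_imp_AE)
    show "set_integrable lborel {0..T} (tmode L k (d + pi / 2) (g k))" if "T > 0" for T
      unfolding tmode_def by (rule ti1_mode_integrable(2)[OF L gi that])
    fix \<theta> assume th: "ttest \<theta>"
    then have s: "smooth \<theta>" by (simp add: ttest_def)
    have "st_int L (\<lambda>t x. \<Sum>j\<in>UNIV. v t x $ j * pdx j (tfun L k d \<theta>) (t, x)) = 0"
      using w test_fun_tfun[OF L th] unfolding weak_div_free_def by blast
    also have "(\<lambda>t x. \<Sum>j\<in>UNIV. v t x $ j * pdx j (tfun L k d \<theta>) (t, x)) = (\<lambda>t x. g k t x * (\<theta> t * cos (freq L k \<bullet> x + (d + pi / 2))))"
      by (simp add: pdx_tfun_eq[OF s] g_def sum_distrib_right sum_distrib_left mult_ac)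
    also have "st_int L \<dots> = (LINT t:{0..}|lborel. \<theta> t * tmode L k (d + pi / 2) (g k) t)"
      by (rule has_st_int[OF has_st_test[OF L gi ttest_tcut(1)[OF th]]])
    finally show "(LINT \<tau>:{0..}|lborel. \<theta> \<tau> * tmode L k (d + pi / 2) (g k) \<tau>) = 0" .
  qed
  \<comment> \<open>the spatial derivative shifts the phases \<open>-\<pi>/2\<close> and \<open>0\<close> to those that determine a coefficient\<close>
  have "AE t in tpos. \<forall>d\<in>{- (pi / 2), 0}. mode L k (d + pi / 2) (g k t) = 0" for k
    using tmode_mode[OF L gi, of k 0 k] tmode_mode[OF L gi, of k "pi / 2" k] one[of k 0] one[of k "- (pi / 2)"]
    by eventually_elim auto
  then have "AE t in tpos. \<forall>k. \<forall>d\<in>{- (pi / 2), 0}. mode L k (d + pi / 2) (g k t) = 0"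
    by (subst AE_all_countable) blast
  moreover have "AE t in tpos. \<forall>i. sqi (cell L) (\<lambda>x. v t x $ i)"
    using v by (subst AE_all_countable) (auto simp: tsq_def)
  ultimately show ?thesis
  proof eventually_elim
    case (elim t)
    show ?case
    proof
      fix k
      have "fcoeff L (g k t) k = 0"
      proof (rule fcoeff_eqI[OF L])
        fix d :: real assume "d \<in> {0, pi / 2}"
        then have "d - pi / 2 \<in> {- (pi / 2), 0}" by auto
        then have "mode L k ((d - pi / 2) + pi / 2) (g k t) = 0" using elim by blast
        then show "mode L k d (g k t) = L ^ 3 * Re (cis (- d) * 0)" by simp
      qed
      moreover have "fcoeff L (g k t) k = freq_dot L k (vfcoeff L (v t) k)"
        unfolding g_def using elim L by (subst fcoeff_sum) (auto intro: sqi_cell_integrable simp: fcoeff_cmult vfcoeff_def)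
      ultimately show "freq_dot L k (vfcoeff L (v t) k) = 0" by simp
    qed
  qed
qed

text \<open>
  Tested with \<open>\<theta>(t) cos(k \<cdot> x + d)\<close>, the filter equation holds mode by mode at almost every
  time: \<open>g\<close> collects the terms that carry a spatial derivative of the test function, \<open>h = v - u\<close> the
  others.
\<close>

lemma weak_filter_Fourier:
  assumes L: "L > 0" and u: "\<And>i. tsq L (\<lambda>t x. u t x $ i)" and v: "\<And>i. tsq L (\<lambda>t x. v t x $ i)"
    and G: "\<And>i j. tsq L (\<lambda>t x. A (conv L \<phi> (u t) x) * Dv t x $ i $ j)" and P: "tsq L P"
    and w: "weak_filter L \<alpha> A \<phi> u v Dv P"
  shows "AE t in tpos. \<forall>k i. - \<i> * ((\<Sum>j\<in>UNIV. complex_of_real (\<alpha>\<^sup>2 * freq L k $ j) * fcoeff L (\<lambda>x. A (conv L \<phi> (u t) x) * Dv t x $ i $ j) k)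
      - complex_of_real (freq L k $ i) * fcoeff L (P t) k) + vfcoeff L (v t) k $ i - vfcoeff L (u t) k $ i = 0"
proof -
  define g where "g k i t x = (\<Sum>j\<in>UNIV. (\<alpha>\<^sup>2 * freq L k $ j) * (A (conv L \<phi> (u t) x) * Dv t x $ i $ j)) + (- freq L k $ i) * P t x" for k i t x
  define h where "h i t x = v t x $ i + (-1) * u t x $ i" for i t x
  have gi: "ti1 L (g k i)" for k i unfolding g_def by (intro ti1_add ti1_sum ti1_cmult tsq_ti1 G P) simp
  have hi: "ti1 L (h i)" for i unfolding h_def by (intro ti1_add ti1_cmult tsq_ti1 u v)
  have one: "AE t in tpos. tmode L k (d + pi / 2) (g k i) t + tmode L k d (h i) t = 0" for k i d
    unfolding AE_tpos
  proof (rule ttest_integral_zero_imp_AE)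
    show "set_integrable lborel {0..T} (\<lambda>t. tmode L k (d + pi / 2) (g k i) t + tmode L k d (h i) t)" if "T > 0" for T
      unfolding tmode_def by (intro set_integral_add(1) ti1_mode_integrable(2)[OF L _ that] gi hi)
    fix \<theta> assume th: "ttest \<theta>"
    then have s: "smooth \<theta>" by (simp add: ttest_def)
    let ?tv = "tmode L k d (\<lambda>t x. v t x $ i)" and ?tu = "tmode L k d (\<lambda>t x. u t x $ i)"
      and ?tg = "tmode L k (d + pi / 2) (g k i)" and ?th = "tmode L k d (h i)"
    have H: "has_st L (\<lambda>t x. g k i t x * (\<theta> t * cos (freq L k \<bullet> x + (d + pi / 2))) + v t x $ i * (\<theta> t * cos (freq L k \<bullet> x + d)))
        (\<lambda>t. \<theta> t * ?tg t + \<theta> t * ?tv t)"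
      by (intro has_st_add has_st_test[OF L _ ttest_tcut(1)[OF th]] gi tsq_ti1 v)
    have U: "has_st L (\<lambda>t x. u t x $ i * (\<theta> t * cos (freq L k \<bullet> x + d))) (\<lambda>t. \<theta> t * ?tu t)"
      by (intro has_st_test[OF L _ ttest_tcut(1)[OF th]] tsq_ti1 u)
    have V: "has_st L (\<lambda>t x. v t x $ i * (\<theta> t * cos (freq L k \<bullet> x + d)) + (-1 * u t x $ i) * (\<theta> t * cos (freq L k \<bullet> x + d)))
        (\<lambda>t. \<theta> t * ?tv t + \<theta> t * tmode L k d (\<lambda>t x. -1 * u t x $ i) t)"
      by (intro has_st_add has_st_test[OF L _ ttest_tcut(1)[OF th]] tsq_ti1 ti1_cmult v u)
    have "st_int L (\<lambda>t x. \<alpha>\<^sup>2 * (\<Sum>j\<in>UNIV. A (conv L \<phi> (u t) x) * Dv t x $ i $ j * pdx j (tfun L k d \<theta>) (t, x))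
         + v t x $ i * tfun L k d \<theta> (t, x) - P t x * pdx i (tfun L k d \<theta>) (t, x)) = st_int L (\<lambda>t x. u t x $ i * tfun L k d \<theta> (t, x))"
      using w test_fun_tfun[OF L th] unfolding weak_filter_def by blast
    also have "(\<lambda>t x. \<alpha>\<^sup>2 * (\<Sum>j\<in>UNIV. A (conv L \<phi> (u t) x) * Dv t x $ i $ j * pdx j (tfun L k d \<theta>) (t, x))
         + v t x $ i * tfun L k d \<theta> (t, x) - P t x * pdx i (tfun L k d \<theta>) (t, x))
       = (\<lambda>t x. g k i t x * (\<theta> t * cos (freq L k \<bullet> x + (d + pi / 2))) + v t x $ i * (\<theta> t * cos (freq L k \<bullet> x + d)))"
      by (intro ext) (simp add: pdx_tfun_eq[OF s] tfun_def g_def sum_distrib_right sum_distrib_left algebra_simps)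
    also have "st_int L (\<lambda>t x. u t x $ i * tfun L k d \<theta> (t, x)) = (LINT t:{0..}|lborel. \<theta> t * ?tu t)"
      using has_st_int[OF U] by (simp add: tfun_def)
    finally have e: "(LINT t:{0..}|lborel. \<theta> t * ?tg t + \<theta> t * ?tv t)
        = (LINT t:{0..}|lborel. \<theta> t * ?tu t)"
      unfolding has_st_int[OF H] .
    have ints: "set_integrable lborel {0..} (\<lambda>t. \<theta> t * ?tg t + \<theta> t * ?tv t)"
      "set_integrable lborel {0..} (\<lambda>t. \<theta> t * ?tu t)"
      using H U by (auto simp: has_st_def)
    have "AE t in tpos. ?th t = ?tv t - ?tu t"
    proof -
      have "AE t in tpos. sqi (cell L) (\<lambda>x. v t x $ i)" "AE t in tpos. sqi (cell L) (\<lambda>x. u t x $ i)" using u v by (auto simp: tsq_def)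
      then show ?thesis
        by eventually_elim (simp add: tmode_def h_def left_diff_distrib integrable_cos_mult sqi_cell_integrable)
    qed
    then have ae: "AE t in lborel. 0 \<le> t \<longrightarrow> ?th t = ?tv t - ?tu t"
      by (simp add: AE_tpos)
    have "(LINT t:{0..}|lborel. \<theta> t * (?tg t + ?th t))
       = (LINT t:{0..}|lborel. (\<theta> t * ?tg t + \<theta> t * ?tv t) - \<theta> t * ?tu t)"
      unfolding set_lebesgue_integral_def
    proof (rule integral_cong_AE)
      show "AE t in lborel. indicator {0..} t *\<^sub>R (\<theta> t * (?tg t + ?th t))
         = indicator {0..} t *\<^sub>R ((\<theta> t * ?tg t + \<theta> t * ?tv t) - \<theta> t * ?tu t)"
        using ae
      proof eventually_elim
        case (elim t)
        show ?case
        proof (cases "0 \<le> t")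
          case True
          then have h: "?th t = ?tv t - ?tu t" using elim by simp
          show ?thesis unfolding h by (simp add: algebra_simps)
        qed simp
      qed
      have "set_integrable lborel {0..} (\<lambda>t. \<theta> t * (?tg t + ?th t))"
        unfolding tmode_def
        by (intro tcut_mult_integrable[OF ttest_tcut(1)[OF th]] set_integral_add(1) ti1_mode_integrable(2)[OF L] gi hi)
      then show "(\<lambda>t. indicator {0..} t *\<^sub>R (\<theta> t * (?tg t + ?th t))) \<in> borel_measurable lborel"
        by (auto simp: set_integrable_def)
      show "(\<lambda>t. indicator {0..} t *\<^sub>R ((\<theta> t * ?tg t + \<theta> t * ?tv t) - \<theta> t * ?tu t)) \<in> borel_measurable lborel"
        using set_integral_diff(1)[OF ints] by (auto simp: set_integrable_def)
    qed
    also have "\<dots> = 0" using set_integral_diff(2)[OF ints] e by simp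
    finally show "(LINT \<tau>:{0..}|lborel. \<theta> \<tau> * (?tg \<tau> + ?th \<tau>)) = 0" .
  qed
  have "AE t in tpos. \<forall>d\<in>{0, pi / 2}. mode L k (d + pi / 2) (g k i t) + mode L k d (h i t) = 0" for k i
    using tmode_mode[OF L gi, of k "0 + pi / 2" k i] tmode_mode[OF L gi, of k "pi / 2 + pi / 2" k i] one[of k 0 i] one[of k "pi / 2" i]
      tmode_mode[OF L hi, of k 0 i] tmode_mode[OF L hi, of k "pi / 2" i]
    by eventually_elim auto
  then have "AE t in tpos. \<forall>k i. \<forall>d\<in>{0, pi / 2}. mode L k (d + pi / 2) (g k i t) + mode L k d (h i t) = 0"
    by (simp add: AE_all_countable)
  moreover have "AE t in tpos. \<forall>i. sqi (cell L) (\<lambda>x. v t x $ i)" "AE t in tpos. \<forall>i. sqi (cell L) (\<lambda>x. u t x $ i)"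
    "AE t in tpos. \<forall>i j. sqi (cell L) (\<lambda>x. A (conv L \<phi> (u t) x) * Dv t x $ i $ j)" "AE t in tpos. sqi (cell L) (P t)"
    using v u G P by (auto simp: tsq_def AE_all_countable)
  ultimately show ?thesis
  proof eventually_elim
    case (elim t)
    show ?case
    proof (intro allI)
      fix k i
      have gs: "fcoeff L (g k i t) k = (\<Sum>j\<in>UNIV. complex_of_real (\<alpha>\<^sup>2 * freq L k $ j) * fcoeff L (\<lambda>x. A (conv L \<phi> (u t) x) * Dv t x $ i $ j) k)
          - complex_of_real (freq L k $ i) * fcoeff L (P t) k"
      proof -
        have e3: "integrable (cell L) (\<lambda>x. A (conv L \<phi> (u t) x) * Dv t x $ i $ j)" for j
          using elim by (auto intro: sqi_cell_integrable)
        have i1: "integrable (cell L) (\<lambda>x. \<Sum>j\<in>UNIV. (\<alpha>\<^sup>2 * freq L k $ j) * (A (conv L \<phi> (u t) x) * Dv t x $ i $ j))"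
          by (intro Bochner_Integration.integrable_sum integrable_mult_right e3)
        have i2: "integrable (cell L) (\<lambda>x. (- freq L k $ i) * P t x)"
          using elim by (intro integrable_mult_right) (auto intro: sqi_cell_integrable)
        have "fcoeff L (g k i t) k = fcoeff L (\<lambda>x. \<Sum>j\<in>UNIV. (\<alpha>\<^sup>2 * freq L k $ j) * (A (conv L \<phi> (u t) x) * Dv t x $ i $ j)) k
           + fcoeff L (\<lambda>x. (- freq L k $ i) * P t x) k"
          unfolding g_def by (rule fcoeff_add[OF i1 i2 L])
        also have "fcoeff L (\<lambda>x. \<Sum>j\<in>UNIV. (\<alpha>\<^sup>2 * freq L k $ j) * (A (conv L \<phi> (u t) x) * Dv t x $ i $ j)) k
           = (\<Sum>j\<in>UNIV. fcoeff L (\<lambda>x. (\<alpha>\<^sup>2 * freq L k $ j) * (A (conv L \<phi> (u t) x) * Dv t x $ i $ j)) k)"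
          by (rule fcoeff_sum[OF _ _ L]) (auto intro: integrable_mult_right e3)
        finally show ?thesis by (simp only: fcoeff_cmult) simp
      qed
      have hs: "fcoeff L (h i t) k = vfcoeff L (v t) k $ i - vfcoeff L (u t) k $ i"
        unfolding h_def using elim L by (simp add: fcoeff_diff sqi_cell_integrable vfcoeff_def)
      have "fcoeff L (h i t) k = \<i> * fcoeff L (g k i t) k"
      proof (rule fcoeff_eqI[OF L])
        fix d :: real assume d: "d \<in> {0, pi / 2}"
        then have "mode L k (d + pi / 2) (g k i t) + mode L k d (h i t) = 0" using elim by blast
        then show "mode L k d (h i t) = L ^ 3 * Re (cis (- d) * (\<i> * fcoeff L (g k i t) k))"
          unfolding mode_shift by (simp add: algebra_simps)
      qed
      then show "- \<i> * ((\<Sum>j\<in>UNIV. complex_of_real (\<alpha>\<^sup>2 * freq L k $ j) * fcoeff L (\<lambda>x. A (conv L \<phi> (u t) x) * Dv t x $ i $ j) k)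
          - complex_of_real (freq L k $ i) * fcoeff L (P t) k) + vfcoeff L (v t) k $ i - vfcoeff L (u t) k $ i = 0"
        unfolding gs[symmetric] using hs by (simp add: algebra_simps)
    qed
  qed
qed

lemma weakly_continuous_mode:
  assumes L: "L > 0" and c: "weakly_continuous L u"
  shows "continuous_on {0..} (\<lambda>t. mode L k d (\<lambda>x. u t x $ i))"
proof -
  define g where "g x = cos (freq L k \<bullet> x + d) *\<^sub>R axis i (1::real)" for x :: "real^3"
  have "L2 L g"
  proof -
    have m: "g \<in> borel_measurable borel" unfolding g_def
      by (intro borel_measurable_continuous_onI continuous_intros)
    have "sqi (cell L) g" by (rule sqi_dominated[OF sqi_const[OF finite_measure_cell, where c="1::real"], of _ _ 1])
      (use m borel_measurable_cell in \<open>auto simp: g_def norm_axis_1\<close>)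
    then have "integrable (cell L) (\<lambda>x. (norm (g x))\<^sup>2)" by (simp add: sqi_def)
    then have "set_integrable lborel (cbox 0 (\<chi> i. L)) (\<lambda>x. (norm (g x))\<^sup>2)"
      unfolding cell_def set_integrable_def by (subst (asm) integrable_restrict_space) auto
    then show ?thesis unfolding L2_def periodic_def using m freq_period[OF L] by (auto simp: g_def)
  qed
  then have "continuous_on {0..} (\<lambda>t. tint L (\<lambda>x. u t x \<bullet> g x))" using c unfolding weakly_continuous_def by blast
  also have "?this \<longleftrightarrow> continuous_on {0..} (\<lambda>t. mode L k d (\<lambda>x. u t x $ i))"
  proof (rule continuous_on_cong[OF refl])
    fix t :: real assume "t \<in> {0..}"
    then have "sqi (cell L) (\<lambda>x. u t x $ i)" using c unfolding weakly_continuous_def by (auto intro: sqi_vec_component L2s_sqi)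
    then show "tint L (\<lambda>x. u t x \<bullet> g x) = mode L k d (\<lambda>x. u t x $ i)"
      by (simp add: integral_cos_mode[OF L, symmetric] sqi_cell_integrable tint_cell g_def inner_axis) (simp add: mult.commute)
  qed
  finally show ?thesis .
qed

text \<open>
  The \<open>i\<close>-th component of \<open>(a \<cdot> \<nabla>) u\<close> if \<open>D\<close> is the Jacobian of \<open>u\<close>.
\<close>

definition advection :: "(real^3 \<Rightarrow> real^3) \<Rightarrow> (real^3 \<Rightarrow> real^3^3) \<Rightarrow> 3 \<Rightarrow> real^3 \<Rightarrow> real" where
  "advection a D i x = (\<Sum>j\<in>UNIV. a x $ j * D x $ i $ j)"

text \<open>
  The right-hand side of the ordinary differential equation for the \<open>k\<close>-th coefficient of the velocity.
\<close>

definition modal_rhs :: "real \<Rightarrow> real \<Rightarrow> (int^3 \<Rightarrow> complex^3) \<Rightarrow> (real^3 \<Rightarrow> real^3) \<Rightarrow> (real^3 \<Rightarrow> real^3) \<Rightarrow> (real^3 \<Rightarrow> real^3^3) \<Rightarrow> (real^3 \<Rightarrow> real) \<Rightarrow> int^3 \<Rightarrow> complex^3" where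
  "modal_rhs L \<nu> f u a D p k = (\<chi> i. - complex_of_real (\<nu> * (norm (freq L k))\<^sup>2) * vfcoeff L u k $ i
     - fcoeff L (advection a D i) k - \<i> * complex_of_real (freq L k $ i) * fcoeff L p k + f k $ i)"

lemma force_component_measurable: "force L f \<Longrightarrow> (\<lambda>t. f t n $ i) \<in> borel_measurable tpos"
proof -
  assume f: "force L f"
  have m: "(\<lambda>t. f t n) \<in> borel_measurable tpos"
    using f unfolding force_def set_borel_measurable_def tpos_def by (subst borel_measurable_restrict_space_iff) auto
  have "(\<lambda>z::complex^3. z $ i) \<in> borel_measurable borel"
    by (intro borel_measurable_continuous_onI continuous_intros)
  from measurable_compose[OF m this] show ?thesis .
qed

text \<open>
  Each Fourier coefficient of \<open>u\<close> is absolutely continuous in time with derivative \<^const>\<open>modal_rhs\<close>.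
  Tested with \<open>\<theta>(t) cos(k \<cdot> x + d)\<close>, the momentum equation says that \<^const>\<open>modal_rhs\<close>, in the phase
  \<open>d\<close>, is the weak derivative of a mode of \<open>u\<close>; this mode is continuous by the weak continuity of \<open>u\<close>,
  so that \<open>du_Bois_Reymond\<close> applies at all times.  The integrand \<open>F\<close> is real and belongs to one phase;
  the phases \<open>0\<close> and \<open>\<pi>/2\<close> give the complex equation.
\<close>

lemma weak_momentum_Fourier:
  assumes L: "L > 0" and u: "\<And>i. tsq L (\<lambda>t x. u t x $ i)" and v: "\<And>i. tsq L (\<lambda>t x. v t x $ i)"
    and D: "\<And>i j. tsq L (\<lambda>t x. Du t x $ i $ j)" and P: "tsq L P" and f: "force L f"
    and w: "weak_momentum L \<nu> f u Du v P" and c: "weakly_continuous L u" and k: "k \<noteq> 0"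
    and d: "d \<in> {0, pi / 2}"
  obtains F where "\<And>T. T > 0 \<Longrightarrow> set_integrable lborel {0..T} F"
    "AE t in tpos. F t = Re (cis (- d) * modal_rhs L \<nu> (f t) (u t) (v t) (Du t) (P t) k $ i)"
    "\<And>s t. 0 \<le> s \<Longrightarrow> s \<le> t \<Longrightarrow> Re (cis (- d) * vfcoeff L (u t) k $ i) - Re (cis (- d) * vfcoeff L (u s) k $ i) = (LINT \<tau>:{s..t}|lborel. F \<tau>)"
proof -
  define g where "g t x = (\<nu> * (norm (freq L k))\<^sup>2) * u t x $ i + advection (v t) (Du t) i x" for t x
  have gi: "ti1 L g" unfolding g_def advection_def by (intro ti1_add ti1_cmult tsq_ti1 u ti1_sum tsq_mult_ti1 v D) simp
  have ui: "ti1 L (\<lambda>t x. u t x $ i)" and Pi: "ti1 L P" by (intro tsq_ti1 u P)+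
  define fr where "fr t = L^3 * Re (cis (- d) * f t k $ i)" for t
  have fm: "fr \<in> borel_measurable tpos"
  proof -
    have "(\<lambda>t. (f t k $ i) \<bullet> cis d) \<in> borel_measurable tpos" by (intro borel_measurable_inner borel_measurable_const force_component_measurable[OF f])
    moreover have "fr = (\<lambda>t. L^3 * ((f t k $ i) \<bullet> cis d))"
      by (simp add: fr_def fun_eq_iff inner_complex_def algebra_simps)
    ultimately show ?thesis by simp
  qed
  have fae: "AE t in lborel. 0 \<le> t \<longrightarrow> vHdot L (-1) (f t)" using f unfolding force_def L2_loc_def by (auto elim!: eventually_mono)
  have fint: "set_integrable lborel {0..T} fr" if T: "T > 0" for T
  proof (rule set_integrable_tpos_bound[OF fm])
    have s: "set_integrable lborel {0..T} (\<lambda>t. (Hdot_norm L (-1) (f t))\<^sup>2)" using f T unfolding force_def L2_loc_def by blast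
    have c1: "set_integrable lborel {0..T} (\<lambda>t. L^3)" by (rule borel_integrable_atLeastAtMost') simp
    show "set_integrable lborel {0..T} (\<lambda>t. L^3 + (norm (freq L k))\<^sup>2 * (Hdot_norm L (-1) (f t))\<^sup>2)"
      by (intro set_integral_add(1) c1 set_integrable_mult_right s)
    show "AE t in lborel. t \<in> {0..T} \<longrightarrow> \<bar>fr t\<bar> \<le> L^3 + (norm (freq L k))\<^sup>2 * (Hdot_norm L (-1) (f t))\<^sup>2"
      using fae
    proof eventually_elim
      case (elim t)
      show ?case
      proof
        assume "t \<in> {0..T}"
        then have "vHdot L (-1) (f t)" using elim by simp
        note hs = vHdotm1_has_sum[OF L this]
        have "(\<Sum>n\<in>{k}. (norm (f t n))\<^sup>2 / (norm (freq L n))\<^sup>2) \<le> (Hdot_norm L (-1) (f t))\<^sup>2 / L^3"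
          by (rule has_sum_mono_neutral[OF has_sum_finite hs]) (use k in auto)
        then have le: "L^3 * (norm (f t k))\<^sup>2 \<le> (norm (freq L k))\<^sup>2 * (Hdot_norm L (-1) (f t))\<^sup>2"
          using L norm_freq_pos[OF L k] by (simp add: field_simps)
        have "\<bar>Re (cis (- d) * f t k $ i)\<bar> \<le> norm (cis (- d) * f t k $ i)" by (rule abs_Re_le_cmod)
        also have "\<dots> \<le> norm (f t k)" by (simp add: norm_mult Finite_Cartesian_Product.norm_nth_le)
        also have "\<dots> \<le> 1 + (norm (f t k))\<^sup>2" using sum_squares_bound[of 1 "norm (f t k)"] by (simp add: power2_eq_square) (smt (verit) norm_ge_zero)
        finally have "L^3 * \<bar>Re (cis (- d) * f t k $ i)\<bar> \<le> L^3 * (1 + (norm (f t k))\<^sup>2)" using L by (intro mult_left_mono) auto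
        then show "\<bar>fr t\<bar> \<le> L^3 + (norm (freq L k))\<^sup>2 * (Hdot_norm L (-1) (f t))\<^sup>2"
          using le L unfolding fr_def abs_mult by (simp add: algebra_simps)
      qed
    qed
  qed
  define F0 where "F0 t = freq L k $ i * tmode L k (d + pi / 2) P t + fr t - tmode L k d g t" for t
  have F0i: "set_integrable lborel {0..T} F0" if "T > 0" for T
    unfolding F0_def tmode_def
    by (intro set_integral_diff(1) set_integral_add(1) set_integrable_mult_right fint that ti1_mode_integrable(2)[OF L] gi Pi)
  have eq: "(LINT \<tau>:{0..}|lborel. pd 1 \<theta> \<tau> * mode L k d (\<lambda>x. u \<tau> x $ i) + \<theta> \<tau> * F0 \<tau>) = 0" if th: "ttest \<theta>" for \<theta>
  proof -
    have s: "smooth \<theta>" using th by (simp add: ttest_def)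
    note c1 = ttest_tcut(1)[OF th] and c2 = ttest_tcut(2)[OF th]
    let ?U = "tmode L k d (\<lambda>t x. (-1) * u t x $ i)" and ?Q = "tmode L k (d + pi / 2) (\<lambda>t x. (- freq L k $ i) * P t x)"
    let ?pair = "\<lambda>t. pairing L (\<lambda>n. f t n $ i) (fcoeff L (\<lambda>x. tfun L k d \<theta> (t, x)))"
    let ?lhs = "(\<lambda>t x. - (u t x $ i * pdt (tfun L k d \<theta>) (t, x))
                     - \<nu> * u t x $ i * (\<Sum>j\<in>UNIV. pdx j (pdx j (tfun L k d \<theta>)) (t, x))
                     + (\<Sum>j\<in>UNIV. v t x $ j * Du t x $ i $ j) * tfun L k d \<theta> (t, x)
                     - P t x * pdx i (tfun L k d \<theta>) (t, x))"
    let ?rhs = "(\<lambda>t x. ((-1) * u t x $ i) * (pd 1 \<theta> t * cos (freq L k \<bullet> x + d)) + g t x * (\<theta> t * cos (freq L k \<bullet> x + d))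
          + ((- freq L k $ i) * P t x) * (\<theta> t * cos (freq L k \<bullet> x + (d + pi / 2))))"
    have H: "has_st L ?rhs
        (\<lambda>t. pd 1 \<theta> t * ?U t + \<theta> t * tmode L k d g t + \<theta> t * ?Q t)"
      by (intro has_st_add has_st_test[OF L _ c1] has_st_test[OF L _ c2] gi ti1_cmult ui Pi)
    have "st_int L ?lhs
     = (LINT t:{0..}|lborel. ?pair t)"
      using w test_fun_tfun[OF L th] unfolding weak_momentum_def by blast
    also have "?lhs
      = ?rhs"
    proof (intro ext)
      fix t and x :: "real^3"
      have "(\<Sum>j\<in>UNIV. pdx j (pdx j (tfun L k d \<theta>)) (t, x)) = - ((norm (freq L k))\<^sup>2 * (\<theta> t * cos (freq L k \<bullet> x + d)))"
        by (simp add: pdx_pdx_tfun[OF s] norm_vec_real sum_negf sum_distrib_right)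
      then show "- (u t x $ i * pdt (tfun L k d \<theta>) (t, x))
                     - \<nu> * u t x $ i * (\<Sum>j\<in>UNIV. pdx j (pdx j (tfun L k d \<theta>)) (t, x))
                     + (\<Sum>j\<in>UNIV. v t x $ j * Du t x $ i $ j) * tfun L k d \<theta> (t, x)
                     - P t x * pdx i (tfun L k d \<theta>) (t, x)
        = ((-1) * u t x $ i) * (pd 1 \<theta> t * cos (freq L k \<bullet> x + d)) + g t x * (\<theta> t * cos (freq L k \<bullet> x + d))
          + ((- freq L k $ i) * P t x) * (\<theta> t * cos (freq L k \<bullet> x + (d + pi / 2)))"
        by (simp only:) (simp add: pdx_tfun_eq[OF s] pdt_tfun[OF s] tfun_def g_def advection_def algebra_simps)
    qed
    finally have e: "(LINT t:{0..}|lborel. pd 1 \<theta> t * ?U t + \<theta> t * tmode L k d g t + \<theta> t * ?Q t)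
      = (LINT t:{0..}|lborel. ?pair t)"
      unfolding has_st_int[OF H] .
    have hi: "set_integrable lborel {0..} (\<lambda>t. pd 1 \<theta> t * ?U t + \<theta> t * tmode L k d g t + \<theta> t * ?Q t)"
      using H by (simp add: has_st_def)
    have fi: "set_integrable lborel {0..} (\<lambda>t. \<theta> t * fr t)" by (rule tcut_mult_integrable[OF c1 fint])
    have pr: "indicator {0..} t *\<^sub>R ?pair t = indicator {0..} t *\<^sub>R (\<theta> t * fr t)"
      if "0 \<le> t \<longrightarrow> vHdot L (-1) (f t)" for t
    proof (cases "0 \<le> t")
      case True
      then have "real_mean0 (\<lambda>n. f t n $ i)" using that by (simp add: vHdot_def Hdot_def)
      from pairing_cos[OF L this k, of "\<theta> t" d] show ?thesis by (simp add: tfun_def fr_def)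
    qed simp
    have e2: "(LINT t:{0..}|lborel. ?pair t) = (LINT t:{0..}|lborel. \<theta> t * fr t)"
    proof -
      have [measurable]: "\<theta> \<in> borel_measurable borel" using c1 by (simp add: tcut_def)
      have "(\<lambda>t. L^3 * (\<theta> t / 2) * ((f t k $ i) \<bullet> cis d + (f t (- k) $ i) \<bullet> cis (- d))) \<in> borel_measurable tpos"
        using borel_measurable_tposI[of \<theta>]
        by (intro borel_measurable_times borel_measurable_add borel_measurable_inner borel_measurable_const
            borel_measurable_divide force_component_measurable[OF f]) auto
      then have "(\<lambda>t. ?pair t) \<in> borel_measurable tpos"
        by (simp add: tfun_def pairing_cos_two_modes[OF L k])
      from borel_measurable_tpos_indicator[OF this, of "{0..}"]
      have "(\<lambda>t. indicator {0..} t *\<^sub>R ?pair t) \<in> borel_measurable lborel" by simp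
      then show ?thesis unfolding set_lebesgue_integral_def
        by (intro integral_cong_AE) (use fae pr fi in \<open>auto elim!: eventually_mono simp: set_integrable_def\<close>)
    qed
    have "(LINT \<tau>:{0..}|lborel. pd 1 \<theta> \<tau> * mode L k d (\<lambda>x. u \<tau> x $ i) + \<theta> \<tau> * F0 \<tau>)
      = (LINT t:{0..}|lborel. \<theta> t * fr t - (pd 1 \<theta> t * ?U t + \<theta> t * tmode L k d g t + \<theta> t * ?Q t))"
      unfolding set_lebesgue_integral_def
    proof (intro Bochner_Integration.integral_cong refl)
      fix t
      have m1: "?U t = - mode L k d (\<lambda>x. u t x $ i)" if "0 \<le> t"
      proof -
        have "sqi (cell L) (\<lambda>x. u t x $ i)" using c that unfolding weakly_continuous_def by (auto intro: sqi_vec_component L2s_sqi)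
        then show ?thesis by (simp add: tmode_def integral_cos_mode[OF L, symmetric] sqi_cell_integrable)
      qed
      have m2: "?Q t = - freq L k $ i * tmode L k (d + pi / 2) P t"
        by (simp add: tmode_def mult.assoc)
      show "indicator {0..} t *\<^sub>R (pd 1 \<theta> t * mode L k d (\<lambda>x. u t x $ i) + \<theta> t * F0 t)
        = indicator {0..} t *\<^sub>R (\<theta> t * fr t - (pd 1 \<theta> t * ?U t + \<theta> t * tmode L k d g t + \<theta> t * ?Q t))"
        unfolding m2 using m1 by (cases "0 \<le> t") (auto simp: F0_def algebra_simps)
    qed
    also have "\<dots> = 0" using set_integral_diff(2)[OF fi hi] e e2 by simp
    finally show ?thesis .
  qed
  have L3: "L^3 > 0" using L by simp
  show ?thesis
  proof (rule that[of "\<lambda>t. F0 t / L^3"])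
    show "set_integrable lborel {0..T} (\<lambda>t. F0 t / L^3)" if "T > 0" for T using F0i[OF that] by (intro set_integrable_divide) auto
    show "Re (cis (- d) * vfcoeff L (u t) k $ i) - Re (cis (- d) * vfcoeff L (u s) k $ i) = (LINT \<tau>:{s..t}|lborel. F0 \<tau> / L^3)"
      if st: "0 \<le> s" "s \<le> t" for s t
    proof -
      have "mode L k d (\<lambda>x. u t x $ i) - mode L k d (\<lambda>x. u s x $ i) = (LINT \<tau>:{s..t}|lborel. F0 \<tau>)"
        by (rule du_Bois_Reymond[OF weakly_continuous_mode[OF L c] F0i eq st])
      then show ?thesis using L3 by (simp add: mode_def vfcoeff_def field_simps)
    qed
    have "AE t in tpos. sqi (cell L) (\<lambda>x. u t x $ i)" using u by (simp add: tsq_def)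
    moreover have "AE t in tpos. integrable (cell L) (advection (v t) (Du t) i)"
      using ti1_sum[of UNIV L "\<lambda>j t x. v t x $ j * Du t x $ i $ j"] tsq_mult_ti1[OF v D]
      unfolding advection_def[abs_def] by (simp add: ti1_def)
    ultimately show "AE t in tpos. F0 t / L^3 = Re (cis (- d) * modal_rhs L \<nu> (f t) (u t) (v t) (Du t) (P t) k $ i)"
      using tmode_mode[OF L gi, of k d] tmode_mode[OF L Pi, of k "d + pi / 2"]
    proof eventually_elim
      case (elim t)
      have "fcoeff L (g t) k = complex_of_real (\<nu> * (norm (freq L k))\<^sup>2) * vfcoeff L (u t) k $ i + fcoeff L (advection (v t) (Du t) i) k"
        unfolding g_def[abs_def] using elim L by (subst fcoeff_add) (auto intro: sqi_cell_integrable simp: fcoeff_cmult vfcoeff_def)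
      then have "F0 t = L^3 * Re (cis (- d) * modal_rhs L \<nu> (f t) (u t) (v t) (Du t) (P t) k $ i)"
        unfolding F0_def elim(3,4) mode_shift[of L k d "P t"] unfolding fr_def mode_def modal_rhs_def by (simp add: algebra_simps)
      then show ?case using L3 by simp
    qed
  qed
qed

section \<open>Energy estimates for the filter\<close>

text \<open>
  \<open>h\<close> is the \<open>j\<close>-th derivative of \<open>g\<close> in the sense of Fourier series.
\<close>

definition has_grad :: "real \<Rightarrow> 3 \<Rightarrow> (real^3 \<Rightarrow> real) \<Rightarrow> (real^3 \<Rightarrow> real) \<Rightarrow> bool" where
  "has_grad L j g h \<longleftrightarrow> sqi (cell L) g \<and> sqi (cell L) h \<and> (\<forall>k. fcoeff L h k = \<i> * complex_of_real (freq L k $ j) * fcoeff L g k)"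

lemma weak_partial_has_grad: "L > 0 \<Longrightarrow> weak_partial L j g h \<Longrightarrow> has_grad L j g h"
  unfolding has_grad_def using fcoeff_weak_partial[of L j g h] by (auto simp: weak_partial_def intro: L2_sqi)

lemma has_grad_fcoeff: "has_grad L j g h \<Longrightarrow> fcoeff L h k = \<i> * complex_of_real (freq L k $ j) * fcoeff L g k"
  by (simp add: has_grad_def)

lemma has_grad_diff: "L > 0 \<Longrightarrow> has_grad L j g h \<Longrightarrow> has_grad L j g' h' \<Longrightarrow> has_grad L j (\<lambda>x. g x - g' x) (\<lambda>x. h x - h' x)"
  unfolding has_grad_def by (auto intro!: sqi_diff simp: fcoeff_diff sqi_cell_integrable right_diff_distrib)

text \<open>
  The filter equation at a fixed time, in Fourier coefficients: \<open>v\<close> is the filtered velocity of \<open>u\<close> with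
  Jacobian \<open>D\<close>, pressure \<open>p\<close> and the coefficient \<open>a\<close> in place of \<open>A (\<phi> * u)\<close>.
\<close>

definition filtered :: "real \<Rightarrow> real \<Rightarrow> (real^3 \<Rightarrow> real) \<Rightarrow> (real^3 \<Rightarrow> real^3) \<Rightarrow> (real^3 \<Rightarrow> real^3) \<Rightarrow> (real^3 \<Rightarrow> real^3^3) \<Rightarrow> (real^3 \<Rightarrow> real) \<Rightarrow> bool" where
  "filtered L \<alpha> a u v D p \<longleftrightarrow> (\<forall>i. sqi (cell L) (\<lambda>x. u x $ i)) \<and> (\<forall>i. sqi (cell L) (\<lambda>x. v x $ i)) \<and> vfcoeff L v 0 = 0 \<and>
    (\<forall>i j. has_grad L j (\<lambda>x. v x $ i) (\<lambda>x. D x $ i $ j)) \<and>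
    (\<forall>i j. sqi (cell L) (\<lambda>x. a x * D x $ i $ j)) \<and> sqi (cell L) p \<and>
    (\<forall>k. freq_dot L k (vfcoeff L v k) = 0) \<and>
    (\<forall>k i. - \<i> * ((\<Sum>j\<in>UNIV. complex_of_real (\<alpha>\<^sup>2 * freq L k $ j) * fcoeff L (\<lambda>x. a x * D x $ i $ j) k)
      - complex_of_real (freq L k $ i) * fcoeff L p k) + vfcoeff L v k $ i - vfcoeff L u k $ i = 0)"

lemma has_grad_sqi: "has_grad L j g h \<Longrightarrow> sqi (cell L) g" "has_grad L j g h \<Longrightarrow> sqi (cell L) h"
  by (auto simp: has_grad_def)

lemma has_sum_diff_real:
  fixes f g :: "'a \<Rightarrow> real"
  assumes "(f has_sum a) A" "(g has_sum b) A" shows "((\<lambda>x. f x - g x) has_sum (a - b)) A"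
  using has_sum_add[OF assms(1) has_sum_cmult_right[OF assms(2), of "-1"]] by simp

text \<open>
  The filter equation tested with a divergence-free field \<open>z\<close>.  By Parseval's identity both sides are sums over
  the frequencies; the \<open>k\<close>-th summands agree by the \<open>k\<close>-th equation, in which the pressure is parallel to
  the frequency and hence orthogonal to the coefficient of \<open>z\<close>.
\<close>

lemma filtered_weak_form:
  assumes L: "L > 0" and f: "filtered L \<alpha> a u v D p"
    and Z: "\<And>i j. has_grad L j (\<lambda>x. z x $ i) (\<lambda>x. Z x $ i $ j)"
    and dz: "\<And>k. freq_dot L k (vfcoeff L z k) = 0"
  shows "\<alpha>\<^sup>2 * (\<Sum>i\<in>UNIV. \<Sum>j\<in>UNIV. \<integral>x. (a x * D x $ i $ j) * Z x $ i $ j \<partial>cell L)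
    + (\<Sum>i\<in>UNIV. \<integral>x. v x $ i * z x $ i \<partial>cell L) = (\<Sum>i\<in>UNIV. \<integral>x. u x $ i * z x $ i \<partial>cell L)"
proof -
  define G where "G i j = fcoeff L (\<lambda>x. a x * D x $ i $ j)" for i j
  define T where "T k = \<alpha>\<^sup>2 * (\<Sum>i\<in>UNIV. \<Sum>j\<in>UNIV. G i j k \<bullet> fcoeff L (\<lambda>x. Z x $ i $ j) k)
     + (\<Sum>i\<in>UNIV. fcoeff L (\<lambda>x. v x $ i) k \<bullet> fcoeff L (\<lambda>x. z x $ i) k) - (\<Sum>i\<in>UNIV. fcoeff L (\<lambda>x. u x $ i) k \<bullet> fcoeff L (\<lambda>x. z x $ i) k)" for k
  have s: "sqi (cell L) (\<lambda>x. u x $ i)" "sqi (cell L) (\<lambda>x. v x $ i)" "sqi (cell L) (\<lambda>x. a x * D x $ i $ j)"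
    "sqi (cell L) (\<lambda>x. z x $ i)" "sqi (cell L) (\<lambda>x. Z x $ i $ j)" for i j
    using f has_grad_sqi[OF Z] unfolding filtered_def by auto
  have "(T has_sum (\<alpha>\<^sup>2 * (\<Sum>i\<in>UNIV. \<Sum>j\<in>UNIV. (\<integral>x. (a x * D x $ i $ j) * Z x $ i $ j \<partial>cell L) / L^3)
    + (\<Sum>i\<in>UNIV. (\<integral>x. v x $ i * z x $ i \<partial>cell L) / L^3) - (\<Sum>i\<in>UNIV. (\<integral>x. u x $ i * z x $ i \<partial>cell L) / L^3))) UNIV"
    unfolding T_def G_def by (intro has_sum_diff_real has_sum_add has_sum_cmult_right has_sum_finite_sum finite parseval_real[OF L] s)
  moreover have "T = (\<lambda>k. 0)"
  proof
    fix k
    have zc: "fcoeff L (\<lambda>x. z x $ i) k = vfcoeff L z k $ i" "fcoeff L (\<lambda>x. v x $ i) k = vfcoeff L v k $ i" "fcoeff L (\<lambda>x. u x $ i) k = vfcoeff L u k $ i" for i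
      by (simp_all add: vfcoeff_def)
    define c where "c = fcoeff L p k"
    have e: "vfcoeff L v k $ i - vfcoeff L u k $ i = \<i> * ((\<Sum>j\<in>UNIV. complex_of_real (\<alpha>\<^sup>2 * freq L k $ j) * G i j k) - complex_of_real (freq L k $ i) * c)" for i
      using f unfolding filtered_def G_def c_def by (simp add: algebra_simps)
    have "T k = \<alpha>\<^sup>2 * (\<Sum>i\<in>UNIV. \<Sum>j\<in>UNIV. G i j k \<bullet> (\<i> * complex_of_real (freq L k $ j) * vfcoeff L z k $ i))
       + (\<Sum>i\<in>UNIV. (vfcoeff L v k $ i - vfcoeff L u k $ i) \<bullet> vfcoeff L z k $ i)"
      unfolding T_def zc by (simp add: has_grad_fcoeff[OF Z] zc inner_diff_left sum_subtractf)
    also have "(\<Sum>i\<in>UNIV. (vfcoeff L v k $ i - vfcoeff L u k $ i) \<bullet> vfcoeff L z k $ i)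
       = (\<Sum>i\<in>UNIV. \<Sum>j\<in>UNIV. (\<i> * (complex_of_real (\<alpha>\<^sup>2 * freq L k $ j) * G i j k)) \<bullet> vfcoeff L z k $ i)
         - (\<Sum>i\<in>UNIV. (\<i> * (complex_of_real (freq L k $ i) * c)) \<bullet> vfcoeff L z k $ i)"
      unfolding e by (simp only: right_diff_distrib inner_diff_left sum_subtractf sum_distrib_left inner_sum_left)
    also have "(\<Sum>i\<in>UNIV. (\<i> * (complex_of_real (freq L k $ i) * c)) \<bullet> vfcoeff L z k $ i)
        = (\<i> * c) \<bullet> freq_dot L k (vfcoeff L z k)"
      unfolding inner_sum_right by (intro sum.cong refl) (simp add: inner_complex_def algebra_simps)
    also have "\<dots> = 0" unfolding dz by simp
    also have "\<alpha>\<^sup>2 * (\<Sum>i\<in>UNIV. \<Sum>j\<in>UNIV. G i j k \<bullet> (\<i> * complex_of_real (freq L k $ j) * vfcoeff L z k $ i))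
       + ((\<Sum>i\<in>UNIV. \<Sum>j\<in>UNIV. (\<i> * (complex_of_real (\<alpha>\<^sup>2 * freq L k $ j) * G i j k)) \<bullet> vfcoeff L z k $ i) - 0)
      = (\<Sum>i\<in>(UNIV::3 set). \<Sum>j\<in>(UNIV::3 set). 0)"
      unfolding sum_distrib_left diff_0_right sum.distrib[symmetric]
      by (intro sum.cong refl) (simp add: inner_complex_def algebra_simps power2_eq_square)
    finally show "T k = 0" by simp
  qed
  ultimately have "((\<lambda>k. 0::real) has_sum (\<alpha>\<^sup>2 * (\<Sum>i\<in>UNIV. \<Sum>j\<in>UNIV. (\<integral>x. (a x * D x $ i $ j) * Z x $ i $ j \<partial>cell L) / L^3)
    + (\<Sum>i\<in>UNIV. (\<integral>x. v x $ i * z x $ i \<partial>cell L) / L^3) - (\<Sum>i\<in>UNIV. (\<integral>x. u x $ i * z x $ i \<partial>cell L) / L^3))) (UNIV :: (int^3) set)"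
    by (simp only:)
  then have "\<alpha>\<^sup>2 * (\<Sum>i\<in>UNIV. \<Sum>j\<in>UNIV. (\<integral>x. (a x * D x $ i $ j) * Z x $ i $ j \<partial>cell L) / L^3)
    + (\<Sum>i\<in>UNIV. (\<integral>x. v x $ i * z x $ i \<partial>cell L) / L^3) - (\<Sum>i\<in>UNIV. (\<integral>x. u x $ i * z x $ i \<partial>cell L) / L^3) = 0"
    using has_sum_0[of UNIV "\<lambda>k::int^3. 0::real"] has_sum_unique by blast
  then have "(\<alpha>\<^sup>2 * (\<Sum>i\<in>UNIV. \<Sum>j\<in>UNIV. \<integral>x. (a x * D x $ i $ j) * Z x $ i $ j \<partial>cell L)
    + (\<Sum>i\<in>UNIV. \<integral>x. v x $ i * z x $ i \<partial>cell L) - (\<Sum>i\<in>UNIV. \<integral>x. u x $ i * z x $ i \<partial>cell L)) / L^3 = 0"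
    by (simp only: sum_divide_distrib[symmetric] add_divide_distrib diff_divide_distrib times_divide_eq_right)
  then show ?thesis using L by simp
qed

text \<open>
  The square of the \<open>L\<^sup>2\<close> norm of a matrix field.
\<close>

abbreviation grad_sq :: "real \<Rightarrow> (real^3 \<Rightarrow> 3 \<Rightarrow> 3 \<Rightarrow> real) \<Rightarrow> real" where
  "grad_sq L G \<equiv> (\<Sum>i\<in>UNIV. \<Sum>j\<in>UNIV. \<integral>x. (G x i j)\<^sup>2 \<partial>cell L)"

text \<open>
  The Sobolev norm of a mean-zero field by integrals over the cell.
\<close>

lemma Hsob_norm_parseval:
  assumes L: "L > 0" and Z: "\<And>i j. has_grad L j (\<lambda>x. z x $ i) (\<lambda>x. Z x $ i $ j)" and z0: "vfcoeff L z 0 = 0"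
  shows "(Hsob_norm L 1 (vfcoeff L z))\<^sup>2 = (\<Sum>i\<in>UNIV. \<integral>x. (z x $ i)\<^sup>2 \<partial>cell L) + grad_sq L (\<lambda>x i j. Z x $ i $ j)"
    and "((\<lambda>n. (norm (freq L n))\<^sup>2 * (norm (vfcoeff L z n))\<^sup>2) has_sum grad_sq L (\<lambda>x i j. Z x $ i $ j) / L^3) UNIV"
proof -
  have s: "sqi (cell L) (\<lambda>x. z x $ i)" "sqi (cell L) (\<lambda>x. Z x $ i $ j)" for i j using has_grad_sqi[OF Z] by auto
  have "((\<lambda>n. \<Sum>i\<in>UNIV. \<Sum>j\<in>UNIV. (norm (fcoeff L (\<lambda>x. Z x $ i $ j) n))\<^sup>2) has_sum (\<Sum>i\<in>UNIV. \<Sum>j\<in>UNIV. (\<integral>x. (Z x $ i $ j)\<^sup>2 \<partial>cell L) / L^3)) UNIV"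
    by (intro has_sum_finite_sum finite parseval_component L s)
  moreover have "(\<Sum>i\<in>UNIV. \<Sum>j\<in>UNIV. (norm (fcoeff L (\<lambda>x. Z x $ i $ j) n))\<^sup>2) = (norm (freq L n))\<^sup>2 * (norm (vfcoeff L z n))\<^sup>2" for n
    by (simp add: has_grad_fcoeff[OF Z] norm_mult power_mult_distrib norm_vec_complex norm_vec_real vfcoeff_def
        sum_distrib_right[symmetric] sum_distrib_left[symmetric])
  ultimately show h: "((\<lambda>n. (norm (freq L n))\<^sup>2 * (norm (vfcoeff L z n))\<^sup>2) has_sum grad_sq L (\<lambda>x i j. Z x $ i $ j) / L^3) UNIV"
    by (simp add: sum_divide_distrib)
  have "((\<lambda>n. \<Sum>i\<in>UNIV. (norm (fcoeff L (\<lambda>x. z x $ i) n))\<^sup>2) has_sum (\<Sum>i\<in>UNIV. (\<integral>x. (z x $ i)\<^sup>2 \<partial>cell L) / L^3)) UNIV"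
    by (intro has_sum_finite_sum finite parseval_component L s)
  then have "((\<lambda>n. (norm (vfcoeff L z n))\<^sup>2) has_sum (\<Sum>i\<in>UNIV. \<integral>x. (z x $ i)\<^sup>2 \<partial>cell L) / L^3) UNIV"
    by (simp add: norm_vec_complex vfcoeff_def sum_divide_distrib)
  from has_sum_add[OF this h]
  have "((\<lambda>n. (1 + (norm (freq L n))\<^sup>2) * (norm (vfcoeff L z n))\<^sup>2) has_sum
     ((\<Sum>i\<in>UNIV. \<integral>x. (z x $ i)\<^sup>2 \<partial>cell L) + grad_sq L (\<lambda>x i j. Z x $ i $ j)) / L^3) UNIV"
    by (simp add: distrib_right add_divide_distrib)
  then have "((\<lambda>n. (1 + (norm (freq L n))\<^sup>2) * (norm (vfcoeff L z n))\<^sup>2) has_sum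
     ((\<Sum>i\<in>UNIV. \<integral>x. (z x $ i)\<^sup>2 \<partial>cell L) + grad_sq L (\<lambda>x i j. Z x $ i $ j)) / L^3) (- {0})"
    by (rule has_sum_cong_neutral[THEN iffD1, rotated 3]) (use z0 in auto)
  then have "(\<Sum>\<^sub>\<infinity>n\<in>- {0}. (1 + (norm (freq L n))\<^sup>2) powr 1 * (norm (vfcoeff L z n))\<^sup>2)
     = ((\<Sum>i\<in>UNIV. \<integral>x. (z x $ i)\<^sup>2 \<partial>cell L) + grad_sq L (\<lambda>x i j. Z x $ i $ j)) / L^3"
    by (intro infsumI) (simp add: add_pos_nonneg)
  then show "(Hsob_norm L 1 (vfcoeff L z))\<^sup>2 = (\<Sum>i\<in>UNIV. \<integral>x. (z x $ i)\<^sup>2 \<partial>cell L) + grad_sq L (\<lambda>x i j. Z x $ i $ j)"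
    using L unfolding Hsob_norm_def by (simp add: sum_nonneg integral_nonneg_AE)
qed

lemma integral_le_integral_sq:
  assumes "sqi M f" "sqi M g"
  shows "(\<integral>x. f x * g x \<partial>M) \<le> (\<integral>x. (f x)\<^sup>2 \<partial>M) / 2 + (\<integral>x. (g x :: real)\<^sup>2 \<partial>M) / 2"
proof -
  have i: "integrable M (\<lambda>x. (f x)\<^sup>2)" "integrable M (\<lambda>x. (g x)\<^sup>2)" using assms by (auto simp: sqi_def)
  have "(\<integral>x. f x * g x \<partial>M) \<le> (\<integral>x. (f x)\<^sup>2 / 2 + (g x)\<^sup>2 / 2 \<partial>M)"
  proof (rule integral_mono)
    fix x show "f x * g x \<le> (f x)\<^sup>2 / 2 + (g x)\<^sup>2 / 2" using sum_squares_bound[of "f x" "g x"] by simp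
  qed (use i sqi_mult_integrable[OF assms] in auto)
  also have "\<dots> = (\<integral>x. (f x)\<^sup>2 \<partial>M) / 2 + (\<integral>x. (g x)\<^sup>2 \<partial>M) / 2" using i by simp
  finally show ?thesis .
qed

text \<open>
  Test the filter equation with its solution.
\<close>

lemma filtered_energy:
  assumes L: "L > 0" and b: "\<beta> > 0" and a: "\<And>x. \<beta> \<le> a x" "a \<in> borel_measurable (cell L)" and f: "filtered L \<alpha> a u v D p"
  shows "2 * \<alpha>\<^sup>2 * \<beta> * grad_sq L (\<lambda>x i j. D x $ i $ j) + (\<Sum>i\<in>UNIV. \<integral>x. (v x $ i)\<^sup>2 \<partial>cell L)
    \<le> (\<Sum>i\<in>UNIV. \<integral>x. (u x $ i)\<^sup>2 \<partial>cell L)"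
proof -
  have D: "\<And>i j. has_grad L j (\<lambda>x. v x $ i) (\<lambda>x. D x $ i $ j)" and dv: "\<And>k. freq_dot L k (vfcoeff L v k) = 0"
    and s: "\<And>i. sqi (cell L) (\<lambda>x. u x $ i)" "\<And>i. sqi (cell L) (\<lambda>x. v x $ i)" "\<And>i j. sqi (cell L) (\<lambda>x. a x * D x $ i $ j)"
    using f unfolding filtered_def by auto
  have sD: "sqi (cell L) (\<lambda>x. D x $ i $ j)" for i j using has_grad_sqi[OF D] by auto
  have "\<beta> * grad_sq L (\<lambda>x i j. D x $ i $ j) \<le> (\<Sum>i\<in>UNIV. \<Sum>j\<in>UNIV. \<integral>x. (a x * D x $ i $ j) * D x $ i $ j \<partial>cell L)"
    unfolding sum_distrib_left
  proof (intro sum_mono)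
    fix i j :: 3
    have "\<beta> * (\<integral>x. (D x $ i $ j)\<^sup>2 \<partial>cell L) = (\<integral>x. \<beta> * (D x $ i $ j)\<^sup>2 \<partial>cell L)" by simp
    also have "\<dots> \<le> (\<integral>x. (a x * D x $ i $ j) * D x $ i $ j \<partial>cell L)"
    proof (rule integral_mono)
      fix x
      have "\<beta> * (D x $ i $ j)\<^sup>2 \<le> a x * (D x $ i $ j)\<^sup>2" by (intro mult_right_mono a) auto
      then show "\<beta> * (D x $ i $ j)\<^sup>2 \<le> (a x * D x $ i $ j) * D x $ i $ j" by (simp add: power2_eq_square mult.assoc)
    qed (use sD[of i j] sqi_mult_integrable[OF s(3) sD] in \<open>auto simp: sqi_def\<close>)
    finally show "\<beta> * (\<integral>x. (D x $ i $ j)\<^sup>2 \<partial>cell L) \<le> (\<integral>x. (a x * D x $ i $ j) * D x $ i $ j \<partial>cell L)" .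
  qed
  then have "\<alpha>\<^sup>2 * (\<beta> * grad_sq L (\<lambda>x i j. D x $ i $ j)) \<le> \<alpha>\<^sup>2 * (\<Sum>i\<in>UNIV. \<Sum>j\<in>UNIV. \<integral>x. (a x * D x $ i $ j) * D x $ i $ j \<partial>cell L)"
    by (intro mult_left_mono) auto
  also have "\<dots> = (\<Sum>i\<in>UNIV. \<integral>x. u x $ i * v x $ i \<partial>cell L) - (\<Sum>i\<in>UNIV. \<integral>x. (v x $ i)\<^sup>2 \<partial>cell L)"
    using filtered_weak_form[OF L f D dv] by (simp add: power2_eq_square)
  also have "(\<Sum>i\<in>UNIV. \<integral>x. u x $ i * v x $ i \<partial>cell L) \<le> (\<Sum>i\<in>UNIV. (\<integral>x. (u x $ i)\<^sup>2 \<partial>cell L) / 2 + (\<integral>x. (v x $ i)\<^sup>2 \<partial>cell L) / 2)"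
    by (intro sum_mono integral_le_integral_sq s)
  finally show ?thesis by (simp add: sum.distrib sum_divide_distrib[symmetric])
qed

text \<open>
  Test the difference of two filter equations with \<open>z = v1 - v2\<close>.  With \<open>Z = D1 - D2\<close> the flux difference is
  \<open>a1 Z + (a1 - a2) D2\<close>: the first part is coercive, and the second is absorbed by half of it at the price
  of \<open>\<kappa>\<^sup>2 / (2 \<beta>)\<close> times the square of \<open>D2\<close>.
\<close>

lemma filtered_difference_energy:
  assumes L: "L > 0" and b: "\<beta> > 0" and a: "\<And>x. \<beta> \<le> a1 x" "a1 \<in> borel_measurable (cell L)" "a2 \<in> borel_measurable (cell L)"
    and f1: "filtered L \<alpha> a1 u1 v1 D1 p1" and f2: "filtered L \<alpha> a2 u2 v2 D2 p2"
    and k: "\<And>x. \<bar>a1 x - a2 x\<bar> \<le> \<kappa>"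
  shows "\<alpha>\<^sup>2 * \<beta> * grad_sq L (\<lambda>x i j. D1 x $ i $ j - D2 x $ i $ j) + (\<Sum>i\<in>UNIV. \<integral>x. (v1 x $ i - v2 x $ i)\<^sup>2 \<partial>cell L)
    \<le> (\<Sum>i\<in>UNIV. \<integral>x. (u1 x $ i - u2 x $ i)\<^sup>2 \<partial>cell L) + \<alpha>\<^sup>2 * (\<kappa>\<^sup>2 / \<beta>) * grad_sq L (\<lambda>x i j. D2 x $ i $ j)"
proof -
  define z where "z x = v1 x - v2 x" for x
  define Z where "Z x = D1 x - D2 x" for x
  have D: "\<And>i j. has_grad L j (\<lambda>x. v1 x $ i) (\<lambda>x. D1 x $ i $ j)" "\<And>i j. has_grad L j (\<lambda>x. v2 x $ i) (\<lambda>x. D2 x $ i $ j)"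
    and s: "\<And>i. sqi (cell L) (\<lambda>x. u1 x $ i)" "\<And>i. sqi (cell L) (\<lambda>x. u2 x $ i)" "\<And>i. sqi (cell L) (\<lambda>x. v1 x $ i)" "\<And>i. sqi (cell L) (\<lambda>x. v2 x $ i)"
      "\<And>i j. sqi (cell L) (\<lambda>x. a1 x * D1 x $ i $ j)" "\<And>i j. sqi (cell L) (\<lambda>x. a2 x * D2 x $ i $ j)"
    and dv: "\<And>k. freq_dot L k (vfcoeff L v1 k) = 0" "\<And>k. freq_dot L k (vfcoeff L v2 k) = 0"
    using f1 f2 unfolding filtered_def by auto
  have sD: "sqi (cell L) (\<lambda>x. D1 x $ i $ j)" "sqi (cell L) (\<lambda>x. D2 x $ i $ j)" for i j using has_grad_sqi[OF D(1)] has_grad_sqi[OF D(2)] by auto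
  have Zw: "has_grad L j (\<lambda>x. z x $ i) (\<lambda>x. Z x $ i $ j)" for i j
    unfolding z_def Z_def by (simp add: has_grad_diff[OF L D(1) D(2)])
  have dz: "freq_dot L k (vfcoeff L z k) = 0" for k
  proof -
    have "vfcoeff L z k $ j = vfcoeff L v1 k $ j - vfcoeff L v2 k $ j" for j
      unfolding z_def vfcoeff_def using s(3,4)[THEN sqi_cell_integrable] L by (simp add: fcoeff_diff)
    then show ?thesis using dv[of k] by (simp add: right_diff_distrib sum_subtractf)
  qed
  have sz: "sqi (cell L) (\<lambda>x. z x $ i)" and sZ: "sqi (cell L) (\<lambda>x. Z x $ i $ j)" for i j
    using has_grad_sqi[OF Zw] by auto
  have sw: "sqi (cell L) (\<lambda>x. u1 x $ i - u2 x $ i)" for i by (intro sqi_diff s)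
  note w1 = filtered_weak_form[OF L f1 Zw dz] and w2 = filtered_weak_form[OF L f2 Zw dz]
  have main: "\<alpha>\<^sup>2 * (\<Sum>i\<in>UNIV. \<Sum>j\<in>UNIV. \<integral>x. (a1 x * D1 x $ i $ j - a2 x * D2 x $ i $ j) * Z x $ i $ j \<partial>cell L)
    + (\<Sum>i\<in>UNIV. \<integral>x. (z x $ i)\<^sup>2 \<partial>cell L) = (\<Sum>i\<in>UNIV. \<integral>x. (u1 x $ i - u2 x $ i) * z x $ i \<partial>cell L)"
  proof -
    have "(\<integral>x. (a1 x * D1 x $ i $ j - a2 x * D2 x $ i $ j) * Z x $ i $ j \<partial>cell L)
      = (\<integral>x. (a1 x * D1 x $ i $ j) * Z x $ i $ j \<partial>cell L) - (\<integral>x. (a2 x * D2 x $ i $ j) * Z x $ i $ j \<partial>cell L)" for i j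
      unfolding left_diff_distrib by (rule Bochner_Integration.integral_diff[OF sqi_mult_integrable[OF s(5) sZ] sqi_mult_integrable[OF s(6) sZ]])
    moreover have "(\<integral>x. (u1 x $ i - u2 x $ i) * z x $ i \<partial>cell L) = (\<integral>x. u1 x $ i * z x $ i \<partial>cell L) - (\<integral>x. u2 x $ i * z x $ i \<partial>cell L)" for i
      unfolding left_diff_distrib by (rule Bochner_Integration.integral_diff[OF sqi_mult_integrable[OF s(1) sz] sqi_mult_integrable[OF s(2) sz]])
    moreover have "(\<integral>x. (z x $ i)\<^sup>2 \<partial>cell L) = (\<integral>x. v1 x $ i * z x $ i \<partial>cell L) - (\<integral>x. v2 x $ i * z x $ i \<partial>cell L)" for i
    proof -
      have "(\<integral>x. (z x $ i)\<^sup>2 \<partial>cell L) = (\<integral>x. v1 x $ i * z x $ i - v2 x $ i * z x $ i \<partial>cell L)"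
        by (simp add: z_def power2_eq_square left_diff_distrib)
      then show ?thesis using Bochner_Integration.integral_diff[OF sqi_mult_integrable[OF s(3) sz] sqi_mult_integrable[OF s(4) sz]] by simp
    qed
    ultimately show ?thesis using w1 w2 by (simp add: sum_subtractf right_diff_distrib)
  qed
  have low: "(\<beta> / 2) * (\<integral>x. (Z x $ i $ j)\<^sup>2 \<partial>cell L) - (\<kappa>\<^sup>2 / (2 * \<beta>)) * (\<integral>x. (D2 x $ i $ j)\<^sup>2 \<partial>cell L)
      \<le> (\<integral>x. (a1 x * D1 x $ i $ j - a2 x * D2 x $ i $ j) * Z x $ i $ j \<partial>cell L)" for i j
  proof -
    have "(\<beta> / 2) * (\<integral>x. (Z x $ i $ j)\<^sup>2 \<partial>cell L) - (\<kappa>\<^sup>2 / (2 * \<beta>)) * (\<integral>x. (D2 x $ i $ j)\<^sup>2 \<partial>cell L)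
      = (\<integral>x. (\<beta> / 2) * (Z x $ i $ j)\<^sup>2 - (\<kappa>\<^sup>2 / (2 * \<beta>)) * (D2 x $ i $ j)\<^sup>2 \<partial>cell L)"
      using sZ[of i j] sD(2)[of i j] by (simp add: sqi_def)
    also have "\<dots> \<le> (\<integral>x. (a1 x * D1 x $ i $ j - a2 x * D2 x $ i $ j) * Z x $ i $ j \<partial>cell L)"
    proof (rule integral_mono)
      fix x
      define d e c where "d = Z x $ i $ j" and "e = D2 x $ i $ j" and "c = a1 x - a2 x"
      have eq: "(a1 x * D1 x $ i $ j - a2 x * D2 x $ i $ j) * Z x $ i $ j = a1 x * d\<^sup>2 + c * e * d"
        by (simp add: d_def e_def c_def Z_def power2_eq_square algebra_simps)
      have "\<beta> * d\<^sup>2 \<le> a1 x * d\<^sup>2" by (intro mult_right_mono a) auto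
      moreover have "- (c * e * d) \<le> (\<beta> / 2) * d\<^sup>2 + (c\<^sup>2 / (2 * \<beta>)) * e\<^sup>2"
      proof -
        have "0 \<le> (\<beta> * d + c * e)\<^sup>2 / (2 * \<beta>)" using b by simp
        also have "\<dots> = (\<beta> / 2) * d\<^sup>2 + (c\<^sup>2 / (2 * \<beta>)) * e\<^sup>2 + c * e * d" using b by (simp add: power2_eq_square field_simps)
        finally show ?thesis by simp
      qed
      moreover have "(c\<^sup>2 / (2 * \<beta>)) * e\<^sup>2 \<le> (\<kappa>\<^sup>2 / (2 * \<beta>)) * e\<^sup>2"
      proof (intro mult_right_mono divide_right_mono)
        show "c\<^sup>2 \<le> \<kappa>\<^sup>2" using power_mono[OF k[of x], of 2] by (simp add: c_def)
      qed (use b in auto)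
      ultimately show "(\<beta> / 2) * (Z x $ i $ j)\<^sup>2 - (\<kappa>\<^sup>2 / (2 * \<beta>)) * (D2 x $ i $ j)\<^sup>2 \<le> (a1 x * D1 x $ i $ j - a2 x * D2 x $ i $ j) * Z x $ i $ j"
        unfolding eq unfolding d_def[symmetric] e_def[symmetric] by linarith
    qed (use sZ[of i j] sD(2)[of i j] sqi_mult_integrable[OF sqi_diff[OF s(5) s(6)] sZ] in \<open>auto simp: sqi_def\<close>)
    finally show ?thesis .
  qed
  have "(\<beta> / 2) * grad_sq L (\<lambda>x i j. Z x $ i $ j) - (\<kappa>\<^sup>2 / (2 * \<beta>)) * grad_sq L (\<lambda>x i j. D2 x $ i $ j)
     \<le> (\<Sum>i\<in>UNIV. \<Sum>j\<in>UNIV. \<integral>x. (a1 x * D1 x $ i $ j - a2 x * D2 x $ i $ j) * Z x $ i $ j \<partial>cell L)"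
    unfolding sum_distrib_left sum_subtractf[symmetric] by (intro sum_mono low)
  then have "\<alpha>\<^sup>2 * ((\<beta> / 2) * grad_sq L (\<lambda>x i j. Z x $ i $ j) - (\<kappa>\<^sup>2 / (2 * \<beta>)) * grad_sq L (\<lambda>x i j. D2 x $ i $ j))
     \<le> \<alpha>\<^sup>2 * (\<Sum>i\<in>UNIV. \<Sum>j\<in>UNIV. \<integral>x. (a1 x * D1 x $ i $ j - a2 x * D2 x $ i $ j) * Z x $ i $ j \<partial>cell L)"
    by (intro mult_left_mono) auto
  also have "\<dots> = (\<Sum>i\<in>UNIV. \<integral>x. (u1 x $ i - u2 x $ i) * z x $ i \<partial>cell L) - (\<Sum>i\<in>UNIV. \<integral>x. (z x $ i)\<^sup>2 \<partial>cell L)"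
    using main by simp
  also have "(\<Sum>i\<in>UNIV. \<integral>x. (u1 x $ i - u2 x $ i) * z x $ i \<partial>cell L)
     \<le> (\<Sum>i\<in>UNIV. (\<integral>x. (u1 x $ i - u2 x $ i)\<^sup>2 \<partial>cell L) / 2 + (\<integral>x. (z x $ i)\<^sup>2 \<partial>cell L) / 2)"
    by (intro sum_mono integral_le_integral_sq sw sz)
  finally have "\<alpha>\<^sup>2 * ((\<beta> / 2) * grad_sq L (\<lambda>x i j. Z x $ i $ j)) - \<alpha>\<^sup>2 * ((\<kappa>\<^sup>2 / (2 * \<beta>)) * grad_sq L (\<lambda>x i j. D2 x $ i $ j))
     \<le> (\<Sum>i\<in>UNIV. \<integral>x. (u1 x $ i - u2 x $ i)\<^sup>2 \<partial>cell L) / 2 - (\<Sum>i\<in>UNIV. \<integral>x. (z x $ i)\<^sup>2 \<partial>cell L) / 2"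
    by (simp add: sum.distrib sum_divide_distrib[symmetric] right_diff_distrib)
  then show ?thesis by (simp add: z_def Z_def)
qed

section \<open>Boundedness of the convolution, Lipschitz continuity of the filter coefficient\<close>

lemma periodic_axis:
  assumes "periodic L g" shows "g (x + (L * real_of_int m) *\<^sub>R axis i 1) = g x"
proof -
  have nat: "g (x + (L * real n) *\<^sub>R axis i 1) = g x" for n x
  proof (induction n)
    case (Suc n)
    have "x + (L * real (Suc n)) *\<^sub>R axis i 1 = (x + (L * real n) *\<^sub>R axis i 1) + L *\<^sub>R axis i 1"
      by (simp add: distrib_left scaleR_add_left add_ac)
    then show ?case using Suc assms unfolding periodic_def by metis
  qed simp
  show ?thesis
  proof (cases "m \<ge> 0")
    case True then show ?thesis using nat[of x "nat m"] by simp
  next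
    case False
    then have "g ((x + (L * real_of_int m) *\<^sub>R axis i 1) + (L * real (nat (- m))) *\<^sub>R axis i 1) = g (x + (L * real_of_int m) *\<^sub>R axis i 1)"
      by (intro nat)
    then show ?thesis using False by simp
  qed
qed

lemma periodic_lattice:
  assumes "periodic L g" shows "g (x + L *\<^sub>R (\<chi> i. real_of_int (m $ i))) = g (x :: real^3)"
proof -
  have e: "L *\<^sub>R (\<chi> i. real_of_int (m $ i)) = (\<Sum>i\<in>UNIV. (L * real_of_int (m $ i)) *\<^sub>R axis i (1::real))"
    by (simp add: vec_eq_iff axis_def if_distrib cong: if_cong)
  have "g (x + (\<Sum>i\<in>I. (L * real_of_int (m $ i)) *\<^sub>R axis i 1)) = g x" if "finite I" for I :: "3 set"
    using that
  proof (induction I rule: finite_induct)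
    case (insert i I)
    then show ?case using periodic_axis[OF assms, of "x + (\<Sum>i\<in>I. (L * real_of_int (m $ i)) *\<^sub>R axis i 1)" "m $ i" i]
      by (simp add: add_ac)
  qed simp
  then show ?thesis unfolding e by simp
qed

lemma nn_integral_translate: "f \<in> borel_measurable borel \<Longrightarrow> (\<integral>\<^sup>+y. f (c + y) \<partial>lborel) = (\<integral>\<^sup>+y. f y \<partial>(lborel :: (real^3) measure))"
  using nn_integral_distr[of "(+) c" lborel borel f] by (simp add: lborel_distr_plus)

lemma nn_integral_reflect: "f \<in> borel_measurable borel \<Longrightarrow> (\<integral>\<^sup>+y. f (c - y) \<partial>lborel) = (\<integral>\<^sup>+y. f y \<partial>(lborel :: (real^3) measure))"
proof -
  assume f: "f \<in> borel_measurable borel"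
  have "lborel = density (distr lborel borel (\<lambda>x::real^3. c + (-1) *\<^sub>R x)) (\<lambda>_. ennreal (\<bar>-1\<bar> ^ DIM(real^3)))"
    by (rule lborel_affine) simp
  then have d: "distr lborel borel (\<lambda>x. c - x) = lborel" by (simp add: density_1)
  have "(\<integral>\<^sup>+y. f (c - y) \<partial>lborel) = (\<integral>\<^sup>+y. f y \<partial>(distr lborel borel (\<lambda>x. c - x)))"
    using f by (subst nn_integral_distr) auto
  then show ?thesis unfolding d .
qed

text \<open>
  After a shift by a period, \<open>x\<close> lies in the cell, so that the reflected cell \<open>x - Q\<close> is covered by the
  translates of \<open>Q\<close> by the periods in \<open>zbox 1\<close>.  The bound is uniform in \<open>x\<close>, as \<open>conv_bounded_L2\<close>
  demands.
\<close>

lemma periodic_reflected_integral_bound: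
  assumes L: "L > 0" and f: "f \<in> borel_measurable borel" and p: "periodic L f"
  shows "(\<integral>\<^sup>+y. indicator (cbox 0 (\<chi> i. L)) y * f (x - y) \<partial>lborel) \<le> of_nat (card (zbox 1)) * (\<integral>\<^sup>+y. indicator (cbox 0 (\<chi> i. L)) y * f y \<partial>(lborel :: (real^3) measure))"
proof -
  define Q where "Q = cbox (0::real^3) (\<chi> i. L)"
  have Qm: "Q \<in> sets borel" by (simp add: Q_def)
  define m :: "int^3" where "m = (\<chi> i. \<lfloor>x $ i / L\<rfloor>)"
  define x' where "x' = x - L *\<^sub>R (\<chi> i. real_of_int (m $ i))"
  have x': "0 \<le> x' $ i \<and> x' $ i \<le> L" for i
  proof -
    have "real_of_int (m $ i) \<le> x $ i / L" "x $ i / L \<le> real_of_int (m $ i) + 1" by (auto simp: m_def)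
    then have "L * real_of_int (m $ i) \<le> x $ i" "x $ i \<le> L * (real_of_int (m $ i) + 1)" using L by (simp_all add: field_simps)
    then show ?thesis by (simp add: x'_def algebra_simps)
  qed
  define t where "t n = L *\<^sub>R (\<chi> i. real_of_int (n $ i))" for n :: "int^3"
  have fx: "f (x - y) = f (x' - y)" for y
    using periodic_lattice[OF p, of "x' - y" m] by (simp add: x'_def algebra_simps)
  have cover: "indicator Q (x' - z) \<le> (\<Sum>n\<in>zbox 1. indicator Q (t n + z) :: ennreal)" for z
  proof (cases "x' - z \<in> Q")
    case True
    then have z: "- L \<le> z $ i \<and> z $ i \<le> L" for i using x'[of i] by (auto simp: Q_def mem_box_cart dest!: spec[of _ i])
    \<comment> \<open>coordinates below \<open>0\<close> are moved up by one period; the others already lie in the cell\<close>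
    define n :: "int^3" where "n = (\<chi> i. if z $ i < 0 then 1 else 0)"
    have n: "n \<in> zbox 1" by (auto simp: zbox_def n_def)
    have zz: "0 \<le> L + z $ i" "z $ i \<le> L" for i using z[of i] by auto
    have "t n + z \<in> Q" using zz L unfolding Q_def mem_box_cart by (auto simp: t_def n_def)
    then have "1 \<le> (indicator Q (t n + z) :: ennreal)" by simp
    also have "\<dots> \<le> (\<Sum>n\<in>zbox 1. indicator Q (t n + z))" by (rule member_le_sum[OF n]) (auto simp: finite_zbox)
    finally show ?thesis using True by simp
  qed simp
  have "(\<integral>\<^sup>+y. indicator Q y * f (x - y) \<partial>lborel) = (\<integral>\<^sup>+y. indicator Q (x' - (x' - y)) * f (x' - y) \<partial>lborel)" by (simp add: fx)
  also have "\<dots> = (\<integral>\<^sup>+z. indicator Q (x' - z) * f z \<partial>lborel)"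
  proof (rule nn_integral_reflect)
    have "(\<lambda>z. indicator Q (x' - z) :: ennreal) \<in> borel_measurable borel"
      by (rule measurable_compose[of "\<lambda>z. x' - z" borel borel]) (use Qm in auto)
    then show "(\<lambda>z. indicator Q (x' - z) * f z) \<in> borel_measurable borel" using f by measurable
  qed
  also have "\<dots> \<le> (\<integral>\<^sup>+z. (\<Sum>n\<in>zbox 1. indicator Q (t n + z) * f z) \<partial>lborel)"
    by (intro nn_integral_mono) (use cover in \<open>auto simp: sum_distrib_right[symmetric] intro!: mult_right_mono\<close>)
  also have "\<dots> = (\<Sum>n\<in>zbox 1. \<integral>\<^sup>+z. indicator Q (t n + z) * f z \<partial>lborel)"
  proof (rule nn_integral_sum)
    fix n
    have "(\<lambda>z. indicator Q (t n + z) :: ennreal) \<in> borel_measurable borel"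
      by (rule measurable_compose[of "\<lambda>z. t n + z" borel borel]) (use Qm in auto)
    then show "(\<lambda>z. indicator Q (t n + z) * f z) \<in> borel_measurable lborel" using f by measurable
  qed
  also have "\<dots> = (\<Sum>n\<in>zbox 1. \<integral>\<^sup>+z. indicator Q z * f z \<partial>lborel)"
  proof (intro sum.cong refl)
    fix n
    have "f z = f (t n + z)" for z using periodic_lattice[OF p, of z n] by (simp add: t_def add.commute)
    then have "(\<integral>\<^sup>+z. indicator Q (t n + z) * f z \<partial>lborel) = (\<integral>\<^sup>+z. indicator Q (t n + z) * f (t n + z) \<partial>lborel)" by simp
    also have "\<dots> = (\<integral>\<^sup>+z. indicator Q z * f z \<partial>lborel)"
      by (rule nn_integral_translate[where f="\<lambda>z. indicator Q z * f z"]) (use f Qm in measurable)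
    finally show "(\<integral>\<^sup>+z. indicator Q (t n + z) * f z \<partial>lborel) = (\<integral>\<^sup>+z. indicator Q z * f z \<partial>lborel)" .
  qed
  finally show ?thesis unfolding Q_def by simp
qed

lemma sqi_cell_iff:
  assumes "f \<in> borel_measurable borel"
  shows "sqi (cell L) f \<longleftrightarrow> (\<integral>\<^sup>+y. indicator (cbox 0 (\<chi> i. L)) y * ennreal ((norm (f y))\<^sup>2) \<partial>lborel) < \<infinity>"
proof -
  have "sqi (cell L) f \<longleftrightarrow> integrable (cell L) (\<lambda>y. (norm (f y))\<^sup>2)" using assms borel_measurable_cell by (auto simp: sqi_def)
  also have "\<dots> \<longleftrightarrow> integrable lborel (\<lambda>y. indicator (cbox 0 (\<chi> i. L)) y *\<^sub>R (norm (f y))\<^sup>2)"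
    unfolding cell_def by (subst integrable_restrict_space) auto
  also have "\<dots> \<longleftrightarrow> (\<integral>\<^sup>+y. indicator (cbox 0 (\<chi> i. L)) y * ennreal ((norm (f y))\<^sup>2) \<partial>lborel) < \<infinity>"
  proof -
    have "(\<lambda>y. indicator (cbox 0 (\<chi> i. L)) y *\<^sub>R (norm (f y))\<^sup>2) \<in> borel_measurable lborel" using assms by measurable
    moreover have "ennreal (norm (indicator (cbox 0 (\<chi> i. L)) y *\<^sub>R (norm (f y))\<^sup>2)) = indicator (cbox 0 (\<chi> i. L)) y * ennreal ((norm (f y))\<^sup>2)" for y
      by (simp add: indicator_def)
    ultimately show ?thesis unfolding integrable_iff_bounded by simp
  qed
  finally show ?thesis .
qed

lemma integral_cell_nn:
  assumes "sqi (cell L) f" "f \<in> borel_measurable borel"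
  shows "ennreal (\<integral>y. (norm (f y))\<^sup>2 \<partial>cell L) = (\<integral>\<^sup>+y. indicator (cbox 0 (\<chi> i. L)) y * ennreal ((norm (f y))\<^sup>2) \<partial>lborel)"
proof -
  have "ennreal (\<integral>y. (norm (f y))\<^sup>2 \<partial>cell L) = (\<integral>\<^sup>+y. ennreal ((norm (f y))\<^sup>2) \<partial>cell L)"
    by (rule nn_integral_eq_integral[symmetric]) (use assms in \<open>auto simp: sqi_def\<close>)
  also have "\<dots> = (\<integral>\<^sup>+y. ennreal ((norm (f y))\<^sup>2) * indicator (cbox 0 (\<chi> i. L)) y \<partial>lborel)"
    unfolding cell_def by (rule nn_integral_restrict_space) simp
  finally show ?thesis by (simp add: mult.commute)
qed

text \<open>
  Convolution with \<open>\<phi>\<close> maps \<open>L\<^sup>2\<close> to bounded functions, and it respects differences.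
\<close>

definition conv_bounded :: "real \<Rightarrow> (real^3 \<Rightarrow> real) \<Rightarrow> real \<Rightarrow> bool" where
  "conv_bounded L \<phi> C \<longleftrightarrow> C \<ge> 0 \<and>
     (\<forall>v x. sqi (cell L) v \<longrightarrow> norm (conv L \<phi> v x) \<le> C * L2_norm L v) \<and>
     (\<forall>v w x. sqi (cell L) v \<longrightarrow> sqi (cell L) w \<longrightarrow> conv L \<phi> (\<lambda>y. v y - w y) x = conv L \<phi> v x - conv L \<phi> w x)"

text \<open>
  The Cauchy-Schwarz inequality, with the norm of \<open>y \<mapsto> \<phi> (x - y)\<close> bounded uniformly in \<open>x\<close>.
\<close>

lemma conv_bounded_L2:
  assumes L: "L > 0" and \<phi>: "L2 L \<phi>"
  obtains C where "conv_bounded L \<phi> C"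
proof -
  have ps: "sqi (cell L) \<phi>" and pm: "\<phi> \<in> borel_measurable borel" and pp: "periodic L \<phi>" using L2_sqi[OF \<phi>] \<phi> by (auto simp: L2_def)
  define N where "N = real (card (zbox 1)) * (\<integral>y. (norm (\<phi> y))\<^sup>2 \<partial>cell L)"
  have N: "N \<ge> 0" by (simp add: N_def integral_nonneg_AE)
  have xm: "(\<lambda>y. \<phi> (x - y)) \<in> borel_measurable borel" for x
    using measurable_compose[of "\<lambda>y. x - y" borel borel \<phi>] pm by simp
  have bd: "(\<integral>\<^sup>+y. indicator (cbox 0 (\<chi> i. L)) y * ennreal ((norm (\<phi> (x - y)))\<^sup>2) \<partial>lborel) \<le> ennreal N" for x
  proof -
    have "(\<integral>\<^sup>+y. indicator (cbox 0 (\<chi> i. L)) y * ennreal ((norm (\<phi> (x - y)))\<^sup>2) \<partial>lborel)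
        \<le> of_nat (card (zbox 1)) * (\<integral>\<^sup>+y. indicator (cbox 0 (\<chi> i. L)) y * ennreal ((norm (\<phi> y))\<^sup>2) \<partial>lborel)"
    proof (rule periodic_reflected_integral_bound[OF L, of "\<lambda>y. ennreal ((norm (\<phi> y))\<^sup>2)"])
      show "(\<lambda>y. ennreal ((norm (\<phi> y))\<^sup>2)) \<in> borel_measurable borel" using pm by measurable
      show "periodic L (\<lambda>y. ennreal ((norm (\<phi> y))\<^sup>2))" using pp by (simp add: periodic_def)
    qed
    also have "\<dots> = ennreal N" unfolding integral_cell_nn[OF ps pm, symmetric] N_def
      by (subst ennreal_mult) (auto simp: integral_nonneg_AE ennreal_of_nat_eq_real_of_nat)
    finally show ?thesis .
  qed
  have xs: "sqi (cell L) (\<lambda>y. \<phi> (x - y))" for x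
    unfolding sqi_cell_iff[OF xm] using bd[of x] by (simp add: le_less_trans)
  have xi: "(\<integral>y. (norm (\<phi> (x - y)))\<^sup>2 \<partial>cell L) \<le> N" for x
  proof -
    have "ennreal (\<integral>y. (norm (\<phi> (x - y)))\<^sup>2 \<partial>cell L) \<le> ennreal N" unfolding integral_cell_nn[OF xs xm] by (rule bd)
    then show ?thesis using N by (simp add: ennreal_le_iff)
  qed
  have ci: "integrable (cell L) (\<lambda>y. \<phi> (x - y) *\<^sub>R v y)" if v: "sqi (cell L) v" for v :: "real^3 \<Rightarrow> real^3" and x
  proof (rule Bochner_Integration.integrable_bound[OF sqi_norm_prod_integrable[OF xs[of x] v]])
    show "(\<lambda>y. \<phi> (x - y) *\<^sub>R v y) \<in> borel_measurable (cell L)" using xs[of x] v by (auto simp: sqi_def)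
  qed simp
  show ?thesis
  proof (rule that[of "sqrt N"], unfold conv_bounded_def, intro conjI allI impI)
    show "sqrt N \<ge> 0" using N by simp
    fix v :: "real^3 \<Rightarrow> real^3" and x assume v: "sqi (cell L) v"
    have "norm (conv L \<phi> v x) \<le> (\<integral>y. norm (\<phi> (x - y) *\<^sub>R v y) \<partial>cell L)" unfolding conv_def tint_cell by (rule integral_norm_bound)
    also have "\<dots> = (\<integral>y. norm (\<phi> (x - y)) * norm (v y) \<partial>cell L)" by simp
    also have "\<dots> \<le> sqrt (\<integral>y. (norm (\<phi> (x - y)))\<^sup>2 \<partial>cell L) * sqrt (\<integral>y. (norm (v y))\<^sup>2 \<partial>cell L)" by (rule sqi_Cauchy_Schwarz[OF xs v])
    also have "\<dots> \<le> sqrt N * L2_norm L v" unfolding L2_norm_def tint_cell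
      by (intro mult_right_mono real_sqrt_le_mono xi) (simp add: integral_nonneg_AE)
    finally show "norm (conv L \<phi> v x) \<le> sqrt N * L2_norm L v" .
  next
    fix v w :: "real^3 \<Rightarrow> real^3" and x assume v: "sqi (cell L) v" and w: "sqi (cell L) w"
    show "conv L \<phi> (\<lambda>y. v y - w y) x = conv L \<phi> v x - conv L \<phi> w x"
      unfolding conv_def tint_cell scaleR_diff_right by (rule Bochner_Integration.integral_diff[OF ci[OF v] ci[OF w]])
  qed
qed

lemma txm_conv:
  assumes \<phi>: "\<phi> \<in> borel_measurable borel" and u: "txm L u"
  shows "txm L (\<lambda>t x. conv L \<phi> (u t) x)"
proof -
  interpret sigma_finite_measure "cell L" using finite_measure_cell finite_measure.axioms(1) by blast
  let ?N = "tpos \<Otimes>\<^sub>M cell L"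
  have c: "(\<lambda>x. x) \<in> measurable (cell L) borel" by (rule borel_measurable_cell) simp
  have fm: "fst \<in> measurable (?N \<Otimes>\<^sub>M cell L) ?N" and sm: "snd \<in> measurable (?N \<Otimes>\<^sub>M cell L) (cell L)" by simp_all
  have x: "(\<lambda>q. snd (fst q)) \<in> measurable (?N \<Otimes>\<^sub>M cell L) borel"
    using measurable_compose[OF measurable_compose[OF fm measurable_snd] c] .
  have y: "(\<lambda>q. snd q) \<in> measurable (?N \<Otimes>\<^sub>M cell L) borel" using measurable_compose[OF sm c] .
  have p: "(\<lambda>q. \<phi> (snd (fst q) - snd q)) \<in> borel_measurable (?N \<Otimes>\<^sub>M cell L)"
    by (rule measurable_compose[OF borel_measurable_diff[OF x y] \<phi>])
  have "(\<lambda>q. (fst (fst q), snd q)) \<in> measurable (?N \<Otimes>\<^sub>M cell L) ?N"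
    by (intro measurable_Pair measurable_compose[OF fm measurable_fst] sm)
  from measurable_compose[OF this u[unfolded txm_def]]
  have v: "(\<lambda>q. u (fst (fst q)) (snd q)) \<in> borel_measurable (?N \<Otimes>\<^sub>M cell L)" by simp
  have "(\<lambda>q. \<phi> (snd (fst q) - snd q) *\<^sub>R u (fst (fst q)) (snd q)) \<in> borel_measurable (?N \<Otimes>\<^sub>M cell L)"
    by (rule borel_measurable_scaleR[OF p v])
  then have "(\<lambda>p. \<integral>y. \<phi> (snd p - y) *\<^sub>R u (fst p) y \<partial>cell L) \<in> borel_measurable ?N"
    by (intro borel_measurable_lebesgue_integral) (simp add: split_beta')
  then show ?thesis unfolding txm_def conv_def tint_cell .
qed

text \<open>
  The partial derivatives are bounded, so the mean value inequality applies.
\<close>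

lemma C_bdd_lip_Lipschitz:
  fixes A :: "real^3 \<Rightarrow> real"
  assumes "C_bdd_lip 1 A"
  obtains K where "K-lipschitz_on UNIV A"
proof -
  have d: "\<And>x. A differentiable (at x)" and b: "\<And>e. e \<in> Basis \<Longrightarrow> bounded (range (pd e A))" using assms by auto
  have "\<forall>e\<in>Basis. \<exists>B. \<forall>x. \<bar>pd e A x\<bar> \<le> B" using b unfolding bounded_iff by fastforce
  then obtain B where B: "\<And>e x. e \<in> Basis \<Longrightarrow> \<bar>pd e A x\<bar> \<le> B e" by metis
  define K where "K = (\<Sum>e\<in>Basis. B e)"
  have K: "K \<ge> 0" unfolding K_def using B by (intro sum_nonneg) (meson abs_ge_zero order_trans)
  have on: "onorm (\<lambda>e. pd e A x) \<le> K" for x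
  proof (rule onorm_bound[OF K])
    fix h :: "real^3"
    interpret bounded_linear "\<lambda>e. pd e A x" using has_derivative_pd[OF d] by (rule has_derivative_bounded_linear)
    have "pd h A x = pd (\<Sum>e\<in>Basis. (h \<bullet> e) *\<^sub>R e) A x" by (simp add: euclidean_representation)
    also have "\<dots> = (\<Sum>e\<in>Basis. (h \<bullet> e) * pd e A x)" by (simp add: sum scaleR)
    also have "\<bar>\<dots>\<bar> \<le> (\<Sum>e\<in>Basis. norm h * B e)"
      by (intro order_trans[OF sum_abs] sum_mono) (auto simp: abs_mult intro!: mult_mono B Basis_le_norm)
    finally show "norm (pd h A x) \<le> K * norm h" by (simp add: K_def sum_distrib_left mult.commute)
  qed
  have "K-lipschitz_on UNIV A"
  proof (rule lipschitz_onI[OF _ K])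
    fix x y
    have "norm (A x - A y) \<le> K * norm (x - y)"
      by (rule differentiable_bound[of UNIV A "\<lambda>x e. pd e A x"]) (auto intro: has_derivative_pd d on)
    then show "dist (A x) (A y) \<le> K * dist x y" by (simp add: dist_norm)
  qed
  then show ?thesis by (rule that)
qed

section \<open>The advection term in Fourier coefficients\<close>

text \<open>
  The contribution of the \<open>m\<close>-th coefficient of \<open>u\<close> to the \<open>k\<close>-th coefficient of \<open>(a \<cdot> \<nabla>) u\<close>, tested
  with the \<open>k\<close>-th coefficient of \<open>w\<close>.
\<close>

definition tri :: "real \<Rightarrow> (int^3 \<Rightarrow> complex^3) \<Rightarrow> (int^3 \<Rightarrow> complex^3) \<Rightarrow> (int^3 \<Rightarrow> complex^3) \<Rightarrow> int^3 \<Rightarrow> int^3 \<Rightarrow> real" where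
  "tri L a u w k m = (\<Sum>i\<in>UNIV. (\<i> * freq_dot L m (a (k - m)) * u m $ i) \<bullet> w k $ i)"

lemma fcoeff_uminus: "fcoeff L g (- n) = cnj (fcoeff L g n)"
proof -
  have "cnj (\<integral>x. cis (- (freq L n \<bullet> x)) * complex_of_real (g x) \<partial>cell L) = (\<integral>x. cis (- (freq L (- n) \<bullet> x)) * complex_of_real (g x) \<partial>cell L)"
    by (simp only: cnj_lebesgue_integral) (simp add: cis_cnj freq_uminus)
  then show ?thesis by (simp add: fcoeff_cfc cfc_def)
qed

lemma norm_cdot_le: "norm (\<Sum>j\<in>UNIV. complex_of_real (x $ j) * a $ j) \<le> norm (x :: real^3) * norm (a :: complex^3)"
proof -
  have "norm (\<Sum>j\<in>UNIV. complex_of_real (x $ j) * a $ j) \<le> (\<Sum>j\<in>UNIV. \<bar>x $ j\<bar> * \<bar>norm (a $ j)\<bar>)"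
    by (rule order_trans[OF norm_sum]) (simp add: norm_mult)
  also have "\<dots> \<le> L2_set (\<lambda>j. x $ j) UNIV * L2_set (\<lambda>j. norm (a $ j)) UNIV" by (rule L2_set_mult_ineq)
  finally show ?thesis by (simp add: norm_vec_def L2_set_def)
qed

lemma tri_bound: "\<bar>tri L a u w k m\<bar> \<le> norm (a (k - m)) * (norm (freq L m) * norm (u m)) * norm (w k)"
proof -
  define l where "l = \<i> * freq_dot L m (a (k - m))"
  have "tri L a u w k m = (\<chi> i. l * u m $ i) \<bullet> w k" by (simp add: tri_def l_def inner_vec_def)
  also have "\<bar>\<dots>\<bar> \<le> norm (\<chi> i. l * u m $ i) * norm (w k)" by (rule Cauchy_Schwarz_ineq2)
  also have "norm (\<chi> i. l * u m $ i) = norm l * norm (u m)"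
  proof -
    have "(norm (\<chi> i. l * u m $ i))\<^sup>2 = (norm l * norm (u m))\<^sup>2"
      by (simp add: norm_vec_complex norm_mult power_mult_distrib sum_distrib_left)
    then show ?thesis by (simp add: power2_eq_iff_nonneg)
  qed
  also have "norm l * norm (u m) * norm (w k) \<le> (norm (freq L m) * norm (a (k - m))) * norm (u m) * norm (w k)"
    unfolding l_def by (intro mult_right_mono) (auto simp: norm_mult intro: norm_cdot_le)
  finally show ?thesis by (simp add: mult_ac)
qed

text \<open>
  The cancellation of the advection term, frequency by frequency.  As \<open>a\<close> is divergence free,
  \<open>k\<close> and \<open>m\<close> have the same product with the coefficient of \<open>a\<close> at \<open>k - m\<close>; as \<open>a\<close> is real, exchanging \<open>k\<close>
  and \<open>m\<close> conjugates it.
\<close>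

lemma tri_antisym:
  assumes div: "\<And>k. freq_dot L k (a k) = 0" and re: "\<And>n j. a (- n) $ j = cnj (a n $ j)"
  shows "tri L a w w k m + tri L a w w m k = 0"
proof -
  define l where "l = freq_dot L m (a (k - m))"
  have "freq_dot L (k - m) (a (k - m)) = 0" by (rule div)
  then have l2: "freq_dot L k (a (k - m)) = l"
    by (simp add: l_def freq_diff left_diff_distrib sum_subtractf)
  have "a (m - k) $ j = cnj (a (k - m) $ j)" for j using re[of "k - m" j] by simp
  then have l3: "freq_dot L k (a (m - k)) = cnj l"
    unfolding l2[symmetric] by simp
  have "(\<i> * l * x) \<bullet> y + (\<i> * cnj l * y) \<bullet> x = 0" for x y :: complex
    by (simp add: inner_complex_def algebra_simps)
  then show ?thesis unfolding tri_def l_def[symmetric] l3 by (simp add: sum.distrib[symmetric])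
qed

lemma tri_antisym_sum:
  assumes div: "\<And>k. freq_dot L k (a k) = 0" and re: "\<And>n j. a (- n) $ j = cnj (a n $ j)"
  shows "(\<Sum>m\<in>K. \<Sum>k\<in>K. tri L a w w k m) = 0"
proof -
  have "(\<Sum>m\<in>K. \<Sum>k\<in>K. tri L a w w k m) + (\<Sum>m\<in>K. \<Sum>k\<in>K. tri L a w w k m) = (\<Sum>m\<in>K. \<Sum>k\<in>K. tri L a w w k m) + (\<Sum>m\<in>K. \<Sum>k\<in>K. tri L a w w m k)"
    using sum.swap[of "\<lambda>m k. tri L a w w k m" K K] by simp
  also have "\<dots> = (\<Sum>m\<in>K. \<Sum>k\<in>K. tri L a w w k m + tri L a w w m k)" by (simp add: sum.distrib)
  also have "\<dots> = 0" by (simp add: tri_antisym[OF div re])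
  finally show ?thesis by simp
qed

text \<open>
  The decomposition \<open>(a1 \<cdot> \<nabla>) u1 - (a2 \<cdot> \<nabla>) u2 = (a1 \<cdot> \<nabla>) w + ((a1 - a2) \<cdot> \<nabla>) u2\<close>.
\<close>

lemma tri_diff:
  "tri L a1 u1 w k m - tri L a2 u2 w k m = tri L a1 (\<lambda>n. u1 n - u2 n) w k m + tri L (\<lambda>n. a1 n - a2 n) u2 w k m"
  unfolding tri_def sum_subtractf[symmetric] sum.distrib[symmetric]
proof (intro sum.cong refl)
  fix i :: 3
  show "(\<i> * freq_dot L m (a1 (k - m)) * u1 m $ i) \<bullet> w k $ i
      - (\<i> * freq_dot L m (a2 (k - m)) * u2 m $ i) \<bullet> w k $ i
    = (\<i> * freq_dot L m (a1 (k - m)) * (u1 m - u2 m) $ i) \<bullet> w k $ i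
      + (\<i> * freq_dot L m (a1 (k - m) - a2 (k - m)) * u2 m $ i) \<bullet> w k $ i"
    by (simp add: right_diff_distrib left_diff_distrib sum_subtractf inner_diff_left)
qed

lemma advection_has_sum:
  assumes L: "L > 0" and a: "\<And>j. sqi (cell L) (\<lambda>x. a x $ j)" and D: "\<And>i j. has_grad L j (\<lambda>x. u x $ i) (\<lambda>x. D x $ i $ j)"
  shows "((\<lambda>m. tri L (vfcoeff L a) (vfcoeff L u) w k m) has_sum (\<Sum>i\<in>UNIV. fcoeff L (advection a D i) k \<bullet> w k $ i)) UNIV"
proof -
  have sD: "sqi (cell L) (\<lambda>x. D x $ i $ j)" for i j using has_grad_sqi[OF D] by blast
  have "((\<lambda>m. \<Sum>j\<in>UNIV. fcoeff L (\<lambda>x. a x $ j) (k - m) * fcoeff L (\<lambda>x. D x $ i $ j) m) has_sum (\<Sum>j\<in>UNIV. fcoeff L (\<lambda>x. a x $ j * D x $ i $ j) k)) UNIV" for i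
    by (intro has_sum_finite_sum finite fcoeff_mult_has_sum L a sD)
  moreover have "(\<Sum>j\<in>UNIV. fcoeff L (\<lambda>x. a x $ j * D x $ i $ j) k) = fcoeff L (advection a D i) k" for i
    unfolding advection_def[abs_def] using L by (subst fcoeff_sum) (auto intro: sqi_mult_integrable a sD)
  moreover have "(\<Sum>j\<in>UNIV. fcoeff L (\<lambda>x. a x $ j) (k - m) * fcoeff L (\<lambda>x. D x $ i $ j) m)
      = \<i> * freq_dot L m (vfcoeff L a (k - m)) * vfcoeff L u m $ i" for i m
    by (simp add: has_grad_fcoeff[OF D] vfcoeff_def sum_distrib_left sum_distrib_right mult_ac)
  ultimately have "((\<lambda>m. \<i> * freq_dot L m (vfcoeff L a (k - m)) * vfcoeff L u m $ i) has_sum fcoeff L (advection a D i) k) UNIV" for i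
    by simp
  then have "((\<lambda>m. (\<i> * freq_dot L m (vfcoeff L a (k - m)) * vfcoeff L u m $ i) \<bullet> w k $ i) has_sum fcoeff L (advection a D i) k \<bullet> w k $ i) UNIV" for i
    by (rule has_sum_bounded_linear[OF bounded_linear_inner_left])
  then show ?thesis unfolding tri_def by (intro has_sum_finite_sum finite) auto
qed

lemma sqsum_le_has_sum:
  assumes "((\<lambda>n. (f n)\<^sup>2) has_sum S) UNIV" shows "sqsum_le f (sqrt S)"
proof -
  have b: "(\<Sum>n\<in>K. (f n)\<^sup>2) \<le> S" if "finite K" for K
    by (rule has_sum_mono_neutral[OF has_sum_finite[OF that] assms]) auto
  have "S \<ge> 0" using b[of "{}"] by simp
  then show ?thesis using b by (simp add: sqsum_le_def)
qed

text \<open>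
  In \<open>(a1 \<cdot> \<nabla>) w\<close>, tested with the part of \<open>w\<close> with frequencies in \<open>K\<close>, the pairs of frequencies in
  \<open>K\<close> cancel by antisymmetry.  What remains pairs frequencies \<open>m\<close> outside \<open>K\<close>, whose part of \<open>w\<close> has the
  squared seminorm \<open>W - E\<close>, with frequencies \<open>k\<close> in \<open>K\<close>.  This tail and the second advection term
  are estimated by \<^const>\<open>trilinear_bound\<close>.
\<close>

lemma advection_difference_bound:
  assumes C: "trilinear_bound L C"
    and K: "finite K" "0 \<notin> K"
    and a1: "sqsum_le (\<lambda>n. norm (freq L n) * norm (a1 n)) A1" "a1 0 = 0"
      "\<And>k. freq_dot L k (a1 k) = 0" "\<And>n j. a1 (- n) $ j = cnj (a1 n $ j)"
    and z: "sqsum_le (\<lambda>n. norm (freq L n) * norm (a1 n - a2 n)) Az" "a1 0 - a2 0 = 0"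
    and u2: "sqsum_le (\<lambda>n. norm (freq L n) * norm (u2 n)) G2"
    and w: "w = (\<lambda>n. u1 n - u2 n)" "((\<lambda>n. (norm (freq L n) * norm (w n))\<^sup>2) has_sum W) UNIV"
    and X: "\<And>k. k \<in> K \<Longrightarrow> ((\<lambda>m. tri L a1 u1 w k m - tri L a2 u2 w k m) has_sum X k) UNIV"
  defines "E \<equiv> (\<Sum>k\<in>K. (norm (freq L k) * norm (w k))\<^sup>2)"
  shows "\<bar>\<Sum>k\<in>K. X k\<bar> \<le> C * A1 * sqrt (W - E) * sqrt E + C * Az * G2 * sqrt E"
proof -
  have TB: "(\<Sum>k\<in>K. \<Sum>m\<in>M. a (k - m) * g m * p k) \<le> C * A * G * P"
    if "finite K" "finite M" "\<And>n. a n \<ge> 0" "\<And>n. g n \<ge> 0" "\<And>n. p n \<ge> 0" "a 0 = 0" "p 0 = 0"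
      "sqsum_le (\<lambda>n. norm (freq L n) * a n) A" "sqsum_le g G" "sqsum_le (\<lambda>n. norm (freq L n) * p n) P" for a g p A G P K M
    using C that unfolding trilinear_bound_def by blast
  define N where "N n = norm (freq L n)" for n
  define p where "p n = (if n \<in> K then norm (w n) else 0)" for n
  define g where "g n = (if n \<in> K then 0 else N n * norm (w n))" for n
  have E0: "E \<ge> 0" unfolding E_def by (intro sum_nonneg) auto
  have P: "sqsum_le (\<lambda>n. norm (freq L n) * p n) (sqrt E)"
    unfolding sqsum_le_def
  proof (intro conjI allI impI)
    fix M :: "(int^3) set" assume M: "finite M"
    have "(\<Sum>n\<in>M. (norm (freq L n) * p n)\<^sup>2) = (\<Sum>n\<in>M \<inter> K. (norm (freq L n) * norm (w n))\<^sup>2)"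
      by (rule sum.mono_neutral_cong_right) (use M in \<open>auto simp: p_def\<close>)
    also have "\<dots> \<le> E" unfolding E_def by (intro sum_mono2 K) auto
    finally show "(\<Sum>n\<in>M. (norm (freq L n) * p n)\<^sup>2) \<le> (sqrt E)\<^sup>2" using E0 by simp
  qed (use E0 in simp)
  have G: "sqsum_le g (sqrt (W - E))"
  proof (rule sqsum_le_has_sum)
    have "((\<lambda>n. (if n \<in> K then (N n * norm (w n))\<^sup>2 else 0)) has_sum E) UNIV"
      by (rule has_sum_cong_neutral[THEN iffD1, OF _ _ _ has_sum_finite[OF K(1), of "\<lambda>n. (N n * norm (w n))\<^sup>2", folded E_def[folded N_def]]]) auto
    from has_sum_diff_real[OF w(2) this]
    show "((\<lambda>n. (g n)\<^sup>2) has_sum (W - E)) UNIV"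
      by (rule has_sum_cong[THEN iffD1, rotated]) (auto simp: g_def N_def)
  qed
  have one: "\<bar>\<Sum>m\<in>M. \<Sum>k\<in>K. tri L a1 u1 w k m - tri L a2 u2 w k m\<bar> \<le> C * A1 * sqrt (W - E) * sqrt E + C * Az * G2 * sqrt E"
    if M: "finite M" "K \<subseteq> M" for M
  proof -
    have "(\<Sum>m\<in>M. \<Sum>k\<in>K. tri L a1 u1 w k m - tri L a2 u2 w k m) = (\<Sum>m\<in>M. \<Sum>k\<in>K. tri L a1 w w k m) + (\<Sum>m\<in>M. \<Sum>k\<in>K. tri L (\<lambda>n. a1 n - a2 n) u2 w k m)"
      by (simp add: tri_diff w(1) sum.distrib)
    also have "(\<Sum>m\<in>M. \<Sum>k\<in>K. tri L a1 w w k m) = (\<Sum>m\<in>M - K. \<Sum>k\<in>K. tri L a1 w w k m)"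
      using sum.subset_diff[OF M(2,1), of "\<lambda>m. \<Sum>k\<in>K. tri L a1 w w k m"] tri_antisym_sum[OF a1(3,4)] by simp
    finally have e: "(\<Sum>m\<in>M. \<Sum>k\<in>K. tri L a1 u1 w k m - tri L a2 u2 w k m) = (\<Sum>m\<in>M - K. \<Sum>k\<in>K. tri L a1 w w k m) + (\<Sum>m\<in>M. \<Sum>k\<in>K. tri L (\<lambda>n. a1 n - a2 n) u2 w k m)" .
    have "\<bar>\<Sum>m\<in>M - K. \<Sum>k\<in>K. tri L a1 w w k m\<bar> \<le> (\<Sum>m\<in>M - K. \<Sum>k\<in>K. norm (a1 (k - m)) * g m * p k)"
    proof (intro order_trans[OF sum_abs] sum_mono order_trans[OF sum_abs])
      fix m k assume "m \<in> M - K" "k \<in> K"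
      then show "\<bar>tri L a1 w w k m\<bar> \<le> norm (a1 (k - m)) * g m * p k"
        using tri_bound[of L a1 w w k m] by (simp add: g_def p_def N_def)
    qed
    also have "\<dots> = (\<Sum>k\<in>K. \<Sum>m\<in>M - K. norm (a1 (k - m)) * g m * p k)" by (rule sum.swap)
    also have "\<dots> \<le> C * A1 * sqrt (W - E) * sqrt E"
      by (rule TB[OF K(1) _ _ _ _ _ _ a1(1) G P]) (use M K a1(2) in \<open>auto simp: g_def p_def N_def\<close>)
    finally have b1: "\<bar>\<Sum>m\<in>M - K. \<Sum>k\<in>K. tri L a1 w w k m\<bar> \<le> C * A1 * sqrt (W - E) * sqrt E" .
    have "\<bar>\<Sum>m\<in>M. \<Sum>k\<in>K. tri L (\<lambda>n. a1 n - a2 n) u2 w k m\<bar> \<le> (\<Sum>m\<in>M. \<Sum>k\<in>K. norm (a1 (k - m) - a2 (k - m)) * (N m * norm (u2 m)) * p k)"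
    proof (intro order_trans[OF sum_abs] sum_mono order_trans[OF sum_abs])
      fix m k assume "m \<in> M" "k \<in> K"
      then show "\<bar>tri L (\<lambda>n. a1 n - a2 n) u2 w k m\<bar> \<le> norm (a1 (k - m) - a2 (k - m)) * (N m * norm (u2 m)) * p k"
        using tri_bound[of L "\<lambda>n. a1 n - a2 n" u2 w k m] by (simp add: p_def N_def)
    qed
    also have "\<dots> = (\<Sum>k\<in>K. \<Sum>m\<in>M. norm (a1 (k - m) - a2 (k - m)) * (N m * norm (u2 m)) * p k)" by (rule sum.swap)
    also have "\<dots> \<le> C * Az * G2 * sqrt E"
      by (rule TB[OF K(1) _ _ _ _ _ _ z(1) _ P, where g="\<lambda>m. N m * norm (u2 m)"]) (use M K z(2) u2 in \<open>auto simp: p_def N_def\<close>)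
    finally show ?thesis unfolding e using b1 by linarith
  qed
  have hs: "((\<lambda>m. \<Sum>k\<in>K. tri L a1 u1 w k m - tri L a2 u2 w k m) has_sum (\<Sum>k\<in>K. X k)) UNIV"
    by (intro has_sum_finite_sum K X)
  then have t: "((\<lambda>M. \<Sum>m\<in>M. \<Sum>k\<in>K. tri L a1 u1 w k m - tri L a2 u2 w k m) \<longlongrightarrow> (\<Sum>k\<in>K. X k)) (finite_subsets_at_top UNIV)"
    by (simp add: has_sum_def)
  show ?thesis
  proof (rule tendsto_upperbound[OF tendsto_rabs[OF t]])
    show "\<forall>\<^sub>F M in finite_subsets_at_top UNIV. \<bar>\<Sum>m\<in>M. \<Sum>k\<in>K. tri L a1 u1 w k m - tri L a2 u2 w k m\<bar> \<le> C * A1 * sqrt (W - E) * sqrt E + C * Az * G2 * sqrt E"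
      unfolding eventually_finite_subsets_at_top using one K(1) by (intro exI[of _ K]) auto
  qed simp
qed

text \<open>
  The viscous term gives \<open>-\<nu> E\<close>, and the pressure drops out as \<open>w\<close> is divergence free.  One quarter of the
  viscous term absorbs the force and another quarter the part \<open>Y2 * sqrt E\<close> of the advection term.
\<close>

lemma modal_energy_bound:
  assumes L: "L > 0" and nu: "\<nu> > 0"
    and K: "finite K" "0 \<notin> K" and E_def: "E = (\<Sum>k\<in>K. (norm (freq L k) * norm (w k))\<^sup>2)"
    and X: "\<bar>\<Sum>k\<in>K. X k\<bar> \<le> Y1 + Y2 * sqrt E"
    and w: "\<And>k. freq_dot L k (w k) = 0"
    and R: "\<And>k i. k \<in> K \<Longrightarrow> R k $ i = - complex_of_real (\<nu> * (norm (freq L k))\<^sup>2) * w k $ i - N k $ i - \<i> * complex_of_real (freq L k $ i) * q k + f k $ i"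
    and N: "\<And>k. k \<in> K \<Longrightarrow> N k \<bullet> w k = X k"
    and f: "((\<lambda>n. (norm (f n))\<^sup>2 / (norm (freq L n))\<^sup>2) has_sum F) (- {0})"
  shows "(\<Sum>k\<in>K. R k \<bullet> w k) \<le> - (\<nu> / 2) * E + Y1 + Y2\<^sup>2 / \<nu> + F / \<nu>"
proof -
  have E0: "E \<ge> 0" unfolding E_def by (intro sum_nonneg) auto
  have Rk: "R k \<bullet> w k = - \<nu> * (norm (freq L k) * norm (w k))\<^sup>2 - X k + f k \<bullet> w k" if k: "k \<in> K" for k
  proof -
    have "R k \<bullet> w k = (\<Sum>i\<in>UNIV. (- complex_of_real (\<nu> * (norm (freq L k))\<^sup>2) * w k $ i - N k $ i - \<i> * complex_of_real (freq L k $ i) * q k + f k $ i) \<bullet> w k $ i)"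
      unfolding inner_vec_def using R[OF k] by simp
    also have "\<dots> = (\<Sum>i\<in>UNIV. - (\<nu> * (norm (freq L k))\<^sup>2) * (norm (w k $ i))\<^sup>2) - N k \<bullet> w k - (\<Sum>i\<in>UNIV. (\<i> * complex_of_real (freq L k $ i) * q k) \<bullet> w k $ i) + f k \<bullet> w k"
    proof -
      have "(- complex_of_real c * z) \<bullet> z = - c * (norm z)\<^sup>2" for c z
        unfolding cmod_power2 by (simp add: inner_complex_def power2_eq_square algebra_simps)
      then show ?thesis by (simp only: inner_add_left inner_diff_left sum.distrib sum_subtractf inner_vec_def)
    qed
    also have "(\<Sum>i\<in>UNIV. (\<i> * complex_of_real (freq L k $ i) * q k) \<bullet> w k $ i) = (\<i> * q k) \<bullet> freq_dot L k (w k)"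
      unfolding inner_sum_right by (intro sum.cong refl) (simp add: inner_complex_def algebra_simps)
    also have "\<dots> = 0" unfolding w by simp
    also have "(\<Sum>i\<in>UNIV. - (\<nu> * (norm (freq L k))\<^sup>2) * (norm (w k $ i))\<^sup>2) = - \<nu> * (norm (freq L k) * norm (w k))\<^sup>2"
      by (simp add: norm_vec_complex power_mult_distrib sum_distrib_left sum_negf mult.assoc)
    finally show ?thesis using N[OF k] by simp
  qed
  have fw: "f k \<bullet> w k \<le> (1 / \<nu>) * ((norm (f k))\<^sup>2 / (norm (freq L k))\<^sup>2) + (\<nu> / 4) * (norm (freq L k) * norm (w k))\<^sup>2" if k: "k \<in> K" for k
  proof -
    have n: "norm (freq L k) > 0" using norm_freq_pos[OF L] k K(2) by metis
    define x y where "x = norm (f k) / norm (freq L k)" and "y = norm (freq L k) * norm (w k)"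
    have "f k \<bullet> w k \<le> norm (f k) * norm (w k)" by (rule norm_cauchy_schwarz)
    also have "\<dots> = x * y" using n by (simp add: x_def y_def)
    also have "\<dots> \<le> (1 / \<nu>) * x\<^sup>2 + (\<nu> / 4) * y\<^sup>2"
    proof -
      have "0 \<le> (x - (\<nu> / 2) * y)\<^sup>2 / \<nu>" using nu by simp
      also have "\<dots> = (1 / \<nu>) * x\<^sup>2 + (\<nu> / 4) * y\<^sup>2 - x * y" using nu by (simp add: power2_eq_square field_simps)
      finally show ?thesis by simp
    qed
    finally show ?thesis by (simp add: x_def y_def power_divide)
  qed
  have "(\<Sum>k\<in>K. (norm (f k))\<^sup>2 / (norm (freq L k))\<^sup>2) \<le> F"
    by (rule has_sum_mono_neutral[OF has_sum_finite[OF K(1)] f]) (use K in auto)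
  then have F: "(1 / \<nu>) * (\<Sum>k\<in>K. (norm (f k))\<^sup>2 / (norm (freq L k))\<^sup>2) \<le> F / \<nu>" using nu by (simp add: divide_right_mono)
  have "(\<Sum>k\<in>K. R k \<bullet> w k) = - \<nu> * E - (\<Sum>k\<in>K. X k) + (\<Sum>k\<in>K. f k \<bullet> w k)"
    unfolding E_def by (simp add: Rk sum.distrib sum_subtractf sum_distrib_left sum_negf)
  also have "(\<Sum>k\<in>K. f k \<bullet> w k) \<le> (1 / \<nu>) * (\<Sum>k\<in>K. (norm (f k))\<^sup>2 / (norm (freq L k))\<^sup>2) + (\<nu> / 4) * E"
    unfolding E_def sum_distrib_left sum.distrib[symmetric] by (intro sum_mono fw)
  finally have 1: "(\<Sum>k\<in>K. R k \<bullet> w k) \<le> - \<nu> * E - (\<Sum>k\<in>K. X k) + (F / \<nu> + (\<nu> / 4) * E)" using F by linarith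
  have "Y2 * sqrt E \<le> Y2\<^sup>2 / \<nu> + (\<nu> / 4) * E"
  proof -
    have "0 \<le> (Y2 - (\<nu> / 2) * sqrt E)\<^sup>2 / \<nu>" using nu by simp
    also have "\<dots> = Y2\<^sup>2 / \<nu> + (\<nu> / 4) * (sqrt E)\<^sup>2 - Y2 * sqrt E" using nu by (simp add: power2_eq_square field_simps)
    finally show ?thesis using E0 by simp
  qed
  moreover have "- (\<Sum>k\<in>K. X k) \<le> Y1 + Y2 * sqrt E" using X by linarith
  ultimately show ?thesis using 1 by (simp add: algebra_simps)
qed

section \<open>A priori bounds and the energy of a mode\<close>

text \<open>
  \<open>v\<close> is a divergence-free field in \<open>H\<^sup>1\<close> with Jacobian \<open>D\<close>.
\<close>

abbreviation velocity_regular :: "real \<Rightarrow> (real^3 \<Rightarrow> real^3) \<Rightarrow> (real^3 \<Rightarrow> real^3^3) \<Rightarrow> bool" where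
  "velocity_regular L v D \<equiv> (\<forall>i j. has_grad L j (\<lambda>x. v x $ i) (\<lambda>x. D x $ i $ j)) \<and> vHdot L 1 (vfcoeff L v) \<and>
     (\<forall>k. freq_dot L k (vfcoeff L v k) = 0)"

text \<open>
  The \<open>i\<close>-th component of the \<open>k\<close>-th coefficient of \<open>u\<close>, in the phase \<open>d\<close>, is a primitive of the same
  phase of \<^const>\<open>modal_rhs\<close>.  The integrand \<open>F\<close> is integrable as such, while its expression by Fourier
  coefficients is valid almost everywhere.
\<close>

abbreviation modal_ode :: "real \<Rightarrow> real \<Rightarrow> (real \<Rightarrow> int^3 \<Rightarrow> complex^3) \<Rightarrow> (real \<Rightarrow> real^3 \<Rightarrow> real^3) \<Rightarrow>
     (real \<Rightarrow> real^3 \<Rightarrow> real^3) \<Rightarrow> (real \<Rightarrow> real^3 \<Rightarrow> real^3^3) \<Rightarrow> (real \<Rightarrow> real^3 \<Rightarrow> real) \<Rightarrow> int^3 \<Rightarrow> 3 \<Rightarrow> real \<Rightarrow> bool" where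
  "modal_ode L \<nu> f u a D P k i d \<equiv> \<exists>F. (\<forall>T>0. set_integrable lborel {0..T} F) \<and>
     (AE t in tpos. F t = Re (cis (- d) * modal_rhs L \<nu> (f t) (u t) (a t) (D t) (P t) k $ i)) \<and>
     (\<forall>s t. 0 \<le> s \<longrightarrow> s \<le> t \<longrightarrow>
        Re (cis (- d) * vfcoeff L (u t) k $ i) - Re (cis (- d) * vfcoeff L (u s) k $ i) = (LINT \<tau>:{s..t}|lborel. F \<tau>))"

text \<open>
  What the estimates below use of a weak Leray solution: at almost every time the filter equation and the
  regularity of the velocity, and the differential equations of the modes.
\<close>

lemma weak_Leray_solution_data:
  assumes L: "L > 0" and b: "0 < \<beta>" and A: "\<And>x. \<beta> \<le> A x \<and> A x \<le> 1" "continuous_on UNIV A" and phi: "\<phi> \<in> borel_measurable borel"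
    and f: "force L f" and sol: "weak_Leray_solution L \<alpha> \<nu> A \<phi> u0 f u ua P Pa"
  obtains Du Dua where
    "AE t in tpos. filtered L \<alpha> (\<lambda>x. A (conv L \<phi> (u t) x)) (u t) (ua t) (Dua t) (Pa t)"
    "AE t in tpos. velocity_regular L (u t) (Du t)"
    "\<And>k i d. k \<noteq> 0 \<Longrightarrow> d \<in> {0, pi / 2} \<Longrightarrow> modal_ode L \<nu> f u ua Du P k i d"
proof -
  from sol obtain Du Dua where m: "tx_measurable u" "tx_measurable ua" "tx_measurable P" "tx_measurable Pa"
    and l: "Linf_loc (L2s L) (L2_norm L) u" "L2_loc (\<lambda>v. vHdot L 1 (vfcoeff L v)) (\<lambda>v. Hdot_norm L 1 (vfcoeff L v)) u"
      "Linf_loc (vH1 L) (\<lambda>v. Hsob_norm L 1 (vfcoeff L v)) ua" "L2_loc (L2 L) (L2_norm L) P" "Linf_loc (L2 L) (L2_norm L) Pa"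
    and J: "weak_jacobian L u Du" "weak_jacobian L ua Dua" and w: "weak_momentum L \<nu> f u Du ua P" "weak_filter L \<alpha> A \<phi> u ua Dua Pa"
    and dv: "weak_div_free L u" "weak_div_free L ua" and wc: "weakly_continuous L u"
    unfolding weak_Leray_solution_def by blast
  note tu = tsq_velocity[OF m(1) l(1)] and tua = tsq_filtered[OF L m(2) l(3)]
    and tD = tsq_gradient_velocity[OF L J(1) l(2)] and tDa = tsq_gradient_filtered[OF L J(2) l(3)]
    and tP = tsq_L2_pressure[OF m(3) l(4)] and tPa = tsq_Linf_pressure[OF m(4) l(5)]
  have Am: "A \<in> borel_measurable borel" by (rule borel_measurable_continuous_onI[OF A(2)])
  have tG: "tsq L (\<lambda>t x. A (conv L \<phi> (u t) x) * Dua t x $ i $ j)" for i j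
  proof (rule tsq_mult_bounded[OF tDa])
    show "txm L (\<lambda>t x. A (conv L \<phi> (u t) x))" by (rule txm_compose[OF txm_conv[OF phi tx_measurable_txm[OF m(1)]] Am])
    show "\<bar>A (conv L \<phi> (u t) x)\<bar> \<le> 1" for t x using A(1)[of "conv L \<phi> (u t) x"] b by auto
  qed
  have Jae: "AE t in tpos. \<forall>i j. has_grad L j (\<lambda>x. v t x $ i) (\<lambda>x. Dv t x $ i $ j)" if "weak_jacobian L v Dv" for v Dv
    using that unfolding weak_jacobian_def AE_tpos by (auto elim!: eventually_mono intro: weak_partial_has_grad[OF L])
  have fl: "AE t in tpos. filtered L \<alpha> (\<lambda>x. A (conv L \<phi> (u t) x)) (u t) (ua t) (Dua t) (Pa t)"
  proof -
    have "AE t in tpos. \<forall>i. sqi (cell L) (\<lambda>x. u t x $ i)" "AE t in tpos. \<forall>i. sqi (cell L) (\<lambda>x. ua t x $ i)" "AE t in tpos. sqi (cell L) (Pa t)"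
      "AE t in tpos. \<forall>i j. sqi (cell L) (\<lambda>x. A (conv L \<phi> (u t) x) * Dua t x $ i $ j)"
      using tu tua tPa tG by (auto simp: tsq_def AE_all_countable)
    moreover have "AE t in tpos. vfcoeff L (ua t) 0 = 0"
      using l(3) unfolding Linf_loc_def AE_tpos by (auto elim!: eventually_mono intro: vH1_mean0)
    ultimately show ?thesis
      using Jae[OF J(2)] weak_div_free_Fourier[OF L tua dv(2)] weak_filter_Fourier[OF L tu tua tG tPa w(2)]
      by eventually_elim (unfold filtered_def, blast)
  qed
  have vel: "AE t in tpos. velocity_regular L (u t) (Du t)"
  proof -
    have "AE t in tpos. vHdot L 1 (vfcoeff L (u t))" using l(2) by (simp add: L2_loc_def AE_tpos)
    then show ?thesis using Jae[OF J(1)] weak_div_free_Fourier[OF L tu dv(1)] by eventually_elim blast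
  qed
  have ode: "modal_ode L \<nu> f u ua Du P k i d"
    if "k \<noteq> 0" "d \<in> {0, pi / 2}" for k i d
    by (rule weak_momentum_Fourier[OF L tu tua tD tP f w(1) wc that, of i]) blast
  show ?thesis by (rule that[OF fl vel ode])
qed

lemma vpairing_le:
  assumes L: "L > 0" and nu: "\<nu> > 0" and c: "vHdot L (-1) c" and d: "vHdot L 1 d"
  shows "2 * vpairing L c d \<le> (1 / \<nu>) * (Hdot_norm L (-1) c)\<^sup>2 + \<nu> * (Hdot_norm L 1 d)\<^sup>2"
proof -
  define q where "q n = (1 / \<nu>) * ((norm (c n))\<^sup>2 / (norm (freq L n))\<^sup>2) + \<nu> * ((norm (freq L n))\<^sup>2 * (norm (d n))\<^sup>2)" for n
  have qs: "(q has_sum ((1 / \<nu>) * ((Hdot_norm L (-1) c)\<^sup>2 / L^3) + \<nu> * ((Hdot_norm L 1 d)\<^sup>2 / L^3))) (- {0})"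
    unfolding q_def by (intro has_sum_add has_sum_cmult_right vHdotm1_has_sum[OF L c] vHdot1_has_sum[OF L d])
  have qle: "2 * (norm (c n) * norm (d n)) \<le> q n" if "n \<noteq> 0" for n
  proof -
    have N: "norm (freq L n) > 0" by (rule norm_freq_pos[OF L that])
    define x y where "x = norm (c n) / norm (freq L n)" and "y = norm (freq L n) * norm (d n)"
    have "0 \<le> (x - \<nu> * y)\<^sup>2 / \<nu>" using nu by simp
    also have "\<dots> = (1 / \<nu>) * x\<^sup>2 + \<nu> * y\<^sup>2 - 2 * (x * y)" using nu by (simp add: power2_eq_square field_simps)
    also have "x * y = norm (c n) * norm (d n)" using N by (simp add: x_def y_def)
    finally show ?thesis by (simp add: q_def x_def y_def power_divide power_mult_distrib)
  qed
  define g where "g i n = Re (c n $ i * cnj (d n $ i))" for i n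
  have gsum: "g i summable_on (- {0})" for i
  proof (rule abs_summable_summable, rule summable_on_comparison_test)
    show "q summable_on (- {0})" using qs has_sum_imp_summable by blast
    fix n :: "int^3" assume "n \<in> - {0}"
    have "\<bar>g i n\<bar> \<le> norm (c n $ i * cnj (d n $ i))" unfolding g_def by (rule abs_Re_le_cmod)
    also have "\<dots> \<le> norm (c n) * norm (d n)" by (simp add: norm_mult mult_mono Finite_Cartesian_Product.norm_nth_le)
    also have "\<dots> \<le> 2 * (norm (c n) * norm (d n))" by simp
    finally show "norm (g i n) \<le> q n" using qle[of n] \<open>n \<in> - {0}\<close> by simp
  qed simp
  have "((\<lambda>n. \<Sum>i\<in>UNIV. g i n) has_sum (\<Sum>i\<in>UNIV. \<Sum>\<^sub>\<infinity>n\<in>- {0}. g i n)) (- {0})"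
    by (intro has_sum_finite_sum finite has_sum_infsum gsum)
  from has_sum_cmult_right[OF this, of 2]
  have "2 * (\<Sum>i\<in>UNIV. \<Sum>\<^sub>\<infinity>n\<in>- {0}. g i n) \<le> (1 / \<nu>) * ((Hdot_norm L (-1) c)\<^sup>2 / L^3) + \<nu> * ((Hdot_norm L 1 d)\<^sup>2 / L^3)"
  proof (rule has_sum_mono[OF _ qs])
    fix n :: "int^3" assume n: "n \<in> - {0}"
    have "(\<Sum>i\<in>UNIV. g i n) = c n \<bullet> d n" by (simp add: g_def inner_vec_def inner_complex_def)
    also have "\<dots> \<le> norm (c n) * norm (d n)" by (rule norm_cauchy_schwarz)
    finally show "2 * (\<Sum>i\<in>UNIV. g i n) \<le> q n" using qle[of n] n by simp
  qed
  then have "L^3 * (2 * (\<Sum>i\<in>UNIV. \<Sum>\<^sub>\<infinity>n\<in>- {0}. g i n)) \<le> L^3 * ((1 / \<nu>) * ((Hdot_norm L (-1) c)\<^sup>2 / L^3) + \<nu> * ((Hdot_norm L 1 d)\<^sup>2 / L^3))"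
    using L by (intro mult_left_mono) auto
  also have "\<dots> = (1 / \<nu>) * (Hdot_norm L (-1) c)\<^sup>2 + \<nu> * (Hdot_norm L 1 d)\<^sup>2" using L by (simp add: field_simps)
  finally show ?thesis by (simp add: vpairing_def pairing_def g_def sum_distrib_left mult_ac)
qed

text \<open>
  In the energy inequality half of the viscous term absorbs the force.
\<close>

lemma energy_a_priori:
  assumes L: "L > 0" and nu: "\<nu> > 0" and f: "force L f" and sol: "weak_Leray_solution L \<alpha> \<nu> A \<phi> u0 f u ua P Pa" and t: "0 \<le> t" "t \<le> T" "0 < T"
  shows "(L2_norm L (u t))\<^sup>2 + \<nu> * (LINT s:{0..t}|lborel. (Hdot_norm L 1 (vfcoeff L (u s)))\<^sup>2)
     \<le> (L2_norm L u0)\<^sup>2 + (1 / \<nu>) * (LINT s:{0..T}|lborel. (Hdot_norm L (-1) (f s))\<^sup>2)"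
proof -
  define h where "h s = (Hdot_norm L 1 (vfcoeff L (u s)))\<^sup>2" for s
  define g where "g s = (Hdot_norm L (-1) (f s))\<^sup>2" for s
  have l: "L2_loc (\<lambda>v. vHdot L 1 (vfcoeff L v)) (\<lambda>v. Hdot_norm L 1 (vfcoeff L v)) u"
    and en: "(L2_norm L (u t))\<^sup>2 + 2 * \<nu> * (LINT s:{0..t}|lborel. h s) \<le> (L2_norm L u0)\<^sup>2 + 2 * (LINT s:{0..t}|lborel. vpairing L (f s) (vfcoeff L (u s)))"
    using sol t unfolding weak_Leray_solution_def h_def by auto
  have hT: "set_integrable lborel {0..T} h" and gT: "set_integrable lborel {0..T} g"
    using l f t unfolding h_def g_def L2_loc_def force_def by auto
  have h: "set_integrable lborel {0..t} h" and g: "set_integrable lborel {0..t} g"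
    using set_integrable_Icc_bounded[OF hT] set_integrable_Icc_bounded[OF gT] t by auto
  have ae: "AE s in lborel. s \<in> {0..t} \<longrightarrow> vpairing L (f s) (vfcoeff L (u s)) \<le> (1 / (2 * \<nu>)) * g s + (\<nu> / 2) * h s"
  proof -
    have "AE s in lborel. 0 \<le> s \<longrightarrow> vHdot L 1 (vfcoeff L (u s))" using l by (simp add: L2_loc_def)
    moreover have "AE s in lborel. 0 \<le> s \<longrightarrow> vHdot L (-1) (f s)" using f unfolding force_def L2_loc_def by (auto elim!: eventually_mono)
    ultimately show ?thesis
    proof eventually_elim
      case (elim s)
      show ?case
      proof
        assume "s \<in> {0..t}"
        then have "2 * vpairing L (f s) (vfcoeff L (u s)) \<le> (1 / \<nu>) * g s + \<nu> * h s"
          unfolding g_def h_def using elim by (intro vpairing_le L nu) auto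
        then show "vpairing L (f s) (vfcoeff L (u s)) \<le> (1 / (2 * \<nu>)) * g s + (\<nu> / 2) * h s" by (simp add: field_simps)
      qed
    qed
  qed
  have ri: "set_integrable lborel {0..t} (\<lambda>s. (1 / (2 * \<nu>)) * g s + (\<nu> / 2) * h s)"
    by (intro set_integral_add(1) set_integrable_mult_right g h)
  have "(LINT s:{0..t}|lborel. vpairing L (f s) (vfcoeff L (u s))) \<le> (LINT s:{0..t}|lborel. (1 / (2 * \<nu>)) * g s + (\<nu> / 2) * h s)"
  \<comment> \<open>if the power of the force is not integrable, its integral is \<open>0\<close> by convention\<close>
  proof (cases "set_integrable lborel {0..t} (\<lambda>s. vpairing L (f s) (vfcoeff L (u s)))")
    case True
    then show ?thesis unfolding set_lebesgue_integral_def using ri ae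
      by (intro integral_mono_AE) (auto simp: set_integrable_def indicator_def elim!: eventually_mono)
  next
    case False
    then have "(LINT s:{0..t}|lborel. vpairing L (f s) (vfcoeff L (u s))) = 0"
      unfolding set_integrable_def set_lebesgue_integral_def by (rule not_integrable_integral_eq)
    also have "0 \<le> (LINT s:{0..t}|lborel. (1 / (2 * \<nu>)) * g s + (\<nu> / 2) * h s)"
      unfolding set_lebesgue_integral_def by (rule integral_nonneg_AE) (use nu in \<open>auto simp: g_def h_def indicator_def\<close>)
    finally show ?thesis .
  qed
  also have "\<dots> = (1 / (2 * \<nu>)) * (LINT s:{0..t}|lborel. g s) + (\<nu> / 2) * (LINT s:{0..t}|lborel. h s)"
    using set_integral_add(2)[OF set_integrable_mult_right[of "1 / (2 * \<nu>)", OF g] set_integrable_mult_right[of "\<nu> / 2", OF h]] by simp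
  finally have "2 * (LINT s:{0..t}|lborel. vpairing L (f s) (vfcoeff L (u s))) \<le> (1 / \<nu>) * (LINT s:{0..t}|lborel. g s) + \<nu> * (LINT s:{0..t}|lborel. h s)"
    by (simp add: field_simps)
  moreover have "(1 / \<nu>) * (LINT s:{0..t}|lborel. g s) \<le> (1 / \<nu>) * (LINT s:{0..T}|lborel. g s)"
  proof (rule mult_left_mono)
    show "(LINT s:{0..t}|lborel. g s) \<le> (LINT s:{0..T}|lborel. g s)" unfolding set_lebesgue_integral_def
      by (rule integral_mono) (use g gT t in \<open>auto simp: set_integrable_def indicator_def g_def\<close>)
  qed (use nu in simp)
  ultimately show ?thesis using en unfolding h_def[symmetric] g_def[symmetric] by (simp add: algebra_simps)
qed

lemma vHdot_diff:
  assumes L: "L > 0" and c: "vHdot L s c" and d: "vHdot L s d" shows "vHdot L s (\<lambda>n. c n - d n)"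
  unfolding vHdot_def Hdot_def
proof (intro allI conjI)
  fix i
  show "real_mean0 (\<lambda>n. (c n - d n) $ i)" using c d by (simp add: vHdot_def Hdot_def real_mean0_def)
  have s: "(\<lambda>n. 2 * (norm (freq L n) powr (2 * s) * (norm (c n $ i))\<^sup>2) + 2 * (norm (freq L n) powr (2 * s) * (norm (d n $ i))\<^sup>2)) summable_on (- {0})"
    using c d by (intro summable_on_add summable_on_cmult_right) (auto simp: vHdot_def Hdot_def)
  show "(\<lambda>n. norm (freq L n) powr (2 * s) * (norm ((c n - d n) $ i))\<^sup>2) summable_on (- {0})"
  proof (rule summable_on_comparison_test[OF s])
    fix n
    have "(norm ((c n - d n) $ i))\<^sup>2 \<le> 2 * (norm (c n $ i))\<^sup>2 + 2 * (norm (d n $ i))\<^sup>2"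
      using norm_add_sq_le[of "c n $ i" "- d n $ i"] by simp
    then have "norm (freq L n) powr (2 * s) * (norm ((c n - d n) $ i))\<^sup>2 \<le> norm (freq L n) powr (2 * s) * (2 * (norm (c n $ i))\<^sup>2 + 2 * (norm (d n $ i))\<^sup>2)"
      by (intro mult_left_mono) auto
    then show "norm (freq L n) powr (2 * s) * (norm ((c n - d n) $ i))\<^sup>2
       \<le> 2 * (norm (freq L n) powr (2 * s) * (norm (c n $ i))\<^sup>2) + 2 * (norm (freq L n) powr (2 * s) * (norm (d n $ i))\<^sup>2)"
      by (simp add: algebra_simps)
  qed simp
qed

lemma Hdot_norm_diff_sq_le:
  assumes L: "L > 0" and c: "vHdot L s c" and d: "vHdot L s d"
  shows "(Hdot_norm L s (\<lambda>n. c n - d n))\<^sup>2 \<le> 2 * (Hdot_norm L s c)\<^sup>2 + 2 * (Hdot_norm L s d)\<^sup>2"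
proof -
  have h: "((\<lambda>n. norm (freq L n) powr (2 * s) * (norm (e n :: complex^3))\<^sup>2) has_sum ((Hdot_norm L s e)\<^sup>2 / L^3)) (- {0})" if "vHdot L s e" for e
    by (rule has_sum_Hdot[OF L]) (use that in \<open>auto simp: vHdot_def Hdot_def\<close>)
  have "(Hdot_norm L s (\<lambda>n. c n - d n))\<^sup>2 / L^3 \<le> 2 * ((Hdot_norm L s c)\<^sup>2 / L^3) + 2 * ((Hdot_norm L s d)\<^sup>2 / L^3)"
  proof (rule has_sum_mono[OF h[OF vHdot_diff[OF L c d]] has_sum_add[OF has_sum_cmult_right[OF h[OF c]] has_sum_cmult_right[OF h[OF d]]]])
    fix n
    have "(norm (c n - d n))\<^sup>2 \<le> 2 * (norm (c n))\<^sup>2 + 2 * (norm (d n))\<^sup>2"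
      using norm_add_sq_le[of "c n" "- d n"] by simp
    then have "norm (freq L n) powr (2 * s) * (norm (c n - d n))\<^sup>2 \<le> norm (freq L n) powr (2 * s) * (2 * (norm (c n))\<^sup>2 + 2 * (norm (d n))\<^sup>2)"
      by (intro mult_left_mono) auto
    then show "norm (freq L n) powr (2 * s) * (norm (c n - d n))\<^sup>2
       \<le> 2 * (norm (freq L n) powr (2 * s) * (norm (c n))\<^sup>2) + 2 * (norm (freq L n) powr (2 * s) * (norm (d n))\<^sup>2)"
      by (simp add: algebra_simps)
  qed
  then have "(Hdot_norm L s (\<lambda>n. c n - d n))\<^sup>2 / L^3 \<le> (2 * (Hdot_norm L s c)\<^sup>2 + 2 * (Hdot_norm L s d)\<^sup>2) / L^3"
    by (simp add: add_divide_distrib)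
  then show ?thesis using L by (simp add: divide_le_cancel)
qed

lemma fcoeff_time_measurable: "txm L g \<Longrightarrow> (\<lambda>t. fcoeff L (g t) n) \<in> borel_measurable tpos"
proof -
  assume g: "txm L g"
  have m1: "txm L (\<lambda>t x. cis (- (freq L n \<bullet> x)))"
    by (intro txm_space borel_measurable_continuous_onI continuous_intros)
  have m2: "txm L (\<lambda>t x. complex_of_real (g t x))" by (rule txm_compose[OF g]) simp
  have "txm L (\<lambda>t x. cis (- (freq L n \<bullet> x)) * complex_of_real (g t x))"
    using m1 m2 unfolding txm_def by (rule borel_measurable_times)
  from txm_integral[OF this] show ?thesis unfolding fcoeff_cfc cfc_def by (intro borel_measurable_divide) auto
qed

lemma Hdot_norm_time_measurable:
  assumes "\<And>n i. (\<lambda>t. c t n $ i :: complex) \<in> borel_measurable M"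
  shows "(\<lambda>t. Hdot_norm L s (c t :: int^3 \<Rightarrow> complex^3)) \<in> borel_measurable M"
proof -
  have n: "(\<lambda>t. (norm (c t n))\<^sup>2) \<in> borel_measurable M" for n
  proof -
    have "(\<lambda>t. norm (c t n $ i)) \<in> borel_measurable M" for i by (rule measurable_compose[OF assms]) simp
    then show ?thesis unfolding norm_vec_complex by (intro borel_measurable_sum borel_measurable_power)
  qed
  have "(\<lambda>t. \<Sum>\<^sub>\<infinity>n\<in>- {0}. norm (freq L n) powr (2 * s) * (norm (c t n))\<^sup>2) \<in> borel_measurable M"
    by (rule borel_measurable_infsum_zbox) (use n in \<open>auto intro: borel_measurable_times\<close>)
  then show ?thesis unfolding Hdot_norm_def
    by (intro measurable_compose[OF _ borel_measurable_sqrt] borel_measurable_times borel_measurable_const)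
qed

lemma Hsob_norm_time_measurable:
  assumes "\<And>n i. (\<lambda>t. c t n $ i :: complex) \<in> borel_measurable M"
  shows "(\<lambda>t. Hsob_norm L s (c t :: int^3 \<Rightarrow> complex^3)) \<in> borel_measurable M"
proof -
  have n: "(\<lambda>t. (norm (c t n))\<^sup>2) \<in> borel_measurable M" for n
  proof -
    have "(\<lambda>t. norm (c t n $ i)) \<in> borel_measurable M" for i by (rule measurable_compose[OF assms]) simp
    then show ?thesis unfolding norm_vec_complex by (intro borel_measurable_sum borel_measurable_power)
  qed
  have "(\<lambda>t. \<Sum>\<^sub>\<infinity>n\<in>- {0}. (1 + (norm (freq L n))\<^sup>2) powr s * (norm (c t n))\<^sup>2) \<in> borel_measurable M"
    by (rule borel_measurable_infsum_zbox) (use n in \<open>auto intro: borel_measurable_times\<close>)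
  then show ?thesis unfolding Hsob_norm_def
    by (intro measurable_compose[OF _ borel_measurable_sqrt] borel_measurable_times borel_measurable_const)
qed

text \<open>
  The chain rule for the real and imaginary parts (the phases \<open>0\<close> and \<open>\<pi>/2\<close>) of each component.
\<close>

lemma modal_energy_identity:
  fixes w R :: "real \<Rightarrow> complex^3"
  assumes ode: "\<And>i d. d \<in> {0, pi / 2} \<Longrightarrow> \<exists>F. (\<forall>T>0. set_integrable lborel {0..T} F) \<and>
       (AE t in tpos. F t = Re (cis (- d) * R t $ i)) \<and>
       (\<forall>s t. 0 \<le> s \<longrightarrow> s \<le> t \<longrightarrow> Re (cis (- d) * w t $ i) - Re (cis (- d) * w s $ i) = (LINT \<tau>:{s..t}|lborel. F \<tau>))"
  obtains E where "\<And>t. t \<ge> 0 \<Longrightarrow> set_integrable lborel {0..t} E" "AE t in tpos. E t = R t \<bullet> w t"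
    "\<And>t. t \<ge> 0 \<Longrightarrow> (norm (w t))\<^sup>2 = (norm (w 0))\<^sup>2 + 2 * (LINT s:{0..t}|lborel. E s)"
proof -
  define I where "I = (UNIV :: 3 set) \<times> {0, pi / 2}"
  have I: "finite I" by (simp add: I_def)
  define v where "v j t = Re (cis (- snd j) * w t $ fst j)" for j t
  have "\<forall>j\<in>I. \<exists>F. (\<forall>T>0. set_integrable lborel {0..T} F) \<and> (AE t in tpos. F t = Re (cis (- snd j) * R t $ fst j)) \<and>
       (\<forall>s t. 0 \<le> s \<longrightarrow> s \<le> t \<longrightarrow> v j t - v j s = (LINT \<tau>:{s..t}|lborel. F \<tau>))"
    unfolding v_def by (intro ballI ode) (auto simp: I_def)
  from bchoice[OF this] obtain F where F0: "\<forall>j\<in>I. (\<forall>T>0. set_integrable lborel {0..T} (F j)) \<and> (AE t in tpos. F j t = Re (cis (- snd j) * R t $ fst j)) \<and>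
       (\<forall>s t. 0 \<le> s \<longrightarrow> s \<le> t \<longrightarrow> v j t - v j s = (LINT \<tau>:{s..t}|lborel. F j \<tau>))" by blast
  then have F: "\<And>j T. j \<in> I \<Longrightarrow> T > 0 \<Longrightarrow> set_integrable lborel {0..T} (F j)"
    "\<And>j. j \<in> I \<Longrightarrow> AE t in tpos. F j t = Re (cis (- snd j) * R t $ fst j)"
    "\<And>j s t. j \<in> I \<Longrightarrow> 0 \<le> s \<Longrightarrow> s \<le> t \<Longrightarrow> v j t - v j s = (LINT \<tau>:{s..t}|lborel. F j \<tau>)"
    by blast+
  have Ft: "set_integrable lborel {0..t} (F j)" if "j \<in> I" "t \<ge> 0" for j t
    using set_integrable_Icc_bounded[OF F(1)[OF that(1), of "t + 1"], of 0 t] that by simp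
  have sq: "set_integrable lborel {0..t} (\<lambda>x. F j x * v j x)" "(v j t)\<^sup>2 = (v j 0)\<^sup>2 + 2 * (LINT x:{0..t}|lborel. F j x * v j x)"
    if "j \<in> I" "t \<ge> 0" for j t
    using indefinite_integral_square[OF Ft[OF that] that(2), of "v j"] F(3)[OF that(1)] by auto
  have sumI: "(\<Sum>j\<in>I. h j) = (\<Sum>i\<in>UNIV. h (i, 0) + h (i, pi / 2))" for h :: "3 \<times> real \<Rightarrow> real"
    unfolding I_def sum.cartesian_product[symmetric, of "\<lambda>i d. h (i, d)", simplified] by simp
  have nw: "(norm (w t))\<^sup>2 = (\<Sum>j\<in>I. (v j t)\<^sup>2)" for t
    by (simp add: sumI v_def norm_vec_complex cmod_power2)
  show ?thesis
  proof (rule that[of "\<lambda>t. \<Sum>j\<in>I. F j t * v j t"])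
    show i: "set_integrable lborel {0..t} (\<lambda>t. \<Sum>j\<in>I. F j t * v j t)" if "t \<ge> 0" for t
      using sq(1)[OF _ that] unfolding set_integrable_def by (simp add: sum_distrib_left del: scaleR_conv_of_real)
    show "(norm (w t))\<^sup>2 = (norm (w 0))\<^sup>2 + 2 * (LINT s:{0..t}|lborel. \<Sum>j\<in>I. F j s * v j s)" if t: "t \<ge> 0" for t
    proof -
      have "(LINT s:{0..t}|lborel. \<Sum>j\<in>I. F j s * v j s) = (\<Sum>j\<in>I. LINT s:{0..t}|lborel. F j s * v j s)"
        using sq(1)[OF _ t] unfolding set_integrable_def set_lebesgue_integral_def
        by (subst Bochner_Integration.integral_sum[symmetric]) (auto simp: sum_distrib_left)
      then show ?thesis unfolding nw using sq(2)[OF _ t] by (simp add: sum.distrib sum_distrib_left)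
    qed
    have "AE t in tpos. \<forall>j\<in>I. F j t = Re (cis (- snd j) * R t $ fst j)"
      using F(2) I by (simp add: AE_finite_all)
    then show "AE t in tpos. (\<Sum>j\<in>I. F j t * v j t) = R t \<bullet> w t"
    proof eventually_elim
      case (elim t)
      then have "(\<Sum>j\<in>I. F j t * v j t) = (\<Sum>j\<in>I. Re (cis (- snd j) * R t $ fst j) * v j t)" by (intro sum.cong) auto
      also have "\<dots> = R t \<bullet> w t" by (simp add: sumI v_def inner_vec_def inner_complex_def)
      finally show ?case .
    qed
  qed
qed

section \<open>Lipschitz dependence of the filtered velocity on the velocity\<close>

lemma trig_poly_sqi: assumes "trig_poly L p" shows "sqi (cell L) p"
proof -
  obtain K a b where K: "finite K" and p: "p = (\<lambda>x. \<Sum>n\<in>K. cos (freq L n \<bullet> x) *\<^sub>R a n + sin (freq L n \<bullet> x) *\<^sub>R b n)"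
    using assms unfolding trig_poly_def by blast
  have "sqi (cell L) (\<lambda>x. cos (freq L n \<bullet> x) *\<^sub>R (a n :: real^3))" "sqi (cell L) (\<lambda>x. sin (freq L n \<bullet> x) *\<^sub>R (b n :: real^3))" for n
    by (rule sqi_mult_bounded[OF sqi_const[OF finite_measure_cell], of _ _ 1];
        auto intro!: borel_measurable_cell borel_measurable_continuous_onI continuous_intros)+
  then show ?thesis unfolding p by (intro sqi_sum K sqi_add)
qed

text \<open>
  The approximating trigonometric polynomials have mean zero, and the mean is continuous in \<open>L\<^sup>2\<close>.
\<close>

lemma L2s_mean0: assumes L: "L > 0" and v: "L2s L v" shows "vfcoeff L v 0 = 0"
proof -
  have vs: "sqi (cell L) v" by (rule L2s_sqi[OF v])
  have "norm (\<integral>x. v x \<partial>cell L) \<le> sqrt (L^3) * e" if e: "e > 0" for e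
  proof -
    obtain p where p: "trig_poly L p" "tint L p = 0" "L2_norm L (\<lambda>x. v x - p x) < e" using v e unfolding L2s_def by blast
    have ps: "sqi (cell L) p" by (rule trig_poly_sqi[OF p(1)])
    have "(\<integral>x. v x \<partial>cell L) = (\<integral>x. v x - p x \<partial>cell L)"
      using p(2) by (simp add: tint_cell sqi_cell_integrable[OF vs] sqi_cell_integrable[OF ps])
    also have "norm \<dots> \<le> (\<integral>x. norm (1::real) * norm (v x - p x) \<partial>cell L)" by simp
    also have "\<dots> \<le> sqrt (\<integral>x. (norm (1::real))\<^sup>2 \<partial>cell L) * sqrt (\<integral>x. (norm (v x - p x))\<^sup>2 \<partial>cell L)"
      by (rule sqi_Cauchy_Schwarz[OF sqi_const[OF finite_measure_cell] sqi_diff[OF vs ps]])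
    also have "\<dots> = sqrt (L^3) * L2_norm L (\<lambda>x. v x - p x)" by (simp add: L2_norm_def tint_cell measure_cell[OF L])
    also have "\<dots> \<le> sqrt (L^3) * e" using p(3) L by (intro mult_left_mono) auto
    finally show ?thesis .
  qed
  then have "norm (\<integral>x. v x \<partial>cell L) \<le> 0 + e" if e: "e > 0" for e
    using that[THEN divide_pos_pos, of "sqrt (L^3)"] L e by (metis add_0 nonzero_mult_div_cancel_left order_less_irrefl real_sqrt_gt_0_iff times_divide_eq_right zero_less_power)
  then have "norm (\<integral>x. v x \<partial>cell L) \<le> 0" by (rule field_le_epsilon)
  then have z: "(\<integral>x. v x \<partial>cell L) = 0" by simp
  have "(\<integral>x. v x $ i \<partial>cell L) = 0" for i
  proof -
    have "(\<integral>x. v x \<bullet> axis i 1 \<partial>cell L) = (\<integral>x. v x \<partial>cell L) \<bullet> axis i 1"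
      by (rule integral_inner_left) (use sqi_cell_integrable[OF vs] in auto)
    then show ?thesis using z by (simp add: inner_axis)
  qed
  then show ?thesis by (simp add: vec_eq_iff vfcoeff_def fcoeff_cfc cfc_def)
qed

lemma sqsum_le_mono: "sqsum_le f A \<Longrightarrow> A \<le> B \<Longrightarrow> sqsum_le f B"
  unfolding sqsum_le_def by (meson order_trans power_mono)

lemma L2_norm_sq_vec: "sqi (cell L) v \<Longrightarrow> (L2_norm L v)\<^sup>2 = (\<Sum>i\<in>UNIV. \<integral>x. (v x $ i)\<^sup>2 \<partial>cell L)" for v :: "real^3 \<Rightarrow> real^3"
  by (simp add: L2_norm_sq integral_norm_sq_vec)

text \<open>
  \<open>filtered_difference_energy\<close> for the coefficients \<open>A (\<phi> * u1)\<close> and \<open>A (\<phi> * u2)\<close>, whose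
  difference is at most \<open>\<Lambda> C\<close> times the norm of \<open>u1 - u2\<close>; the gradient of \<open>v2\<close> is bounded by
  \<open>filtered_energy\<close>.
\<close>

lemma filtered_stability:
  fixes A :: "real^3 \<Rightarrow> real"
  assumes L: "L > 0" and al: "\<alpha> > 0" and be: "\<beta> > 0" and A: "\<And>x. \<beta> \<le> A x" and Lip: "\<Lambda>-lipschitz_on UNIV A"
    and c: "conv_bounded L \<phi> C"
    and m: "(\<lambda>x. A (conv L \<phi> u1 x)) \<in> borel_measurable (cell L)" "(\<lambda>x. A (conv L \<phi> u2 x)) \<in> borel_measurable (cell L)"
    and f1: "filtered L \<alpha> (\<lambda>x. A (conv L \<phi> u1 x)) u1 v1 D1 p1" and f2: "filtered L \<alpha> (\<lambda>x. A (conv L \<phi> u2 x)) u2 v2 D2 p2"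
    and u: "sqi (cell L) u1" "sqi (cell L) u2" and M: "(L2_norm L u1)\<^sup>2 \<le> M" "(L2_norm L u2)\<^sup>2 \<le> M"
  defines "D0 \<equiv> (1 + 1 / (\<alpha>\<^sup>2 * \<beta>)) * (1 + \<Lambda>\<^sup>2 * C\<^sup>2 * M / (2 * \<beta>\<^sup>2))"
  shows "grad_sq L (\<lambda>x i j. D1 x $ i $ j - D2 x $ i $ j) \<le> D0 * (L2_norm L (\<lambda>x. u1 x - u2 x))\<^sup>2"
    and "(Hsob_norm L 1 (vfcoeff L (\<lambda>x. v1 x - v2 x)))\<^sup>2 \<le> D0 * (L2_norm L (\<lambda>x. u1 x - u2 x))\<^sup>2"
    and "grad_sq L (\<lambda>x i j. D1 x $ i $ j) \<le> M / (2 * \<alpha>\<^sup>2 * \<beta>)"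
proof -
  define y where "y = (L2_norm L (\<lambda>x. u1 x - u2 x))\<^sup>2"
  define S where "S = grad_sq L (\<lambda>x i j. D1 x $ i $ j - D2 x $ i $ j)"
  define s where "s = (\<Sum>i\<in>UNIV. \<integral>x. (v1 x $ i - v2 x $ i)\<^sup>2 \<partial>cell L)"
  define q where "q = 1 + \<Lambda>\<^sup>2 * C\<^sup>2 * M / (2 * \<beta>\<^sup>2)"
  have nn: "S \<ge> 0" "s \<ge> 0" "y \<ge> 0" "M \<ge> 0"
    unfolding S_def s_def y_def using M(1) by (auto intro!: sum_nonneg integral_nonneg_AE intro: order_trans[OF zero_le_power2])
  have ab: "\<alpha>\<^sup>2 * \<beta> > 0" using al be by simp
  have gr: "grad_sq L (\<lambda>x i j. D x $ i $ j) \<le> M / (2 * \<alpha>\<^sup>2 * \<beta>)"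
    if "filtered L \<alpha> (\<lambda>x. A (conv L \<phi> u x)) u v D p" "(\<lambda>x. A (conv L \<phi> u x)) \<in> borel_measurable (cell L)" "sqi (cell L) u" "(L2_norm L u)\<^sup>2 \<le> M" for u v D p
  proof -
    have "2 * \<alpha>\<^sup>2 * \<beta> * grad_sq L (\<lambda>x i j. D x $ i $ j) + (\<Sum>i\<in>UNIV. \<integral>x. (v x $ i)\<^sup>2 \<partial>cell L) \<le> (L2_norm L u)\<^sup>2"
      unfolding L2_norm_sq_vec[OF that(3)] by (rule filtered_energy[OF L be _ that(2,1)]) (rule A)
    moreover have "(\<Sum>i\<in>UNIV. \<integral>x. (v x $ i)\<^sup>2 \<partial>cell L) \<ge> 0" by (intro sum_nonneg integral_nonneg_AE) auto
    ultimately have "2 * \<alpha>\<^sup>2 * \<beta> * grad_sq L (\<lambda>x i j. D x $ i $ j) \<le> M" using that(4) by linarith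
    then show ?thesis using ab by (simp add: pos_le_divide_eq mult.commute mult.left_commute)
  qed
  show "grad_sq L (\<lambda>x i j. D1 x $ i $ j) \<le> M / (2 * \<alpha>\<^sup>2 * \<beta>)" by (rule gr[OF f1 m(1) u(1) M(1)])
  define \<kappa> where "\<kappa> = \<Lambda> * (C * sqrt y)"
  have k: "\<bar>A (conv L \<phi> u1 x) - A (conv L \<phi> u2 x)\<bar> \<le> \<kappa>" for x
  proof -
    have "\<bar>A (conv L \<phi> u1 x) - A (conv L \<phi> u2 x)\<bar> \<le> \<Lambda> * norm (conv L \<phi> u1 x - conv L \<phi> u2 x)"
      using lipschitz_onD[OF Lip] by (simp add: dist_norm)
    also have "conv L \<phi> u1 x - conv L \<phi> u2 x = conv L \<phi> (\<lambda>x. u1 x - u2 x) x" using c u unfolding conv_bounded_def by simp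
    also have "\<Lambda> * norm \<dots> \<le> \<Lambda> * (C * L2_norm L (\<lambda>x. u1 x - u2 x))"
      using c sqi_diff[OF u] lipschitz_on_nonneg[OF Lip] unfolding conv_bounded_def by (intro mult_left_mono) auto
    finally show ?thesis by (simp add: \<kappa>_def y_def L2_norm_nonneg)
  qed
  have k2: "\<kappa>\<^sup>2 = \<Lambda>\<^sup>2 * C\<^sup>2 * y" using nn by (simp add: \<kappa>_def power_mult_distrib)
  have sw: "sqi (cell L) (\<lambda>x. u1 x - u2 x)" by (rule sqi_diff[OF u])
  have "\<alpha>\<^sup>2 * \<beta> * S + s \<le> y + \<alpha>\<^sup>2 * (\<kappa>\<^sup>2 / \<beta>) * grad_sq L (\<lambda>x i j. D2 x $ i $ j)"
    using filtered_difference_energy[OF L be _ m f1 f2 k] A unfolding S_def s_def y_def L2_norm_sq_vec[OF sw] by simp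
  also have "\<dots> \<le> y + \<alpha>\<^sup>2 * (\<kappa>\<^sup>2 / \<beta>) * (M / (2 * \<alpha>\<^sup>2 * \<beta>))"
    by (intro add_left_mono mult_left_mono gr[OF f2 m(2) u(2) M(2)]) (use be in auto)
  also have "\<dots> = q * y" unfolding q_def k2 using al be by (simp add: field_simps power2_eq_square)
  finally have main: "\<alpha>\<^sup>2 * \<beta> * S + s \<le> q * y" .
  have "\<alpha>\<^sup>2 * \<beta> * S \<le> q * y" using main nn by linarith
  then have Sle: "S \<le> (1 / (\<alpha>\<^sup>2 * \<beta>)) * (q * y)" using ab by (simp add: field_simps)
  have "\<alpha>\<^sup>2 * \<beta> * S \<ge> 0" using nn(1) ab by simp
  then have sle: "s \<le> q * y" using main by linarith
  have qy: "q * y \<ge> 0" using sle nn by linarith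
  have D0: "D0 * y = q * y + (1 / (\<alpha>\<^sup>2 * \<beta>)) * (q * y)" unfolding D0_def q_def[symmetric] by (simp add: algebra_simps)
  show "S \<le> D0 * y" unfolding D0 using Sle qy by linarith
  have g: "has_grad L j (\<lambda>x. (v1 x - v2 x) $ i) (\<lambda>x. (D1 x - D2 x) $ i $ j)" for i j
    using f1 f2 unfolding filtered_def by (simp add: has_grad_diff[OF L])
  have z0: "vfcoeff L (\<lambda>x. v1 x - v2 x) 0 = 0"
  proof -
    have "vfcoeff L (\<lambda>x. v1 x - v2 x) 0 $ i = vfcoeff L v1 0 $ i - vfcoeff L v2 0 $ i" for i
      unfolding vfcoeff_def using f1 f2 L by (simp add: filtered_def fcoeff_diff sqi_cell_integrable)
    then show ?thesis using f1 f2 by (simp add: vec_eq_iff filtered_def)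
  qed
  have "(Hsob_norm L 1 (vfcoeff L (\<lambda>x. v1 x - v2 x)))\<^sup>2 = s + S"
    using Hsob_norm_parseval(1)[OF L g z0] by (simp add: s_def S_def)
  then show "(Hsob_norm L 1 (vfcoeff L (\<lambda>x. v1 x - v2 x)))\<^sup>2 \<le> D0 * y" unfolding D0 using Sle sle by linarith
qed

text \<open>
  A nonnegative function can have a negative essential supremum only on a null space.
\<close>

lemma esssup_nonneg:
  fixes T :: real
  assumes T: "T > 0" and f: "\<And>t. f t \<ge> 0"
  shows "0 \<le> esssup (restrict_space lborel {0..T}) (\<lambda>t. ereal (f t))"
proof (rule ccontr)
  assume "\<not> ?thesis"
  then have n: "esssup (restrict_space lborel {0..T}) (\<lambda>t. ereal (f t)) < 0" by simp
  have "AE t in restrict_space lborel {0..T}. ereal (f t) \<le> esssup (restrict_space lborel {0..T}) (\<lambda>t. ereal (f t))" by (rule esssup_AE)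
  then have "AE t in restrict_space lborel {0..T}. False"
    by eventually_elim (use n f in \<open>meson ereal_less_eq(5) leD order_trans\<close>)
  then obtain N where N: "{t \<in> space (restrict_space lborel {0..T}). \<not> False} \<subseteq> N"
    "emeasure (restrict_space lborel {0..T}) N = 0" "N \<in> sets (restrict_space lborel {0..T})" by (rule AE_E)
  have "emeasure (restrict_space lborel {0..T}) {0..T} \<le> emeasure (restrict_space lborel {0..T}) N"
    by (rule emeasure_mono) (use N in \<open>auto simp: space_restrict_space\<close>)
  moreover have "emeasure (restrict_space lborel {0..T}) {0..T} = ennreal T"
    using T by (subst emeasure_restrict_space) auto
  ultimately show False using N(2) T by simp
qed

text \<open>
  A pointwise bound almost everywhere passes to essential suprema; if the right-hand one is infinite, so is
  the whole right-hand side as \<open>D > 0\<close>.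
\<close>

lemma Linf_norm_sq_le:
  fixes T :: real
  assumes T: "T > 0" and D: "D > 0" and g: "\<And>t. g t \<ge> 0" and h: "\<And>t. h t \<ge> 0"
    and gm: "(\<lambda>t. g t) \<in> borel_measurable (restrict_space lborel {0..T})"
    and le: "AE t in lborel. t \<in> {0..T} \<longrightarrow> (g t)\<^sup>2 \<le> D * (h t)\<^sup>2"
  shows "(esssup (restrict_space lborel {0..T}) (\<lambda>t. ereal (g t)))\<^sup>2 \<le> ereal D * (esssup (restrict_space lborel {0..T}) (\<lambda>t. ereal (h t)))\<^sup>2"
proof -
  let ?M = "restrict_space lborel {0..T}"
  define G where "G = esssup ?M (\<lambda>t. ereal (g t))"
  define H where "H = esssup ?M (\<lambda>t. ereal (h t))"
  have G0: "0 \<le> G" and H0: "0 \<le> H" unfolding G_def H_def by (intro esssup_nonneg T g h)+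
  show ?thesis
  proof (cases "H = \<infinity>")
    case True
    then show ?thesis unfolding G_def[symmetric] H_def[symmetric] using D by (simp add: power2_eq_square)
  next
    case False
    then obtain r where r: "H = ereal r" "r \<ge> 0" using H0 by (cases H) auto
    have "AE t in ?M. ereal (h t) \<le> H" unfolding H_def by (rule esssup_AE)
    then have hr: "AE t in ?M. h t \<le> r" using r by simp
    have "AE t in ?M. (g t)\<^sup>2 \<le> D * (h t)\<^sup>2" using le by (subst AE_restrict_space_iff) auto
    then have "AE t in ?M. ereal (g t) \<le> ereal (sqrt D * r)" using hr
    proof eventually_elim
      case (elim t)
      have "(h t)\<^sup>2 \<le> r\<^sup>2" using elim h by (intro power_mono)
      then have "(g t)\<^sup>2 \<le> D * r\<^sup>2" using elim D by (meson mult_left_mono order_trans less_imp_le)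
      then have "(g t)\<^sup>2 \<le> (sqrt D * r)\<^sup>2" using D by (simp add: power_mult_distrib)
      then have "g t \<le> sqrt D * r" by (rule power2_le_imp_le) (use D r in simp)
      then show ?case by simp
    qed
    then have "G \<le> ereal (sqrt D * r)" unfolding G_def by (intro esssup_I) (use gm in auto)
    then obtain x where x: "G = ereal x" "0 \<le> x" "x \<le> sqrt D * r" using G0 by (cases G) auto
    have "x\<^sup>2 \<le> (sqrt D * r)\<^sup>2" using x by (intro power_mono)
    then have "x\<^sup>2 \<le> D * r\<^sup>2" using D by (simp add: power_mult_distrib)
    then show ?thesis unfolding G_def[symmetric] H_def[symmetric] x(1) r(1) by simp
  qed
qed

section \<open>The energy inequality for the difference of two velocities\<close>

lemma vfcoeff_diff:
  assumes "L > 0" "sqi (cell L) (u :: _ \<Rightarrow> real^3)" "sqi (cell L) v"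
  shows "vfcoeff L (\<lambda>x. u x - v x) n = vfcoeff L u n - vfcoeff L v n"
  using assms sqi_vec_component[of "cell L" u] sqi_vec_component[of "cell L" v]
  by (simp add: vec_eq_iff vfcoeff_def fcoeff_diff sqi_cell_integrable)

lemma L2_norm_diff_sq_le:
  assumes "sqi (cell L) u" "sqi (cell L) v"
  shows "(L2_norm L (\<lambda>x. u x - v x))\<^sup>2 \<le> 2 * (L2_norm L u)\<^sup>2 + 2 * (L2_norm L v)\<^sup>2"
  unfolding L2_norm_sq using sqi_integral_add_le[OF assms(1) sqi_uminus[OF assms(2)]] by simp

text \<open>
  The rate of change of the energy in the modes \<open>K\<close> of \<open>w = u1 - u2\<close> at a fixed time.  The terms on
  the right are half of the viscosity, the tail that replaces the cancellation in \<open>(a1 \<cdot> \<nabla>) w\<close>, the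
  term \<open>((a1 - a2) \<cdot> \<nabla>) u2\<close>, and the force.
\<close>

lemma pointwise_energy:
  assumes L: "L > 0" and nu: "\<nu> > 0"
    and C: "trilinear_bound L C"
    and K: "finite K" "0 \<notin> K"
    and u: "\<And>i j. has_grad L j (\<lambda>x. u1 x $ i) (\<lambda>x. D1 x $ i $ j)" "\<And>i j. has_grad L j (\<lambda>x. u2 x $ i) (\<lambda>x. D2 x $ i $ j)"
    and vu: "vHdot L 1 (vfcoeff L u1)" "vHdot L 1 (vfcoeff L u2)"
    and du: "\<And>k. freq_dot L k (vfcoeff L u1 k) = 0" "\<And>k. freq_dot L k (vfcoeff L u2 k) = 0"
    and a: "\<And>i j. has_grad L j (\<lambda>x. a1 x $ i) (\<lambda>x. B1 x $ i $ j)" "\<And>i j. has_grad L j (\<lambda>x. a2 x $ i) (\<lambda>x. B2 x $ i $ j)"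
    and a0: "vfcoeff L a1 0 = 0" "vfcoeff L a2 0 = 0"
    and da: "\<And>k. freq_dot L k (vfcoeff L a1 k) = 0"
    and B1: "grad_sq L (\<lambda>x i j. B1 x $ i $ j) \<le> S1"
    and Bz: "grad_sq L (\<lambda>x i j. B1 x $ i $ j - B2 x $ i $ j) \<le> Sz"
    and f: "vHdot L (-1) (\<lambda>n. f1 n - f2 n)"
  defines "w \<equiv> \<lambda>n. vfcoeff L u1 n - vfcoeff L u2 n"
    and "e \<equiv> L^3 * (\<Sum>k\<in>K. (norm (freq L k) * norm (vfcoeff L u1 k - vfcoeff L u2 k))\<^sup>2)"
  shows "L^3 * (\<Sum>k\<in>K. (modal_rhs L \<nu> f1 u1 a1 D1 p1 k - modal_rhs L \<nu> f2 u2 a2 D2 p2 k) \<bullet> w k)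
    \<le> - (\<nu> / 2) * e + C * sqrt (S1 / L^3) * (sqrt ((Hdot_norm L 1 w)\<^sup>2 - e) * sqrt e)
      + C\<^sup>2 / (\<nu> * L^3) * Sz * (Hdot_norm L 1 (vfcoeff L u2))\<^sup>2 + (Hdot_norm L (-1) (\<lambda>n. f1 n - f2 n))\<^sup>2 / \<nu>"
proof -
  have L3: "L^3 > 0" using L by simp
  define E where "E = (\<Sum>k\<in>K. (norm (freq L k) * norm (w k))\<^sup>2)"
  define W where "W = (Hdot_norm L 1 w)\<^sup>2 / L^3"
  define h2 where "h2 = (Hdot_norm L 1 (vfcoeff L u2))\<^sup>2"
  define X where "X k = (\<Sum>i\<in>UNIV. fcoeff L (advection a1 D1 i) k \<bullet> w k $ i) - (\<Sum>i\<in>UNIV. fcoeff L (advection a2 D2 i) k \<bullet> w k $ i)" for k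
  have eE: "e = L^3 * E" by (simp add: e_def E_def w_def)
  have S0: "S1 \<ge> 0" "Sz \<ge> 0" "h2 \<ge> 0"
  proof -
    have "0 \<le> grad_sq L (\<lambda>x i j. B1 x $ i $ j)" by (intro sum_nonneg integral_nonneg_AE) auto
    then show "S1 \<ge> 0" using B1 by (rule order_trans)
    have "0 \<le> grad_sq L (\<lambda>x i j. B1 x $ i $ j - B2 x $ i $ j)" by (intro sum_nonneg integral_nonneg_AE) auto
    then show "Sz \<ge> 0" using Bz by (rule order_trans)
  qed (simp add: h2_def)
  have sa: "sqi (cell L) (\<lambda>x. a1 x $ i)" "sqi (cell L) (\<lambda>x. a2 x $ i)" for i using has_grad_sqi[OF a(1)] has_grad_sqi[OF a(2)] by auto
  have zc: "vfcoeff L (\<lambda>x. a1 x - a2 x) n = vfcoeff L a1 n - vfcoeff L a2 n" for n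
    using sa L by (simp add: vec_eq_iff vfcoeff_def fcoeff_diff sqi_cell_integrable)
  have zg: "has_grad L j (\<lambda>x. (a1 x - a2 x) $ i) (\<lambda>x. (B1 x - B2 x) $ i $ j)" for i j
    using has_grad_diff[OF L a(1) a(2)] by simp
  have A1: "sqsum_le (\<lambda>n. norm (freq L n) * norm (vfcoeff L a1 n)) (sqrt (S1 / L^3))"
  proof (rule sqsum_le_mono)
    show "sqsum_le (\<lambda>n. norm (freq L n) * norm (vfcoeff L a1 n)) (sqrt (grad_sq L (\<lambda>x i j. B1 x $ i $ j) / L^3))"
      using Hsob_norm_parseval(2)[OF L a(1) a0(1)] by (intro sqsum_le_has_sum) (simp add: power_mult_distrib)
  qed (use B1 L3 in \<open>simp add: divide_right_mono\<close>)
  have Az: "sqsum_le (\<lambda>n. norm (freq L n) * norm (vfcoeff L a1 n - vfcoeff L a2 n)) (sqrt (Sz / L^3))"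
  proof (rule sqsum_le_mono)
    show "sqsum_le (\<lambda>n. norm (freq L n) * norm (vfcoeff L a1 n - vfcoeff L a2 n)) (sqrt (grad_sq L (\<lambda>x i j. (B1 x - B2 x) $ i $ j) / L^3))"
      using Hsob_norm_parseval(2)[OF L zg] a0 by (intro sqsum_le_has_sum) (simp add: power_mult_distrib zc)
  qed (use Bz L3 in \<open>simp add: divide_right_mono\<close>)
  have all0: "((\<lambda>n. (norm (freq L n) * norm (c n))\<^sup>2) has_sum (Hdot_norm L 1 c)\<^sup>2 / L^3) UNIV" if "vHdot L 1 c" for c :: "int^3 \<Rightarrow> complex^3"
    by (rule has_sum_cong_neutral[THEN iffD1, OF _ _ _ vHdot1_has_sum[OF L that]]) (auto simp: power_mult_distrib)
  have G2: "sqsum_le (\<lambda>n. norm (freq L n) * norm (vfcoeff L u2 n)) (sqrt (h2 / L^3))"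
    unfolding h2_def by (rule sqsum_le_has_sum[OF all0[OF vu(2)]])
  have Wh: "((\<lambda>n. (norm (freq L n) * norm (w n))\<^sup>2) has_sum W) UNIV"
    unfolding W_def by (rule all0) (use vHdot_diff[OF L vu] in \<open>simp add: w_def\<close>)
  have re: "vfcoeff L a1 (- n) $ j = cnj (vfcoeff L a1 n $ j)" for n j by (simp add: vfcoeff_def fcoeff_uminus)
  have Xs: "((\<lambda>m. tri L (vfcoeff L a1) (vfcoeff L u1) w k m - tri L (vfcoeff L a2) (vfcoeff L u2) w k m) has_sum X k) UNIV" for k
    unfolding X_def by (intro has_sum_diff_real advection_has_sum L sa u)
  have XB: "\<bar>\<Sum>k\<in>K. X k\<bar> \<le> C * sqrt (S1 / L^3) * sqrt (W - E) * sqrt E + C * sqrt (Sz / L^3) * sqrt (h2 / L^3) * sqrt E"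
    unfolding E_def
    by (rule advection_difference_bound[OF C K A1 a0(1) da re Az _ G2 w_def[THEN meta_eq_to_obj_eq] Wh Xs]) (auto simp: a0)
  define q where "q k = fcoeff L p1 k - fcoeff L p2 k" for k
  define N where "N k = (\<chi> i. fcoeff L (advection a1 D1 i) k - fcoeff L (advection a2 D2 i) k)" for k
  have NX: "N k \<bullet> w k = X k" for k by (simp add: N_def X_def inner_vec_def inner_diff_left sum_subtractf)
  have dw: "freq_dot L k (w k) = 0" for k
    using du[of k] by (simp add: w_def right_diff_distrib sum_subtractf)
  have "(\<Sum>k\<in>K. (modal_rhs L \<nu> f1 u1 a1 D1 p1 k - modal_rhs L \<nu> f2 u2 a2 D2 p2 k) \<bullet> w k)
     \<le> - (\<nu> / 2) * E + C * sqrt (S1 / L^3) * sqrt (W - E) * sqrt E + (C * sqrt (Sz / L^3) * sqrt (h2 / L^3))\<^sup>2 / \<nu> + ((Hdot_norm L (-1) (\<lambda>n. f1 n - f2 n))\<^sup>2 / L^3) / \<nu>"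
  proof (rule modal_energy_bound[OF L nu K E_def XB dw _ NX vHdotm1_has_sum[OF L f]])
    fix k i
    show "(modal_rhs L \<nu> f1 u1 a1 D1 p1 k - modal_rhs L \<nu> f2 u2 a2 D2 p2 k) $ i =
       - complex_of_real (\<nu> * (norm (freq L k))\<^sup>2) * w k $ i - N k $ i - \<i> * complex_of_real (freq L k $ i) * q k + (f1 k - f2 k) $ i"
      by (simp add: modal_rhs_def w_def N_def q_def algebra_simps)
  qed
  then have "L^3 * (\<Sum>k\<in>K. (modal_rhs L \<nu> f1 u1 a1 D1 p1 k - modal_rhs L \<nu> f2 u2 a2 D2 p2 k) \<bullet> w k)
     \<le> L^3 * (- (\<nu> / 2) * E + C * sqrt (S1 / L^3) * sqrt (W - E) * sqrt E + (C * sqrt (Sz / L^3) * sqrt (h2 / L^3))\<^sup>2 / \<nu> + ((Hdot_norm L (-1) (\<lambda>n. f1 n - f2 n))\<^sup>2 / L^3) / \<nu>)"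
    using L3 by (intro mult_left_mono) auto
  also have "\<dots> = - (\<nu> / 2) * e + C * sqrt (S1 / L^3) * (L^3 * (sqrt (W - E) * sqrt E)) + L^3 * ((C * sqrt (Sz / L^3) * sqrt (h2 / L^3))\<^sup>2 / \<nu>) + (Hdot_norm L (-1) (\<lambda>n. f1 n - f2 n))\<^sup>2 / \<nu>"
    using L by (simp add: eE algebra_simps)
  also have "L^3 * (sqrt (W - E) * sqrt E) = sqrt ((Hdot_norm L 1 w)\<^sup>2 - e) * sqrt e"
  proof -
    have "sqrt ((Hdot_norm L 1 w)\<^sup>2 - e) = sqrt (L^3 * (W - E))" using L by (simp add: W_def eE right_diff_distrib)
    moreover have "sqrt (L^3) * sqrt (L^3) = L^3" using L3 by simp
    ultimately show ?thesis unfolding eE real_sqrt_mult by (metis mult.assoc mult.left_commute)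
  qed
  also have "L^3 * ((C * sqrt (Sz / L^3) * sqrt (h2 / L^3))\<^sup>2 / \<nu>) = C\<^sup>2 / (\<nu> * L^3) * Sz * h2"
    using S0 L nu by (simp add: power_mult_distrib field_simps)
  finally show ?thesis unfolding h2_def .
qed

text \<open>
  The constant of \<open>filtered_stability\<close>.
\<close>

definition stab_D :: "real \<Rightarrow> real \<Rightarrow> real \<Rightarrow> real \<Rightarrow> real \<Rightarrow> real" where
  "stab_D \<alpha> \<beta> \<Lambda> C M = (1 + 1 / (\<alpha>\<^sup>2 * \<beta>)) * (1 + \<Lambda>\<^sup>2 * C\<^sup>2 * M / (2 * \<beta>\<^sup>2))"

text \<open>
  The core of the proof: the energy identities of finitely many modes are summed, \<open>pointwise_energy\<close> is
  inserted, and the box of frequencies grows.  The tail term, which is dominated by the dissipation,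
  tends to zero, and Gronwall's inequality closes the estimate.
\<close>

lemma leray_stability:
  fixes A :: "real^3 \<Rightarrow> real" and T :: real
  assumes L: "L > 0" and al: "\<alpha> > 0" and nu: "\<nu> > 0" and be: "0 < \<beta>"
    and A: "\<And>x. \<beta> \<le> A x \<and> A x \<le> 1" and phi: "\<phi> \<in> borel_measurable borel"
    and Lip: "\<Lambda>-lipschitz_on UNIV A"
    and c: "conv_bounded L \<phi> Cc"
    and C: "trilinear_bound L C"
    and f: "force L f1" "force L f2" and T: "T > 0"
    and sol1: "weak_Leray_solution L \<alpha> \<nu> A \<phi> u01 f1 u1 ua1 P1 Pa1"
    and sol2: "weak_Leray_solution L \<alpha> \<nu> A \<phi> u02 f2 u2 ua2 P2 Pa2"
    and bounded: "\<forall>t\<in>{0..T}. (L2_norm L (u1 t))\<^sup>2 \<le> M \<and> (L2_norm L (u2 t))\<^sup>2 \<le> M"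
    and Mh: "(LINT s:{0..T}|lborel. (Hdot_norm L 1 (vfcoeff L (u2 s)))\<^sup>2) \<le> M / \<nu>"
  defines "D \<equiv> stab_D \<alpha> \<beta> \<Lambda> Cc M" and "m0 \<equiv> 2 * C\<^sup>2 / (\<nu> * L^3) * stab_D \<alpha> \<beta> \<Lambda> Cc M"
    and "a \<equiv> (L2_norm L (\<lambda>x. u1 0 x - u2 0 x))\<^sup>2 + 2 / \<nu> * (LINT t:{0..T}|lborel. (Hdot_norm L (-1) (\<lambda>n. f1 t n - f2 t n))\<^sup>2)"
  shows "\<And>t. t \<in> {0..T} \<Longrightarrow> (L2_norm L (\<lambda>x. u1 t x - u2 t x))\<^sup>2 \<le> a * exp (m0 * (M / \<nu>))"
    and "\<nu> * (LINT t:{0..T}|lborel. (Hdot_norm L 1 (vfcoeff L (\<lambda>x. u1 t x - u2 t x)))\<^sup>2) \<le> a * (1 + m0 * (M / \<nu>) * exp (m0 * (M / \<nu>)))"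
    and "AE t in lborel. t \<in> {0..T} \<longrightarrow> (Hsob_norm L 1 (vfcoeff L (\<lambda>x. ua1 t x - ua2 t x)))\<^sup>2 \<le> D * (L2_norm L (\<lambda>x. u1 t x - u2 t x))\<^sup>2"
    and "a \<ge> 0"
proof -
  have L3: "L^3 > 0" using L by simp
  have Ac: "continuous_on UNIV A" by (rule lipschitz_on_continuous_on[OF Lip])
  have A': "\<beta> \<le> A x" for x using A by blast
  have M: "(L2_norm L (u1 t))\<^sup>2 \<le> M" "(L2_norm L (u2 t))\<^sup>2 \<le> M" if "t \<in> {0..T}" for t using bounded that by auto
  have m: "tx_measurable u1" "tx_measurable u2" "weakly_continuous L u1" "weakly_continuous L u2"
    and l2: "L2_loc (\<lambda>v. vHdot L 1 (vfcoeff L v)) (\<lambda>v. Hdot_norm L 1 (vfcoeff L v)) u1" "L2_loc (\<lambda>v. vHdot L 1 (vfcoeff L v)) (\<lambda>v. Hdot_norm L 1 (vfcoeff L v)) u2"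
    using sol1 sol2 unfolding weak_Leray_solution_def by auto
  have su: "sqi (cell L) (u1 t)" "sqi (cell L) (u2 t)" and mean: "vfcoeff L (u1 t) 0 = 0" "vfcoeff L (u2 t) 0 = 0" if "t \<ge> 0" for t
    using m(3,4) that unfolding weakly_continuous_def by (auto intro: L2s_sqi L2s_mean0[OF L])
  have tx: "txm L u1" "txm L u2" using m by (auto intro: tx_measurable_txm)
  obtain Du1 Dua1 where s1: "AE t in tpos. filtered L \<alpha> (\<lambda>x. A (conv L \<phi> (u1 t) x)) (u1 t) (ua1 t) (Dua1 t) (Pa1 t)"
    "AE t in tpos. velocity_regular L (u1 t) (Du1 t)"
    and o1: "\<And>k i d. k \<noteq> 0 \<Longrightarrow> d \<in> {0, pi / 2} \<Longrightarrow> modal_ode L \<nu> f1 u1 ua1 Du1 P1 k i d"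
    by (rule weak_Leray_solution_data[OF L be A Ac phi f(1) sol1]) (rule that)
  obtain Du2 Dua2 where s2: "AE t in tpos. filtered L \<alpha> (\<lambda>x. A (conv L \<phi> (u2 t) x)) (u2 t) (ua2 t) (Dua2 t) (Pa2 t)"
    "AE t in tpos. velocity_regular L (u2 t) (Du2 t)"
    and o2: "\<And>k i d. k \<noteq> 0 \<Longrightarrow> d \<in> {0, pi / 2} \<Longrightarrow> modal_ode L \<nu> f2 u2 ua2 Du2 P2 k i d"
    by (rule weak_Leray_solution_data[OF L be A Ac phi f(2) sol2]) (rule that)
  define w where "w t k = vfcoeff L (u1 t) k - vfcoeff L (u2 t) k" for t k
  define R where "R k t = modal_rhs L \<nu> (f1 t) (u1 t) (ua1 t) (Du1 t) (P1 t) k - modal_rhs L \<nu> (f2 t) (u2 t) (ua2 t) (Du2 t) (P2 t) k" for k t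
  define y where "y t = (L2_norm L (\<lambda>x. u1 t x - u2 t x))\<^sup>2" for t
  define e where "e t = (Hdot_norm L 1 (w t))\<^sup>2" for t
  define h2 where "h2 t = (Hdot_norm L 1 (vfcoeff L (u2 t)))\<^sup>2" for t
  define fd where "fd t = (Hdot_norm L (-1) (\<lambda>n. f1 t n - f2 t n))\<^sup>2" for t
  \<comment> \<open>the part of \<open>e\<close> in the box of size \<open>N\<close>\<close>
  define eN where "eN N t = L^3 * (\<Sum>k\<in>zbox N - {0}. (norm (freq L k) * norm (w t k))\<^sup>2)" for N t
  have wv: "vfcoeff L (\<lambda>x. u1 t x - u2 t x) = w t" if "t \<ge> 0" for t
    using vfcoeff_diff[OF L su[OF that]] by (simp add: w_def fun_eq_iff)
  have y0: "y t \<ge> 0" and e0: "e t \<ge> 0" and h0: "h2 t \<ge> 0" and fd0: "fd t \<ge> 0" and eN0: "eN N t \<ge> 0" for t N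
    using L by (auto simp: y_def e_def h2_def fd_def eN_def intro!: mult_nonneg_nonneg sum_nonneg)
  have Mge: "M \<ge> 0" using M(1)[of 0] T order_trans[OF zero_le_power2] by fastforce
  have D0: "D \<ge> 1" and Dp: "D > 0"
  proof -
    have "1 * 1 \<le> (1 + 1 / (\<alpha>\<^sup>2 * \<beta>)) * (1 + \<Lambda>\<^sup>2 * Cc\<^sup>2 * M / (2 * \<beta>\<^sup>2))"
      by (rule mult_mono) (use be Mge in auto)
    then show "D \<ge> 1" by (simp add: D_def stab_D_def)
    then show "D > 0" by simp
  qed
  have m0D: "m0 = 2 * C\<^sup>2 / (\<nu> * L^3) * D" by (simp add: m0_def D_def)
  have m0p: "m0 \<ge> 0" unfolding m0D using Dp nu L by simp
  have Am: "A \<in> borel_measurable borel" by (rule borel_measurable_continuous_onI[OF Ac])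
  have am: "(\<lambda>x. A (conv L \<phi> (u t) x)) \<in> borel_measurable (cell L)" if "txm L u" "t \<ge> 0" for u t
    by (rule txm_section[OF txm_compose[OF txm_conv[OF phi that(1)] Am] that(2)])
  have filt: "AE t in lborel. t \<in> {0..T} \<longrightarrow>
      grad_sq L (\<lambda>x i j. Dua1 t x $ i $ j - Dua2 t x $ i $ j) \<le> D * y t \<and>
      (Hsob_norm L 1 (vfcoeff L (\<lambda>x. ua1 t x - ua2 t x)))\<^sup>2 \<le> D * y t \<and>
      grad_sq L (\<lambda>x i j. Dua1 t x $ i $ j) \<le> M / (2 * \<alpha>\<^sup>2 * \<beta>)"
    using AE_tpos_imp[OF s1(1), of T] AE_tpos_imp[OF s2(1), of T]
  proof eventually_elim
    case (elim t)
    show ?case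
    proof
      assume t: "t \<in> {0..T}"
      then have t0: "t \<ge> 0" by simp
      have F: "filtered L \<alpha> (\<lambda>x. A (conv L \<phi> (u1 t) x)) (u1 t) (ua1 t) (Dua1 t) (Pa1 t)"
        "filtered L \<alpha> (\<lambda>x. A (conv L \<phi> (u2 t) x)) (u2 t) (ua2 t) (Dua2 t) (Pa2 t)" using elim t by auto
      show "grad_sq L (\<lambda>x i j. Dua1 t x $ i $ j - Dua2 t x $ i $ j) \<le> D * y t \<and>
        (Hsob_norm L 1 (vfcoeff L (\<lambda>x. ua1 t x - ua2 t x)))\<^sup>2 \<le> D * y t \<and>
        grad_sq L (\<lambda>x i j. Dua1 t x $ i $ j) \<le> M / (2 * \<alpha>\<^sup>2 * \<beta>)"
        unfolding D_def stab_D_def y_def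
        using filtered_stability[OF L al be A' Lip c am[OF tx(1) t0] am[OF tx(2) t0] F su[OF t0] M(1)[OF t] M(2)[OF t]] by blast
    qed
  qed
  then show "AE t in lborel. t \<in> {0..T} \<longrightarrow> (Hsob_norm L 1 (vfcoeff L (\<lambda>x. ua1 t x - ua2 t x)))\<^sup>2 \<le> D * (L2_norm L (\<lambda>x. u1 t x - u2 t x))\<^sup>2"
    unfolding y_def by eventually_elim blast
  have cm: "(\<lambda>t. vfcoeff L (u1 t) n $ i) \<in> borel_measurable tpos" "(\<lambda>t. vfcoeff L (u2 t) n $ i) \<in> borel_measurable tpos" for n i
    unfolding vfcoeff_def vec_lambda_beta by (intro fcoeff_time_measurable txm_component tx)+
  have wm: "(\<lambda>t. w t n $ i) \<in> borel_measurable tpos" for n i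
    unfolding w_def vector_minus_component by (intro borel_measurable_diff cm)
  have nwm: "(\<lambda>t. norm (w t n)) \<in> borel_measurable tpos" for n
  proof -
    have "(\<lambda>t. norm (w t n $ i)) \<in> borel_measurable tpos" for i by (rule measurable_compose[OF wm]) simp
    then show ?thesis unfolding norm_vec_def L2_set_def
      by (intro measurable_compose[OF _ borel_measurable_sqrt] borel_measurable_sum borel_measurable_power)
  qed
  have em: "e \<in> borel_measurable tpos" unfolding e_def[abs_def] by (intro borel_measurable_power Hdot_norm_time_measurable wm)
  have h2m: "h2 \<in> borel_measurable tpos" unfolding h2_def[abs_def] by (intro borel_measurable_power Hdot_norm_time_measurable cm)
  have fdm: "fd \<in> borel_measurable tpos" unfolding fd_def[abs_def]
    by (intro borel_measurable_power Hdot_norm_time_measurable)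
       (auto simp: vector_minus_component intro!: borel_measurable_diff force_component_measurable f)
  have ym: "y \<in> borel_measurable tpos" unfolding y_def[abs_def] L2_norm_sq
    by (rule txm_integral, rule txm_compose[OF txm_diff[OF tx]]) simp
  have eNm: "eN N \<in> borel_measurable tpos" for N unfolding eN_def[abs_def]
    by (intro borel_measurable_times borel_measurable_const borel_measurable_sum borel_measurable_power nwm)
  have h1i: "set_integrable lborel {0..T} (\<lambda>t. (Hdot_norm L 1 (vfcoeff L (u1 t)))\<^sup>2)" and h2i: "set_integrable lborel {0..T} h2"
    using l2 T unfolding L2_loc_def h2_def by auto
  have vH: "AE t in lborel. t \<in> {0..T} \<longrightarrow> vHdot L 1 (vfcoeff L (u1 t)) \<and> vHdot L 1 (vfcoeff L (u2 t))"
    using AE_tpos_imp[OF s1(2), of T] AE_tpos_imp[OF s2(2), of T] by eventually_elim blast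
  have vF: "AE t in lborel. t \<in> {0..T} \<longrightarrow> vHdot L (-1) (f1 t) \<and> vHdot L (-1) (f2 t)"
  proof -
    have "AE t in lborel. 0 \<le> t \<longrightarrow> vHdot L (-1) (f1 t) \<and> div_free_coeffs L (f1 t)"
      "AE t in lborel. 0 \<le> t \<longrightarrow> vHdot L (-1) (f2 t) \<and> div_free_coeffs L (f2 t)"
      using f unfolding force_def L2_loc_def by blast+
    then show ?thesis by eventually_elim auto
  qed
  have ei: "set_integrable lborel {0..T} e"
  proof (rule set_integrable_tpos_bound[OF em])
    show "set_integrable lborel {0..T} (\<lambda>t. 2 * (Hdot_norm L 1 (vfcoeff L (u1 t)))\<^sup>2 + 2 * h2 t)"
      by (intro set_integral_add(1) set_integrable_mult_right h1i h2i)
    show "AE t in lborel. t \<in> {0..T} \<longrightarrow> \<bar>e t\<bar> \<le> 2 * (Hdot_norm L 1 (vfcoeff L (u1 t)))\<^sup>2 + 2 * h2 t"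
      using vH by eventually_elim (use Hdot_norm_diff_sq_le[OF L] in \<open>auto simp: e_def h2_def w_def[abs_def]\<close>)
  qed
  have fdi: "set_integrable lborel {0..T} fd"
  proof (rule set_integrable_tpos_bound[OF fdm])
    have "set_integrable lborel {0..T} (\<lambda>t. (Hdot_norm L (-1) (f1 t))\<^sup>2)" "set_integrable lborel {0..T} (\<lambda>t. (Hdot_norm L (-1) (f2 t))\<^sup>2)"
      using f T unfolding force_def L2_loc_def by auto
    then show "set_integrable lborel {0..T} (\<lambda>t. 2 * (Hdot_norm L (-1) (f1 t))\<^sup>2 + 2 * (Hdot_norm L (-1) (f2 t))\<^sup>2)"
      by (intro set_integral_add(1) set_integrable_mult_right)
    show "AE t in lborel. t \<in> {0..T} \<longrightarrow> \<bar>fd t\<bar> \<le> 2 * (Hdot_norm L (-1) (f1 t))\<^sup>2 + 2 * (Hdot_norm L (-1) (f2 t))\<^sup>2"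
      using vF by eventually_elim (use Hdot_norm_diff_sq_le[OF L] in \<open>auto simp: fd_def\<close>)
  qed
  have yb: "y t \<le> 4 * M" if "t \<in> {0..T}" for t
    unfolding y_def using L2_norm_diff_sq_le[of L "u1 t" "u2 t"] su[of t] M(1)[OF that] M(2)[OF that] that by simp
  define mm where "mm t = m0 * h2 t" for t
  have mmi: "set_integrable lborel {0..T} mm" unfolding mm_def[abs_def] by (intro set_integrable_mult_right h2i)
  have myi: "set_integrable lborel {0..T} (\<lambda>t. mm t * y t)"
  proof (rule set_integrable_tpos_bound)
    show "(\<lambda>t. mm t * y t) \<in> borel_measurable tpos" unfolding mm_def by (intro borel_measurable_times borel_measurable_const h2m ym)
    show "set_integrable lborel {0..T} (\<lambda>t. mm t * (4 * M))" by (intro set_integrable_mult_left mmi)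
    show "AE t in lborel. t \<in> {0..T} \<longrightarrow> \<bar>mm t * y t\<bar> \<le> mm t * (4 * M)"
      by (rule AE_I2) (auto simp: mm_def abs_mult y0 h0 m0p intro!: mult_left_mono mult_nonneg_nonneg yb)
  qed
  \<comment> \<open>every mode has an energy identity for all times, with an integrand that is known almost everywhere\<close>
  have ex: "\<exists>E. (\<forall>t\<ge>0. set_integrable lborel {0..t} E) \<and> (AE t in tpos. E t = R k t \<bullet> w t k) \<and>
     (\<forall>t\<ge>0. (norm (w t k))\<^sup>2 = (norm (w 0 k))\<^sup>2 + 2 * (LINT s:{0..t}|lborel. E s))" if k: "k \<noteq> 0" for k
  proof -
    have "\<exists>F. (\<forall>T>0. set_integrable lborel {0..T} F) \<and> (AE t in tpos. F t = Re (cis (- d) * R k t $ i)) \<and>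
       (\<forall>s t. 0 \<le> s \<longrightarrow> s \<le> t \<longrightarrow> Re (cis (- d) * w t k $ i) - Re (cis (- d) * w s k $ i) = (LINT \<tau>:{s..t}|lborel. F \<tau>))"
      if d: "d \<in> {0, pi / 2}" for i d
    proof -
      obtain F1 where F1: "\<And>T. T > 0 \<Longrightarrow> set_integrable lborel {0..T} F1" "AE t in tpos. F1 t = Re (cis (- d) * modal_rhs L \<nu> (f1 t) (u1 t) (ua1 t) (Du1 t) (P1 t) k $ i)"
        "\<And>s t. 0 \<le> s \<Longrightarrow> s \<le> t \<Longrightarrow> Re (cis (- d) * vfcoeff L (u1 t) k $ i) - Re (cis (- d) * vfcoeff L (u1 s) k $ i) = (LINT \<tau>:{s..t}|lborel. F1 \<tau>)"
        using o1[OF k d, of i] by blast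
      obtain F2 where F2: "\<And>T. T > 0 \<Longrightarrow> set_integrable lborel {0..T} F2" "AE t in tpos. F2 t = Re (cis (- d) * modal_rhs L \<nu> (f2 t) (u2 t) (ua2 t) (Du2 t) (P2 t) k $ i)"
        "\<And>s t. 0 \<le> s \<Longrightarrow> s \<le> t \<Longrightarrow> Re (cis (- d) * vfcoeff L (u2 t) k $ i) - Re (cis (- d) * vfcoeff L (u2 s) k $ i) = (LINT \<tau>:{s..t}|lborel. F2 \<tau>)"
        using o2[OF k d, of i] by blast
      show ?thesis
      proof (intro exI[of _ "\<lambda>t. F1 t - F2 t"] conjI allI impI)
        show "set_integrable lborel {0..T} (\<lambda>t. F1 t - F2 t)" if "T > 0" for T by (intro set_integral_diff(1) F1(1) F2(1) that)
        show "AE t in tpos. F1 t - F2 t = Re (cis (- d) * R k t $ i)"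
          using F1(2) F2(2) by eventually_elim (simp add: R_def algebra_simps)
        fix s t :: real assume st: "0 \<le> s" "s \<le> t"
        have i: "set_integrable lborel {s..t} F1" "set_integrable lborel {s..t} F2"
          using set_integrable_Icc_bounded[OF F1(1)[of "t + 1"], of s t] set_integrable_Icc_bounded[OF F2(1)[of "t + 1"], of s t] st by auto
        show "Re (cis (- d) * w t k $ i) - Re (cis (- d) * w s k $ i) = (LINT \<tau>:{s..t}|lborel. F1 \<tau> - F2 \<tau>)"
          unfolding set_integral_diff(2)[OF i] F1(3)[OF st, symmetric] F2(3)[OF st, symmetric] by (simp add: w_def algebra_simps)
      qed
    qed
    note ode = this
    obtain E where "\<And>t. t \<ge> 0 \<Longrightarrow> set_integrable lborel {0..t} E" "AE t in tpos. E t = R k t \<bullet> w t k"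
      "\<And>t. t \<ge> 0 \<Longrightarrow> (norm (w t k))\<^sup>2 = (norm (w 0 k))\<^sup>2 + 2 * (LINT s:{0..t}|lborel. E s)"
      by (rule modal_energy_identity[where w="\<lambda>t. w t k" and R="\<lambda>t. R k t"], rule ode) (assumption, rule that)
    then show ?thesis by blast
  qed
  define E where "E k = (SOME E. (\<forall>t\<ge>0. set_integrable lborel {0..t} E) \<and> (AE t in tpos. E t = R k t \<bullet> w t k) \<and>
     (\<forall>t\<ge>0. (norm (w t k))\<^sup>2 = (norm (w 0 k))\<^sup>2 + 2 * (LINT s:{0..t}|lborel. E s)))" for k
  have Ex: "(\<forall>t\<ge>0. set_integrable lborel {0..t} (E k)) \<and> (AE t in tpos. E k t = R k t \<bullet> w t k) \<and>
     (\<forall>t\<ge>0. (norm (w t k))\<^sup>2 = (norm (w 0 k))\<^sup>2 + 2 * (LINT s:{0..t}|lborel. E k s))" if "k \<noteq> 0" for k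
    unfolding E_def by (rule someI_ex[OF ex[OF that]])
  have E: "\<And>k t. k \<noteq> 0 \<Longrightarrow> t \<ge> 0 \<Longrightarrow> set_integrable lborel {0..t} (E k)" "\<And>k. k \<noteq> 0 \<Longrightarrow> AE t in tpos. E k t = R k t \<bullet> w t k"
     "\<And>k t. k \<noteq> 0 \<Longrightarrow> t \<ge> 0 \<Longrightarrow> (norm (w t k))\<^sup>2 = (norm (w 0 k))\<^sup>2 + 2 * (LINT s:{0..t}|lborel. E k s)"
    using Ex by blast+
  have EAE: "AE t in lborel. t \<in> {0..T} \<longrightarrow> (\<forall>k. k \<noteq> 0 \<longrightarrow> E k t = R k t \<bullet> w t k)"
  proof -
    have "AE t in tpos. \<forall>k. k \<noteq> 0 \<longrightarrow> E k t = R k t \<bullet> w t k" using E(2) by (auto simp: AE_all_countable)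
    then show ?thesis by (rule AE_tpos_imp)
  qed
  define c1 where "c1 = C * sqrt (M / (2 * \<alpha>\<^sup>2 * \<beta>) / L^3)"
  have c1: "c1 \<ge> 0" unfolding c1_def using C Mge be L by (simp add: trilinear_bound_def)
  define g where "g N s = - \<nu> * eN N s + 2 * c1 * (sqrt (e s - eN N s) * sqrt (eN N s)) + mm s * y s + 2 / \<nu> * fd s" for N s
  have bound: "AE s in lborel. s \<in> {0..T} \<longrightarrow> (\<forall>N. 2 * (L^3 * (\<Sum>k\<in>zbox N - {0}. E k s)) \<le> g N s) \<and> (\<lambda>N. eN N s) \<longlonglongrightarrow> e s \<and> (\<forall>N. eN N s \<le> e s)"
    using EAE vH vF filt AE_tpos_imp[OF s1(1), of T] AE_tpos_imp[OF s2(1), of T] AE_tpos_imp[OF s1(2), of T] AE_tpos_imp[OF s2(2), of T]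
  proof eventually_elim
    case (elim s)
    show ?case
    proof
      assume s: "s \<in> {0..T}"
      have vw: "vHdot L 1 (w s)" unfolding w_def[abs_def] using elim s by (intro vHdot_diff L) auto
      note hs = vHdot1_has_sum[OF L vw]
      have eNa: "eN N s = L^3 * (\<Sum>k\<in>zbox N - {0}. (norm (freq L k))\<^sup>2 * (norm (w s k))\<^sup>2)" for N by (simp add: eN_def power_mult_distrib)
      have "(\<lambda>N. \<Sum>k\<in>zbox N - {0}. (norm (freq L k))\<^sup>2 * (norm (w s k))\<^sup>2) \<longlonglongrightarrow> e s / L^3"
        unfolding e_def by (rule has_sum_zbox[OF hs])
      then have "(\<lambda>N. eN N s) \<longlonglongrightarrow> L^3 * (e s / L^3)" unfolding eNa by (intro tendsto_intros)
      then have lim: "(\<lambda>N. eN N s) \<longlonglongrightarrow> e s" using L by simp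
      have "(\<Sum>k\<in>zbox N - {0}. (norm (freq L k))\<^sup>2 * (norm (w s k))\<^sup>2) \<le> e s / L^3" for N
        unfolding e_def by (rule has_sum_mono_neutral[OF has_sum_finite hs]) (auto simp: finite_zbox)
      then have le: "eN N s \<le> e s" for N unfolding eNa using L3 by (simp add: field_simps)
      have fa: "filtered L \<alpha> (\<lambda>x. A (conv L \<phi> (u1 s) x)) (u1 s) (ua1 s) (Dua1 s) (Pa1 s)"
        "filtered L \<alpha> (\<lambda>x. A (conv L \<phi> (u2 s) x)) (u2 s) (ua2 s) (Dua2 s) (Pa2 s)" using elim s by auto
      have "2 * (L^3 * (\<Sum>k\<in>zbox N - {0}. E k s)) \<le> g N s" for N
      proof -
        have "L^3 * (\<Sum>k\<in>zbox N - {0}. E k s) = L^3 * (\<Sum>k\<in>zbox N - {0}. R k s \<bullet> w s k)"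
          using elim s by (intro arg_cong[where f="\<lambda>x. L^3 * x"] sum.cong) auto
        also have "\<dots> \<le> - (\<nu> / 2) * eN N s + C * sqrt (M / (2 * \<alpha>\<^sup>2 * \<beta>) / L^3) * (sqrt ((Hdot_norm L 1 (w s))\<^sup>2 - eN N s) * sqrt (eN N s))
            + C\<^sup>2 / (\<nu> * L^3) * (D * y s) * (Hdot_norm L 1 (vfcoeff L (u2 s)))\<^sup>2 + (Hdot_norm L (-1) (\<lambda>n. f1 s n - f2 s n))\<^sup>2 / \<nu>"
          unfolding R_def eN_def w_def[abs_def]
        proof (rule pointwise_energy[OF L nu C, where ?B1.0="Dua1 s" and ?B2.0="Dua2 s"])
          show "vHdot L (-1) (\<lambda>n. f1 s n - f2 s n)" using elim s by (intro vHdot_diff L) auto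
        qed (use elim s fa in \<open>auto simp: finite_zbox filtered_def\<close>)
        also have "\<dots> = - (\<nu> / 2) * eN N s + c1 * (sqrt (e s - eN N s) * sqrt (eN N s)) + mm s * y s / 2 + fd s / \<nu>"
          unfolding c1_def e_def mm_def m0D fd_def h2_def by (simp add: algebra_simps)
        finally have "L^3 * (\<Sum>k\<in>zbox N - {0}. E k s) \<le> - (\<nu> / 2) * eN N s + c1 * (sqrt (e s - eN N s) * sqrt (eN N s)) + mm s * y s / 2 + fd s / \<nu>" .
        then have "2 * (L^3 * (\<Sum>k\<in>zbox N - {0}. E k s)) \<le> 2 * (- (\<nu> / 2) * eN N s + c1 * (sqrt (e s - eN N s) * sqrt (eN N s)) + mm s * y s / 2 + fd s / \<nu>)"
          by (rule mult_left_mono) simp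
        also have "\<dots> = g N s" by (simp add: g_def algebra_simps)
        finally show ?thesis .
      qed
      then show "(\<forall>N. 2 * (L^3 * (\<Sum>k\<in>zbox N - {0}. E k s)) \<le> g N s) \<and> (\<lambda>N. eN N s) \<longlonglongrightarrow> e s \<and> (\<forall>N. eN N s \<le> e s)"
        using lim le by blast
    qed
  qed
  \<comment> \<open>\<open>G\<close> is the limit of the upper bounds \<open>g N\<close> as the boxes grow, and \<open>H\<close> an integrable majorant\<close>
  define G where "G s = - \<nu> * e s + mm s * y s + 2 / \<nu> * fd s" for s
  define H where "H s = (\<nu> + 2 * c1) * e s + mm s * y s + 2 / \<nu> * fd s" for s
  have Hi: "set_integrable lborel {0..T} H" unfolding H_def by (intro set_integral_add(1) set_integrable_mult_right ei myi fdi)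
  have gm: "g N \<in> borel_measurable tpos" for N unfolding g_def[abs_def] mm_def
    by (intro borel_measurable_add borel_measurable_times borel_measurable_const borel_measurable_diff
        measurable_compose[OF _ borel_measurable_sqrt] em eNm h2m ym fdm)
  have gH: "AE s in lborel. s \<in> {0..T} \<longrightarrow> (\<forall>N. \<bar>g N s\<bar> \<le> H s)"
    using bound
  proof eventually_elim
    case (elim s)
    show ?case
    proof (intro impI allI)
      fix N assume "s \<in> {0..T}"
      then have le: "eN N s \<le> e s" using elim by blast
      have "sqrt (e s - eN N s) * sqrt (eN N s) \<le> sqrt (e s) * sqrt (e s)"
        using le eN0[of N s] by (intro mult_mono) auto
      then have s1: "sqrt (e s - eN N s) * sqrt (eN N s) \<le> e s" using e0[of s] by simp
      have s0: "0 \<le> sqrt (e s - eN N s) * sqrt (eN N s)" using le eN0 by simp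
      have "2 * c1 * (sqrt (e s - eN N s) * sqrt (eN N s)) \<le> 2 * c1 * e s" using s1 c1 by (intro mult_left_mono) auto
      moreover have "0 \<le> 2 * c1 * (sqrt (e s - eN N s) * sqrt (eN N s))" using s0 c1 by simp
      moreover have "\<nu> * eN N s \<le> \<nu> * e s" "0 \<le> \<nu> * eN N s" using le nu eN0[of N s] by auto
      moreover have "0 \<le> mm s * y s" "0 \<le> 2 / \<nu> * fd s" using m0p h0[of s] y0[of s] fd0[of s] nu by (auto simp: mm_def)
      moreover have "H s = \<nu> * e s + 2 * c1 * e s + mm s * y s + 2 / \<nu> * fd s" by (simp add: H_def algebra_simps)
      moreover have "0 \<le> 2 * c1 * e s" using c1 e0[of s] by simp
      ultimately show "\<bar>g N s\<bar> \<le> H s" unfolding g_def by linarith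
    qed
  qed
  have par: "((\<lambda>n. (norm (w t n))\<^sup>2) has_sum y t / L^3) (- {0})" if "t \<ge> 0" for t
  proof -
    have "((\<lambda>n. (norm (vfcoeff L (\<lambda>x. u1 t x - u2 t x) n))\<^sup>2) has_sum y t / L^3) UNIV"
      unfolding y_def by (rule parseval_vector[OF L sqi_diff[OF su[OF that]]])
    then have "((\<lambda>n. (norm (w t n))\<^sup>2) has_sum y t / L^3) UNIV" unfolding wv[OF that] .
    then show ?thesis by (rule has_sum_cong_neutral[THEN iffD1, rotated 3]) (use mean[OF that] in \<open>auto simp: w_def\<close>)
  qed
  have ineq: "y t + \<nu> * (LINT s:{0..t}|lborel. e s) \<le> y 0 + 2 / \<nu> * (LINT s:{0..T}|lborel. fd s) + (LINT s:{0..t}|lborel. mm s * y s)"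
    if t: "t \<in> {0..T}" for t
  proof -
    have t0: "t \<ge> 0" and tT: "t \<le> T" using t by auto
    have sub: "set_integrable lborel {0..t} q" if "set_integrable lborel {0..T} q" for q :: "real \<Rightarrow> real"
      by (rule set_integrable_Icc_bounded[OF that]) (use tT in auto)
    have tAE: "AE s in lborel. s \<in> {0..t} \<longrightarrow> Q s" if "AE s in lborel. s \<in> {0..T} \<longrightarrow> Q s" for Q
      using that by eventually_elim (use tT in auto)
    have gi: "set_integrable lborel {0..t} (g N)" for N
      by (rule set_integrable_tpos_bound[OF gm sub[OF Hi] tAE]) (use gH in \<open>auto elim!: eventually_mono\<close>)
    have step: "L^3 * (\<Sum>k\<in>zbox N - {0}. (norm (w t k))\<^sup>2) \<le> y 0 + (LINT s:{0..t}|lborel. g N s)" for N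
    proof -
      have Ei: "set_integrable lborel {0..t} (\<lambda>s. 2 * (L^3 * (\<Sum>k\<in>zbox N - {0}. E k s)))"
        and EI: "(LINT s:{0..t}|lborel. 2 * (L^3 * (\<Sum>k\<in>zbox N - {0}. E k s))) = 2 * (L^3 * (\<Sum>k\<in>zbox N - {0}. LINT s:{0..t}|lborel. E k s))"
      proof -
        have 1: "integrable lborel (\<lambda>s. indicator {0..t} s * E k s)" if "k \<in> zbox N - {0}" for k
          using E(1)[OF _ t0, of k] that by (auto simp: set_integrable_def)
        have eq: "(\<lambda>s. indicator {0..t} s *\<^sub>R (2 * (L^3 * (\<Sum>k\<in>zbox N - {0}. E k s)))) = (\<lambda>s. 2 * (L^3 * (\<Sum>k\<in>zbox N - {0}. indicator {0..t} s * E k s)))"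
          by (simp add: sum_distrib_left mult_ac)
        show "set_integrable lborel {0..t} (\<lambda>s. 2 * (L^3 * (\<Sum>k\<in>zbox N - {0}. E k s)))"
          unfolding set_integrable_def eq by (intro integrable_mult_right Bochner_Integration.integrable_sum 1)
        have "(\<integral>s. (\<Sum>k\<in>zbox N - {0}. indicator {0..t} s * E k s) \<partial>lborel) = (\<Sum>k\<in>zbox N - {0}. \<integral>s. indicator {0..t} s * E k s \<partial>lborel)"
          by (rule Bochner_Integration.integral_sum) (rule 1)
        then show "(LINT s:{0..t}|lborel. 2 * (L^3 * (\<Sum>k\<in>zbox N - {0}. E k s))) = 2 * (L^3 * (\<Sum>k\<in>zbox N - {0}. LINT s:{0..t}|lborel. E k s))"
          unfolding set_lebesgue_integral_def eq by simp
      qed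
      have "L^3 * (\<Sum>k\<in>zbox N - {0}. (norm (w t k))\<^sup>2) = L^3 * (\<Sum>k\<in>zbox N - {0}. (norm (w 0 k))\<^sup>2 + 2 * (LINT s:{0..t}|lborel. E k s))"
        by (intro arg_cong[where f="\<lambda>x. L^3 * x"] sum.cong refl E(3) t0) auto
      also have "\<dots> = L^3 * (\<Sum>k\<in>zbox N - {0}. (norm (w 0 k))\<^sup>2) + (LINT s:{0..t}|lborel. 2 * (L^3 * (\<Sum>k\<in>zbox N - {0}. E k s)))"
        unfolding EI by (simp add: sum.distrib sum_distrib_left distrib_left mult_ac)
      also have "L^3 * (\<Sum>k\<in>zbox N - {0}. (norm (w 0 k))\<^sup>2) \<le> y 0"
      proof -
        have "(\<Sum>k\<in>zbox N - {0}. (norm (w 0 k))\<^sup>2) \<le> y 0 / L^3"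
          by (rule has_sum_mono_neutral[OF has_sum_finite par]) (auto simp: finite_zbox)
        then show ?thesis using L3 by (simp add: field_simps)
      qed
      also have "(LINT s:{0..t}|lborel. 2 * (L^3 * (\<Sum>k\<in>zbox N - {0}. E k s))) \<le> (LINT s:{0..t}|lborel. g N s)"
        unfolding set_lebesgue_integral_def
      proof (rule integral_mono_AE)
        show "AE s in lborel. indicator {0..t} s *\<^sub>R (2 * (L^3 * (\<Sum>k\<in>zbox N - {0}. E k s))) \<le> indicator {0..t} s *\<^sub>R g N s"
          using tAE[OF bound] by eventually_elim (auto simp: indicator_def)
      qed (use Ei gi in \<open>auto simp: set_integrable_def\<close>)
      finally show ?thesis by simp
    qed
    have "(\<lambda>N. LINT s:{0..t}|lborel. g N s) \<longlonglongrightarrow> (LINT s:{0..t}|lborel. G s)"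
      unfolding set_lebesgue_integral_def
    proof (rule integral_dominated_convergence[where w="\<lambda>s. indicator {0..t} s *\<^sub>R H s"])
      show "(\<lambda>s. indicator {0..t} s *\<^sub>R G s) \<in> borel_measurable lborel"
      proof -
        have "G \<in> borel_measurable tpos" unfolding G_def[abs_def] mm_def
          by (intro borel_measurable_add borel_measurable_times borel_measurable_const h2m ym em fdm)
        from borel_measurable_tpos_indicator[OF this, of "{0..t}"] show ?thesis by simp
      qed
      show "(\<lambda>s. indicator {0..t} s *\<^sub>R g N s) \<in> borel_measurable lborel" for N
        using gi[of N] by (auto simp: set_integrable_def)
      show "integrable lborel (\<lambda>s. indicator {0..t} s *\<^sub>R H s)" using sub[OF Hi] by (simp add: set_integrable_def)
      show "AE s in lborel. norm (indicator {0..t} s *\<^sub>R g N s) \<le> indicator {0..t} s *\<^sub>R H s" for N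
        using tAE[OF gH] by eventually_elim (auto simp: indicator_def)
      show "AE s in lborel. (\<lambda>N. indicator {0..t} s *\<^sub>R g N s) \<longlonglongrightarrow> indicator {0..t} s *\<^sub>R G s"
        using tAE[OF bound]
      proof eventually_elim
        case (elim s)
        show ?case
        proof (cases "s \<in> {0..t}")
          case True
          then have l: "(\<lambda>N. eN N s) \<longlonglongrightarrow> e s" using elim by blast
          have "(\<lambda>N. g N s) \<longlonglongrightarrow> - \<nu> * e s + 2 * c1 * (sqrt (e s - e s) * sqrt (e s)) + mm s * y s + 2 / \<nu> * fd s"
            unfolding g_def by (intro tendsto_intros l)
          then have "(\<lambda>N. g N s) \<longlonglongrightarrow> G s" by (simp add: G_def)
          then show ?thesis by (intro tendsto_intros)
        qed simp
      qed
    qed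
    then have r: "(\<lambda>N. y 0 + (LINT s:{0..t}|lborel. g N s)) \<longlonglongrightarrow> y 0 + (LINT s:{0..t}|lborel. G s)" by (intro tendsto_intros)
    have "(\<lambda>N. L^3 * (\<Sum>k\<in>zbox N - {0}. (norm (w t k))\<^sup>2)) \<longlonglongrightarrow> L^3 * (y t / L^3)"
      by (intro tendsto_intros has_sum_zbox par t0)
    then have l: "(\<lambda>N. L^3 * (\<Sum>k\<in>zbox N - {0}. (norm (w t k))\<^sup>2)) \<longlonglongrightarrow> y t" using L by simp
    have "y t \<le> y 0 + (LINT s:{0..t}|lborel. G s)" by (rule LIMSEQ_le[OF l r]) (use step in blast)
    also have "(LINT s:{0..t}|lborel. G s) = - \<nu> * (LINT s:{0..t}|lborel. e s) + (LINT s:{0..t}|lborel. mm s * y s) + 2 / \<nu> * (LINT s:{0..t}|lborel. fd s)"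
    proof -
      have i: "set_integrable lborel {0..t} (\<lambda>s. - \<nu> * e s)" "set_integrable lborel {0..t} (\<lambda>s. mm s * y s)" "set_integrable lborel {0..t} (\<lambda>s. 2 / \<nu> * fd s)"
        by (intro set_integrable_mult_right sub ei myi fdi)+
      show ?thesis unfolding G_def
        by (simp only: set_integral_add(2)[OF set_integral_add(1)[OF i(1,2)] i(3)] set_integral_add(2)[OF i(1,2)] set_integral_mult_right)
    qed
    finally have "y t + \<nu> * (LINT s:{0..t}|lborel. e s) \<le> y 0 + 2 / \<nu> * (LINT s:{0..t}|lborel. fd s) + (LINT s:{0..t}|lborel. mm s * y s)" by simp
    moreover have "2 / \<nu> * (LINT s:{0..t}|lborel. fd s) \<le> 2 / \<nu> * (LINT s:{0..T}|lborel. fd s)"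
    proof (rule mult_left_mono)
      show "(LINT s:{0..t}|lborel. fd s) \<le> (LINT s:{0..T}|lborel. fd s)" unfolding set_lebesgue_integral_def
        by (rule integral_mono) (use sub[OF fdi] fdi tT fd0 in \<open>auto simp: set_integrable_def indicator_def\<close>)
    qed (use nu in simp)
    ultimately show ?thesis by linarith
  qed
  have a_eq: "a = y 0 + 2 / \<nu> * (LINT s:{0..T}|lborel. fd s)" by (simp add: a_def y_def fd_def)
  have int0: "0 \<le> (LINT s:{0..t}|lborel. q s)" if "\<And>s. q s \<ge> 0" for q :: "real \<Rightarrow> real" and t
    unfolding set_lebesgue_integral_def by (rule integral_nonneg_AE) (use that in \<open>auto simp: indicator_def\<close>)
  show a0: "a \<ge> 0" unfolding a_eq using y0[of 0] int0[of fd T] fd0 nu by simp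
  have mm0: "mm t \<ge> 0" for t using m0p h0 by (simp add: mm_def)
  have mmT: "(LINT s:{0..T}|lborel. mm s) \<le> m0 * (M / \<nu>)"
    using mult_left_mono[OF Mh m0p] by (simp add: mm_def h2_def)
  have mmt: "(LINT s:{0..t}|lborel. mm s) \<le> m0 * (M / \<nu>)" if "t \<in> {0..T}" for t
  proof -
    have "(LINT s:{0..t}|lborel. mm s) \<le> (LINT s:{0..T}|lborel. mm s)" unfolding set_lebesgue_integral_def
      by (rule integral_mono) (use set_integrable_Icc_bounded[OF mmi, of 0 t] mmi that mm0 in \<open>auto simp: set_integrable_def indicator_def\<close>)
    then show ?thesis using mmT by simp
  qed
  have yG: "y t \<le> a * exp (m0 * (M / \<nu>))" if t: "t \<in> {0..T}" for t
  proof -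
    have "y t \<le> a * exp (LINT s:{0..t}|lborel. mm s)"
    proof (rule Gronwall_integral[OF mmi mm0 myi yb _ t])
      fix t assume t: "t \<in> {0..T}"
      have "0 \<le> \<nu> * (LINT s:{0..t}|lborel. e s)" using int0[of e t] e0 nu by simp
      then show "y t \<le> a + (LINT s:{0..t}|lborel. mm s * y s)" using ineq[OF t] unfolding a_eq by linarith
    qed
    also have "\<dots> \<le> a * exp (m0 * (M / \<nu>))" using a0 mmt[OF t] by (intro mult_left_mono) auto
    finally show ?thesis .
  qed
  then show "\<And>t. t \<in> {0..T} \<Longrightarrow> (L2_norm L (\<lambda>x. u1 t x - u2 t x))\<^sup>2 \<le> a * exp (m0 * (M / \<nu>))" by (simp add: y_def)
  have "(LINT s:{0..T}|lborel. mm s * y s) \<le> (LINT s:{0..T}|lborel. mm s * (a * exp (m0 * (M / \<nu>))))"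
    unfolding set_lebesgue_integral_def
    by (rule integral_mono)
       (use myi set_integrable_mult_left[OF mmi, of "a * exp (m0 * (M / \<nu>))"] yG mm0 in \<open>auto simp: set_integrable_def indicator_def intro!: mult_left_mono\<close>)
  also have "\<dots> = (LINT s:{0..T}|lborel. mm s) * (a * exp (m0 * (M / \<nu>)))" by simp
  also have "\<dots> \<le> m0 * (M / \<nu>) * (a * exp (m0 * (M / \<nu>)))" using mmT a0 by (intro mult_right_mono) auto
  finally have "\<nu> * (LINT s:{0..T}|lborel. e s) \<le> a * (1 + m0 * (M / \<nu>) * exp (m0 * (M / \<nu>)))"
    using ineq[of T] T y0[of T] unfolding a_eq[symmetric] by (simp add: algebra_simps)
  moreover have "(LINT t:{0..T}|lborel. (Hdot_norm L 1 (vfcoeff L (\<lambda>x. u1 t x - u2 t x)))\<^sup>2) = (LINT s:{0..T}|lborel. e s)"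
    by (intro set_lebesgue_integral_cong) (auto simp: wv e_def)
  ultimately show "\<nu> * (LINT t:{0..T}|lborel. (Hdot_norm L 1 (vfcoeff L (\<lambda>x. u1 t x - u2 t x)))\<^sup>2) \<le> a * (1 + m0 * (M / \<nu>) * exp (m0 * (M / \<nu>)))"
    by simp
qed

section \<open>The stability theorem\<close>

theorem theorem2p2:
  fixes L \<alpha> \<nu> \<beta> T :: real
    and A \<phi> :: "real^3 \<Rightarrow> real"
    and u01 u02 :: "real^3 \<Rightarrow> real^3"
    and f1 f2 :: "real \<Rightarrow> int^3 \<Rightarrow> complex^3"
  assumes "L > 0" and "\<alpha> > 0" and "\<nu> > 0" and "0 < \<beta>" and "\<beta> < 1"
    and "\<And>x. \<beta> \<le> A x \<and> A x \<le> 1" and "C_bdd_lip 1 A"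
    and "H1 L \<phi>"
    and "L2s L u01" and "L2s L u02"
    and "force L f1" and "force L f2"
    and "T > 0"
  shows "\<exists>C0>0. \<exists>D0>0. \<forall>u1 u\<alpha>1 P1 P\<alpha>1 u2 u\<alpha>2 P2 P\<alpha>2.
     weak_Leray_solution L \<alpha> \<nu> A \<phi> u01 f1 u1 u\<alpha>1 P1 P\<alpha>1 \<longrightarrow>
     weak_Leray_solution L \<alpha> \<nu> A \<phi> u02 f2 u2 u\<alpha>2 P2 P\<alpha>2 \<longrightarrow>
       (E_norm L \<nu> T (\<lambda>t x. u1 t x - u2 t x))\<^sup>2
         \<le> exp (C0 * sqrt T) *
            ((L2_norm L (\<lambda>x. u01 x - u02 x))\<^sup>2
             + 4 / \<nu> * (LINT t:{0..T}|lborel. (Hdot_norm L (-1) (\<lambda>n. f1 t n - f2 t n))\<^sup>2))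
     \<and> (Linf_norm T (\<lambda>v. Hsob_norm L 1 (vfcoeff L v)) (\<lambda>t x. u\<alpha>1 t x - u\<alpha>2 t x))\<^sup>2
         \<le> ereal D0 * (Linf_norm T (L2_norm L) (\<lambda>t x. u1 t x - u2 t x))\<^sup>2"
proof -
  note L = assms(1) and al = assms(2) and nu = assms(3) and be = assms(4) and A = assms(6)
    and f = assms(11,12) and T = assms(13)
  obtain \<Lambda> where Lip: "\<Lambda>-lipschitz_on UNIV A"
    by (rule C_bdd_lip_Lipschitz[OF assms(7)]) (rule that)
  have phi2: "L2 L \<phi>" and phi: "\<phi> \<in> borel_measurable borel" using assms(8) by (auto simp: H1_def L2_def)
  obtain Cc where c: "conv_bounded L \<phi> Cc"
    by (rule conv_bounded_L2[OF L phi2]) (rule that)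
  obtain C where C: "trilinear_bound L C"
    by (rule trilinear_sum_bound[OF L]) (rule that)
  have lint0: "0 \<le> (LINT s:{0..T}|lborel. q s)" if "\<And>s. q s \<ge> 0" for q :: "real \<Rightarrow> real"
    unfolding set_lebesgue_integral_def by (rule integral_nonneg_AE) (use that in \<open>auto simp: indicator_def\<close>)
  define M1 where "M1 = (L2_norm L u01)\<^sup>2 + (1 / \<nu>) * (LINT s:{0..T}|lborel. (Hdot_norm L (-1) (f1 s))\<^sup>2)"
  define M2 where "M2 = (L2_norm L u02)\<^sup>2 + (1 / \<nu>) * (LINT s:{0..T}|lborel. (Hdot_norm L (-1) (f2 s))\<^sup>2)"
  define M where "M = M1 + M2"
  have M0: "M1 \<ge> 0" "M2 \<ge> 0" unfolding M1_def M2_def using nu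
    by (intro add_nonneg_nonneg mult_nonneg_nonneg lint0; simp)+
  define D where "D = stab_D \<alpha> \<beta> \<Lambda> Cc M"
  define \<mu> where "\<mu> = 2 * C\<^sup>2 / (\<nu> * L^3) * D * (M / \<nu>)"
  have D0: "D > 0" unfolding D_def stab_D_def M_def using be M0 by (intro mult_pos_pos add_pos_nonneg) auto
  have \<mu>0: "\<mu> \<ge> 0" unfolding \<mu>_def M_def using nu L D0 M0 by simp
  \<comment> \<open>the two summands bound the supremum and the dissipation in the square of the energy norm\<close>
  define K where "K = 2 * exp \<mu> + 2 * (1 + \<mu> * exp \<mu>)"
  have K1: "K > 1"
  proof -
    have gt: "1 < 2 * x + 2 * (1 + y)" if "0 < x" "0 \<le> y" for x y :: real using that by (simp add: algebra_simps)
    show ?thesis unfolding K_def by (rule gt) (use \<mu>0 in auto)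
  qed
  \<comment> \<open>\<open>K > 1\<close> makes this positive, and \<open>exp (C0 * sqrt T) = K\<close>\<close>
  define C0 where "C0 = ln K / sqrt T"
  have C0: "C0 > 0" unfolding C0_def using K1 T by simp
  have KC: "exp (C0 * sqrt T) = K" unfolding C0_def using K1 T by simp
  show ?thesis
  proof (rule exI[of _ C0], rule conjI[OF C0], rule exI[of _ D], rule conjI[OF D0], intro allI impI)
    fix u1 ua1 P1 Pa1 u2 ua2 P2 Pa2
    assume sol1: "weak_Leray_solution L \<alpha> \<nu> A \<phi> u01 f1 u1 ua1 P1 Pa1"
      and sol2: "weak_Leray_solution L \<alpha> \<nu> A \<phi> u02 f2 u2 ua2 P2 Pa2"
    have en0: "0 \<le> \<nu> * (LINT s:{0..t}|lborel. (Hdot_norm L 1 (vfcoeff L (u s)))\<^sup>2)" for t u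
      unfolding set_lebesgue_integral_def using nu by (intro mult_nonneg_nonneg integral_nonneg_AE) auto
    have "(L2_norm L (u1 t))\<^sup>2 \<le> M" "(L2_norm L (u2 t))\<^sup>2 \<le> M" if "t \<in> {0..T}" for t
      using energy_a_priori[OF L nu f(1) sol1 _ _ T, of t] energy_a_priori[OF L nu f(2) sol2 _ _ T, of t] that en0[of t u1] en0[of t u2] M0
      unfolding M_def M1_def M2_def by auto
    then have MB: "\<forall>t\<in>{0..T}. (L2_norm L (u1 t))\<^sup>2 \<le> M \<and> (L2_norm L (u2 t))\<^sup>2 \<le> M" by blast
    have "\<nu> * (LINT s:{0..T}|lborel. (Hdot_norm L 1 (vfcoeff L (u2 s)))\<^sup>2) \<le> M"
      using energy_a_priori[OF L nu f(2) sol2, of T T] T zero_le_power2[of "L2_norm L (u2 T)"] M0(1)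
      unfolding M_def M2_def[symmetric] by linarith
    then have Mh: "(LINT s:{0..T}|lborel. (Hdot_norm L 1 (vfcoeff L (u2 s)))\<^sup>2) \<le> M / \<nu>"
      using nu by (simp add: pos_le_divide_eq mult.commute)
    define F where "F = (LINT t:{0..T}|lborel. (Hdot_norm L (-1) (\<lambda>n. f1 t n - f2 t n))\<^sup>2)"
    define a where "a = (L2_norm L (\<lambda>x. u1 0 x - u2 0 x))\<^sup>2 + 2 / \<nu> * F"
    note ls = leray_stability[OF L al nu be A phi Lip c C f T sol1 sol2 MB Mh, folded D_def F_def, folded a_def \<mu>_def]
    have F0: "F \<ge> 0" unfolding F_def by (rule lint0) simp
    have "AE x in lborel. u1 0 x = u01 x" "AE x in lborel. u2 0 x = u02 x"
      using sol1 sol2 unfolding weak_Leray_solution_def by blast+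
    then have i0: "AE x in cell L. u1 0 x - u2 0 x = u01 x - u02 x"
      unfolding cell_def by (subst AE_restrict_space_iff) auto
    have "weakly_continuous L u1" "weakly_continuous L u2" using sol1 sol2 unfolding weak_Leray_solution_def by blast+
    then have l2s: "L2s L (u1 t)" "L2s L (u2 t)" if "t \<ge> 0" for t using that by (auto simp: weakly_continuous_def)
    have sq: "sqi (cell L) (\<lambda>x. u1 0 x - u2 0 x)" "sqi (cell L) (\<lambda>x. u01 x - u02 x)"
      using sqi_diff[OF L2s_sqi[OF l2s(1)] L2s_sqi[OF l2s(2)]] sqi_diff[OF L2s_sqi[OF assms(9)] L2s_sqi[OF assms(10)]] by simp_all
    have n0: "(L2_norm L (\<lambda>x. u1 0 x - u2 0 x))\<^sup>2 = (L2_norm L (\<lambda>x. u01 x - u02 x))\<^sup>2"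
      unfolding L2_norm_sq
      by (rule integral_cong_AE) (use i0 sq in \<open>auto simp: sqi_def elim!: eventually_mono\<close>)
    have adata: "a \<le> (L2_norm L (\<lambda>x. u01 x - u02 x))\<^sup>2 + 4 / \<nu> * F"
      unfolding a_def n0 using F0 nu by (intro add_left_mono mult_right_mono divide_right_mono) auto
    define s where "s = (SUP t\<in>{0..T}. L2_norm L (\<lambda>x. u1 t x - u2 t x))"
    define e where "e = (LINT t:{0..T}|lborel. (Hdot_norm L 1 (vfcoeff L (\<lambda>x. u1 t x - u2 t x)))\<^sup>2)"
    have e0: "e \<ge> 0" unfolding e_def by (rule lint0) simp
    have yle: "L2_norm L (\<lambda>x. u1 t x - u2 t x) \<le> sqrt (a * exp \<mu>)" if "t \<in> {0..T}" for t
      using ls(1)[OF that] by (rule real_le_rsqrt)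
    have sle: "s \<le> sqrt (a * exp \<mu>)" unfolding s_def by (rule cSUP_least) (use T yle in auto)
    have "L2_norm L (\<lambda>x. u1 0 x - u2 0 x) \<le> s" unfolding s_def
    proof (rule cSUP_upper)
      show "bdd_above ((\<lambda>t. L2_norm L (\<lambda>x. u1 t x - u2 t x)) ` {0..T})" by (rule bdd_aboveI2) (rule yle)
    qed (use T in simp)
    then have s0: "0 \<le> s" using L2_norm_nonneg order_trans by blast
    have s2: "s\<^sup>2 \<le> a * exp \<mu>" using power_mono[OF sle s0, of 2] ls(4) by simp
    have "(E_norm L \<nu> T (\<lambda>t x. u1 t x - u2 t x))\<^sup>2 = (s + sqrt \<nu> * sqrt e)\<^sup>2"
      by (simp add: E_norm_def s_def e_def)
    also have "\<dots> \<le> 2 * s\<^sup>2 + 2 * (sqrt \<nu> * sqrt e)\<^sup>2"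
      using zero_le_power2[of "s - sqrt \<nu> * sqrt e"] by (simp add: power2_eq_square algebra_simps)
    also have "(sqrt \<nu> * sqrt e)\<^sup>2 = \<nu> * e" using nu e0 by (simp add: power_mult_distrib)
    also have "2 * s\<^sup>2 + 2 * (\<nu> * e) \<le> 2 * (a * exp \<mu>) + 2 * (a * (1 + \<mu> * exp \<mu>))"
      using s2 ls(2) unfolding e_def by simp
    also have "\<dots> = K * a" by (simp add: K_def algebra_simps)
    also have "\<dots> \<le> K * ((L2_norm L (\<lambda>x. u01 x - u02 x))\<^sup>2 + 4 / \<nu> * F)"
      using adata K1 by (intro mult_left_mono) auto
    finally have E1: "(E_norm L \<nu> T (\<lambda>t x. u1 t x - u2 t x))\<^sup>2 \<le> exp (C0 * sqrt T) * ((L2_norm L (\<lambda>x. u01 x - u02 x))\<^sup>2 + 4 / \<nu> * F)"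
      unfolding KC .
    have "tx_measurable ua1" "tx_measurable ua2" using sol1 sol2 unfolding weak_Leray_solution_def by blast+
    then have dm: "txm L (\<lambda>t x. ua1 t x - ua2 t x)" by (intro txm_diff tx_measurable_txm)
    have hm: "(\<lambda>t. Hsob_norm L 1 (vfcoeff L (\<lambda>x. ua1 t x - ua2 t x))) \<in> borel_measurable tpos"
      by (rule Hsob_norm_time_measurable, unfold vfcoeff_def vec_lambda_beta)
         (rule fcoeff_time_measurable[OF txm_component[OF dm]])
    have gm: "(\<lambda>t. Hsob_norm L 1 (vfcoeff L (\<lambda>x. ua1 t x - ua2 t x))) \<in> borel_measurable (restrict_space lborel {0..T})"
      using borel_measurable_tpos_indicator[OF hm, of "{0..T}"]
      by (subst borel_measurable_restrict_space_iff) auto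
    have E2: "(Linf_norm T (\<lambda>v. Hsob_norm L 1 (vfcoeff L v)) (\<lambda>t x. ua1 t x - ua2 t x))\<^sup>2
         \<le> ereal D * (Linf_norm T (L2_norm L) (\<lambda>t x. u1 t x - u2 t x))\<^sup>2"
      unfolding Linf_norm_def
      by (rule Linf_norm_sq_le[OF T D0 _ L2_norm_nonneg gm ls(3)]) (use L in \<open>simp add: Hsob_norm_nonneg\<close>)
    from E1 E2 show "(E_norm L \<nu> T (\<lambda>t x. u1 t x - u2 t x))\<^sup>2
         \<le> exp (C0 * sqrt T) *
            ((L2_norm L (\<lambda>x. u01 x - u02 x))\<^sup>2
             + 4 / \<nu> * (LINT t:{0..T}|lborel. (Hdot_norm L (-1) (\<lambda>n. f1 t n - f2 t n))\<^sup>2))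
     \<and> (Linf_norm T (\<lambda>v. Hsob_norm L 1 (vfcoeff L v)) (\<lambda>t x. ua1 t x - ua2 t x))\<^sup>2
         \<le> ereal D * (Linf_norm T (L2_norm L) (\<lambda>t x. u1 t x - u2 t x))\<^sup>2"
      unfolding F_def by blast
  qed
qed

end
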